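(* Let $q>2$ be a prime power and let $\lambda$ be an integer with $2\le\lambda\le q-1$. The generalized Hermitian Singer functional code $C_{\mathcal{L}}(\mathtt{D},\lambda\mathtt{G})$ is a linear code over $\mathbb{F}_{q^2}$ with parameters $$\left[\,q(q^2-q+1),\ \tfrac12(2\lambda-1)(q^2-q)+\lambda+1,\ (q-\lambda)(q^2-q+1)\,\right]_{q^2}$$ (length, dimension, minimum distance), and its minimum distance is equal to its designed minimum distance $n-\deg(\lambda\mathtt{G})$, where $n=q(q^2-q+1)$ is the length.
   Context: Let $q>2$ be a prime power and let $PG(2,q^6)$ have homogeneous coordinates $(X_1:X_2:X_0)$. Let $\Pi$ be the set of points $(\gamma:\gamma^{q^2+1}:1)$ with $\gamma\in\mathbb{F}_{q^6}$, $\gamma^{q^4+q^2+1}=1$, whose lines are the sections by the lines $sX_1+s^{q^2+1}X_2+X_0=0$ with $s^{q^4+q^2+1}=1$. $\Pi$ is a projective plane of order $q^2$, and there is a projectivity of $PG(2,q^6)$ mapping $\Pi$ onto $PG(2,q^2)$. The Frobenius collineation of $\Pi$, which fixes exactly the points of $\Pi$, is $\Phi_\Pi:(x_1:x_2:x_0)\mapsto(x_0^{q^2}:x_1^{q^2}:x_2^{q^2})$. A curve, divisor or rational function is "defined over $\mathbb{F}_{q^2}$" (equivalently, over $\Pi$) if it is so in the usual sense after applying a projectivity mapping $\Pi$ onto $PG(2,q^2)$. Let $\Gamma$ be the Singer subgroup: the cyclic group of order $q^2-q+1$ generated by the projectivity $(x_1:x_2:x_0)\mapsto(\beta x_1:\beta^{q}x_2:x_0)$,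 where $\beta$ is a primitive $(q^2-q+1)$-th root of unity in $\mathbb{F}_{q^6}$ (note $\beta^{q^2+1}=\beta^q$). It preserves $\Pi$ and every curve $H_t$: $tX_1X_2^q+t^{q^2+1}X_2X_0^q+X_0X_1^q=0$ with $t^{q^2+q+1}=1$. Each $H_t$ is a Hermitian curve of $\Pi$: it is non-singular of genus $\mathfrak{g}=\frac12(q^2-q)$, is defined over $\mathbb{F}_{q^2}$ (that is, in the usual sense after applying a projectivity mapping $\Pi$ onto $PG(2,q^2)$), and has exactly $q^3+1$ points in $\Pi$. These points are its $\mathbb{F}_{q^2}$-rational points. Fix $\tau$ with $\tau^{q^2+q+1}=1$. Let $G=\{P_1,\dots,P_N\}$, $N=q^2-q+1$, be the $\Gamma$-orbit of a point of $H_\tau\cap\Pi$, and put $\mathtt{G}=P_1+\cdots+P_N$. Let $D=\{Q_1,\dots,Q_n\}$ be the set of all other points of $H_\tau\cap\Pi$, so $n=q^3+1-(q^2-q+1)$, and put $\mathtt{D}=Q_1+\cdots+Q_n$. Let $\mathcal{L}(\lambda\mathtt{G})$ be the Riemann-Roch space over $\mathbb{F}_{q^2}$, i.e. the rational functions $f$ on $H_\tau$ defined over $\mathbb{F}_{q^2}$ with $f=0$ or $\mathrm{div}(f)+\lambda\mathtt{G}\succcurlyeq 0$. The generalized Hermitian Singer functional code is $$C_{\mathcal{L}}(\mathtt{D},\lambda\mathtt{G})=\{(f(Q_1),\dots,f(Q_n)) : f\in\mathcal{L}(\lambda\mathtt{G})\}\subseteq\mathbb{F}_{q^2}^n .$$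 Its designed minimum distance is $n-\deg(\lambda\mathtt{G})=n-\lambda(q^2-q+1)$. *)

theory Defs
  imports
    "HOL-Analysis.Analysis"
    "HOL-Algebra.Algebraic_Closure_Type"
    "HOL-Number_Theory.Prime_Powers"
begin

text \<open>
  Points of the projective plane are one-dimensional subspaces of the column vectors
  of length 3. The coordinates \<open>(X\<^sub>1 : X\<^sub>2 : X\<^sub>0)\<close> are, in this order, the components
  \<open>v $ 1\<close>, \<open>v $ 2\<close>, \<open>v $ 3\<close>.
\<close>

type_synonym 'k point = "('k ^ 3) set"

definition proj_point :: "'k::field ^ 3 \<Rightarrow> 'k point" where
  "proj_point v = vec.span {v}"

definition proj_plane :: "'k::field set \<Rightarrow> 'k point set" where
  "proj_plane F = {proj_point v | v. v \<noteq> 0 \<and> (\<forall>i. v $ i \<in> F)}"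

definition proj_map :: "'k::field ^ 3 ^ 3 \<Rightarrow> 'k point \<Rightarrow> 'k point" where
  "proj_map M P = (\<lambda>v. M *v v) ` P"

text \<open>Over an algebraically closed field of characteristic \<open>p\<close> and for \<open>m\<close> a positive power
  of \<open>p\<close>, this is the subfield with \<open>m\<close> elements.\<close>

definition GF :: "nat \<Rightarrow> 'k::field set" where
  "GF m = {x. x ^ m = x}"


section \<open>Rational functions on a projective plane curve\<close>

text \<open>
  A form with coefficients in \<open>F\<close> is identified with the polynomial function it induces on
  \<open>'k ^ 3\<close>; nothing is lost over an infinite field. The zero form has every degree.
\<close>

definition forms :: "'k::field set \<Rightarrow> nat \<Rightarrow> ('k ^ 3 \<Rightarrow> 'k) set" where
  "forms F d = {A. \<exists>a. (\<forall>i j. a i j \<in> F) \<and>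
     A = (\<lambda>v. \<Sum>(i, j)\<in>{(i, j). i + j \<le> d}. a i j * v $ 1 ^ i * v $ 2 ^ j * v $ 3 ^ (d - i - j))}"

text \<open>
  In the following, \<open>C\<close> is the point set of an irreducible plane curve over an algebraically
  closed field \<open>'k\<close>. Its function field consists of the fractions \<open>A / B\<close> of forms of the same
  degree with \<open>B\<close> not vanishing identically on \<open>C\<close>, two fractions being identified if
  they agree on \<open>C\<close>.
\<close>

definition fractions :: "'k::field point set \<Rightarrow> (('k ^ 3 \<Rightarrow> 'k) \<times> ('k ^ 3 \<Rightarrow> 'k)) set" where
  "fractions C = {(A, B). (\<exists>d. A \<in> forms UNIV d \<and> B \<in> forms UNIV d) \<and>
     (\<exists>P\<in>C. \<exists>v\<in>P. B v \<noteq> 0)}"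

definition fraction_rel :: "'k::field point set \<Rightarrow> (('k ^ 3 \<Rightarrow> 'k) \<times> ('k ^ 3 \<Rightarrow> 'k)) rel" where
  "fraction_rel C = {((A, B), (A', B')). (A, B) \<in> fractions C \<and> (A', B') \<in> fractions C \<and>
     (\<forall>P\<in>C. \<forall>v\<in>P. A v * B' v = A' v * B v)}"

type_synonym 'k ratfun = "(('k ^ 3 \<Rightarrow> 'k) \<times> ('k ^ 3 \<Rightarrow> 'k)) set"

definition fraction :: "'k::field point set \<Rightarrow> ('k ^ 3 \<Rightarrow> 'k) \<Rightarrow> ('k ^ 3 \<Rightarrow> 'k) \<Rightarrow> 'k ratfun" where
  "fraction C A B = fraction_rel C `` {(A, B)}"

definition function_field :: "'k::field point set \<Rightarrow> 'k ratfun ring" where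
  "function_field C = \<lparr>
     carrier = fractions C // fraction_rel C,
     mult = (\<lambda>f g. \<Union>(A, B)\<in>f. \<Union>(A', B')\<in>g.
        fraction C (\<lambda>v. A v * A' v) (\<lambda>v. B v * B' v)),
     one = fraction C (\<lambda>v. 1) (\<lambda>v. 1),
     zero = fraction C (\<lambda>v. 0) (\<lambda>v. 1),
     add = (\<lambda>f g. \<Union>(A, B)\<in>f. \<Union>(A', B')\<in>g.
        fraction C (\<lambda>v. A v * B' v + A' v * B v) (\<lambda>v. B v * B' v))\<rparr>"

definition regular_at :: "'k::field point \<Rightarrow> 'k ratfun \<Rightarrow> bool" where
  "regular_at P f \<longleftrightarrow> (\<exists>(A, B)\<in>f. \<exists>v\<in>P. B v \<noteq> 0)"

definition value_at :: "'k::field point \<Rightarrow> 'k ratfun \<Rightarrow> 'k" where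
  "value_at P f = (THE y. \<exists>(A, B)\<in>f. \<exists>v\<in>P. B v \<noteq> 0 \<and> y = A v / B v)"

definition local_ring :: "'k::field point set \<Rightarrow> 'k point \<Rightarrow> 'k ratfun set" where
  "local_ring C P = {f \<in> carrier (function_field C). regular_at P f}"

definition maximal_ideal_at :: "'k::field point set \<Rightarrow> 'k point \<Rightarrow> 'k ratfun set" where
  "maximal_ideal_at C P = {f \<in> local_ring C P. value_at P f = 0}"

definition local_parameter :: "'k::field point set \<Rightarrow> 'k point \<Rightarrow> 'k ratfun \<Rightarrow> bool" where
  "local_parameter C P t \<longleftrightarrow> t \<in> maximal_ideal_at C P \<and>
     maximal_ideal_at C P = {t \<otimes>\<^bsub>function_field C\<^esub> g | g. g \<in> local_ring C P}"

text \<open>Meaningful for \<open>f\<close> nonzero and \<open>P\<close> a non-singular point of \<open>C\<close>, in which case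
  the local ring at \<open>P\<close> is a discrete valuation ring.\<close>

definition order_at :: "'k::field point set \<Rightarrow> 'k point \<Rightarrow> 'k ratfun \<Rightarrow> int" where
  "order_at C P f = (THE n. \<exists>t u. local_parameter C P t \<and>
     u \<in> local_ring C P - maximal_ideal_at C P \<and>
     f = u \<otimes>\<^bsub>function_field C\<^esub> (t [^]\<^bsub>function_field C\<^esub> (n::int)))"

text \<open>Divisors are integer-valued functions on points.\<close>

type_synonym 'k divisor = "'k point \<Rightarrow> int"

definition principal_divisor :: "'k::field point set \<Rightarrow> 'k ratfun \<Rightarrow> 'k divisor" where
  "principal_divisor C f = (\<lambda>P. if P \<in> C then order_at C P f else 0)"

definition divisor_degree :: "'k divisor \<Rightarrow> int" where
  "divisor_degree E = (\<Sum>P | E P \<noteq> 0. E P)"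


section \<open>The plane \<open>\<Pi>\<close>, the Singer subgroup and the Hermitian curves\<close>

definition Pi_plane :: "nat \<Rightarrow> 'k::field point set" where
  "Pi_plane q = {proj_point (vector [g, g ^ (q^2 + 1), 1]) | g.
     g \<in> GF (q^6) \<and> g ^ (q^4 + q^2 + 1) = 1}"

definition projectivity_to_canonical :: "nat \<Rightarrow> 'k::field ^ 3 ^ 3 \<Rightarrow> bool" where
  "projectivity_to_canonical q M \<longleftrightarrow> invertible M \<and> (\<forall>i j. M $ i $ j \<in> GF (q^6)) \<and>
     proj_map M ` Pi_plane q = proj_plane (GF (q^2))"

text \<open>A rational function is defined over \<open>\<Pi>\<close> if its transform \<open>f \<circ> M\<^sup>-\<^sup>1\<close> is a quotient
  \<open>A / B\<close> of forms with coefficients in the field of \<open>q\<^sup>2\<close> elements, i.e. if \<open>f\<close> is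
  represented by \<open>(A \<circ> M) / (B \<circ> M)\<close>, for a projectivity \<open>M\<close> carrying \<open>\<Pi>\<close> to the canonical
  subplane.\<close>

definition defined_over_Pi :: "nat \<Rightarrow> 'k::field ratfun \<Rightarrow> bool" where
  "defined_over_Pi q f \<longleftrightarrow> (\<exists>M. projectivity_to_canonical q M \<and>
     (\<exists>d. \<exists>A\<in>forms (GF (q^2)) d. \<exists>B\<in>forms (GF (q^2)) d.
        ((\<lambda>v. A (M *v v)), (\<lambda>v. B (M *v v))) \<in> f))"

definition singer_matrix :: "nat \<Rightarrow> 'k::field \<Rightarrow> 'k ^ 3 ^ 3" where
  "singer_matrix q \<beta> = vector [vector [\<beta>, 0, 0], vector [0, \<beta> ^ q, 0], vector [0, 0, 1]]"

text \<open>Nonnegative powers suffice, since the generator has finite order.\<close>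

definition singer_orbit :: "nat \<Rightarrow> 'k::field \<Rightarrow> 'k point \<Rightarrow> 'k point set" where
  "singer_orbit q \<beta> P = range (\<lambda>k. (proj_map (singer_matrix q \<beta>) ^^ k) P)"

definition primitive_root_of_unity :: "nat \<Rightarrow> 'k::field \<Rightarrow> bool" where
  "primitive_root_of_unity m \<beta> \<longleftrightarrow> \<beta> ^ m = 1 \<and> (\<forall>k. 0 < k \<and> k < m \<longrightarrow> \<beta> ^ k \<noteq> 1)"

definition hermitian_curve :: "nat \<Rightarrow> 'k::field \<Rightarrow> 'k point set" where
  "hermitian_curve q t = {P \<in> proj_plane UNIV. \<forall>v\<in>P.
     t * v $ 1 * v $ 2 ^ q + t ^ (q^2 + 1) * v $ 2 * v $ 3 ^ q + v $ 3 * v $ 1 ^ q = 0}"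

definition riemann_roch_space :: "nat \<Rightarrow> 'k::field point set \<Rightarrow> 'k divisor \<Rightarrow> 'k ratfun set" where
  "riemann_roch_space q C E = {f \<in> carrier (function_field C). defined_over_Pi q f \<and>
     (f = \<zero>\<^bsub>function_field C\<^esub> \<or> (\<forall>P. principal_divisor C f P + E P \<ge> 0))}"


section \<open>Codes\<close>

definition functional_code ::
    "nat \<Rightarrow> 'k::field point set \<Rightarrow> ('n \<Rightarrow> 'k point) \<Rightarrow> 'k divisor \<Rightarrow> ('k ^ 'n) set" where
  "functional_code q C Q E = {(\<chi> i. value_at (Q i) f) | f. f \<in> riemann_roch_space q C E}"

text \<open>The inclusion of coordinate spaces induced by a field in its algebraic closure.\<close>

definition vec_to_ac :: "'f::field ^ 'n \<Rightarrow> 'f alg_closure ^ 'n" where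
  "vec_to_ac c = (\<chi> i. to_ac (c $ i))"

definition hamming_dist :: "'f ^ 'n \<Rightarrow> 'f ^ 'n \<Rightarrow> nat" where
  "hamming_dist x y = card {i. x $ i \<noteq> y $ i}"

definition min_distance :: "('f ^ 'n) set \<Rightarrow> nat" where
  "min_distance S = Min {hamming_dist x y | x y. x \<in> S \<and> y \<in> S \<and> x \<noteq> y}"

end

theory Submission
  imports Defs
begin

text \<open>
  Put \<open>N = q\<^sup>2 - q + 1\<close>. On the curve, \<open>x = X\<^sub>1 X\<^sub>2\<^bsup>q-1\<^esup> / X\<^sub>0\<^sup>q\<close> is invariant under the Singer group and
  \<open>b = X\<^sub>2 / X\<^sub>0\<close> satisfies \<open>b\<^sup>N = x\<^sup>q / Z(x)\<close> with \<open>Z\<close> linear, so the function field is a Kummer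
  extension of \<open>K(x)\<close>, totally ramified at the three coordinate points only, and the orbits in question
  are fibers of \<open>x\<close>. Expanding in powers of \<open>b\<close> writes each \<open>f\<close> with \<open>div f + \<lambda> G \<ge> 0\<close>, \<open>G\<close> being the
  fiber over \<open>x = c\<close>, uniquely as \<open>\<Sum>\<^sub>k p\<^sub>k(x) m\<^sub>k / (x - c)\<^sup>\<lambda>\<close> with fixed monomials \<open>m\<^sub>k\<close> in \<open>x, z, b\<close>
  and explicit degree bounds for the \<open>p\<^sub>k\<close>; summing these gives the dimension. Such an \<open>f\<close> has at most
  \<open>\<lambda> N\<close> zeros because its norm to \<open>K(x)\<close> has, and products of \<open>\<lambda>\<close> Hermitian curves, each cutting out
  one further orbit, attain this. Functions defined over \<open>\<Pi>\<close> are those commuting with the Frobenius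
  collineation; traces of monomials provide enough of them for the dimension over the constants.
\<close>

hide_const (open) up_ring.coeff up_ring.monom module.smult Coset.order Divisibility.prime
  Polynomials.degree Polynomials.lead_coeff

no_notation fps_nth (infixl "$" 75)

section \<open>Laurent series and polynomial evaluation\<close>

text \<open>Orders, values and divisors are defined through local rings of a concrete quotient of
  pairs of forms, so every statement about them has to be reduced to those definitions. The
  reduction goes through Laurent series: a point of the curve with Laurent series as coordinates and
  nonconstant \<open>x\<close> embeds the function field (\<open>fv\<close>), and at the expansion
  of an ordinary point the order becomes \<open>fls_subdegree\<close>. The sharp degree bounds come
  from total ramification: at a coordinate point a polynomial in \<open>x\<close> has order
  divisible by \<open>N\<close> while the order of \<open>b\<close> is prime to \<open>N\<close>, so
  the terms of an expansion in powers of \<open>b\<close> cannot cancel, and a bound for the sum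
  bounds each term. Away from these points \<open>x\<close> is unramified, and regularity along a
  whole fiber of \<open>N\<close> points lets a denominator be cancelled. The dimension then is a
  sum of differences of floors, evaluated by pairing \<open>k\<close> with \<open>N - k\<close>. A
  separate obstacle is rationality: \<open>defined_over_Pi\<close> quantifies over the projectivity,
  so all admissible ones have to induce the same Frobenius up to a scalar.\<close>

text \<open>Residue in the sense of the residue field: the series has no pole and takes the value
  \<open>a\<close> at the origin. The coefficient of the inverse of the variable is not
  meant.\<close>

definition has_residue :: "'k::field fls \<Rightarrow> 'k \<Rightarrow> bool" where
  "has_residue f a \<longleftrightarrow> f \<in> range fps_to_fls \<and> fls_nth f 0 = a"

lemma has_residueE:
  assumes "has_residue f a"
  obtains g where "f = fps_to_fls g" "fps_nth g 0 = a"
  using assms by (auto simp: has_residue_def)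

lemma has_residue_fps: "fps_nth g 0 = a \<Longrightarrow> has_residue (fps_to_fls g) a"
  by (auto simp: has_residue_def)

lemma has_residue_const: "has_residue (fls_const a) a"
  by (metis fps_const_to_fls fps_nth_fps_const has_residue_fps)

lemma has_residue_0: "has_residue 0 0"
  using has_residue_const[of 0] by simp

lemma has_residue_1: "has_residue 1 1"
  using has_residue_const[of 1] by simp

lemma has_residue_X: "has_residue fls_X 0"
  using has_residue_fps[of fps_X 0] by simp

lemma has_residue_add: "has_residue f a \<Longrightarrow> has_residue g b \<Longrightarrow> has_residue (f + g) (a + b)"
  by (elim has_residueE) (metis fps_add_nth fps_to_fls_plus has_residue_fps)

lemma has_residue_diff: "has_residue f a \<Longrightarrow> has_residue g b \<Longrightarrow> has_residue (f - g) (a - b)"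
  by (elim has_residueE) (metis fps_sub_nth fps_to_fls_minus has_residue_fps)

lemma has_residue_mult: "has_residue f a \<Longrightarrow> has_residue g b \<Longrightarrow> has_residue (f * g) (a * b)"
  by (elim has_residueE) (metis fls_times_fps_to_fls fps_mult_nth_0 has_residue_fps)

lemma has_residue_power: "has_residue f a \<Longrightarrow> has_residue (f ^ n) (a ^ n)"
  by (induction n) (auto intro: has_residue_1 has_residue_mult)

lemma has_residue_inverse: "has_residue f a \<Longrightarrow> a \<noteq> 0 \<Longrightarrow> has_residue (inverse f) (inverse a)"
  by (elim has_residueE) (metis fls_inverse_fps_to_fls fps_inverse_nth_0 has_residue_fps subdegree_eq_0_iff)

lemma has_residue_divide:
  "has_residue f a \<Longrightarrow> has_residue g b \<Longrightarrow> b \<noteq> 0 \<Longrightarrow> has_residue (f / g) (a / b)"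
  using has_residue_mult[OF _ has_residue_inverse] by (metis divide_inverse)

lemma has_residue_sum:
  "(\<And>i. i \<in> I \<Longrightarrow> has_residue (f i) (a i)) \<Longrightarrow> has_residue (sum f I) (sum a I)"
  by (induction I rule: infinite_finite_induct) (auto intro: has_residue_0 has_residue_add)

lemma has_residue_powi: "has_residue f a \<Longrightarrow> a \<noteq> 0 \<Longrightarrow> has_residue (f powi n) (a powi n)"
  unfolding power_int_def
  by (auto intro!: has_residue_power has_residue_inverse)

lemma has_residue_unique: "has_residue f a \<Longrightarrow> has_residue f b \<Longrightarrow> a = b"
  by (simp add: has_residue_def)

lemma has_residue_nz:
  assumes "has_residue f a" "a \<noteq> 0"
  shows "f \<noteq> 0" "fls_subdegree f = 0"
  using assms by (auto simp: has_residue_def fls_subdegree_fls_to_fps subdegree_eq_0_iff)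

lemma has_residue_subdegree_nonneg: "has_residue f a \<Longrightarrow> fls_subdegree f \<ge> 0"
  by (auto simp: has_residue_def fls_subdegree_fls_to_fps)

lemma has_residueI_nonneg: "fls_subdegree f \<ge> 0 \<Longrightarrow> has_residue f (fls_nth f 0)"
  unfolding has_residue_def
  by (metis fls_as_fps' fls_regpart_to_fls_trivial rangeI)

lemma has_residueI_pos:
  assumes "f = 0 \<or> fls_subdegree f > 0"
  shows "has_residue f 0"
  using assms has_residueI_nonneg[of f] has_residue_0 by auto

lemma has_residue_0_pos: "has_residue f 0 \<Longrightarrow> f \<noteq> 0 \<Longrightarrow> fls_subdegree f > 0"
  by (metis has_residue_def has_residue_subdegree_nonneg le_less nth_fls_subdegree_nonzero)

lemma fls_subdegree_powi: "fls_subdegree (f powi n) = n * fls_subdegree (f :: 'k::field fls)"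
  by (cases "f = 0") (auto simp: power_int_def fls_subdegree_pow fls_inverse_subdegree power_0_left)

text \<open>Among terms of pairwise distinct orders exactly one has the least order, and its leading
  coefficient survives in the sum. Hence vanishing of the sum up to \<open>M\<close> forces every
  term up to \<open>M\<close>; this is the form in which total ramification is exploited.\<close>

lemma subdegree_ge_of_sum:
  fixes t :: "'i \<Rightarrow> 'k::field fls"
  assumes "finite I" and inj: "inj_on (\<lambda>i. fls_subdegree (t i)) {i\<in>I. t i \<noteq> 0}"
    and M: "\<And>n. n < M \<Longrightarrow> fls_nth (\<Sum>i\<in>I. t i) n = 0"
    and i: "i \<in> I" "t i \<noteq> 0"
  shows "fls_subdegree (t i) \<ge> M"
proof -
  define J where "J = {i\<in>I. t i \<noteq> 0}"
  have J: "finite J" "J \<noteq> {}" using assms by (auto simp: J_def)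
  obtain j where j: "j \<in> J" "\<And>k. k \<in> J \<Longrightarrow> fls_subdegree (t j) \<le> fls_subdegree (t k)"
    using J arg_min_if_finite[of J "\<lambda>j. fls_subdegree (t j)"]
    by (metis linorder_le_less_linear)
  have "fls_nth (\<Sum>i\<in>I. t i) (fls_subdegree (t j)) = (\<Sum>i\<in>I. fls_nth (t i) (fls_subdegree (t j)))"
    by (simp add: fls_nth_sum)
  also have "\<dots> = (\<Sum>i\<in>{j}. fls_nth (t i) (fls_subdegree (t j)))"
  proof (rule sum.mono_neutral_right)
    show "\<forall>i\<in>I - {j}. fls_nth (t i) (fls_subdegree (t j)) = 0"
    proof
      fix k assume k: "k \<in> I - {j}"
      show "fls_nth (t k) (fls_subdegree (t j)) = 0"
      proof (cases "t k = 0")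
        case False
        then have "fls_subdegree (t j) < fls_subdegree (t k)"
          using j k inj unfolding inj_on_def J_def by fastforce
        then show ?thesis by simp
      qed simp
    qed
  qed (use assms j J_def in auto)
  also have "\<dots> \<noteq> 0" using j by (simp add: J_def)
  finally have "M \<le> fls_subdegree (t j)" using M by force
  also have "\<dots> \<le> fls_subdegree (t i)" using j(2) i by (simp add: J_def)
  finally show ?thesis .
qed

lemma sum_eq_0_distinct_subdegree:
  fixes t :: "'i \<Rightarrow> 'k::field fls"
  assumes "finite I" "inj_on (\<lambda>i. fls_subdegree (t i)) {i\<in>I. t i \<noteq> 0}"
    "(\<Sum>i\<in>I. t i) = 0" "i \<in> I"
  shows "t i = 0"
proof (rule ccontr)
  assume "t i \<noteq> 0"
  with subdegree_ge_of_sum[of I t "fls_subdegree (t i) + 1" i] assms show False by simp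
qed

lemma map_poly_add_hom:
  assumes "h 0 = 0" "\<And>a b. h (a + b) = h a + h b"
  shows "map_poly h (p + q) = map_poly h p + map_poly h q"
  by (rule poly_eqI) (simp add: coeff_map_poly assms)

lemma map_poly_mult_hom:
  fixes h :: "'a::comm_semiring_0 \<Rightarrow> 'b::comm_semiring_0"
  assumes "h 0 = 0" "\<And>a b. h (a + b) = h a + h b" "\<And>a b. h (a * b) = h a * h b"
  shows "map_poly h (p * q) = map_poly h p * map_poly h q"
proof (rule poly_eqI)
  fix n
  have "h (sum f A) = (\<Sum>i\<in>A. h (f i))" for f :: "nat \<Rightarrow> 'a" and A
    by (induction A rule: infinite_finite_induct) (auto simp: assms)
  then show "coeff (map_poly h (p * q)) n = coeff (map_poly h p * map_poly h q) n"
    by (simp add: coeff_map_poly assms coeff_mult)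
qed

definition evalp :: "'k::field poly \<Rightarrow> 'k fls \<Rightarrow> 'k fls" where
  "evalp p x = poly (map_poly fls_const p) x"

lemma evalp_0 [simp]: "evalp 0 x = 0"
  by (simp add: evalp_def)

lemma evalp_1 [simp]: "evalp 1 x = 1"
  by (simp add: evalp_def)

lemma evalp_pCons [simp]: "evalp (pCons a p) x = fls_const a + x * evalp p x"
  by (simp add: evalp_def map_poly_pCons)

lemma evalp_add [simp]: "evalp (p + q) x = evalp p x + evalp q x"
  by (simp add: evalp_def map_poly_add_hom fls_plus_const)

lemma evalp_mult [simp]: "evalp (p * q) x = evalp p x * evalp q x"
  by (simp add: evalp_def map_poly_mult_hom fls_plus_const)

lemma evalp_smult [simp]: "evalp (smult c p) x = fls_const c * evalp p x"
  using evalp_mult[of "[:c:]" p x] by simp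

lemma evalp_power [simp]: "evalp (p ^ n) x = evalp p x ^ n"
  by (induction n) auto

lemma evalp_monom [simp]: "evalp (monom c n) x = fls_const c * x ^ n"
  by (simp add: evalp_def map_poly_monom poly_monom)

lemma evalp_sum: "evalp (sum f A) x = (\<Sum>i\<in>A. evalp (f i) x)"
  by (induction A rule: infinite_finite_induct) auto

lemma evalp_const: "evalp p (fls_const a) = fls_const (poly p a)"
  by (induction p) (auto simp: fls_plus_const)

lemma has_residue_evalp: "has_residue x a \<Longrightarrow> has_residue (evalp p x) (poly p a)"
  by (induction p) (auto intro!: has_residue_0 has_residue_add has_residue_const has_residue_mult)

text \<open>After splitting off the full power of the linear factor at \<open>d\<close>, the
  cofactor has a nonzero value at \<open>d\<close> and so becomes a unit. The exponent
  \<open>e\<close> is the ramification index over \<open>d\<close>.\<close>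

lemma evalp_subdegree_order:
  assumes "p \<noteq> 0" "fls_subdegree (x - fls_const d) = e" "e > 0"
  shows "evalp p x \<noteq> 0" "fls_subdegree (evalp p x) = e * int (order d p)"
proof -
  obtain r where r: "p = [:-d, 1:] ^ order d p * r" "\<not> [:-d, 1:] dvd r"
    using order_decomp[OF \<open>p \<noteq> 0\<close>] by blast
  have x: "x - fls_const d \<noteq> 0" using assms by auto
  have "has_residue (x - fls_const d + fls_const d) (0 + d)"
    using assms by (intro has_residue_add has_residue_const has_residueI_pos) auto
  then have hr: "has_residue (evalp r x) (poly r d)"
    by (auto intro: has_residue_evalp)
  have rd: "poly r d \<noteq> 0" using r(2) by (simp add: poly_eq_0_iff_dvd)
  have e: "evalp p x = (x - fls_const d) ^ order d p * evalp r x"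
    by (subst r(1)) (simp add: algebra_simps)
  show "evalp p x \<noteq> 0" using e x has_residue_nz[OF hr rd] by simp
  show "fls_subdegree (evalp p x) = e * int (order d p)"
    using e x has_residue_nz[OF hr rd] assms by (simp add: fls_subdegree_pow)
qed

text \<open>At a pole of \<open>x\<close> the leading term dominates: each Horner step adds a
  constant to a series of negative order.\<close>

lemma evalp_subdegree_neg:
  assumes "p \<noteq> 0" "fls_subdegree x = - e" "e > 0"
  shows "evalp p x \<noteq> 0 \<and> fls_subdegree (evalp p x) = - (e * int (degree p))"
  using assms(1)
proof (induction p)
  case (pCons a p)
  have x: "x \<noteq> 0" using assms by auto
  show ?case
  proof (cases "p = 0")
    case False
    with pCons have IH: "evalp p x \<noteq> 0" "fls_subdegree (evalp p x) = - (e * int (degree p))" by auto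
    have s: "fls_subdegree (x * evalp p x) = - (e * (1 + int (degree p)))"
      using x IH assms by (simp add: algebra_simps)
    have neg: "- (e * (1 + int (degree p))) < 0" using assms(3) by simp
    have "fls_subdegree (fls_const a + x * evalp p x) = fls_subdegree (x * evalp p x)"
      by (rule fls_subdegree_add_eq2) (use x IH neg s in auto)
    then show ?thesis using s neg False by auto
  qed (use pCons in auto)
qed auto

text \<open>The polynomial splits into linear factors, and a nonconstant series is a zero of none of
  them. Thus every nonconstant Laurent series is transcendental over the constants.\<close>

lemma evalp_nonconst_nonzero:
  fixes p :: "'k::alg_closed_field poly"
  assumes "x \<notin> range fls_const" "p \<noteq> 0"
  shows "evalp p x \<noteq> 0"
proof -
  obtain A where A: "p = smult (lead_coeff p) (\<Prod>a\<in>#A. [:-a, 1:])"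
    using alg_closed_imp_factorization[OF assms(2)] by blast
  have "evalp (\<Prod>a\<in>#A. [:-a, 1:]) x \<noteq> 0" for A
    using assms(1) by (induction A) (auto simp del: mult_pCons_left simp: eq_neg_iff_add_eq_0 add.commute)
  then show ?thesis using assms(2) by (subst A) auto
qed

text \<open>The outer variable stands for \<open>b\<close>, the coefficients are polynomials in
  \<open>x\<close>.\<close>

definition evalpp :: "'k::field poly poly \<Rightarrow> 'k fls \<Rightarrow> 'k fls \<Rightarrow> 'k fls" where
  "evalpp G x b = poly (map_poly (\<lambda>p. evalp p x) G) b"

lemma evalpp_0 [simp]: "evalpp 0 x b = 0"
  by (simp add: evalpp_def)

lemma evalpp_1 [simp]: "evalpp 1 x b = 1"
  by (simp add: evalpp_def)

lemma evalpp_add [simp]: "evalpp (p + q) x b = evalpp p x b + evalpp q x b"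
  by (simp add: evalpp_def map_poly_add_hom)

lemma evalpp_mult [simp]: "evalpp (p * q) x b = evalpp p x b * evalpp q x b"
  by (simp add: evalpp_def map_poly_mult_hom)

lemma evalpp_monom [simp]: "evalpp (monom c n) x b = evalp c x * b ^ n"
  by (simp add: evalpp_def map_poly_monom poly_monom)

lemma evalpp_sum: "evalpp (sum f A) x b = (\<Sum>i\<in>A. evalpp (f i) x b)"
  by (induction A rule: infinite_finite_induct) auto

lemma evalpp_prod: "evalpp (prod f A) x b = (\<Prod>i\<in>A. evalpp (f i) x b)"
  by (induction A rule: infinite_finite_induct) auto

lemma evalpp_altdef: "evalpp G x b = (\<Sum>k\<le>degree G. evalp (coeff G k) x * b ^ k)"
  by (subst poly_as_sum_of_monoms[symmetric]) (simp add: evalpp_sum)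

section \<open>Forms and their extension to Laurent series\<close>

text \<open>Forms are given as functions on \<open>'k ^ 3\<close> only; \<open>B\<close> carries the evaluation of the form \<open>A\<close> at
  points with Laurent series as coordinates.\<close>

definition lifts :: "nat \<Rightarrow> ('k::field ^ 3 \<Rightarrow> 'k) \<Rightarrow> ('k fls ^ 3 \<Rightarrow> 'k fls) \<Rightarrow> bool" where
  "lifts d A B \<longleftrightarrow> (\<exists>a.
     A = (\<lambda>v. \<Sum>(i, j)\<in>{(i, j). i + j \<le> d}. a i j * v $ 1 ^ i * v $ 2 ^ j * v $ 3 ^ (d - i - j)) \<and>
     B = (\<lambda>v. \<Sum>(i, j)\<in>{(i, j). i + j \<le> d}. fls_const (a i j) * v $ 1 ^ i * v $ 2 ^ j * v $ 3 ^ (d - i - j)))"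

lemma finite_exponents: "finite {(i, j). i + j \<le> (d::nat)}"
  by (rule finite_subset[of _ "{..d} \<times> {..d}"]) auto

lemma forms_iff_lifts: "A \<in> forms UNIV d \<longleftrightarrow> (\<exists>B. lifts d A B)"
  by (auto simp: forms_def lifts_def)

text \<open>Lets a form and its evaluation at Laurent points be treated together, monomial by
  monomial, with three symmetric exponents in place of the truncated difference
  \<open>d - i - j\<close>.\<close>

lemma lifts_induct [consumes 1, case_names zero add monom]:
  assumes "lifts d A B"
    and "P (\<lambda>v. 0) (\<lambda>v. 0)"
    and add: "\<And>A B A' B'. P A B \<Longrightarrow> P A' B' \<Longrightarrow> P (\<lambda>v. A v + A' v) (\<lambda>v. B v + B' v)"
    and monom: "\<And>c i j k. i + j + k = d \<Longrightarrow>
       P (\<lambda>v. c * v $ 1 ^ i * v $ 2 ^ j * v $ 3 ^ k) (\<lambda>v. fls_const c * v $ 1 ^ i * v $ 2 ^ j * v $ 3 ^ k)"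
  shows "P A B"
proof -
  obtain a where a: "A = (\<lambda>v. \<Sum>(i, j)\<in>{(i, j). i + j \<le> d}. a i j * v $ 1 ^ i * v $ 2 ^ j * v $ 3 ^ (d - i - j))"
     "B = (\<lambda>v. \<Sum>(i, j)\<in>{(i, j). i + j \<le> d}. fls_const (a i j) * v $ 1 ^ i * v $ 2 ^ j * v $ 3 ^ (d - i - j))"
    using assms(1) by (auto simp: lifts_def)
  have "P (\<lambda>v. \<Sum>(i, j)\<in>T. a i j * v $ 1 ^ i * v $ 2 ^ j * v $ 3 ^ (d - i - j))
     (\<lambda>v. \<Sum>(i, j)\<in>T. fls_const (a i j) * v $ 1 ^ i * v $ 2 ^ j * v $ 3 ^ (d - i - j))"
    if "finite T" "T \<subseteq> {(i, j). i + j \<le> d}" for T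
    using that
  proof (induction T)
    case (insert x T)
    obtain i j where x: "x = (i, j)" by (cases x)
    show ?case
      using add[OF monom[of i j "d - i - j" "a i j"] insert.IH] insert x by simp
  qed (use assms in auto)
  from this[OF finite_exponents order_refl] show ?thesis by (simp add: a)
qed

lemma lifts_zero: "lifts d (\<lambda>v. 0) (\<lambda>v. 0)"
  unfolding lifts_def by (rule exI[of _ "\<lambda>i j. 0"]) simp

lemma lifts_add:
  assumes "lifts d A B" "lifts d A' B'"
  shows "lifts d (\<lambda>v. A v + A' v) (\<lambda>v. B v + B' v)"
proof -
  from assms obtain a a' where "A = (\<lambda>v. \<Sum>(i, j)\<in>{(i, j). i + j \<le> d}. a i j * v $ 1 ^ i * v $ 2 ^ j * v $ 3 ^ (d - i - j))"
     "B = (\<lambda>v. \<Sum>(i, j)\<in>{(i, j). i + j \<le> d}. fls_const (a i j) * v $ 1 ^ i * v $ 2 ^ j * v $ 3 ^ (d - i - j))"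
     "A' = (\<lambda>v. \<Sum>(i, j)\<in>{(i, j). i + j \<le> d}. a' i j * v $ 1 ^ i * v $ 2 ^ j * v $ 3 ^ (d - i - j))"
     "B' = (\<lambda>v. \<Sum>(i, j)\<in>{(i, j). i + j \<le> d}. fls_const (a' i j) * v $ 1 ^ i * v $ 2 ^ j * v $ 3 ^ (d - i - j))"
    unfolding lifts_def by blast
  then show ?thesis
    unfolding lifts_def
    by (intro exI[of _ "\<lambda>i j. a i j + a' i j"])
       (auto simp: fun_eq_iff case_prod_unfold algebra_simps fls_plus_const[symmetric] simp flip: sum.distrib)
qed

lemma lifts_monom:
  assumes "i + j + k = d"
  shows "lifts d (\<lambda>v. c * v $ 1 ^ i * v $ 2 ^ j * v $ 3 ^ k) (\<lambda>v. fls_const c * v $ 1 ^ i * v $ 2 ^ j * v $ 3 ^ k)"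
proof -
  have k: "k = d - i - j" using assms by simp
  have mem: "(i, j) \<in> {(i, j). i + j \<le> d}" using assms by auto
  have 1: "(\<Sum>(i', j')\<in>{(i, j). i + j \<le> d}. (if i' = i \<and> j' = j then c else 0) * v $ 1 ^ i' * v $ 2 ^ j' * v $ 3 ^ (d - i' - j'))
    = c * v $ 1 ^ i * v $ 2 ^ j * v $ 3 ^ k" for v
    by (subst sum.mono_neutral_right[OF finite_exponents, of "{(i, j)}"]) (use mem k in \<open>auto split: if_splits\<close>)
  have 2: "(\<Sum>(i', j')\<in>{(i, j). i + j \<le> d}. fls_const (if i' = i \<and> j' = j then c else 0) * v $ 1 ^ i' * v $ 2 ^ j' * v $ 3 ^ (d - i' - j'))
    = fls_const c * v $ 1 ^ i * v $ 2 ^ j * v $ 3 ^ k" for v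
    by (subst sum.mono_neutral_right[OF finite_exponents, of "{(i, j)}"]) (use mem k in \<open>auto split: if_splits\<close>)
  show ?thesis
    unfolding lifts_def
    by (rule exI[of _ "\<lambda>i' j'. if i' = i \<and> j' = j then c else 0"]) (simp only: 1 2 simp_thms)
qed

lemma lifts_mult:
  assumes "lifts d A B" "lifts e A' B'"
  shows "lifts (d + e) (\<lambda>v. A v * A' v) (\<lambda>v. B v * B' v)"
  using assms(1)
proof (induction rule: lifts_induct)
  case zero
  then show ?case using lifts_zero by simp
next
  case (add A B A'' B'')
  then show ?case using lifts_add[OF add] by (simp add: algebra_simps)
next
  case (monom c i j k)
  show ?case using assms(2)
  proof (induction rule: lifts_induct)
    case zero
    then show ?case using lifts_zero by simp
  next
    case (add A B A'' B'')
    then show ?case using lifts_add[OF add] by (simp add: algebra_simps)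
  next
    case (monom c' i' j' k')
    have "lifts (d + e) (\<lambda>v. (c * c') * v $ 1 ^ (i + i') * v $ 2 ^ (j + j') * v $ 3 ^ (k + k'))
      (\<lambda>v. fls_const (c * c') * v $ 1 ^ (i + i') * v $ 2 ^ (j + j') * v $ 3 ^ (k + k'))"
      using monom \<open>i + j + k = d\<close> by (intro lifts_monom) auto
    then show ?case
      by (simp add: power_add algebra_simps flip: fls_const_mult_const)
  qed
qed

lemma lifts_const: "lifts 0 (\<lambda>v. c) (\<lambda>v. fls_const c)"
  using lifts_monom[of 0 0 0 0 c] by simp

lemma lifts_1: "lifts 0 (\<lambda>v. 1) (\<lambda>v. 1)"
  using lifts_const[of 1] by simp

lemma lifts_cmult: "lifts d A B \<Longrightarrow> lifts d (\<lambda>v. c * A v) (\<lambda>v. fls_const c * B v)"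
  using lifts_mult[OF lifts_const[of c]] by simp

lemma lifts_diff:
  assumes "lifts d A B" "lifts d A' B'"
  shows "lifts d (\<lambda>v. A v - A' v) (\<lambda>v. B v - B' v)"
  using lifts_add[OF assms(1) lifts_cmult[OF assms(2), of "-1"]] by simp

lemma lifts_power: "lifts d A B \<Longrightarrow> lifts (n * d) (\<lambda>v. A v ^ n) (\<lambda>v. B v ^ n)"
  by (induction n) (auto intro: lifts_1 lifts_mult)

lemma lifts_sum:
  "(\<And>i. i \<in> I \<Longrightarrow> lifts d (A i) (B i)) \<Longrightarrow> lifts d (\<lambda>v. \<Sum>i\<in>I. A i v) (\<lambda>v. \<Sum>i\<in>I. B i v)"
  by (induction I rule: infinite_finite_induct) (auto intro: lifts_zero lifts_add)

lemma lifts_coord: "lifts 1 (\<lambda>v. v $ i) (\<lambda>v. v $ i)"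
  using lifts_monom[of 1 0 0 1 1] lifts_monom[of 0 1 0 1 1] lifts_monom[of 0 0 1 1 1] exhaust_3[of i]
  by auto

lemma lifts_eval_const: "lifts d A B \<Longrightarrow> B (\<chi> i. fls_const (v $ i)) = fls_const (A v)"
  by (induction rule: lifts_induct) (auto simp: fls_plus_const fls_const_power[symmetric])

lemma lifts_scale: "lifts d A B \<Longrightarrow> A (c *s v) = c ^ d * A v \<and> B (c' *s w) = c' ^ d * B w"
  by (induction rule: lifts_induct) (auto simp: algebra_simps power_mult_distrib power_add)

text \<open>Specialization: if the coordinates of a Laurent point reduce to those of
  \<open>v\<close>, evaluating the form and reducing commute.\<close>

lemma lifts_residue:
  assumes "lifts d A B" "\<And>i. has_residue (w $ i) (v $ i)"
  shows "has_residue (B w) (A v)"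
  using assms(1)
  by (induction rule: lifts_induct)
     (auto intro!: assms(2) has_residue_0 has_residue_add has_residue_mult has_residue_power has_residue_const)

lemma lifts_compose:
  assumes "A \<in> forms UNIV d" "\<And>i. (\<lambda>v. v' v $ i) \<in> forms UNIV e"
  shows "(\<lambda>v. A (v' v)) \<in> forms UNIV (d * e)"
proof -
  obtain B where B: "lifts d A B" using assms(1) forms_iff_lifts by blast
  obtain L where L: "\<And>i. lifts e (\<lambda>v. v' v $ i) (L i)"
    using choice[of "\<lambda>i L. lifts e (\<lambda>v. v' v $ i) L"] assms(2)[unfolded forms_iff_lifts] by blast
  from B have "\<exists>B. lifts (d * e) (\<lambda>v. A (v' v)) B"
  proof (induction rule: lifts_induct)
    case (monom c i j k)
    have "lifts (0 + i * e + j * e + k * e) (\<lambda>v. c * v' v $ 1 ^ i * v' v $ 2 ^ j * v' v $ 3 ^ k)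
      (\<lambda>v. fls_const c * L 1 v ^ i * L 2 v ^ j * L 3 v ^ k)"
      by (intro lifts_mult lifts_power L lifts_const)
    moreover have "0 + i * e + j * e + k * e = d * e" using monom(1) by (auto simp: algebra_simps)
    ultimately show ?case by auto
  next
    case (add A B A' B')
    then obtain C C' where "lifts (d * e) (\<lambda>v. A (v' v)) C" "lifts (d * e) (\<lambda>v. A' (v' v)) C'" by blast
    show ?case by (rule exI, rule lifts_add) fact+
  qed (blast intro: lifts_zero)
  then show ?thesis using forms_iff_lifts by blast
qed

section \<open>Roots of polynomials over an algebraically closed field\<close>

lemma proots_prod_linear: "proots (\<Prod>x\<in>#A. [:-x, 1:]) = (A :: 'a::idom multiset)"
proof (induction A)
  case (add x A)
  have "(\<Prod>x\<in>#A. [:-x, 1::'a:]) \<noteq> 0" by (auto simp: prod_mset_zero_iff)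
  then show ?case using add by (simp add: proots_mult del: mult_pCons_left)
qed simp

lemma size_proots_alg_closed:
  fixes p :: "'a::alg_closed_field poly"
  assumes "p \<noteq> 0"
  shows "size (proots p) = degree p"
proof -
  obtain A where A: "size A = degree p" "p = smult (lead_coeff p) (\<Prod>x\<in>#A. [:-x, 1:])"
    using alg_closed_imp_factorization[OF assms] by blast
  have "proots p = A"
    using assms by (subst A(2)) (simp add: proots_prod_linear)
  then show ?thesis using A by simp
qed

lemma card_roots_separable:
  fixes p :: "'a::alg_closed_field poly"
  assumes "p \<noteq> 0" "\<And>a. poly p a = 0 \<Longrightarrow> poly (pderiv p) a \<noteq> 0"
  shows "card {x. poly p x = 0} = degree p"
proof -
  have ord: "order a p = 1" if "poly p a = 0" for a
  proof -
    have "\<not> order a p \<ge> 2"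
    proof
      assume "order a p \<ge> 2"
      then have "[:-a, 1:] ^ 2 dvd p" using order_divides by blast
      then obtain r where "p = [:-a, 1:] ^ 2 * r" by (elim dvdE)
      then have r: "p = [:-a, 1:] * ([:-a, 1:] * r)" by (simp only: power2_eq_square mult.assoc)
      have "poly (pderiv p) a = 0"
        unfolding r pderiv_mult by (simp del: mult_pCons_left)
      then show False using assms that by blast
    qed
    moreover have "order a p \<noteq> 0" using that assms(1) order_root by blast
    ultimately show ?thesis by simp
  qed
  have "degree p = size (proots p)" using size_proots_alg_closed[OF assms(1)] by simp
  also have "\<dots> = (\<Sum>a\<in>set_mset (proots p). count (proots p) a)"
    by (simp add: size_multiset_overloaded_eq)
  also have "\<dots> = (\<Sum>a\<in>{x. poly p x = 0}. 1)"
    using assms ord by (intro sum.cong) auto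
  finally show ?thesis by simp
qed

lemma infinite_UNIV_alg_closed: "infinite (UNIV :: 'a::alg_closed_field set)"
proof
  assume fin: "finite (UNIV :: 'a set)"
  define p where "p = (\<Prod>a\<in>(UNIV :: 'a set). [:-a, 1:])"
  have "degree p = card (UNIV :: 'a set)"
    unfolding p_def by (subst degree_prod_eq_sum_degree) auto
  also have "\<dots> > 0" using fin by (simp add: card_gt_0_iff)
  finally have "degree p > 0" .
  then have "degree (p + 1) > 0" by (subst degree_add_eq_left) auto
  then obtain x where x: "poly (p + 1) x = 0" using alg_closed_imp_poly_has_root by blast
  have "poly p x = 0" unfolding p_def poly_prod using fin by (auto simp: prod_zero_iff)
  then show False using x by simp
qed

lemma card_nth_roots:
  fixes y :: "'a::alg_closed_field"
  assumes "n > 0" "of_nat n \<noteq> (0::'a)" "y \<noteq> 0"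
  shows "card {x. x ^ n = y} = n"
proof -
  define p where "p = monom 1 n + [:-y:]"
  have deg: "degree p = n" unfolding p_def
    using assms by (subst degree_add_eq_left) (auto simp: degree_monom_eq)
  have roots: "poly p x = 0 \<longleftrightarrow> x ^ n = y" for x by (auto simp: p_def poly_monom)
  have "card {x. poly p x = 0} = degree p"
  proof (rule card_roots_separable)
    show "p \<noteq> 0" using deg assms by auto
    fix a assume "poly p a = 0"
    then have "a ^ n = y" by (simp add: roots)
    with assms have "a \<noteq> 0" by (auto simp: power_0_left)
    then show "poly (pderiv p) a \<noteq> 0"
      using assms by (simp add: p_def pderiv_add pderiv_monom poly_monom pderiv_pCons)
  qed
  then show ?thesis by (simp add: deg roots)
qed

section \<open>The curve and its Kummer coordinates\<close>

text \<open>On the curve \<open>c\<^sub>1 x + c\<^sub>2 + c\<^sub>3 z = 0\<close> and \<open>b ^ N = x ^ q / z\<close>, so \<open>b\<close> is a Kummer generator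
  of the function field over \<open>K(x)\<close>.\<close>

definition x_coord :: "nat \<Rightarrow> 'a::field ^ 3 \<Rightarrow> 'a" where
  "x_coord q v = v $ 1 * v $ 2 ^ (q - 1) / v $ 3 ^ q"

definition z_coord :: "nat \<Rightarrow> 'a::field ^ 3 \<Rightarrow> 'a" where
  "z_coord q v = v $ 1 ^ q / (v $ 2 * v $ 3 ^ (q - 1))"

definition b_coord :: "'a::field ^ 3 \<Rightarrow> 'a" where
  "b_coord v = v $ 2 / v $ 3"

definition const_vec :: "'a::field ^ 3 \<Rightarrow> 'a fls ^ 3" where
  "const_vec v = (\<chi> i. fls_const (v $ i))"

lemma index_mod_3: "(4::3) = 1" "(5::3) = 2" by simp_all

lemma fls_const_divide: "fls_const (a / b) = fls_const a / fls_const (b :: 'a::field)"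
  by (simp add: divide_inverse fls_const_mult_const fls_inverse_const flip: fls_const_mult_const)

lemma fls_const_sum: "fls_const (sum f A) = (\<Sum>i\<in>A. fls_const (f i :: 'a::field))"
  by (induction A rule: infinite_finite_induct) (auto simp flip: fls_plus_const)

text \<open>Arbitrary nonzero coefficients make the equation invariant in shape under the cyclic
  shift of the coordinates, so one computation serves all three charts and all three coordinate
  points. Indices live in the type \<open>3\<close>, where \<open>i + 1\<close> and
  \<open>i + 2\<close> are taken cyclically.\<close>

locale curve =
  fixes q :: nat and c :: "3 \<Rightarrow> 'k::alg_closed_field"
  assumes prime_char: "prime CHAR('k)" and q_power: "\<exists>m. q = CHAR('k) ^ m" and q_gt_2: "q > 2"
    and c_nz: "\<And>i. c i \<noteq> 0"
begin

definition H :: "'k ^ 3 \<Rightarrow> 'k" where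
  "H v = (\<Sum>i\<in>UNIV. c i * v $ i * v $ (i + 1) ^ q)"

definition HL :: "'k fls ^ 3 \<Rightarrow> 'k fls" where
  "HL w = (\<Sum>i\<in>UNIV. fls_const (c i) * w $ i * w $ (i + 1) ^ q)"

definition N :: nat where "N = q ^ 2 - q + 1"

definition Z :: "'k poly" where "Z = [:- (c 2 / c 3), - (c 1 / c 3):]"

text \<open>Points of the curve over the Laurent series, off the coordinate triangle. Constant
  points are included here and excluded only by \<open>generic\<close>.\<close>

definition good :: "'k fls ^ 3 \<Rightarrow> bool" where
  "good w \<longleftrightarrow> (\<forall>i. w $ i \<noteq> 0) \<and> HL w = 0"

abbreviation x where "x \<equiv> x_coord q"
abbreviation z where "z \<equiv> z_coord q"
abbreviation b where "b \<equiv> b_coord"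

lemma H_expand: "H v = c 1 * v $ 1 * v $ 2 ^ q + c 2 * v $ 2 * v $ 3 ^ q + c 3 * v $ 3 * v $ 1 ^ q"
  by (simp add: H_def sum_3 index_mod_3)

lemma HL_expand: "HL v = fls_const (c 1) * v $ 1 * v $ 2 ^ q + fls_const (c 2) * v $ 2 * v $ 3 ^ q
    + fls_const (c 3) * v $ 3 * v $ 1 ^ q"
  by (simp add: HL_def sum_3 index_mod_3)

lemma lifts_H: "lifts (q + 1) H HL"
proof -
  have "lifts (0 + 1 + q * 1) (\<lambda>v. \<Sum>i\<in>UNIV. c i * v $ i * v $ (i + 1) ^ q)
    (\<lambda>w. \<Sum>i\<in>UNIV. fls_const (c i) * w $ i * w $ (i + 1) ^ q)"
    by (intro lifts_sum lifts_mult lifts_const lifts_coord lifts_power)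
  then show ?thesis by (simp add: H_def[abs_def] HL_def[abs_def] add.commute)
qed

lemma H_scale: "H (a *s v) = a ^ (q + 1) * H v"
  using lifts_scale[OF lifts_H] by blast

lemma HL_const_vec: "HL (const_vec v) = fls_const (H v)"
  using lifts_eval_const[OF lifts_H] by (simp add: const_vec_def)

lemma N_eq: "N = q * (q - 1) + 1"
  by (simp add: N_def power2_eq_square diff_mult_distrib2)

lemma N_gt: "N > q"
proof -
  have "q * 2 \<le> q * (q - 1)" using q_gt_2 by (intro mult_le_mono2) auto
  then show ?thesis using q_gt_2 unfolding N_eq by linarith
qed

lemma N_pos: "N > 0" by (simp add: N_eq)

lemma coprime_N_q: "coprime (int N) (int q)"
proof -
  have "int N = int (q - 1) * int q + 1" by (simp add: N_eq)
  then show ?thesis by (metis coprime_1_left coprime_iff_gcd_eq_1 gcd_add_mult add.commute gcd.commute)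
qed

lemma char_dvd_q: "CHAR('k) dvd q"
proof -
  obtain m where m: "q = CHAR('k) ^ m" using q_power by blast
  then have "m \<noteq> 0" using q_gt_2 by (intro notI) simp
  then show ?thesis using m by (simp add: dvd_power)
qed

lemma of_nat_q: "of_nat q = (0::'k)"
  using char_dvd_q by (simp add: of_nat_eq_0_iff_char_dvd)

lemma of_nat_N: "of_nat N = (1::'k)"
  by (simp add: N_eq of_nat_q)

lemma frobenius_add: "(u + v) ^ q = u ^ q + (v ^ q :: 'k)"
  using q_power prime_char freshmans_dream' by blast

lemma frobenius_diff: "(u - v) ^ q = u ^ q - (v ^ q :: 'k)"
  by (metis add_diff_cancel_right' diff_add_cancel frobenius_add)

lemma frobenius_add_fls: "(u + v) ^ q = u ^ q + (v ^ q :: 'k fls)"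
  using q_power prime_char freshmans_dream'[where 'a = "'k fls"] by (metis semiring_char_fls)

lemma frobenius_add_fps: "(u + v) ^ q = u ^ q + (v ^ q :: 'k fps)"
  using q_power prime_char freshmans_dream'[where 'a = "'k fps"] by (metis semiring_char_fps)

lemma frobenius_diff_fps: "(u - v) ^ q = u ^ q - (v ^ q :: 'k fps)"
  by (metis add_diff_cancel_right' diff_add_cancel frobenius_add_fps)

lemma good_coord: "good w \<Longrightarrow> w $ i \<noteq> 0"
  by (simp add: good_def)

lemma good_xzb_nz: "good w \<Longrightarrow> x w \<noteq> 0" "good w \<Longrightarrow> z w \<noteq> 0" "good w \<Longrightarrow> b w \<noteq> 0"
  by (auto simp: x_coord_def z_coord_def b_coord_def good_coord)

lemma power_q_split: "u ^ q = u * (u :: 'a::monoid_mult) ^ (q - 1)"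
  using q_gt_2 by (cases q) auto

text \<open>A monomial identity that does not involve the equation of the curve; the exponents match
  because \<open>N + (q - 1) = q * q\<close>.\<close>

lemma bN_eq:
  assumes "\<And>i. w $ i \<noteq> (0::'a::field)"
  shows "b w ^ N * z w = x w ^ q"
proof -
  have 1: "b w ^ N * z w * (w $ 3 ^ N * (w $ 2 * w $ 3 ^ (q - 1))) = w $ 2 ^ N * w $ 1 ^ q"
    using assms by (simp add: b_coord_def z_coord_def power_divide field_simps)
  have 2: "x w ^ q * (w $ 3 ^ q) ^ q = w $ 1 ^ q * (w $ 2 ^ (q - 1)) ^ q"
    using assms by (simp add: x_coord_def power_divide power_mult_distrib)
  have 3: "w $ 3 ^ N * (w $ 2 * w $ 3 ^ (q - 1)) = w $ 2 * (w $ 3 ^ q) ^ q"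
  proof -
    have "N + (q - 1) = q * q" using q_gt_2 unfolding N_eq by (cases q) auto
    then have "w $ 3 ^ N * w $ 3 ^ (q - 1) = (w $ 3 ^ q) ^ q" by (simp flip: power_add power_mult)
    then show ?thesis by (simp add: algebra_simps)
  qed
  have 4: "w $ 2 ^ N = w $ 2 * (w $ 2 ^ (q - 1)) ^ q"
    by (simp add: N_eq mult.commute[of q] flip: power_mult)
  have "b w ^ N * z w * (w $ 2 * (w $ 3 ^ q) ^ q) = w $ 2 * (x w ^ q * (w $ 3 ^ q) ^ q)"
    using 1[unfolded 3 4] by (simp only: 2 mult_ac)
  then have "b w ^ N * z w * (w $ 2 * (w $ 3 ^ q) ^ q) = x w ^ q * (w $ 2 * (w $ 3 ^ q) ^ q)"
    by (simp only: mult_ac)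
  then show ?thesis using assms by simp
qed

lemma z_eq_Z:
  assumes "good w"
  shows "z w = evalp Z (x w)"
proof -
  have nz: "\<And>i. w $ i \<noteq> 0" using assms good_coord by blast
  have "x w * (w $ 2 * w $ 3 ^ q) = w $ 1 * w $ 2 ^ q"
    using nz by (simp add: x_coord_def power_q_split[of "w $ 2"])
  moreover have "z w * (w $ 2 * w $ 3 ^ q) = w $ 3 * w $ 1 ^ q"
    using nz by (simp add: z_coord_def power_q_split[of "w $ 3"])
  ultimately have "(fls_const (c 1) * x w + fls_const (c 2) + fls_const (c 3) * z w) * (w $ 2 * w $ 3 ^ q) = HL w"
    by (simp add: HL_expand algebra_simps)
  with assms nz have "fls_const (c 1) * x w + fls_const (c 2) + fls_const (c 3) * z w = 0"
    by (simp add: good_def)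
  then have "fls_const (c 3) * z w = - (fls_const (c 1) * x w + fls_const (c 2))"
    by (metis eq_neg_iff_add_eq_0 add.commute)
  moreover have "fls_const (c 3) * evalp Z (x w) = - (fls_const (c 1) * x w + fls_const (c 2))"
    using c_nz[of 3] by (simp add: Z_def fls_const_divide field_simps)
  ultimately show ?thesis using c_nz[of 3] by (metis fls_const_eq_0_iff mult_left_cancel)
qed

section \<open>Forms as combinations of powers of \<open>b\<close> over K(\<open>x\<close>)\<close>

text \<open>An element written on the basis \<open>1, b, ..., b ^ (N - 1)\<close> of the Kummer
  extension, with coefficients polynomial in \<open>x\<close>; only the first \<open>N\<close>
  values of \<open>p\<close> count.\<close>

definition pev :: "(nat \<Rightarrow> 'k poly) \<Rightarrow> 'k fls \<Rightarrow> 'k fls \<Rightarrow> 'k fls" where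
  "pev p u y = (\<Sum>k<N. evalp (p k) u * y ^ k)"

lemma power_mod_N:
  assumes "good w"
  shows "z w ^ (n div N) * b w ^ n = x w ^ (q * (n div N)) * b w ^ (n mod N)"
proof -
  have "b w ^ n = (b w ^ N) ^ (n div N) * b w ^ (n mod N)"
    by (metis div_mult_mod_eq mult.commute power_add power_mult)
  then have "z w ^ (n div N) * b w ^ n = (b w ^ N * z w) ^ (n div N) * b w ^ (n mod N)"
    by (simp add: power_mult_distrib algebra_simps)
  also have "b w ^ N * z w = x w ^ q" using bN_eq good_coord[OF assms] by blast
  finally show ?thesis by (simp add: power_mult)
qed

text \<open>Replacing \<open>b ^ N\<close> by \<open>x ^ q / z\<close> introduces powers of
  \<open>z\<close> in the denominator, at most \<open>n div N\<close> for the exponent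
  \<open>n\<close>; the degree of \<open>G\<close> is a crude common bound for them.\<close>

lemma reduce_mod_N:
  "\<exists>J p. \<forall>w. good w \<longrightarrow> z w ^ J * evalpp G (x w) (b w) = pev p (x w) (b w)"
proof -
  define J where "J = degree G"
  define g where "g n = coeff G n * monom 1 (q * (n div N)) * Z ^ (J - n div N)" for n
  define p where "p k = (\<Sum>n\<in>{n. n \<le> J \<and> n mod N = k}. g n)" for k
  have "z w ^ J * evalpp G (x w) (b w) = pev p (x w) (b w)" if w: "good w" for w
  proof -
    have summand: "z w ^ J * (evalp (coeff G n) (x w) * b w ^ n) = evalp (g n) (x w) * b w ^ (n mod N)"
      if "n \<le> J" for n
    proof -
      have "z w ^ J = z w ^ (J - n div N) * z w ^ (n div N)"
        using that by (metis div_le_dividend le_add_diff_inverse2 le_trans power_add)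
      then show ?thesis
        using power_mod_N[OF w, of n] z_eq_Z[OF w]
        by (simp add: g_def algebra_simps)
    qed
    have "z w ^ J * evalpp G (x w) (b w) = (\<Sum>n\<le>J. z w ^ J * (evalp (coeff G n) (x w) * b w ^ n))"
      by (simp add: evalpp_altdef J_def sum_distrib_left)
    also have "\<dots> = (\<Sum>n\<le>J. evalp (g n) (x w) * b w ^ (n mod N))"
      using summand by (intro sum.cong) auto
    also have "\<dots> = (\<Sum>k<N. \<Sum>n\<in>{n\<in>{..J}. n mod N = k}. evalp (g n) (x w) * b w ^ (n mod N))"
      by (rule sum.group[symmetric]) (use N_pos in auto)
    also have "\<dots> = pev p (x w) (b w)"
      unfolding pev_def p_def evalp_sum sum_distrib_right
      by (intro sum.cong) auto
    finally show ?thesis .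
  qed
  then show ?thesis by blast
qed

lemma monomial_coords:
  assumes w: "\<And>i. w $ i \<noteq> (0::'a::field)" and ijk: "i + j + k = d"
  shows "w $ 1 ^ i * w $ 2 ^ j * w $ 3 ^ k = w $ 3 ^ d * (x w ^ i * b w powi (int j - int (q - 1) * int i))"
proof -
  have 1: "w $ 1 = w $ 3 * x w * b w powi (- int (q - 1))"
    using w by (simp add: x_coord_def b_coord_def power_int_minus power_divide power_q_split[of "w $ 3"]
        del: of_nat_diff of_nat_diff_if)
  have "w $ 1 ^ i = w $ 3 ^ i * x w ^ i * b w powi (- int (q - 1) * int i)"
    by (subst 1) (simp add: power_mult_distrib power_int_mult del: of_nat_diff mult_minus_left)
  moreover have "w $ 2 ^ j = w $ 3 ^ j * b w powi int j"
    using w by (simp add: b_coord_def power_divide)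
  moreover have "b w powi (int j - int (q - 1) * int i) = b w powi (- int (q - 1) * int i) * b w powi int j"
    using w by (subst power_int_add[symmetric]) (auto simp: b_coord_def)
  ultimately show ?thesis using ijk by (simp add: power_add flip: ijk)
qed

text \<open>Up to the factor \<open>w $ 3 ^ d\<close> a monomial is a power of \<open>x\<close>
  times a possibly negative power of \<open>b\<close>. Reducing the latter modulo \<open>N\<close>
  may leave negative powers of \<open>x\<close> and \<open>z\<close>, which the factor
  \<open>(x w * z w) ^ E\<close> clears.\<close>

lemma normal_form:
  assumes "lifts d A B"
  shows "\<exists>E p. \<forall>w. good w \<longrightarrow> (x w * z w) ^ E * B w = w $ 3 ^ d * pev p (x w) (b w)"
  using assms
proof (induction rule: lifts_induct)
  case zero
  show ?case by (rule exI[of _ 0], rule exI[of _ "\<lambda>_. 0"]) (simp add: pev_def)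
next
  case (add A B A' B')
  then obtain E p E' p' where
    1: "\<And>w. good w \<Longrightarrow> (x w * z w) ^ E * B w = w $ 3 ^ d * pev p (x w) (b w)" and
    2: "\<And>w. good w \<Longrightarrow> (x w * z w) ^ E' * B' w = w $ 3 ^ d * pev p' (x w) (b w)" by blast
  define Y where "Y = [:0, 1:] * Z"
  have Y: "evalp Y (x w) = x w * z w" if "good w" for w
    using z_eq_Z[OF that] by (simp add: Y_def)
  have "(x w * z w) ^ (E + E') * (B w + B' w)
    = w $ 3 ^ d * pev (\<lambda>k. Y ^ E' * p k + Y ^ E * p' k) (x w) (b w)" if w: "good w" for w
  proof -
    have "(x w * z w) ^ (E + E') * (B w + B' w) = (x w * z w) ^ E' * ((x w * z w) ^ E * B w)
       + (x w * z w) ^ E * ((x w * z w) ^ E' * B' w)"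
      by (simp add: power_add algebra_simps)
    also have "\<dots> = w $ 3 ^ d * ((x w * z w) ^ E' * pev p (x w) (b w) + (x w * z w) ^ E * pev p' (x w) (b w))"
      unfolding 1[OF w] 2[OF w] by (simp only: distrib_left mult_ac)
    also have "(x w * z w) ^ E' * pev p (x w) (b w) + (x w * z w) ^ E * pev p' (x w) (b w)
      = pev (\<lambda>k. Y ^ E' * p k + Y ^ E * p' k) (x w) (b w)"
      by (simp add: pev_def Y[OF w] sum_distrib_left algebra_simps sum.distrib)
    finally show ?thesis .
  qed
  then show ?case by blast
next
  case (monom a i j k)
  define m where "m = int j - int (q - 1) * int i"
  define e where "e = m div int N"
  define k0 where "k0 = nat (m mod int N)"
  have k0: "k0 < N" "int k0 = m mod int N" using N_pos by (auto simp: k0_def nat_less_iff)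
  have m: "m = int k0 + int N * e" using k0 by (simp add: e_def)
  \<comment> \<open>Large enough for the resulting exponents \<open>E + i + q * e\<close> of
    \<open>x\<close> and \<open>E - e\<close> of \<open>z\<close> to be nonnegative, whatever the
    sign of \<open>e\<close>.\<close>
  define E where "E = nat (int q * \<bar>e\<bar> + \<bar>e\<bar>)"
  define s where "s = nat (int E + int i + int q * e)"
  define t where "t = nat (int E - e)"
  have qe: "\<bar>int q * e\<bar> = int q * \<bar>e\<bar>" by (simp add: abs_mult)
  have s: "int s = int E + int i + int q * e" unfolding s_def E_def using qe by linarith
  have "0 \<le> int q * \<bar>e\<bar>" by simp
  then have t: "int t = int E - e" unfolding t_def E_def by linarith
  define p where "p = (\<lambda>k. if k = k0 then smult a (monom 1 s * Z ^ t) else 0)"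
  have "(x w * z w) ^ E * (fls_const a * w $ 1 ^ i * w $ 2 ^ j * w $ 3 ^ k)
     = w $ 3 ^ d * pev p (x w) (b w)" if w: "good w" for w
  proof -
    note nz = good_xzb_nz[OF w]
    have "(b w ^ N) = x w ^ q / z w"
      using bN_eq[OF good_coord[OF w]] nz by (simp add: field_simps)
    then have "b w powi m = b w ^ k0 * (x w ^ q / z w) powi e"
      unfolding m using nz by (simp add: power_int_add power_int_mult)
    also have "\<dots> = b w ^ k0 * x w powi (int q * e) * z w powi (- e)"
      by (simp add: power_int_mult_distrib power_int_inverse power_int_mult power_int_minus divide_inverse)
    finally have bm: "b w powi m = b w ^ k0 * x w powi (int q * e) * z w powi (- e)" .
    have "x w ^ E * x w ^ i * x w powi (int q * e) = x w powi int s"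
      unfolding s using nz by (simp add: power_int_add)
    moreover have "z w ^ E * z w powi (- e) = z w powi int t"
      unfolding t using nz by (simp add: power_int_diff power_int_minus divide_inverse)
    ultimately have xz: "x w ^ s * z w ^ t = (x w ^ E * x w ^ i * x w powi (int q * e)) * (z w ^ E * z w powi (- e))"
      by simp
    have "(x w * z w) ^ E * (x w ^ i * b w powi m) = x w ^ s * z w ^ t * b w ^ k0"
      unfolding bm xz by (simp only: power_mult_distrib mult_ac)
    moreover have "pev p (x w) (b w) = fls_const a * (x w ^ s * z w ^ t * b w ^ k0)"
      unfolding pev_def p_def using k0 z_eq_Z[OF w]
      by (subst sum.mono_neutral_right[of _ "{k0}"]) (auto simp: algebra_simps)
    ultimately show ?thesis
      using monomial_coords[OF good_coord[OF w] monom, folded m_def]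
      by (simp add: algebra_simps)
  qed
  then show ?case by blast
qed

text \<open>The point of the curve over \<open>x = d\<close> with \<open>X\<^sub>2 / X\<^sub>3 = y\<close>.\<close>

definition pt :: "'k \<Rightarrow> 'k \<Rightarrow> 'k ^ 3" where
  "pt d y = vector [d / y ^ (q - 1), y, 1]"

definition fiber :: "'k \<Rightarrow> 'k set" where
  "fiber d = {y. y ^ N = d ^ q / poly Z d}"

lemma coord_const_vec:
  "x (const_vec v) = fls_const (x v)" "z (const_vec v) = fls_const (z v)" "b (const_vec v) = fls_const (b v)"
  by (simp_all add: x_coord_def z_coord_def b_coord_def const_vec_def fls_const_divide fls_const_power[symmetric]
      fls_const_mult_const[symmetric] del: fls_const_mult_const)

lemma good_const_vec: "(\<And>i. v $ i \<noteq> 0) \<Longrightarrow> H v = 0 \<Longrightarrow> good (const_vec v)"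
  by (simp add: good_def HL_const_vec) (simp add: const_vec_def)

lemma pt_props:
  assumes "d \<noteq> 0" "poly Z d \<noteq> 0" "y \<in> fiber d"
  shows "y \<noteq> 0" "pt d y $ i \<noteq> 0" "H (pt d y) = 0" "x (pt d y) = d" "b (pt d y) = y" "z (pt d y) = poly Z d"
proof -
  have yN: "y ^ N = d ^ q / poly Z d" using assms by (simp add: fiber_def)
  with assms N_pos show y: "y \<noteq> 0" by (auto simp: power_0_left)
  show nz: "pt d y $ i \<noteq> 0" for i
    using y assms(1) exhaust_3[of i] by (auto simp: pt_def vector_3)
  show "x (pt d y) = d" "b (pt d y) = y"
    using y by (simp_all add: pt_def x_coord_def b_coord_def vector_3)
  have "y ^ N = (y ^ (q - 1)) ^ q * y" by (simp add: N_eq mult.commute[of q] flip: power_mult)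
  then have "z (pt d y) = d ^ q / y ^ N"
    using y by (simp add: pt_def z_coord_def vector_3 power_divide)
  also have "\<dots> = poly Z d" using assms yN by simp
  finally show zz: "z (pt d y) = poly Z d" .
  have 1: "(d / y ^ (q - 1)) ^ q = poly Z d * y"
    using zz y by (simp add: pt_def z_coord_def vector_3 field_simps)
  have "H (pt d y) = c 1 * (d / y ^ (q - 1)) * y ^ q + c 2 * y + c 3 * (d / y ^ (q - 1)) ^ q"
    by (simp add: H_expand pt_def vector_3)
  also have "\<dots> = (c 1 * d + c 2 + c 3 * poly Z d) * y"
    unfolding 1 using y by (simp add: power_q_split[of y] algebra_simps)
  also have "\<dots> = 0" using c_nz[of 3] by (simp add: Z_def field_simps)
  finally show "H (pt d y) = 0" .
qed

lemma card_fiber: "d \<noteq> 0 \<Longrightarrow> poly Z d \<noteq> 0 \<Longrightarrow> card (fiber d) = N"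
  unfolding fiber_def by (rule card_nth_roots) (use N_pos of_nat_N in auto)

lemma pt_surj:
  assumes "\<And>i. v $ i \<noteq> 0" "H v = 0"
  shows "v = v $ 3 *s pt (x v) (b v)" "x v \<noteq> 0" "poly Z (x v) \<noteq> 0" "b v \<in> fiber (x v)"
proof -
  have g: "good (const_vec v)" using assms by (rule good_const_vec)
  show x0: "x v \<noteq> 0" using assms by (simp add: x_coord_def)
  have "fls_const (z v) = fls_const (poly Z (x v))"
    using z_eq_Z[OF g] by (simp add: coord_const_vec evalp_const)
  then have z: "z v = poly Z (x v)" by (metis fls_const_nth)
  moreover have "z v \<noteq> 0" using assms by (simp add: z_coord_def)
  ultimately show z0: "poly Z (x v) \<noteq> 0" by simp
  show "b v \<in> fiber (x v)" using bN_eq[OF assms(1)] z z0 by (simp add: fiber_def field_simps)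
  have "v $ 1 = v $ 3 * (x v / b v ^ (q - 1))"
    using assms(1) by (simp add: x_coord_def b_coord_def power_divide power_q_split[of "v $ 3"])
  moreover have "v $ 2 = v $ 3 * b v" using assms(1) by (simp add: b_coord_def)
  ultimately show "v = v $ 3 *s pt (x v) (b v)"
    by (simp add: vec_eq_iff forall_3 pt_def vector_3)
qed

lemma poly_eq_0_cofinitely:
  fixes p :: "'k poly"
  assumes "finite S" "\<And>d. d \<notin> S \<Longrightarrow> poly p d = 0"
  shows "p = 0"
proof (rule ccontr)
  assume "p \<noteq> 0"
  then have "finite {d. poly p d = 0}" by (rule poly_roots_finite)
  then have "finite (S \<union> {d. poly p d = 0})" using assms by simp
  moreover have "S \<union> {d. poly p d = 0} = UNIV" using assms by auto
  ultimately show False using infinite_UNIV_alg_closed[where 'a = 'k] by simp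
qed

text \<open>A polynomial in \<open>b\<close> of degree below \<open>N\<close> with the
  \<open>N\<close> distinct elements of the fiber as zeros.\<close>

lemma fiber_sum_eq_0:
  assumes "d \<noteq> 0" "poly Z d \<noteq> 0" "\<And>y. y \<in> fiber d \<Longrightarrow> (\<Sum>k<N. a k * y ^ k) = 0" "k < N"
  shows "a k = 0"
proof -
  define f where "f = (\<Sum>k<N. monom (a k) k)"
  have "f = 0"
  proof (rule poly_eqI_degree)
    show "poly f y = poly 0 y" if "y \<in> fiber d" for y
      using assms(3)[OF that] by (simp add: f_def poly_sum poly_monom)
    have "degree f \<le> N - 1"
      unfolding f_def by (rule degree_sum_le) (auto intro: order.trans[OF degree_monom_le])
    then show "degree f < card (fiber d)" using card_fiber assms N_pos by simp
    show "degree 0 < card (fiber d)" using card_fiber assms N_pos by simp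
  qed
  then have "coeff f k = 0" by simp
  then show ?thesis using assms(4) by (simp add: f_def coeff_sum)
qed

lemma Z_nz: "Z \<noteq> 0"
  using c_nz by (simp add: Z_def)

text \<open>Over each \<open>d\<close> outside the finite branch values the coefficients
  \<open>p k\<close> vanish at \<open>d\<close>, one full fiber being enough; hence they vanish
  identically.\<close>

lemma pev_vanishing:
  assumes "\<And>d y. d \<noteq> 0 \<Longrightarrow> poly Z d \<noteq> 0 \<Longrightarrow> y \<in> fiber d \<Longrightarrow> pev p (fls_const d) (fls_const y) = 0" "k < N"
  shows "p k = 0"
proof (rule poly_eq_0_cofinitely)
  show "finite ({0} \<union> {d. poly Z d = 0})" using poly_roots_finite[OF Z_nz] by simp
  fix d assume d: "d \<notin> {0} \<union> {d. poly Z d = 0}"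
  have "(\<Sum>k<N. poly (p k) d * y ^ k) = 0" if "y \<in> fiber d" for y
  proof -
    have "fls_const (\<Sum>k<N. poly (p k) d * y ^ k) = pev p (fls_const d) (fls_const y)"
      by (simp add: pev_def evalp_const fls_const_sum fls_const_power flip: fls_const_mult_const)
    then show ?thesis using assms(1) d that by auto
  qed
  then show "poly (p k) d = 0"
    using fiber_sum_eq_0[of d "\<lambda>k. poly (p k) d" k] d assms(2) by auto
qed

section \<open>The Galois action and the norm to K(\<open>x\<close>)\<close>

text \<open>Acts on the Kummer extension by sending \<open>b\<close> to \<open>u * b\<close>. It has
  exactly \<open>N\<close> elements because \<open>N\<close> is congruent to 1 modulo the
  characteristic.\<close>

definition mu :: "'k set" where "mu = {u. u ^ N = 1}"

lemma card_mu: "card mu = N"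
  unfolding mu_def by (rule card_nth_roots) (use N_pos of_nat_N in auto)

lemma finite_mu: "finite mu"
  using card_mu N_pos card_ge_0_finite by metis

lemma mu_nz: "u \<in> mu \<Longrightarrow> u \<noteq> 0"
  using N_pos by (auto simp: mu_def power_0_left)

lemma mu_power_nontrivial:
  assumes "\<not> N dvd n"
  shows "\<exists>u\<in>mu. u ^ n \<noteq> 1"
proof (rule ccontr)
  assume *: "\<not> ?thesis"
  define r where "r = n mod N"
  have r: "0 < r" "r < N" using assms N_pos by (auto simp: r_def dvd_eq_mod_eq_0)
  define f where "f = monom (1::'k) r + [:-1:]"
  have deg: "degree f = r"
    unfolding f_def using r by (subst degree_add_eq_left) (auto simp: degree_monom_eq)
  have "poly f u = 0" if "u \<in> mu" for u
  proof -
    have "u ^ n = (u ^ N) ^ (n div N) * u ^ r"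
      by (metis div_mult_mod_eq mult.commute power_add power_mult r_def)
    then have "u ^ r = 1" using * that by (simp add: mu_def)
    then show ?thesis by (simp add: f_def poly_monom)
  qed
  then have "f = 0"
    using card_mu r deg by (intro poly_eqI_degree[where A = mu]) auto
  then show False using deg r by simp
qed

text \<open>The norm to \<open>K(x)\<close>: the product over \<open>\<zeta>\<close> is invariant under \<open>b \<mapsto> \<eta> b\<close>, so only powers of
  \<open>b ^ N = x ^ q / z\<close> survive.\<close>

lemma norm_form:
  "\<exists>D J Gs. \<forall>w. good w \<longrightarrow>
     z w ^ J * (\<Prod>u\<in>mu. pev p (x w) (fls_const u * b w)) = evalp D (x w) \<and>
     pev p (x w) (b w) * evalpp Gs (x w) (b w) = evalp D (x w)"
proof -
  define G where "G u = (\<Sum>k<N. monom (smult (u ^ k) (p k)) k)" for u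
  define P where "P = (\<Prod>u\<in>mu. G u)"
  define J where "J = degree P"
  define g where "g n = coeff P n * monom 1 (q * (n div N)) * Z ^ (J - n div N)" for n
  define D where "D = (\<Sum>n\<in>{n\<in>{..J}. N dvd n}. g n)"
  \<comment> \<open>The product of the remaining conjugates, rescaled by the same power of
    \<open>Z\<close>: the cofactor that turns \<open>pev p\<close> into its norm and thereby
    rationalizes denominators.\<close>
  define Gs where "Gs = monom (Z ^ J) 0 * (\<Prod>u\<in>mu - {1}. G u)"
  have G_eval: "evalpp (G u) x' b' = pev p x' (fls_const u * b')" for u x' b'
    by (simp add: G_def pev_def evalpp_sum power_mult_distrib fls_const_power mult_ac)
  have coeff_G: "coeff (G u) n = (if n < N then smult (u ^ n) (p n) else 0)" for u n
    by (simp add: G_def coeff_sum)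
  have twist: "pcompose (G u) [:0, [:v:]:] = G (u * v)" for u v
    by (rule poly_eqI)
       (simp add: coeff_pcompose_linear coeff_G power_mult_distrib mult_ac poly_const_pow)
  have inv: "pcompose P [:0, [:v:]:] = P" if v: "v \<in> mu" for v
  proof -
    have "pcompose P [:0, [:v:]:] = (\<Prod>u\<in>mu. G (u * v))"
      by (simp add: P_def pcompose_prod twist)
    also have "\<dots> = P"
      unfolding P_def using mu_nz[OF v] v
      by (intro prod.reindex_bij_witness[of _ "\<lambda>u. u / v" "\<lambda>u. u * v"])
         (auto simp: mu_def power_mult_distrib power_divide)
    finally show ?thesis .
  qed
  have coeff_P: "coeff P n = 0" if n: "\<not> N dvd n" for n
  proof -
    obtain v where v: "v \<in> mu" "v ^ n \<noteq> 1" using mu_power_nontrivial[OF n] by blast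
    have "coeff (pcompose P [:0, [:v:]:]) n = coeff P n" using inv[OF v(1)] by simp
    then have "smult (v ^ n) (coeff P n) = coeff P n"
      by (simp add: coeff_pcompose_linear poly_const_pow)
    then have "smult (v ^ n - 1) (coeff P n) = 0" by (simp add: smult_diff_left)
    then show ?thesis using v by simp
  qed
  have "z w ^ J * (\<Prod>u\<in>mu. pev p (x w) (fls_const u * b w)) = evalp D (x w) \<and>
     pev p (x w) (b w) * evalpp Gs (x w) (b w) = evalp D (x w)" if w: "good w" for w
  proof -
    have summand: "z w ^ J * (evalp (coeff P n) (x w) * b w ^ n) = (if N dvd n then evalp (g n) (x w) else 0)"
      if "n \<le> J" for n
    proof (cases "N dvd n")
      case True
      have "z w ^ J = z w ^ (J - n div N) * z w ^ (n div N)"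
        using that by (metis div_le_dividend le_add_diff_inverse2 le_trans power_add)
      then show ?thesis
        using True power_mod_N[OF w, of n] z_eq_Z[OF w]
        by (simp add: g_def algebra_simps)
    qed (simp add: coeff_P)
    have "z w ^ J * evalpp P (x w) (b w) = (\<Sum>n\<le>J. z w ^ J * (evalp (coeff P n) (x w) * b w ^ n))"
      by (simp add: evalpp_altdef J_def sum_distrib_left)
    also have "\<dots> = (\<Sum>n\<le>J. if N dvd n then evalp (g n) (x w) else 0)"
      using summand by (intro sum.cong) auto
    also have "\<dots> = evalp D (x w)"
      unfolding D_def evalp_sum by (rule sum.inter_filter[symmetric]) simp
    finally have 1: "z w ^ J * evalpp P (x w) (b w) = evalp D (x w)" .
    have "evalpp P (x w) (b w) = (\<Prod>u\<in>mu. pev p (x w) (fls_const u * b w))"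
      by (simp add: P_def evalpp_prod G_eval)
    moreover have "pev p (x w) (b w) * evalpp Gs (x w) (b w) = z w ^ J * evalpp P (x w) (b w)"
    proof -
      have "1 \<in> mu" by (simp add: mu_def)
      then have "P = G 1 * (\<Prod>u\<in>mu - {1}. G u)" unfolding P_def by (rule prod.remove[OF finite_mu])
      then show ?thesis by (simp add: Gs_def G_eval z_eq_Z[OF w] mult_ac)
    qed
    ultimately show ?thesis using 1 by simp
  qed
  then show ?thesis by blast
qed

end

section \<open>Formal expansions at the points of the curve\<close>

text \<open>Banach's fixed point theorem for the adic metric. The contraction is required only for
  \<open>n > 0\<close>, that is, among series with the same constant term; the first hypothesis
  starts the iteration there.\<close>

lemma fps_fixpoint:
  fixes F :: "'a::comm_ring_1 fps \<Rightarrow> 'a fps"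
  assumes F0: "fps_nth (F 0) 0 = 0"
    and contr: "\<And>B B' n. 0 < n \<Longrightarrow> \<forall>k<n. fps_nth B k = fps_nth B' k \<Longrightarrow>
       \<forall>k<Suc n. fps_nth (F B) k = fps_nth (F B') k"
  shows "\<exists>B. fps_nth B 0 = 0 \<and> F B = B"
proof -
  define S where "S n = (F ^^ n) 0" for n
  have step: "\<forall>k<Suc n. fps_nth (S (Suc n)) k = fps_nth (S n) k" for n
  proof (induction n)
    case 0
    then show ?case using F0 by (simp add: S_def)
  next
    case (Suc n)
    then show ?case using contr[of "Suc n" "S (Suc n)" "S n"] by (simp add: S_def)
  qed
  have stable: "fps_nth (S (k + m)) k = fps_nth (S k) k" for k m
    by (induction m) (use step in auto)
  define B where "B = Abs_fps (\<lambda>n. fps_nth (S n) n)"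
  have BS: "\<forall>k<Suc n. fps_nth B k = fps_nth (S n) k" for n
    using stable[of _ "n - _"] by (auto simp: B_def) (metis le_add_diff_inverse less_Suc_eq_le stable)
  have "fps_nth (F B) n = fps_nth B n" for n
    using contr[of "Suc n" B "S n", OF _ BS] BS[of "Suc n"] by (simp add: S_def)
  then have "F B = B" by (simp add: fps_eq_iff)
  moreover have "fps_nth B 0 = 0" by (simp add: B_def S_def)
  ultimately show ?thesis by blast
qed

lemma index_cyclic: "j = i \<or> j = i + 1 \<or> j = i + (2::3)"
  using exhaust_3[of i] exhaust_3[of j] by (auto simp: index_mod_3)

lemma index_distinct: "i + 1 \<noteq> i" "i + 2 \<noteq> i" "i + 1 \<noteq> i + 2" "i \<noteq> i + 1" "i \<noteq> i + 2" "i + 2 \<noteq> i + (1::3)"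
  by simp_all

lemma index_add: "i + 2 + 1 = (i::3)" "i + 1 + 1 = i + 2" "i + 1 + 2 = i" "i + 2 + 2 = i + 1"
  using exhaust_3[of i] by (auto simp: index_mod_3)

lemma sum_cyclic: "(\<Sum>j\<in>UNIV. f j) = f i + f (i + 1) + f (i + (2::3))"
  using exhaust_3[of i] by (auto simp: sum_3 index_mod_3 ac_simps)

context curve
begin

lemma HL_cyclic: "HL w = fls_const (c i) * w $ i * w $ (i + 1) ^ q
    + fls_const (c (i + 1)) * w $ (i + 1) * w $ (i + 2) ^ q + fls_const (c (i + 2)) * w $ (i + 2) * w $ i ^ q"
  unfolding HL_def by (subst sum_cyclic[of _ i]) (simp add: index_add)

lemma H_cyclic: "H v = c i * v $ i * v $ (i + 1) ^ q
    + c (i + 1) * v $ (i + 1) * v $ (i + 2) ^ q + c (i + 2) * v $ (i + 2) * v $ i ^ q"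
  unfolding H_def by (subst sum_cyclic[of _ i]) (simp add: index_add)

text \<open>Smoothness in an affine chart: \<open>q\<close>-th powers have zero derivative, so the
  derivative in the last unknown is the nonzero constant \<open>e\<close>. Solving for the linear
  occurrence of that unknown gives a contraction, since differences enter through their
  \<open>q\<close>-th powers.\<close>

lemma expansion_fps:
  fixes a b e u v :: 'k
  assumes "e \<noteq> 0" and rel: "a * u ^ q + b * u * v ^ q + e * v = 0"
  shows "\<exists>B. fps_nth B 0 = 0 \<and>
    fps_const a * (fps_const u + fps_X) ^ q
    + fps_const b * (fps_const u + fps_X) * (fps_const v + B) ^ q + fps_const e * (fps_const v + B) = 0"
proof -
  define F where "F B = - fps_const (1 / e) * (fps_const a * (fps_const u + fps_X) ^ q
    + fps_const b * (fps_const u + fps_X) * (fps_const v + B) ^ q) - fps_const v" for B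
  have "\<exists>B. fps_nth B 0 = 0 \<and> F B = B"
  proof (rule fps_fixpoint)
    have "fps_nth (F 0) 0 = - (1 / e) * (a * u ^ q + b * u * v ^ q) - v"
      by (simp add: F_def fps_nth_power_0 fps_const_power)
    also have "a * u ^ q + b * u * v ^ q = - (e * v)"
      using rel by (simp add: eq_neg_iff_add_eq_0)
    finally show "fps_nth (F 0) 0 = 0" using assms(1) by simp
  next
    fix B B' :: "'k fps" and n :: nat
    assume n: "0 < n" and eq: "\<forall>k<n. fps_nth B k = fps_nth B' k"
    have "\<forall>k<n. fps_nth (B - B') k = 0" using eq by simp
    then obtain R where R: "B - B' = fps_X ^ n * R"
      by (metis fps_shift_times_fps_X_power' mult.commute subdegree_geI fps_shift_times_fps_X_power
          fps_zero_nth subdegree_0 fps_shift_fps_X_power mult_zero_left)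
    have factor: "- g * (f + h * s) - r - (- g * (f + h * t) - r) = - g * h * (s - t)" for g f h s r t :: "'k fps"
      by (simp add: algebra_simps)
    have "F B - F B' = - fps_const (1 / e) * (fps_const b * (fps_const u + fps_X))
       * ((fps_const v + B) ^ q - (fps_const v + B') ^ q)"
      unfolding F_def by (rule factor)
    also have "(fps_const v + B) ^ q - (fps_const v + B') ^ q = (B - B') ^ q"
      by (simp add: frobenius_add_fps frobenius_diff_fps)
    also have "\<dots> = fps_X ^ (n * q) * R ^ q"
      by (simp add: R power_mult_distrib power_mult)
    finally have "F B - F B' = fps_X ^ (n * q) * (R ^ q * (- fps_const (1 / e) * (fps_const b * (fps_const u + fps_X))))"
      by (simp only: mult_ac)
    moreover have "Suc n \<le> n * q"
    proof -
      have "n * 2 \<le> n * q" using q_gt_2 by simp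
      then show ?thesis using n by linarith
    qed
    ultimately have "\<forall>k<Suc n. fps_nth (F B - F B') k = 0"
      by (auto simp: fps_X_power_mult_nth)
    then show "\<forall>k<Suc n. fps_nth (F B) k = fps_nth (F B') k" by simp
  qed
  then obtain B where B: "fps_nth B 0 = 0" "F B = B" by blast
  have "fps_const e * (fps_const v + B) = fps_const e * (F B + fps_const v)" using B by (simp add: add.commute)
  also have "\<dots> = - (fps_const a * (fps_const u + fps_X) ^ q
    + fps_const b * (fps_const u + fps_X) * (fps_const v + B) ^ q)"
  proof -
    have "fps_const e * fps_const (1 / e) = 1" using assms(1) by (simp flip: fps_const_mult)
    then have "fps_const e * (- fps_const (1 / e) * t) = - t" for t
      by (metis mult.assoc mult_1 mult_minus_left mult_minus_right)
    then show ?thesis by (simp add: F_def)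
  qed
  finally show ?thesis using B(1) by (intro exI[of _ B]) simp
qed

text \<open>In the chart of coordinate \<open>i\<close> the next coordinate, shifted by its value,
  is a local parameter at every point; no case distinction between points is needed.\<close>

lemma expansion_exists:
  assumes "H v = 0" "v $ i \<noteq> 0"
  shows "\<exists>w. good w \<and> w $ i = 1 \<and> w $ (i + 1) = fls_const (v $ (i + 1) / v $ i) + fls_X \<and>
    (\<forall>j. has_residue (w $ j) (v $ j / v $ i))"
proof -
  define u where "u = v $ (i + 1) / v $ i"
  define t where "t = v $ (i + 2) / v $ i"
  have v: "v $ (i + 1) = u * v $ i" "v $ (i + 2) = t * v $ i" using assms by (auto simp: u_def t_def)
  have "H v = (c i * u ^ q + c (i + 1) * u * t ^ q + c (i + 2) * t) * v $ i ^ (q + 1)"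
    unfolding H_cyclic[of v i] v by (simp add: algebra_simps power_mult_distrib)
  with assms have "c i * u ^ q + c (i + 1) * u * t ^ q + c (i + 2) * t = 0" by simp
  from expansion_fps[OF c_nz this] obtain B where B: "fps_nth B 0 = 0"
    "fps_const (c i) * (fps_const u + fps_X) ^ q
    + fps_const (c (i + 1)) * (fps_const u + fps_X) * (fps_const t + B) ^ q
    + fps_const (c (i + 2)) * (fps_const t + B) = 0" by blast
  define w :: "'k fls ^ 3" where "w = (\<chi> j. if j = i then 1 else if j = i + 1 then fps_to_fls (fps_const u + fps_X)
    else fps_to_fls (fps_const t + B))"
  have w: "w $ i = 1" "w $ (i + 1) = fps_to_fls (fps_const u + fps_X)" "w $ (i + 2) = fps_to_fls (fps_const t + B)"
    by (simp_all add: w_def index_distinct)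
  have "HL w = fps_to_fls (fps_const (c i) * (fps_const u + fps_X) ^ q
    + fps_const (c (i + 1)) * (fps_const u + fps_X) * (fps_const t + B) ^ q
    + fps_const (c (i + 2)) * (fps_const t + B))"
    by (simp add: HL_cyclic[of w i] w fls_times_fps_to_fls fps_to_fls_power)
  then have HLw: "HL w = 0" using B(2) by simp
  have nz1: "fps_const u + fps_X \<noteq> 0"
  proof
    assume "fps_const u + fps_X = 0"
    then have "fps_nth (fps_const u + fps_X) 1 = 0" by simp
    then show False by simp
  qed
  have nz2: "fps_const t + B \<noteq> 0"
  proof
    assume t: "fps_const t + B = 0"
    have 0: "(0 :: 'k fps) ^ q = 0" using q_gt_2 by simp
    have "fps_const (c i) * (fps_const u + fps_X) ^ q = 0"
      using B(2) unfolding t 0 by (simp only: mult_zero_right add_0_right)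
    then show False using nz1 c_nz[of i] by (metis fps_const_eq_0_iff mult_eq_0_iff power_not_zero)
  qed
  have "w $ j \<noteq> 0" for j
    using index_cyclic[of j i] w nz1 nz2 by (auto simp del: fps_to_fls_plus)
  then have "good w" using HLw by (simp add: good_def)
  moreover have "has_residue (w $ j) (v $ j / v $ i)" for j
  proof -
    have "has_residue (w $ i) 1" "has_residue (w $ (i + 1)) u" "has_residue (w $ (i + 2)) t"
      unfolding w by (auto intro!: has_residue_1 has_residue_fps simp: B(1) simp del: fps_to_fls_plus)
    then show ?thesis using index_cyclic[of j i] assms by (auto simp: u_def t_def)
  qed
  ultimately show ?thesis using w(1,2) by (intro exI[of _ w]) (simp add: u_def)
qed

definition expn :: "3 \<Rightarrow> 'k ^ 3 \<Rightarrow> 'k fls ^ 3" where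
  "expn i v = (SOME w. good w \<and> w $ i = 1 \<and> w $ (i + 1) = fls_const (v $ (i + 1) / v $ i) + fls_X \<and>
    (\<forall>j. has_residue (w $ j) (v $ j / v $ i)))"

lemma expn_props:
  assumes "H v = 0" "v $ i \<noteq> 0"
  shows "good (expn i v)" "expn i v $ i = 1" "expn i v $ (i + 1) = fls_const (v $ (i + 1) / v $ i) + fls_X"
    "has_residue (expn i v $ j) (v $ j / v $ i)"
  using someI_ex[OF expansion_exists[OF assms]] unfolding expn_def by blast+

text \<open>Since \<open>x\<close> is then transcendental over the constants, evaluation at
  \<open>w\<close> is injective on the function field.\<close>

definition generic :: "'k fls ^ 3 \<Rightarrow> bool" where
  "generic w \<longleftrightarrow> good w \<and> x w \<notin> range fls_const"

lemma generic_good: "generic w \<Longrightarrow> good w"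
  by (simp add: generic_def)

text \<open>If \<open>x\<close> were constant, so would be \<open>b ^ N\<close>, hence
  \<open>b\<close>, hence all ratios of coordinates; but one of these ratios is a constant plus
  \<open>fls_X\<close>.\<close>

lemma generic_expn:
  assumes "H v = 0" "v $ i \<noteq> 0"
  shows "generic (expn i v)"
proof -
  define w where "w = expn i v"
  note w = expn_props[OF assms, folded w_def]
  have "x w \<notin> range fls_const"
  proof
    assume "x w \<in> range fls_const"
    then obtain d where d: "x w = fls_const d" by blast
    have zc: "z w = fls_const (poly Z d)" using z_eq_Z[OF w(1)] by (simp add: d evalp_const)
    have "b w ^ N * z w = x w ^ q" using bN_eq good_coord[OF w(1)] by blast
    then have "b w ^ N = fls_const (d ^ q / poly Z d)"
      using good_xzb_nz[OF w(1)] zc d by (simp add: fls_const_divide fls_const_power field_simps)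
    then have "evalp (monom 1 N - [:d ^ q / poly Z d:]) (b w) = 0"
      by (simp add: evalp_def diff_conv_add_uminus map_poly_add_hom map_poly_monom poly_monom map_poly_pCons
          fls_plus_const del: add_uminus_conv_diff)
    moreover have "monom 1 N - [:d ^ q / poly Z d:] \<noteq> 0"
    proof
      assume "monom 1 N - [:d ^ q / poly Z d:] = 0"
      then have "coeff (monom 1 N - [:d ^ q / poly Z d:]) N = 0" by simp
      then show False using N_pos by (cases N) auto
    qed
    ultimately have "b w \<in> range fls_const" using evalp_nonconst_nonzero by blast
    then obtain y where y: "b w = fls_const y" by blast
    have "w $ 1 / w $ 3 = x w / b w ^ (q - 1)"
      using good_coord[OF w(1)]
      by (simp add: x_coord_def b_coord_def power_divide power_q_split[of "w $ 3"])
    then have 1: "w $ 1 = fls_const (d / y ^ (q - 1)) * w $ 3"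
      using good_coord[OF w(1)] by (simp add: d y fls_const_divide fls_const_power field_simps)
    have 2: "w $ 2 = fls_const y * w $ 3" using y good_coord[OF w(1)] by (simp add: b_coord_def field_simps)
    have 3: "w $ 3 = fls_const 1 * w $ 3" by simp
    have "\<exists>e. w $ j = fls_const e * w $ 3" for j
      using exhaust_3[of j] 1 2 3 by auto
    then obtain e f where e: "w $ i = fls_const e * w $ 3" and f: "w $ (i + 1) = fls_const f * w $ 3" by metis
    have "e \<noteq> 0" using e w(2) by auto
    have "fls_const e * w $ (i + 1) = fls_const f * w $ i" using e f by (simp add: algebra_simps)
    then have "fls_nth (fls_const e * w $ (i + 1)) 1 = fls_nth (fls_const f * w $ i) 1" by simp
    then show False using w(2,3) \<open>e \<noteq> 0\<close> by simp
  qed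
  then show ?thesis using w by (simp add: generic_def w_def)
qed

section \<open>The three points on the coordinate axes\<close>

definition E :: "3 \<Rightarrow> 'k fls ^ 3" where "E i = expn i (axis i 1)"

lemma H_axis: "H (axis i 1) = 0"
  using q_gt_2 by (simp add: H_cyclic[of _ i] axis_def index_distinct)

text \<open>The equation reads \<open>Y\<close> times a unit equals a constant times
  \<open>fls_X ^ q\<close>, which gives the order \<open>q\<close> of the remaining coordinate
  \<open>Y\<close>: the tangent meets the curve there with multiplicity \<open>q\<close>.\<close>

lemma E_props:
  "good (E i)" "generic (E i)" "E i $ i = 1" "E i $ (i + 1) = fls_X"
  "E i $ (i + 2) \<noteq> 0" "fls_subdegree (E i $ (i + 2)) = int q" "\<And>j. has_residue (E i $ j) (axis i 1 $ j)"
proof -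
  have [simp]: "axis i 1 $ i = (1::'k)" "axis i 1 $ (i + 1) = (0::'k)" "axis i 1 $ (i + 2) = (0::'k)"
    by (simp_all add: axis_def index_distinct)
  have "axis i 1 $ i \<noteq> (0::'k)" by simp
  note p = expn_props[OF H_axis this, folded E_def]
  show g: "good (E i)" using p by simp
  show "generic (E i)" unfolding E_def by (rule generic_expn) (use H_axis in auto)
  show 1: "E i $ i = 1" and 2: "E i $ (i + 1) = fls_X" using p by simp_all
  show res: "has_residue (E i $ j) (axis i 1 $ j)" for j using p(4)[of j] by simp
  show B: "E i $ (i + 2) \<noteq> 0" using g by (rule good_coord)
  define Y where "Y = E i $ (i + 2)"
  have "has_residue Y 0" using res[of "i + 2"] by (simp add: Y_def)
  then have Yf: "has_residue (fls_const (c (i + 2)) + fls_const (c (i + 1)) * fls_X * Y ^ (q - 1))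
      (c (i + 2) + c (i + 1) * 0 * 0 ^ (q - 1))"
    by (intro has_residue_add has_residue_const has_residue_mult has_residue_power has_residue_X)
  have "Y * (fls_const (c (i + 2)) + fls_const (c (i + 1)) * fls_X * Y ^ (q - 1)) = - fls_const (c i) * fls_X ^ q"
  proof -
    have "HL (E i) = 0" using g by (simp add: good_def)
    then have "fls_const (c i) * fls_X ^ q + (fls_const (c (i + 1)) * fls_X * Y ^ q + fls_const (c (i + 2)) * Y) = 0"
      by (simp add: HL_cyclic[of _ i] 1 2 Y_def add.assoc)
    then show ?thesis
      by (simp add: power_q_split[of Y] algebra_simps eq_neg_iff_add_eq_0)
  qed
  then have "fls_subdegree (Y * (fls_const (c (i + 2)) + fls_const (c (i + 1)) * fls_X * Y ^ (q - 1)))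
     = fls_subdegree (- fls_const (c i) * fls_X ^ q)" by simp
  then have "fls_subdegree Y + 0 = int q"
    using has_residue_nz[OF Yf] c_nz B by (simp add: Y_def fls_subdegree_pow)
  then show "fls_subdegree (E i $ (i + 2)) = int q" by (simp add: Y_def)
qed

lemma E_subdegree_coord:
  "fls_subdegree (E i $ i) = 0" "fls_subdegree (E i $ (i + 1)) = 1" "fls_subdegree (E i $ (i + 2)) = int q"
  using E_props by auto

lemma int_N: "int N = int q * (int q - 1) + 1"
  using q_gt_2 by (simp add: N_eq of_nat_diff)

lemma subdegree_xzb:
  assumes "good w"
  shows "fls_subdegree (x w) = fls_subdegree (w $ 1) + (int q - 1) * fls_subdegree (w $ 2) - int q * fls_subdegree (w $ 3)"
    "fls_subdegree (z w) = int q * fls_subdegree (w $ 1) - fls_subdegree (w $ 2) - (int q - 1) * fls_subdegree (w $ 3)"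
    "fls_subdegree (b w) = fls_subdegree (w $ 2) - fls_subdegree (w $ 3)"
  using good_coord[OF assms] q_gt_2
  by (simp_all add: x_coord_def z_coord_def b_coord_def fls_divide_subdegree fls_subdegree_pow of_nat_diff)

lemma E_subdegree_xzb:
  "fls_subdegree (x (E 3)) = int N" "fls_subdegree (z (E 3)) = 0" "fls_subdegree (b (E 3)) = int q"
  "fls_subdegree (x (E 1)) = - int N" "fls_subdegree (z (E 1)) = - int N" "fls_subdegree (b (E 1)) = 1 - int q"
  "fls_subdegree (x (E 2)) = 0" "fls_subdegree (z (E 2)) = int N" "fls_subdegree (b (E 2)) = -1"
proof -
  have s: "fls_subdegree (E 3 $ 3) = 0" "fls_subdegree (E 3 $ 1) = 1" "fls_subdegree (E 3 $ 2) = int q"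
    "fls_subdegree (E 1 $ 1) = 0" "fls_subdegree (E 1 $ 2) = 1" "fls_subdegree (E 1 $ 3) = int q"
    "fls_subdegree (E 2 $ 2) = 0" "fls_subdegree (E 2 $ 3) = 1" "fls_subdegree (E 2 $ 1) = int q"
    using E_subdegree_coord[of 1] E_subdegree_coord[of 2] E_subdegree_coord[of 3]
    by (simp_all add: index_mod_3)
  show "fls_subdegree (x (E 3)) = int N" "fls_subdegree (z (E 3)) = 0" "fls_subdegree (b (E 3)) = int q"
  "fls_subdegree (x (E 1)) = - int N" "fls_subdegree (z (E 1)) = - int N" "fls_subdegree (b (E 1)) = 1 - int q"
  "fls_subdegree (x (E 2)) = 0" "fls_subdegree (z (E 2)) = int N" "fls_subdegree (b (E 2)) = -1"
    by (simp_all add: subdegree_xzb[OF E_props(1)] s int_N algebra_simps)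
qed

text \<open>The zero of \<open>Z\<close> and the value of \<open>x\<close> at \<open>E 2\<close>:
  the third branch value besides zero and infinity.\<close>

definition d2 :: 'k where "d2 = - (c 2 / c 1)"

lemma Z_alt: "Z = smult (- (c 1 / c 3)) [:- d2, 1:]"
  using c_nz by (simp add: Z_def d2_def)

lemma Z_root: "poly Z d = 0 \<longleftrightarrow> d = d2"
  unfolding Z_alt using c_nz by (simp add: algebra_simps del: smult_pCons)

lemma Z_factor: "evalp Z u = fls_const (- (c 1 / c 3)) * (u - fls_const d2)"
  unfolding Z_alt evalp_smult by simp

lemma d2_nz: "d2 \<noteq> 0"
  using c_nz by (simp add: d2_def)

lemma E2_x_d2: "fls_subdegree (x (E 2) - fls_const d2) = int N"
proof -
  have "z (E 2) = fls_const (- (c 1 / c 3)) * (x (E 2) - fls_const d2)"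
    using z_eq_Z[OF E_props(1)] Z_factor by simp
  then have "fls_subdegree (z (E 2)) = fls_subdegree (x (E 2) - fls_const d2)"
    using good_xzb_nz(2)[OF E_props(1), of 2] c_nz by (auto simp del: fls_const_uminus)
  then show ?thesis using E_subdegree_xzb by simp
qed

section \<open>Orders at the coordinate points and nonvanishing at generic points\<close>

lemma E_evalp:
  assumes "p \<noteq> 0"
  shows "fls_subdegree (evalp p (x (E 3))) = int N * int (order 0 p)"
    "fls_subdegree (evalp p (x (E 2))) = int N * int (order d2 p)"
    "fls_subdegree (evalp p (x (E 1))) = - (int N * int (degree p))"
  using evalp_subdegree_order[OF assms, of "x (E 3)" 0 "int N"]
    evalp_subdegree_order[OF assms, of "x (E 2)" d2 "int N"]
    evalp_subdegree_neg[OF assms, of "x (E 1)" "int N"] N_pos E_subdegree_xzb E2_x_d2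
  by auto

lemma generic_evalp_nz: "generic w \<Longrightarrow> p \<noteq> 0 \<Longrightarrow> evalp p (x w) \<noteq> 0"
  using evalp_nonconst_nonzero by (auto simp: generic_def)

lemma E_coprime: "coprime (int N) (fls_subdegree (b (E i)))"
proof -
  have "coprime (int N) (1 - int q)"
  proof (rule coprimeI)
    fix d assume d: "d dvd int N" "d dvd 1 - int q"
    then have "d dvd int N + int q * (1 - int q)" by (intro dvd_add dvd_mult)
    then show "is_unit d" by (simp add: int_N algebra_simps)
  qed
  then show ?thesis using exhaust_3[of i] coprime_N_q by (auto simp: E_subdegree_xzb)
qed

text \<open>Polynomials in \<open>x\<close> have orders divisible by \<open>N\<close>, and the order
  of \<open>b\<close> is prime to \<open>N\<close>; so the terms for different \<open>k\<close>
  below \<open>N\<close> have orders that differ even modulo \<open>N\<close>.\<close>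

lemma E_distinct:
  "inj_on (\<lambda>k. fls_subdegree (evalp (p k) (x (E i)) * b (E i) ^ k)) {k\<in>{..<N}. evalp (p k) (x (E i)) * b (E i) ^ k \<noteq> 0}"
proof (rule inj_onI)
  fix k k'
  assume k: "k \<in> {k\<in>{..<N}. evalp (p k) (x (E i)) * b (E i) ^ k \<noteq> 0}"
    and k': "k' \<in> {k\<in>{..<N}. evalp (p k) (x (E i)) * b (E i) ^ k \<noteq> 0}"
    and eq: "fls_subdegree (evalp (p k) (x (E i)) * b (E i) ^ k) = fls_subdegree (evalp (p k') (x (E i)) * b (E i) ^ k')"
  have div: "int N dvd fls_subdegree (evalp p (x (E i)))" for p
    using E_evalp[of p] exhaust_3[of i] by (cases "p = 0") auto
  define \<beta> where "\<beta> = fls_subdegree (b (E i))"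
  have "fls_subdegree (evalp (p k) (x (E i))) + int k * \<beta> = fls_subdegree (evalp (p k') (x (E i))) + int k' * \<beta>"
    using eq k k' by (simp add: fls_subdegree_pow \<beta>_def)
  then have "(int k - int k') * \<beta> = fls_subdegree (evalp (p k') (x (E i))) - fls_subdegree (evalp (p k) (x (E i)))"
    by (simp add: algebra_simps)
  then have "int N dvd (int k - int k') * \<beta>" using div by (metis dvd_diff)
  then have "int N dvd int k - int k'"
    using E_coprime[of i] by (simp add: \<beta>_def coprime_dvd_mult_left_iff)
  then have "int N dvd \<bar>int k - int k'\<bar>" by simp
  then show "k = k'" using k k' zdvd_not_zless[of "\<bar>int k - int k'\<bar>" "int N"] by force
qed

lemma pev_E_nonzero:
  assumes "k < N" "p k \<noteq> 0"
  shows "pev p (x (E i)) (b (E i)) \<noteq> 0"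
proof
  assume "pev p (x (E i)) (b (E i)) = 0"
  then have "evalp (p k) (x (E i)) * b (E i) ^ k = 0"
    unfolding pev_def using assms(1)
    by (intro sum_eq_0_distinct_subdegree[OF _ E_distinct]) auto
  then show False
    using assms generic_evalp_nz[OF E_props(2)] good_xzb_nz(3)[OF E_props(1)] by simp
qed

lemma pev_twist: "pev p u (fls_const v * y) = pev (\<lambda>k. smult (v ^ k) (p k)) u y"
  by (simp add: pev_def power_mult_distrib fls_const_power mult_ac)

text \<open>It suffices to look at one point. At \<open>E 3\<close> no conjugate vanishes, twisting
  by a root of unity only rescales the coefficients.\<close>

lemma norm_form_nz:
  assumes "k < N" "p k \<noteq> 0"
    and D: "\<And>w. good w \<Longrightarrow> z w ^ J * (\<Prod>u\<in>mu. pev p (x w) (fls_const u * b w)) = evalp D (x w)"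
  shows "D \<noteq> 0"
proof -
  have "pev p (x (E 3)) (fls_const u * b (E 3)) \<noteq> 0" if "u \<in> mu" for u
    unfolding pev_twist using pev_E_nonzero[of k "\<lambda>k. smult (u ^ k) (p k)"] assms mu_nz[OF that] by simp
  then have "evalp D (x (E 3)) \<noteq> 0"
    unfolding D[OF E_props(1), symmetric] using good_xzb_nz[OF E_props(1)] finite_mu by (auto simp: prod_zero_iff)
  then show ?thesis by auto
qed

text \<open>Carries nonvanishing from \<open>E 3\<close> to every generic point: the element divides
  its norm, a nonzero polynomial in the transcendental \<open>x\<close>.\<close>

lemma pev_generic_nonzero:
  assumes "k < N" "p k \<noteq> 0" "generic w"
  shows "pev p (x w) (b w) \<noteq> 0"
proof -
  obtain D J Gs where D: "\<And>w. good w \<Longrightarrow> z w ^ J * (\<Prod>u\<in>mu. pev p (x w) (fls_const u * b w)) = evalp D (x w)"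
    "\<And>w. good w \<Longrightarrow> pev p (x w) (b w) * evalpp Gs (x w) (b w) = evalp D (x w)"
    using norm_form[of p] by blast
  have "evalp D (x w) \<noteq> 0" using norm_form_nz[OF assms(1,2) D(1)] generic_evalp_nz assms(3) by blast
  then show ?thesis using D(2)[OF generic_good[OF assms(3)]] by auto
qed

text \<open>This contains the irreducibility of the curve.\<close>

theorem vanishes_iff:
  assumes "lifts d A B" "generic w"
  shows "B w = 0 \<longleftrightarrow> (\<forall>v. H v = 0 \<longrightarrow> A v = 0)"
proof -
  obtain e p where p: "\<And>w. good w \<Longrightarrow> (x w * z w) ^ e * B w = w $ 3 ^ d * pev p (x w) (b w)"
    using normal_form[OF assms(1)] by blast
  show ?thesis
  proof
    assume "B w = 0"
    then have "pev p (x w) (b w) = 0"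
      using p[OF generic_good[OF assms(2)]] good_coord[OF generic_good[OF assms(2)]] by auto
    then have p0: "p k = 0" if "k < N" for k using pev_generic_nonzero that assms(2) by blast
    have B0: "B w' = 0" if "good w'" for w'
      using p[OF that] p0 good_xzb_nz[OF that] by (simp add: pev_def)
    have nz: "A v = 0" if v: "H v = 0" "v $ i \<noteq> 0" for v i
    proof -
      have "has_residue (B (expn i v)) (A ((1 / v $ i) *s v))"
        by (rule lifts_residue[OF assms(1)]) (use expn_props(4)[OF v] in simp)
      moreover have "B (expn i v) = 0" using B0 expn_props(1)[OF v] by blast
      ultimately have "A ((1 / v $ i) *s v) = 0" using has_residue_0 has_residue_unique by metis
      then show ?thesis using lifts_scale[OF assms(1)] v(2) by simp
    qed
    \<comment> \<open>The zero vector lies on no point, but \<open>H\<close> vanishes there; a form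
      of degree 0 takes its constant value at it, so that case is compared with a coordinate
      point.\<close>
    have "A v = 0" if "H v = 0" for v
    proof (cases "v = 0")
      case True
      have "A (axis 1 1) = 0" using nz[OF H_axis, of 1 1] by simp
      moreover have "A (0 *s axis 1 1) = 0 ^ d * A (axis 1 1)" using lifts_scale[OF assms(1)] by blast
      ultimately show ?thesis using True by simp
    qed (use nz that in \<open>auto simp: vec_eq_iff\<close>)
    then show "\<forall>v. H v = 0 \<longrightarrow> A v = 0" by blast
  next
    assume A: "\<forall>v. H v = 0 \<longrightarrow> A v = 0"
    have "p k = 0" if "k < N" for k
    proof (rule pev_vanishing[OF _ that])
      fix d' y assume d: "d' \<noteq> 0" "poly Z d' \<noteq> 0" "y \<in> fiber d'"
      note pt = pt_props[OF d]
      have g: "good (const_vec (pt d' y))" using pt good_const_vec by blast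
      have "B (const_vec (pt d' y)) = 0"
        using lifts_eval_const[OF assms(1)] A pt by (simp add: const_vec_def)
      then show "pev p (fls_const d') (fls_const y) = 0"
        using p[OF g] good_coord[OF g] by (simp add: coord_const_vec pt)
    qed
    then show "B w = 0"
      using p[OF generic_good[OF assms(2)]] good_xzb_nz[OF generic_good[OF assms(2)]] by (simp add: pev_def)
  qed
qed

end

section \<open>The function field and its valuations\<close>

lemma proj_point_iff: "u \<in> proj_point v \<longleftrightarrow> (\<exists>a. u = a *s v)"
  by (auto simp: proj_point_def vec.span_singleton)

lemma forms_mult: "A \<in> forms UNIV d \<Longrightarrow> B \<in> forms UNIV e \<Longrightarrow> (\<lambda>v. A v * B v) \<in> forms UNIV (d + e)"
  by (auto simp: forms_iff_lifts intro: lifts_mult)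

lemma forms_add: "A \<in> forms UNIV d \<Longrightarrow> B \<in> forms UNIV d \<Longrightarrow> (\<lambda>v. A v + B v) \<in> forms UNIV d"
  by (auto simp: forms_iff_lifts intro: lifts_add)

lemma forms_diff: "A \<in> forms UNIV d \<Longrightarrow> B \<in> forms UNIV d \<Longrightarrow> (\<lambda>v. A v - B v) \<in> forms UNIV d"
  by (auto simp: forms_iff_lifts intro: lifts_diff)

lemma forms_cmult: "A \<in> forms UNIV d \<Longrightarrow> (\<lambda>v. a * A v) \<in> forms UNIV d"
  by (auto simp: forms_iff_lifts intro: lifts_cmult)

lemma forms_power: "A \<in> forms UNIV d \<Longrightarrow> (\<lambda>v. A v ^ n) \<in> forms UNIV (n * d)"
  by (auto simp: forms_iff_lifts intro: lifts_power)

lemma forms_coord: "(\<lambda>v. v $ i) \<in> forms UNIV 1"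
  using lifts_coord[of i] unfolding forms_iff_lifts by blast

lemma forms_1: "(\<lambda>v. 1) \<in> forms UNIV 0"
  by (auto simp: forms_iff_lifts intro: lifts_1)

lemma forms_0: "(\<lambda>v. 0) \<in> forms UNIV d"
  by (auto simp: forms_iff_lifts intro: lifts_zero)

context curve
begin

definition CC :: "'k point set" where
  "CC = {P \<in> proj_plane UNIV. \<forall>v\<in>P. H v = 0}"

lemma proj_point_CC: "v \<noteq> 0 \<Longrightarrow> H v = 0 \<Longrightarrow> proj_point v \<in> CC"
  by (auto simp: CC_def proj_plane_def proj_point_iff H_scale)

lemma self_proj_point: "v \<in> proj_point v"
  unfolding proj_point_iff by (rule exI[of _ 1]) simp

lemma CC_E:
  assumes "P \<in> CC"
  obtains v i where "P = proj_point v" "H v = 0" "v $ i \<noteq> 0"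
  using assms self_proj_point unfolding CC_def proj_plane_def by (force simp: vec_eq_iff)

lemma all_CC: "(\<forall>P\<in>CC. \<forall>v\<in>P. \<phi> v) \<longleftrightarrow> (\<forall>v. H v = 0 \<longrightarrow> \<phi> v)"
proof
  assume *: "\<forall>P\<in>CC. \<forall>v\<in>P. \<phi> v"
  show "\<forall>v. H v = 0 \<longrightarrow> \<phi> v"
  proof (intro allI impI)
    fix v assume v: "H v = 0"
    show "\<phi> v"
    proof (cases "v = 0")
      case True
      have "proj_point (axis 1 1) \<in> CC" by (rule proj_point_CC) (auto simp: H_axis axis_eq_0_iff)
      moreover have "0 \<in> proj_point (axis 1 1 :: 'k ^ 3)"
        unfolding proj_point_iff by (rule exI[of _ 0]) simp
      ultimately show ?thesis using * True by blast
    qed (use * v proj_point_CC self_proj_point in blast)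
  qed
qed (auto simp: CC_def)

lemma ex_CC: "(\<exists>P\<in>CC. \<exists>v\<in>P. \<phi> v) \<longleftrightarrow> (\<exists>v. H v = 0 \<and> \<phi> v)"
  using all_CC[of "\<lambda>v. \<not> \<phi> v"] by blast

lemma form_degree_unique:
  fixes A :: "'k ^ 3 \<Rightarrow> 'k"
  assumes "lifts d A B" "lifts d' A B'" "d \<noteq> d'"
  shows "A v = 0"
proof -
  define f where "f = monom (1::'k) d - monom 1 d'"
  have "coeff f d = 1" using assms(3) by (simp add: f_def)
  then have "f \<noteq> 0" by auto
  then have "finite {a. poly f a = 0}" by (rule poly_roots_finite)
  then obtain a where "poly f a \<noteq> 0"
    using infinite_UNIV_alg_closed[where 'a = 'k] by (metis (mono_tags, lifting) Collect_cong UNIV_def)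
  then have a: "a ^ d \<noteq> a ^ d'" by (simp add: f_def poly_monom)
  have "A (a *s v) = a ^ d * A v" "A (a *s v) = a ^ d' * A v"
    using lifts_scale[OF assms(1)] lifts_scale[OF assms(2)] by blast+
  then have "a ^ d * A v = a ^ d' * A v" by metis
  then show ?thesis using a by simp
qed

text \<open>Well defined at generic points by \<open>vanishes_iff\<close>, the degree being determined by \<open>A\<close>
  unless \<open>A\<close> is zero.\<close>

definition ev :: "('k ^ 3 \<Rightarrow> 'k) \<Rightarrow> 'k fls ^ 3 \<Rightarrow> 'k fls" where
  "ev A w = (THE y. \<exists>d B. lifts d A B \<and> y = B w)"

lemma ev_eq:
  assumes "lifts d A B" "generic w"
  shows "ev A w = B w"
  unfolding ev_def
proof (rule the_equality)
  fix y assume "\<exists>d B. lifts d A B \<and> y = B w"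
  then obtain d' B' where B': "lifts d' A B'" "y = B' w" by blast
  show "y = B w"
  proof (cases "d = d'")
    case True
    then have "lifts d (\<lambda>v. A v - A v) (\<lambda>w. B w - B' w)" using assms B' by (intro lifts_diff) auto
    from vanishes_iff[OF this assms(2)] show ?thesis using B' by simp
  next
    case False
    then have "A v = 0" for v using form_degree_unique[OF assms(1) B'(1)] by blast
    then show ?thesis using vanishes_iff[OF assms] vanishes_iff[OF B'(1) assms(2)] B' by simp
  qed
qed (use assms in blast)

lemma ev_mult:
  assumes "A \<in> forms UNIV d" "B \<in> forms UNIV e" "generic w"
  shows "ev (\<lambda>v. A v * B v) w = ev A w * ev B w"
proof -
  obtain A' B' where l: "lifts d A A'" "lifts e B B'" using assms by (auto simp: forms_iff_lifts)
  show ?thesis using ev_eq[OF lifts_mult[OF l] assms(3)] ev_eq[OF l(1) assms(3)] ev_eq[OF l(2) assms(3)] by simp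
qed

lemma ev_add:
  assumes "A \<in> forms UNIV d" "B \<in> forms UNIV d" "generic w"
  shows "ev (\<lambda>v. A v + B v) w = ev A w + ev B w"
proof -
  obtain A' B' where l: "lifts d A A'" "lifts d B B'" using assms by (auto simp: forms_iff_lifts)
  show ?thesis using ev_eq[OF lifts_add[OF l] assms(3)] ev_eq[OF l(1) assms(3)] ev_eq[OF l(2) assms(3)] by simp
qed

lemma ev_diff:
  assumes "A \<in> forms UNIV d" "B \<in> forms UNIV d" "generic w"
  shows "ev (\<lambda>v. A v - B v) w = ev A w - ev B w"
proof -
  obtain A' B' where l: "lifts d A A'" "lifts d B B'" using assms by (auto simp: forms_iff_lifts)
  show ?thesis using ev_eq[OF lifts_diff[OF l] assms(3)] ev_eq[OF l(1) assms(3)] ev_eq[OF l(2) assms(3)] by simp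
qed

lemma ev_cmult:
  assumes "A \<in> forms UNIV d" "generic w"
  shows "ev (\<lambda>v. a * A v) w = fls_const a * ev A w"
proof -
  obtain A' where l: "lifts d A A'" using assms by (auto simp: forms_iff_lifts)
  show ?thesis using ev_eq[OF lifts_cmult[OF l] assms(2)] ev_eq[OF l assms(2)] by simp
qed

lemma ev_power:
  assumes "A \<in> forms UNIV d" "generic w"
  shows "ev (\<lambda>v. A v ^ n) w = ev A w ^ n"
proof -
  obtain A' where l: "lifts d A A'" using assms by (auto simp: forms_iff_lifts)
  show ?thesis using ev_eq[OF lifts_power[OF l] assms(2)] ev_eq[OF l assms(2)] by simp
qed

lemma ev_coord: "generic w \<Longrightarrow> ev (\<lambda>v. v $ i) w = w $ i"
  using ev_eq[OF lifts_coord] by blast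

lemma ev_1: "generic w \<Longrightarrow> ev (\<lambda>v. 1) w = 1"
  using ev_eq[OF lifts_1] by blast

lemma ev_0: "generic w \<Longrightarrow> ev (\<lambda>v. 0) w = 0"
  using ev_eq[OF lifts_zero] by blast

lemma ev_eq_0_iff:
  assumes "A \<in> forms UNIV d" "generic w"
  shows "ev A w = 0 \<longleftrightarrow> (\<forall>v. H v = 0 \<longrightarrow> A v = 0)"
proof -
  obtain A' where l: "lifts d A A'" using assms by (auto simp: forms_iff_lifts)
  show ?thesis using vanishes_iff[OF l assms(2)] ev_eq[OF l assms(2)] by simp
qed

lemma ev_residue:
  assumes "A \<in> forms UNIV d" "H v = 0" "v $ i \<noteq> 0"
  shows "has_residue (ev A (expn i v)) (A v / v $ i ^ d)"
proof -
  obtain B where B: "lifts d A B" using assms(1) forms_iff_lifts by blast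
  have "has_residue (B (expn i v)) (A ((1 / v $ i) *s v))"
    by (rule lifts_residue[OF B]) (use expn_props(4)[OF assms(2,3)] in simp)
  moreover have "A ((1 / v $ i) *s v) = A v / v $ i ^ d"
    using lifts_scale[OF B, of "1 / v $ i" v] by (simp add: power_one_over field_simps)
  ultimately show ?thesis using ev_eq[OF B generic_expn[OF assms(2,3)]] by simp
qed

section \<open>The function field inside the Laurent series\<close>

abbreviation K where "K \<equiv> function_field CC"

lemma fractions_iff:
  assumes "generic w"
  shows "(A, B) \<in> fractions CC \<longleftrightarrow> (\<exists>d. A \<in> forms UNIV d \<and> B \<in> forms UNIV d) \<and> ev B w \<noteq> 0"
proof -
  have "(A, B) \<in> fractions CC \<longleftrightarrow> (\<exists>d. A \<in> forms UNIV d \<and> B \<in> forms UNIV d) \<and> (\<exists>v. H v = 0 \<and> B v \<noteq> 0)"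
    by (simp add: fractions_def ex_CC)
  then show ?thesis using ev_eq_0_iff[OF _ assms] by blast
qed

lemma fraction_rel_iff:
  assumes "generic w"
  shows "((A, B), (A', B')) \<in> fraction_rel CC \<longleftrightarrow> (A, B) \<in> fractions CC \<and> (A', B') \<in> fractions CC \<and>
     ev A w / ev B w = ev A' w / ev B' w"
proof (cases "(A, B) \<in> fractions CC \<and> (A', B') \<in> fractions CC")
  case True
  then obtain d d' where d: "A \<in> forms UNIV d" "B \<in> forms UNIV d" "ev B w \<noteq> 0"
    "A' \<in> forms UNIV d'" "B' \<in> forms UNIV d'" "ev B' w \<noteq> 0"
    using fractions_iff[OF assms] by metis
  note f1 = forms_mult[OF d(1,5)] and f2 = forms_mult[OF d(4,2), unfolded add.commute[of d' d]]
  have "(\<forall>v. H v = 0 \<longrightarrow> A v * B' v = A' v * B v) \<longleftrightarrow> ev (\<lambda>v. A v * B' v - A' v * B v) w = 0"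
    using ev_eq_0_iff[OF forms_diff[OF f1 f2] assms] by simp
  also have "\<dots> \<longleftrightarrow> ev A w * ev B' w = ev A' w * ev B w"
    using ev_diff[OF f1 f2 assms] ev_mult[OF d(1,5) assms] ev_mult[OF d(4,2) assms] by simp
  also have "\<dots> \<longleftrightarrow> ev A w / ev B w = ev A' w / ev B' w"
    using d by (simp add: frac_eq_eq)
  finally show ?thesis using True by (simp add: fraction_rel_def all_CC)
qed (auto simp: fraction_rel_def)

lemma fraction_eq:
  assumes "generic w" "(A, B) \<in> fractions CC"
  shows "fraction CC A B = {(A', B') \<in> fractions CC. ev A' w / ev B' w = ev A w / ev B w}"
  using assms fraction_rel_iff[OF assms(1)] by (auto simp: fraction_def)

lemma carrier_K: "carrier K = {fraction CC A B | A B. (A, B) \<in> fractions CC}"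
  by (auto simp: function_field_def quotient_def fraction_def)

text \<open>The embedding of the function field attached to the generic point \<open>w\<close>. The
  laws of multiplication, inversion and powers are all verified through it, by injectivity.\<close>

definition fv :: "'k fls ^ 3 \<Rightarrow> 'k ratfun \<Rightarrow> 'k fls" where
  "fv w f = (THE y. \<exists>A B. (A, B) \<in> f \<and> y = ev A w / ev B w)"

lemma carrier_eq:
  assumes "f \<in> carrier K" "generic w"
  shows "f = {(A, B) \<in> fractions CC. ev A w / ev B w = fv w f}" "f \<noteq> {}"
proof -
  obtain A B where AB: "(A, B) \<in> fractions CC" "f = fraction CC A B" using assms carrier_K by blast
  have f: "f = {(A', B') \<in> fractions CC. ev A' w / ev B' w = ev A w / ev B w}"
    using fraction_eq assms AB by blast
  have "fv w f = ev A w / ev B w"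
    unfolding fv_def by (rule the_equality) (use f AB in auto)
  then show "f = {(A, B) \<in> fractions CC. ev A w / ev B w = fv w f}" using f by simp
  show "f \<noteq> {}" using f AB by auto
qed

lemma fv_fraction:
  assumes "generic w" "(A, B) \<in> fractions CC"
  shows "fraction CC A B \<in> carrier K" "fv w (fraction CC A B) = ev A w / ev B w"
proof -
  show 1: "fraction CC A B \<in> carrier K" using assms carrier_K by blast
  have "(A, B) \<in> fraction CC A B" using fraction_eq assms by blast
  then show "fv w (fraction CC A B) = ev A w / ev B w"
    by (subst (asm) carrier_eq(1)[OF 1 assms(1)]) simp
qed

lemma carrier_mem:
  assumes "f \<in> carrier K" "(A, B) \<in> f" "generic w"
  shows "(A, B) \<in> fractions CC" "fv w f = ev A w / ev B w" "fraction CC A B = f"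
proof -
  show 1: "(A, B) \<in> fractions CC" and 2: "fv w f = ev A w / ev B w"
    using assms(2) by (subst (asm) carrier_eq(1)[OF assms(1,3)], simp)+
  show "fraction CC A B = f"
    using fraction_eq[OF assms(3) 1] carrier_eq(1)[OF assms(1,3)] 2 by simp
qed

lemma fv_inj:
  assumes "f \<in> carrier K" "g \<in> carrier K" "generic w" "fv w f = fv w g"
  shows "f = g"
proof -
  have "f = {(A, B) \<in> fractions CC. ev A w / ev B w = fv w f}" using carrier_eq(1) assms by blast
  also have "\<dots> = {(A, B) \<in> fractions CC. ev A w / ev B w = fv w g}" using assms(4) by simp
  also have "\<dots> = g" using carrier_eq(1)[OF assms(2,3)] by (rule sym)
  finally show ?thesis .
qed

lemma fractions_mult:
  assumes "(A, B) \<in> fractions CC" "(A', B') \<in> fractions CC"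
  shows "(\<lambda>v. A v * A' v, \<lambda>v. B v * B' v) \<in> fractions CC"
proof -
  note w = E_props(2)[of 1]
  obtain d d' where d: "A \<in> forms UNIV d" "B \<in> forms UNIV d" "ev B (E 1) \<noteq> 0"
    "A' \<in> forms UNIV d'" "B' \<in> forms UNIV d'" "ev B' (E 1) \<noteq> 0"
    using assms fractions_iff[OF w] by metis
  have "ev (\<lambda>v. B v * B' v) (E 1) \<noteq> 0" using ev_mult[OF d(2,5) w] d by simp
  then show ?thesis using fractions_iff[OF w] forms_mult[OF d(1,4)] forms_mult[OF d(2,5)] by blast
qed

lemma mult_K:
  assumes "f \<in> carrier K" "g \<in> carrier K"
  shows "f \<otimes>\<^bsub>K\<^esub> g \<in> carrier K" "generic w \<Longrightarrow> fv w (f \<otimes>\<^bsub>K\<^esub> g) = fv w f * fv w g"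
proof -
  have *: "f \<otimes>\<^bsub>K\<^esub> g \<in> carrier K \<and> fv w (f \<otimes>\<^bsub>K\<^esub> g) = fv w f * fv w g" if w: "generic w" for w
  proof -
    have fr: "fraction CC (\<lambda>v. A v * A' v) (\<lambda>v. B v * B' v)
        = {(A, B) \<in> fractions CC. ev A w / ev B w = fv w f * fv w g}"
      if "(A, B) \<in> f" "(A', B') \<in> g" for A B A' B'
    proof -
      note m = carrier_mem[OF assms(1) that(1) w] carrier_mem[OF assms(2) that(2) w]
      obtain d d' where d: "A \<in> forms UNIV d" "B \<in> forms UNIV d" "A' \<in> forms UNIV d'" "B' \<in> forms UNIV d'"
        using m(1,4) fractions_iff[OF w] by metis
      show ?thesis
        using fraction_eq[OF w fractions_mult[OF m(1,4)]] ev_mult[OF d(1,3) w] ev_mult[OF d(2,4) w] m(2,5)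
        by simp
    qed
    obtain A B A' B' where mem: "(A, B) \<in> f" "(A', B') \<in> g"
      using carrier_eq(2)[OF assms(1) w] carrier_eq(2)[OF assms(2) w] by fast
    have "f \<otimes>\<^bsub>K\<^esub> g = (\<Union>(A, B)\<in>f. \<Union>(A', B')\<in>g. fraction CC (\<lambda>v. A v * A' v) (\<lambda>v. B v * B' v))"
      by (simp add: function_field_def)
    also have "\<dots> = {(A, B) \<in> fractions CC. ev A w / ev B w = fv w f * fv w g}"
      using fr mem by (auto simp: case_prod_unfold)
    also have "\<dots> = fraction CC (\<lambda>v. A v * A' v) (\<lambda>v. B v * B' v)" using fr[OF mem] by simp
    finally have eq: "f \<otimes>\<^bsub>K\<^esub> g = fraction CC (\<lambda>v. A v * A' v) (\<lambda>v. B v * B' v)" .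
    note m = carrier_mem[OF assms(1) mem(1) w] carrier_mem[OF assms(2) mem(2) w]
    obtain d d' where d: "A \<in> forms UNIV d" "B \<in> forms UNIV d" "A' \<in> forms UNIV d'" "B' \<in> forms UNIV d'"
      using m(1,4) fractions_iff[OF w] by metis
    show ?thesis
      unfolding eq using fv_fraction[OF w fractions_mult[OF m(1,4)]] ev_mult[OF d(1,3) w] ev_mult[OF d(2,4) w] m(2,5)
      by simp
  qed
  show "f \<otimes>\<^bsub>K\<^esub> g \<in> carrier K" using *[OF E_props(2)[of 1]] by blast
  show "generic w \<Longrightarrow> fv w (f \<otimes>\<^bsub>K\<^esub> g) = fv w f * fv w g" using * by blast
qed

lemma one_K: "\<one>\<^bsub>K\<^esub> \<in> carrier K" "generic w \<Longrightarrow> fv w \<one>\<^bsub>K\<^esub> = 1"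
proof -
  have 1: "(\<lambda>v. 1, \<lambda>v. 1) \<in> fractions CC"
    using fractions_iff[OF E_props(2)[of 1]] forms_1 ev_1[OF E_props(2)[of 1]] by auto
  then show "\<one>\<^bsub>K\<^esub> \<in> carrier K" using fv_fraction[OF E_props(2)[of 1]] by (simp add: function_field_def)
  show "generic w \<Longrightarrow> fv w \<one>\<^bsub>K\<^esub> = 1" using fv_fraction 1 ev_1 by (simp add: function_field_def)
qed

lemma zero_K: "\<zero>\<^bsub>K\<^esub> \<in> carrier K" "generic w \<Longrightarrow> fv w \<zero>\<^bsub>K\<^esub> = 0"
proof -
  have 1: "(\<lambda>v. 0, \<lambda>v. 1) \<in> fractions CC"
    using fractions_iff[OF E_props(2)[of 1]] forms_1 forms_0 ev_1[OF E_props(2)[of 1]] by auto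
  then show "\<zero>\<^bsub>K\<^esub> \<in> carrier K" using fv_fraction[OF E_props(2)[of 1]] by (simp add: function_field_def)
  show "generic w \<Longrightarrow> fv w \<zero>\<^bsub>K\<^esub> = 0" using fv_fraction 1 ev_1 ev_0 by (simp add: function_field_def)
qed

lemma fv_eq_0_iff: "f \<in> carrier K \<Longrightarrow> generic w \<Longrightarrow> fv w f = 0 \<longleftrightarrow> f = \<zero>\<^bsub>K\<^esub>"
  using fv_inj zero_K by metis

lemma comm_monoid_K: "comm_monoid K"
proof (rule comm_monoidI)
  note w = E_props(2)[of 1]
  fix f g h assume f: "f \<in> carrier K" and g: "g \<in> carrier K" and h: "h \<in> carrier K"
  show "f \<otimes>\<^bsub>K\<^esub> g \<in> carrier K" using mult_K f g by blast
  show "f \<otimes>\<^bsub>K\<^esub> g \<otimes>\<^bsub>K\<^esub> h = f \<otimes>\<^bsub>K\<^esub> (g \<otimes>\<^bsub>K\<^esub> h)"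
    by (rule fv_inj[OF _ _ w]) (simp_all add: mult_K f g h w mult.assoc)
  show "f \<otimes>\<^bsub>K\<^esub> g = g \<otimes>\<^bsub>K\<^esub> f"
    by (rule fv_inj[OF _ _ w]) (simp_all add: mult_K f g h w mult.commute)
  show "\<one>\<^bsub>K\<^esub> \<otimes>\<^bsub>K\<^esub> f = f"
    by (rule fv_inj[OF _ _ w]) (simp_all add: mult_K one_K f w)
qed (rule one_K)

lemma inv_K:
  assumes "f \<in> carrier K" "f \<noteq> \<zero>\<^bsub>K\<^esub>"
  shows "inv\<^bsub>K\<^esub> f \<in> carrier K" "generic w \<Longrightarrow> fv w (inv\<^bsub>K\<^esub> f) = inverse (fv w f)"
proof -
  note w0 = E_props(2)[of 1]
  obtain A B where AB: "(A, B) \<in> f" using carrier_eq(2)[OF assms(1) w0] by fast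
  note m = carrier_mem[OF assms(1) AB]
  have ne: "ev A w \<noteq> 0" if "generic w" for w
    using fv_eq_0_iff[OF assms(1) that] assms(2) m(2)[OF that] by auto
  have BA: "(B, A) \<in> fractions CC" using m(1)[OF w0] fractions_iff[OF w0] ne[OF w0] by blast
  note g = fv_fraction[OF _ BA]
  have one: "f \<otimes>\<^bsub>K\<^esub> fraction CC B A = \<one>\<^bsub>K\<^esub>"
  proof (rule fv_inj[OF _ _ w0])
    have "ev B (E 1) \<noteq> 0" using m(1)[OF w0] fractions_iff[OF w0] by blast
    then show "fv (E 1) (f \<otimes>\<^bsub>K\<^esub> fraction CC B A) = fv (E 1) \<one>\<^bsub>K\<^esub>"
      using mult_K(2)[OF assms(1) g(1)[OF w0] w0] g(2)[OF w0] m(2)[OF w0] ne[OF w0] one_K(2)[OF w0] by simp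
  qed (use mult_K one_K assms g w0 in auto)
  interpret comm_monoid K by (rule comm_monoid_K)
  have inv: "inv\<^bsub>K\<^esub> f = fraction CC B A"
    using comm_inv_char[OF assms(1) g(1)[OF w0] one] .
  show "inv\<^bsub>K\<^esub> f \<in> carrier K" unfolding inv using g(1)[OF w0] .
  show "generic w \<Longrightarrow> fv w (inv\<^bsub>K\<^esub> f) = inverse (fv w f)"
    unfolding inv using g(2) m(2) by simp
qed

lemma nat_pow_K:
  assumes "f \<in> carrier K"
  shows "f [^]\<^bsub>K\<^esub> (n::nat) \<in> carrier K \<and> (generic w \<longrightarrow> fv w (f [^]\<^bsub>K\<^esub> n) = fv w f ^ n)"
proof -
  interpret comm_monoid K by (rule comm_monoid_K)
  show ?thesis
    by (induction n) (simp_all add: one_K mult_K assms nat_pow_Suc)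
qed

lemma int_pow_K:
  assumes "f \<in> carrier K" "f \<noteq> \<zero>\<^bsub>K\<^esub>"
  shows "f [^]\<^bsub>K\<^esub> (n::int) \<in> carrier K" "generic w \<Longrightarrow> fv w (f [^]\<^bsub>K\<^esub> n) = fv w f powi n"
proof -
  have nz: "f [^]\<^bsub>K\<^esub> (m::nat) \<noteq> \<zero>\<^bsub>K\<^esub>" for m
  proof
    assume "f [^]\<^bsub>K\<^esub> m = \<zero>\<^bsub>K\<^esub>"
    then have "fv (E 1) f ^ m = 0" using nat_pow_K[OF assms(1), of m "E 1"] zero_K(2) E_props(2)[of 1] by simp
    then show False using fv_eq_0_iff[OF assms(1) E_props(2)] assms(2) by auto
  qed
  have *: "f [^]\<^bsub>K\<^esub> n = (if n < 0 then inv\<^bsub>K\<^esub> (f [^]\<^bsub>K\<^esub> (nat (-n))) else f [^]\<^bsub>K\<^esub> (nat n))"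
    by (simp add: int_pow_def2)
  show "f [^]\<^bsub>K\<^esub> n \<in> carrier K"
  proof (cases "n < 0")
    case True
    then show ?thesis unfolding * using inv_K(1)[OF _ nz] nat_pow_K[OF assms(1)] by (simp only: if_True)
  qed (use * nat_pow_K[OF assms(1)] in \<open>simp only: if_False\<close>)
  show "generic w \<Longrightarrow> fv w (f [^]\<^bsub>K\<^esub> n) = fv w f powi n"
  proof (cases "n < 0")
    case True
    assume w: "generic w"
    have "fv w (f [^]\<^bsub>K\<^esub> n) = inverse (fv w f ^ nat (- n))"
      unfolding * using True inv_K(2)[OF _ nz w] nat_pow_K[OF assms(1)] w by (simp only: if_True)
    then show ?thesis using True by (simp add: power_int_def power_inverse)
  next
    case False
    assume w: "generic w"
    then have "fv w (f [^]\<^bsub>K\<^esub> n) = fv w f ^ nat n"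
      unfolding * using False nat_pow_K[OF assms(1)] by (simp only: if_False)
    then show ?thesis using False by (simp add: power_int_def)
  qed
qed

lemma ev_forms_combination:
  assumes "A \<in> forms UNIV d" "B \<in> forms UNIV e" "A' \<in> forms UNIV d'" "B' \<in> forms UNIV e'"
    "d + e = d' + e'" "generic w"
  shows "ev (\<lambda>v. A v * B v + A' v * B' v) w = ev A w * ev B w + ev A' w * ev B' w"
    "ev (\<lambda>v. A v * B v - A' v * B' v) w = ev A w * ev B w - ev A' w * ev B' w"
  using ev_add[OF forms_mult[OF assms(1,2)] forms_mult[OF assms(3,4), folded assms(5)] assms(6)]
    ev_diff[OF forms_mult[OF assms(1,2)] forms_mult[OF assms(3,4), folded assms(5)] assms(6)]
    ev_mult assms by auto

end

section \<open>The local rings are discrete valuation rings\<close>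

locale curve_point = curve +
  fixes v :: "'a ^ 3" and i :: 3
  assumes Hv: "H v = 0" and vi: "v $ i \<noteq> 0"
begin

definition "a0 = v $ (i + 1) / v $ i"
definition "b0 = v $ (i + 2) / v $ i"
definition "w = expn i v"
definition "T = (\<lambda>u. u $ (i + 1) - a0 * u $ i)"
definition "S = (\<lambda>u. u $ (i + 2) - b0 * u $ i)"
text \<open>\<open>S\<close> and \<open>T\<close> are lines through the point. Subtracting from the
  equation its value at \<open>v\<close>, and using that \<open>q\<close>-th powers are additive,
  writes \<open>H\<close> as \<open>S * U + T * V\<close>; these are the cofactors.\<close>

definition "U = (\<lambda>u. c (i + 2) * u $ i ^ q + (c (i + 1) * a0) * (S u ^ (q - 1) * u $ i))"
definition "V = (\<lambda>u. c (i + 1) * u $ (i + 2) ^ q + c i * (T u ^ (q - 1) * u $ i))"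

lemma w_generic: "generic w"
  unfolding w_def by (rule generic_expn) (use Hv vi in auto)

lemma w_coord: "w $ i = 1" "w $ (i + 1) = fls_const a0 + fls_X"
  using expn_props[OF Hv vi] by (auto simp: w_def a0_def)

lemma T_form: "T \<in> forms UNIV 1" unfolding T_def by (intro forms_diff forms_cmult forms_coord)
lemma S_form: "S \<in> forms UNIV 1" unfolding S_def by (intro forms_diff forms_cmult forms_coord)

lemma U_form: "U \<in> forms UNIV q"
proof -
  have "(\<lambda>u::'a^3. u $ i ^ q) \<in> forms UNIV (q * 1)" by (intro forms_power forms_coord)
  moreover have "(\<lambda>u. S u ^ (q - 1) * u $ i) \<in> forms UNIV ((q - 1) * 1 + 1)"
    by (intro forms_mult forms_power S_form forms_coord)
  moreover have "(q - 1) * 1 + 1 = q" using q_gt_2 by simp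
  ultimately show ?thesis unfolding U_def by (intro forms_add forms_cmult) auto
qed

lemma V_form: "V \<in> forms UNIV q"
proof -
  have "(\<lambda>u::'a^3. u $ (i + 2) ^ q) \<in> forms UNIV (q * 1)" by (intro forms_power forms_coord)
  moreover have "(\<lambda>u. T u ^ (q - 1) * u $ i) \<in> forms UNIV ((q - 1) * 1 + 1)"
    by (intro forms_mult forms_power T_form forms_coord)
  moreover have "(q - 1) * 1 + 1 = q" using q_gt_2 by simp
  ultimately show ?thesis unfolding V_def by (intro forms_add forms_cmult) auto
qed

lemma SU_TV: "H u = 0 \<Longrightarrow> S u * U u = - (T u * V u)"
proof -
  assume "H u = 0"
  have 1: "v $ (i + 1) = a0 * v $ i" "v $ (i + 2) = b0 * v $ i" using vi by (auto simp: a0_def b0_def)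
  have "H v = (c i * a0 ^ q + c (i + 1) * a0 * b0 ^ q + c (i + 2) * b0) * v $ i ^ (q + 1)"
    unfolding H_cyclic[of v i] 1 by (simp add: algebra_simps power_mult_distrib)
  then have 0: "c i * a0 ^ q + c (i + 1) * a0 * b0 ^ q + c (i + 2) * b0 = 0" using Hv vi by simp
  have TT: "T u ^ (q - 1) * T u = u $ (i + 1) ^ q - a0 ^ q * u $ i ^ q"
    using frobenius_diff[of "u $ (i + 1)" "a0 * u $ i"]
    by (simp add: T_def power_mult_distrib power_q_split[of "_ - _"] mult.commute)
  have SS: "S u ^ (q - 1) * S u = u $ (i + 2) ^ q - b0 ^ q * u $ i ^ q"
    using frobenius_diff[of "u $ (i + 2)" "b0 * u $ i"]
    by (simp add: S_def power_mult_distrib power_q_split[of "_ - _"] mult.commute)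
  have "S u * U u + T u * V u = c (i + 2) * u $ i ^ q * S u + c (i + 1) * a0 * u $ i * (S u ^ (q - 1) * S u)
     + c (i + 1) * u $ (i + 2) ^ q * T u + c i * u $ i * (T u ^ (q - 1) * T u)"
    by (simp add: U_def V_def algebra_simps)
  also have "\<dots> = H u - u $ i ^ q * u $ i * (c i * a0 ^ q + c (i + 1) * a0 * b0 ^ q + c (i + 2) * b0)"
    unfolding TT SS H_cyclic[of u i] by (simp add: T_def S_def algebra_simps)
  also have "\<dots> = 0" using \<open>H u = 0\<close> 0 by simp
  finally show ?thesis by (simp add: eq_neg_iff_add_eq_0)
qed

lemma ev_T: "ev T w = fls_X"
proof -
  have "ev T w = ev (\<lambda>u. u $ (i + 1)) w - ev (\<lambda>u. a0 * u $ i) w"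
    unfolding T_def by (rule ev_diff) (auto intro: forms_coord forms_cmult[OF forms_coord] w_generic)
  then show ?thesis using ev_cmult[OF forms_coord w_generic, of a0 i]
    by (simp add: ev_coord w_generic w_coord)
qed

lemma ev_SU: "ev S w * ev U w = - (ev T w * ev V w)"
proof -
  have "ev (\<lambda>u. S u * U u + T u * V u) w = 0"
  proof (subst ev_eq_0_iff[OF _ w_generic])
    show "(\<lambda>u. S u * U u + T u * V u) \<in> forms UNIV (1 + q)"
      by (intro forms_add forms_mult S_form T_form U_form V_form)
  qed (use SU_TV in auto)
  then show ?thesis
    using ev_forms_combination(1)[OF S_form U_form T_form V_form refl w_generic]
    by (simp add: eq_neg_iff_add_eq_0)
qed

lemma residue_U: "has_residue (ev U w) (c (i + 2))"
proof -
  have "S v = 0" using vi by (simp add: S_def b0_def)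
  then have "U v = c (i + 2) * v $ i ^ q" using q_gt_2 by (simp add: U_def power_0_left)
  then show ?thesis using ev_residue[OF U_form Hv vi] vi by (simp add: w_def)
qed

section \<open>First-order expansion of forms at a point\<close>

text \<open>The ideal of the point is generated by \<open>T\<close> and \<open>S\<close>: a form is
  its value times a power of coordinate \<open>i\<close> plus a combination of these two. For
  \<open>d = 0\<close> the degree \<open>d - 1\<close> is truncated to 0, hence the clause that then
  forces the cofactors to vanish.\<close>

definition decomposes :: "nat \<Rightarrow> ('a ^ 3 \<Rightarrow> 'a) \<Rightarrow> bool" where
  "decomposes d A \<longleftrightarrow> (\<exists>A1 A2. A1 \<in> forms UNIV (d - 1) \<and> A2 \<in> forms UNIV (d - 1) \<and>
     (d = 0 \<longrightarrow> A1 = (\<lambda>_. 0) \<and> A2 = (\<lambda>_. 0)) \<and>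
     (\<forall>u. A u = A v / v $ i ^ d * u $ i ^ d + T u * A1 u + S u * A2 u))"

lemma decomposesI:
  assumes "A1 \<in> forms UNIV (d - 1)" "A2 \<in> forms UNIV (d - 1)" "d = 0 \<Longrightarrow> A1 = (\<lambda>_. 0)" "d = 0 \<Longrightarrow> A2 = (\<lambda>_. 0)"
    "\<And>u. A u = A v / v $ i ^ d * u $ i ^ d + T u * A1 u + S u * A2 u"
  shows "decomposes d A"
  unfolding decomposes_def using assms by blast

lemma decomposes_add:
  assumes "decomposes d A" "decomposes d B"
  shows "decomposes d (\<lambda>u. A u + B u)"
proof -
  obtain A1 A2 B1 B2 where *: "A1 \<in> forms UNIV (d - 1)" "A2 \<in> forms UNIV (d - 1)"
    "d = 0 \<longrightarrow> A1 = (\<lambda>_. 0) \<and> A2 = (\<lambda>_. 0)" "\<And>u. A u = A v / v $ i ^ d * u $ i ^ d + T u * A1 u + S u * A2 u"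
    "B1 \<in> forms UNIV (d - 1)" "B2 \<in> forms UNIV (d - 1)"
    "d = 0 \<longrightarrow> B1 = (\<lambda>_. 0) \<and> B2 = (\<lambda>_. 0)" "\<And>u. B u = B v / v $ i ^ d * u $ i ^ d + T u * B1 u + S u * B2 u"
    using assms unfolding decomposes_def by blast
  show ?thesis
  proof (rule decomposesI[OF forms_add[OF *(1,5)] forms_add[OF *(2,6)]])
    fix u
    show "A u + B u = (A v + B v) / v $ i ^ d * u $ i ^ d + T u * (A1 u + B1 u) + S u * (A2 u + B2 u)"
      by (subst *(4)[of u], subst *(8)[of u]) (simp add: algebra_simps add_divide_distrib)
  qed (use *(3,7) in simp_all)
qed

lemma decomposes_mult:
  assumes "decomposes d A" "A \<in> forms UNIV d" "decomposes e B" "B \<in> forms UNIV e"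
  shows "decomposes (d + e) (\<lambda>u. A u * B u)"
proof -
  obtain A1 A2 B1 B2 where *: "A1 \<in> forms UNIV (d - 1)" "A2 \<in> forms UNIV (d - 1)"
    "d = 0 \<longrightarrow> A1 = (\<lambda>_. 0) \<and> A2 = (\<lambda>_. 0)" "\<And>u. A u = A v / v $ i ^ d * u $ i ^ d + T u * A1 u + S u * A2 u"
    "B1 \<in> forms UNIV (e - 1)" "B2 \<in> forms UNIV (e - 1)"
    "e = 0 \<longrightarrow> B1 = (\<lambda>_. 0) \<and> B2 = (\<lambda>_. 0)" "\<And>u. B u = B v / v $ i ^ e * u $ i ^ e + T u * B1 u + S u * B2 u"
    using assms(1,3) unfolding decomposes_def by blast
  define a where "a = A v / v $ i ^ d"
  define C1 where "C1 = (\<lambda>u. A1 u * B u + a * (u $ i ^ d * B1 u))"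
  define C2 where "C2 = (\<lambda>u. A2 u * B u + a * (u $ i ^ d * B2 u))"
  have ui: "(\<lambda>u::'a^3. u $ i ^ d) \<in> forms UNIV d"
    using forms_power[OF forms_coord, of i d] by simp
  have F: "(\<lambda>u. F u * B u + a * (u $ i ^ d * G u)) \<in> forms UNIV (d + e - 1)"
    if "F \<in> forms UNIV (d - 1)" "G \<in> forms UNIV (e - 1)" "d = 0 \<Longrightarrow> F = (\<lambda>_. 0)" "e = 0 \<Longrightarrow> G = (\<lambda>_. 0)" for F G
  proof (rule forms_add)
    show "(\<lambda>u. F u * B u) \<in> forms UNIV (d + e - 1)"
    proof (cases "d = 0")
      case False
      then have "d - 1 + e = d + e - 1" by simp
      then show ?thesis using forms_mult[OF that(1) assms(4)] by simp
    qed (use that(3) forms_0 in auto)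
    show "(\<lambda>u. a * (u $ i ^ d * G u)) \<in> forms UNIV (d + e - 1)"
    proof (cases "e = 0")
      case False
      then have "d + (e - 1) = d + e - 1" by simp
      then show ?thesis using forms_cmult[OF forms_mult[OF ui that(2)]] by simp
    qed (use that(4) forms_0 in auto)
  qed
  have eq: "A u * B u = A v * B v / v $ i ^ (d + e) * u $ i ^ (d + e) + T u * C1 u + S u * C2 u" for u
  proof -
    have "A u * B u = a * u $ i ^ d * B u + (T u * A1 u + S u * A2 u) * B u"
      by (subst *(4)[of u]) (simp add: a_def algebra_simps)
    also have "a * u $ i ^ d * B u = a * u $ i ^ d * (B v / v $ i ^ e * u $ i ^ e) + a * u $ i ^ d * (T u * B1 u + S u * B2 u)"
      by (subst *(8)[of u]) (simp only: algebra_simps)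
    also have "a * u $ i ^ d * (B v / v $ i ^ e * u $ i ^ e) = A v * B v / v $ i ^ (d + e) * u $ i ^ (d + e)"
      by (simp add: a_def power_add)
    finally show ?thesis by (simp add: C1_def C2_def algebra_simps)
  qed
  show ?thesis
  proof (rule decomposesI[OF _ _ _ _ eq])
    show "C1 \<in> forms UNIV (d + e - 1)" "C2 \<in> forms UNIV (d + e - 1)"
      unfolding C1_def C2_def by (rule F; use *(1-3,5-7) in simp)+
    show "C1 = (\<lambda>_. 0)" "C2 = (\<lambda>_. 0)" if "d + e = 0"
      using *(3,7) that by (simp_all add: C1_def C2_def)
  qed
qed

lemma decomposes_const: "decomposes 0 (\<lambda>u. a)"
  unfolding decomposes_def
  by (rule exI[of _ "\<lambda>_. 0"], rule exI[of _ "\<lambda>_. 0"]) (simp add: forms_0)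

lemma decomposes_coord: "decomposes 1 (\<lambda>u. u $ j)"
proof -
  have "\<exists>s t. \<forall>u::'a^3. u $ j = v $ j / v $ i * u $ i + T u * s + S u * t"
    using index_cyclic[of j i]
  proof (elim disjE)
    assume j: "j = i"
    show ?thesis by (rule exI[of _ 0], rule exI[of _ 0]) (use vi j in simp)
  next
    assume j: "j = i + 1"
    show ?thesis by (rule exI[of _ 1], rule exI[of _ 0]) (use vi j in \<open>simp add: T_def a0_def\<close>)
  next
    assume j: "j = i + 2"
    show ?thesis by (rule exI[of _ 0], rule exI[of _ 1]) (use vi j in \<open>simp add: S_def b0_def\<close>)
  qed
  then obtain s t where st: "\<forall>u::'a^3. u $ j = v $ j / v $ i * u $ i + T u * s + S u * t" by blast
  have "(\<lambda>u::'a^3. e) \<in> forms UNIV 0" for e using forms_cmult[OF forms_1, of e] by simp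
  then show ?thesis
  proof (intro decomposesI)
    show "u $ j = v $ j / v $ i ^ 1 * u $ i ^ 1 + T u * s + S u * t" for u
      unfolding power_one_right using st by blast
  qed (simp_all add: \<open>(\<lambda>u. s) \<in> forms UNIV 0\<close> \<open>(\<lambda>u. t) \<in> forms UNIV 0\<close>)
qed

lemma decomposes_power: "decomposes d A \<Longrightarrow> A \<in> forms UNIV d \<Longrightarrow> decomposes (n * d) (\<lambda>u. A u ^ n)"
proof (induction n)
  case 0
  then show ?case using decomposes_const[of 1] by simp
next
  case (Suc n)
  then show ?case using decomposes_mult[of d A "n * d" "\<lambda>u. A u ^ n"] forms_power by auto
qed

lemma decomposes_form:
  assumes "A \<in> forms UNIV d"
  shows "decomposes d A"
proof -
  obtain B where "lifts d A B" using assms forms_iff_lifts by blast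
  then show ?thesis
  proof (induction rule: lifts_induct)
    case zero
    show ?case unfolding decomposes_def
      by (rule exI[of _ "\<lambda>_. 0"], rule exI[of _ "\<lambda>_. 0"]) (simp add: forms_0)
  next
    case (add A B A' B')
    then show ?case by (rule decomposes_add)
  next
    case (monom a j k l)
    have pw: "decomposes n (\<lambda>u. u $ m ^ n) \<and> (\<lambda>u::'a^3. u $ m ^ n) \<in> forms UNIV n" for n m
      using decomposes_power[OF decomposes_coord forms_coord, of n m] forms_power[OF forms_coord, of m n] by simp
    have c: "(\<lambda>u::'a^3. a) \<in> forms UNIV 0" using forms_cmult[OF forms_1, of a] by simp
    have "decomposes (0 + j + k + l) (\<lambda>u. a * u $ 1 ^ j * u $ 2 ^ k * u $ 3 ^ l)"
      using pw c by (intro decomposes_mult decomposes_const forms_mult) auto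
    then show ?case using monom by simp
  qed
qed

text \<open>The reason why \<open>T\<close> generates the maximal ideal: \<open>U\<close> is a unit at the point.\<close>

lemma clear_zero:
  assumes "A \<in> forms UNIV d" "A v = 0"
  shows "\<exists>A'\<in>forms UNIV (d - 1 + q). ev A w * ev U w = fls_X * ev A' w"
proof -
  obtain A1 A2 where *: "A1 \<in> forms UNIV (d - 1)" "A2 \<in> forms UNIV (d - 1)" "d = 0 \<longrightarrow> A1 = (\<lambda>_. 0) \<and> A2 = (\<lambda>_. 0)"
    "\<And>u. A u = T u * A1 u + S u * A2 u"
    using decomposes_form[OF assms(1)] assms(2) unfolding decomposes_def by auto
  have "A = (\<lambda>u. T u * A1 u + S u * A2 u)" using *(4) by blast
  then have A: "ev A w = ev T w * ev A1 w + ev S w * ev A2 w"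
    using ev_forms_combination(1)[OF T_form *(1) S_form *(2) refl w_generic] by simp
  \<comment> \<open>Result of multiplying the decomposition by \<open>U\<close>, replacing
    \<open>S * U\<close> by \<open>- T * V\<close> on the curve, and dividing by
    \<open>T\<close>.\<close>
  define A' where "A' = (\<lambda>u. A1 u * U u - A2 u * V u)"
  have 1: "A' \<in> forms UNIV (d - 1 + q)"
    unfolding A'_def by (intro forms_diff forms_mult * U_form V_form)
  have 2: "ev A' w = ev A1 w * ev U w - ev A2 w * ev V w"
    unfolding A'_def by (rule ev_forms_combination(2)[OF *(1) U_form *(2) V_form refl w_generic])
  have "ev T w * ev A' w = ev T w * ev A1 w * ev U w + ev A2 w * (- (ev T w * ev V w))"
    unfolding 2 by (simp add: algebra_simps)
  also have "\<dots> = ev A w * ev U w" unfolding A ev_SU[symmetric] by (simp add: algebra_simps)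
  finally have "ev A w * ev U w = fls_X * ev A' w" using ev_T by simp
  then show ?thesis using 1 by blast
qed

lemma residue_form: "A \<in> forms UNIV d \<Longrightarrow> has_residue (ev A w) (A v / v $ i ^ d)"
  using ev_residue[OF _ Hv vi] by (simp add: w_def)

text \<open>As long as the denominator vanishes at the point, so does the numerator, by the
  assumption on orders. Both are multiplied by the unit \<open>U\<close> and divided by the local
  parameter, which lowers the order of the denominator by one.\<close>

lemma clear_denominator:
  assumes "A \<in> forms UNIV d" "B \<in> forms UNIV d" "ev B w \<noteq> 0"
    "ev A w = 0 \<or> fls_subdegree (ev A w) \<ge> fls_subdegree (ev B w)"
  shows "\<exists>d' A' B'. A' \<in> forms UNIV d' \<and> B' \<in> forms UNIV d' \<and> B' v \<noteq> 0 \<and> ev B' w \<noteq> 0 \<and>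
     ev A' w / ev B' w = ev A w / ev B w"
  using assms
proof (induction "nat (fls_subdegree (ev B w))" arbitrary: A B d rule: less_induct)
  case less
  note rB = residue_form[OF less.prems(2)] and rA = residue_form[OF less.prems(1)]
  show ?case
  proof (cases "B v = 0")
    case False
    then show ?thesis using less.prems by blast
  next
    case True
    then have sB: "fls_subdegree (ev B w) > 0" using rB less.prems(3) has_residue_0_pos by simp
    then have "has_residue (ev A w) 0" using less.prems(4) by (intro has_residueI_pos) auto
    then have "A v = 0" using rA has_residue_unique vi by fastforce
    obtain A' where A': "A' \<in> forms UNIV (d - 1 + q)" "ev A w * ev U w = fls_X * ev A' w"
      using clear_zero[OF less.prems(1) \<open>A v = 0\<close>] by blast
    obtain B' where B': "B' \<in> forms UNIV (d - 1 + q)" "ev B w * ev U w = fls_X * ev B' w"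
      using clear_zero[OF less.prems(2) True] by blast
    note U = has_residue_nz[OF residue_U c_nz]
    have X: "fls_X \<noteq> (0 :: 'a fls)" by simp
    have B'nz: "ev B' w \<noteq> 0" using B'(2) less.prems(3) U by auto
    have A'nz: "ev A' w = 0 \<longleftrightarrow> ev A w = 0" using A'(2) U X by (metis mult_eq_0_iff)
    have "fls_subdegree (ev B w * ev U w) = fls_subdegree (fls_X * ev B' w)" using B'(2) by simp
    then have sB': "fls_subdegree (ev B' w) = fls_subdegree (ev B w) - 1"
      using U B'nz less.prems(3) X by (simp del: fls_mult_fls_X_nonzero)
    have sA': "fls_subdegree (ev A' w) = fls_subdegree (ev A w) - 1" if "ev A w \<noteq> 0"
    proof -
      have "fls_subdegree (ev A w * ev U w) = fls_subdegree (fls_X * ev A' w)" using A'(2) by simp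
      then show ?thesis using U A'nz that X by simp
    qed
    have "ev A' w / ev B' w = (ev A w * ev U w) / (ev B w * ev U w)"
      unfolding A'(2) B'(2) using X by simp
    then have "ev A' w / ev B' w = ev A w / ev B w" using U by simp
    moreover have "\<exists>d'' A'' B''. A'' \<in> forms UNIV d'' \<and> B'' \<in> forms UNIV d'' \<and> B'' v \<noteq> 0 \<and> ev B'' w \<noteq> 0 \<and>
     ev A'' w / ev B'' w = ev A' w / ev B' w"
      using less.hyps[OF _ A'(1) B'(1) B'nz] sB sB' sA' A'nz less.prems(4) by auto
    ultimately show ?thesis by simp
  qed
qed

section \<open>Regularity, values and orders read off from the expansion\<close>

abbreviation P where "P \<equiv> proj_point v"

lemma value_residue:
  assumes "f \<in> carrier K" "(A, B) \<in> f" "u \<in> P" "B u \<noteq> 0"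
  shows "has_residue (fv w f) (A u / B u)"
proof -
  note m = carrier_mem[OF assms(1,2) w_generic]
  obtain d where d: "A \<in> forms UNIV d" "B \<in> forms UNIV d" using m(1) fractions_iff[OF w_generic] by blast
  obtain A' B' where l: "lifts d A A'" "lifts d B B'" using d by (auto simp: forms_iff_lifts)
  obtain a where a: "u = a *s v" using assms(3) proj_point_iff by blast
  have u: "A u = a ^ d * A v" "B u = a ^ d * B v"
    unfolding a using lifts_scale[OF l(1)] lifts_scale[OF l(2)] by blast+
  have Bv: "B v / v $ i ^ d \<noteq> 0" using assms(4) u vi by auto
  have "has_residue (ev A w / ev B w) ((A v / v $ i ^ d) / (B v / v $ i ^ d))"
    by (intro has_residue_divide residue_form d Bv)
  moreover have "(A v / v $ i ^ d) / (B v / v $ i ^ d) = A v / B v"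
    using vi by simp
  moreover have "a ^ d \<noteq> 0" using u(2) assms(4) by auto
  then have "A u / B u = A v / B v" unfolding u by (rule mult_divide_mult_cancel_left)
  ultimately show ?thesis unfolding m(2) by metis
qed

text \<open>That nonnegative order implies regularity is the substantial half: a representative with
  nonvanishing denominator has to be produced, which \<open>clear_denominator\<close> does.\<close>

lemma regular_iff:
  assumes "f \<in> carrier K"
  shows "regular_at P f \<longleftrightarrow> fls_subdegree (fv w f) \<ge> 0"
proof
  assume "regular_at P f"
  then show "fls_subdegree (fv w f) \<ge> 0"
    unfolding regular_at_def using value_residue[OF assms] has_residue_subdegree_nonneg by blast
next
  assume sub: "fls_subdegree (fv w f) \<ge> 0"
  obtain A B where AB: "(A, B) \<in> f" using carrier_eq(2)[OF assms w_generic] by fast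
  note m = carrier_mem[OF assms AB w_generic]
  obtain d where d: "A \<in> forms UNIV d" "B \<in> forms UNIV d" "ev B w \<noteq> 0"
    using m(1) fractions_iff[OF w_generic] by blast
  have "ev A w = 0 \<or> fls_subdegree (ev A w) \<ge> fls_subdegree (ev B w)"
    using sub m(2) d(3) by (cases "ev A w = 0") (auto simp: fls_divide_subdegree)
  then obtain d' A' B' where AB': "A' \<in> forms UNIV d'" "B' \<in> forms UNIV d'" "B' v \<noteq> 0" "ev B' w \<noteq> 0"
     "ev A' w / ev B' w = ev A w / ev B w"
    using clear_denominator d by blast
  have "(A', B') \<in> fractions CC" using AB' fractions_iff[OF w_generic] by blast
  then have "(A', B') \<in> f"
    by (subst carrier_eq(1)[OF assms w_generic]) (simp add: AB'(5) m(2))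
  then show "regular_at P f" unfolding regular_at_def using AB'(3) self_proj_point by blast
qed

lemma value_at_eq:
  assumes "f \<in> carrier K" "fls_subdegree (fv w f) \<ge> 0"
  shows "has_residue (fv w f) (value_at P f)"
proof -
  have "regular_at P f" using regular_iff assms by blast
  then obtain A B u where AB: "(A, B) \<in> f" "u \<in> P" "B u \<noteq> 0" unfolding regular_at_def by blast
  note r = value_residue[OF assms(1)]
  have "value_at P f = A u / B u"
    unfolding value_at_def
  proof (rule the_equality)
    fix y assume "\<exists>(A, B)\<in>f. \<exists>v\<in>P. B v \<noteq> 0 \<and> y = A v / B v"
    then show "y = A u / B u" using r AB has_residue_unique by blast
  qed (use AB in blast)
  then show ?thesis using r[OF AB] by simp
qed

lemma value_at_quotient:
  assumes "f \<in> carrier K" "(A, B) \<in> f" "B v \<noteq> 0"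
  shows "value_at P f = A v / B v"
  using value_residue[OF assms(1,2) self_proj_point assms(3)] value_at_eq[OF assms(1)]
    has_residue_unique has_residue_subdegree_nonneg by blast

lemma local_ring_iff: "f \<in> local_ring CC P \<longleftrightarrow> f \<in> carrier K \<and> fls_subdegree (fv w f) \<ge> 0"
  using regular_iff by (auto simp: local_ring_def)

lemma maximal_ideal_iff: "f \<in> maximal_ideal_at CC P \<longleftrightarrow> f \<in> carrier K \<and> has_residue (fv w f) 0"
  unfolding maximal_ideal_at_def local_ring_iff mem_Collect_eq
  using value_at_eq has_residue_unique has_residue_subdegree_nonneg by metis

definition "t0 = fraction CC T (\<lambda>u. u $ i)"

lemma t0: "t0 \<in> carrier K" "fv w t0 = fls_X" "t0 \<noteq> \<zero>\<^bsub>K\<^esub>"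
proof -
  have "ev (\<lambda>u. u $ i) w = 1" using ev_coord w_generic w_coord by simp
  then have "(T, \<lambda>u. u $ i) \<in> fractions CC"
    using fractions_iff[OF w_generic] T_form forms_coord by fastforce
  note f = fv_fraction[OF w_generic this]
  show 1: "t0 \<in> carrier K" "fv w t0 = fls_X"
    using f ev_T ev_coord w_generic w_coord by (simp_all add: t0_def)
  show "t0 \<noteq> \<zero>\<^bsub>K\<^esub>" using fv_eq_0_iff[OF 1(1) w_generic] 1(2) by auto
qed

lemma t0_local_parameter: "local_parameter CC P t0"
  unfolding local_parameter_def
proof (rule conjI, goal_cases)
  case 1
  show "t0 \<in> maximal_ideal_at CC P" using maximal_ideal_iff t0 has_residue_X by auto
next
  case 2
  show ?case
  proof (rule Set.set_eqI, rule iffI)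
  fix f assume "f \<in> maximal_ideal_at CC P"
  then have f: "f \<in> carrier K" "has_residue (fv w f) 0" using maximal_ideal_iff by auto
  define g where "g = f \<otimes>\<^bsub>K\<^esub> inv\<^bsub>K\<^esub> t0"
  note i = inv_K[OF t0(1,3)]
  have g: "g \<in> carrier K" "fv w g = fv w f * inverse fls_X"
    unfolding g_def using mult_K f i t0 w_generic by auto
  have "fls_subdegree (fv w g) \<ge> 0"
  proof (cases "fv w f = 0")
    case False
    then show ?thesis using has_residue_0_pos[OF f(2)] g(2) by (simp add: fls_inverse_subdegree)
  qed (use g in simp)
  then have "g \<in> local_ring CC P" using g local_ring_iff by blast
  moreover have "f = t0 \<otimes>\<^bsub>K\<^esub> g"
    by (rule fv_inj[OF _ _ w_generic]) (use f g t0 mult_K w_generic in auto)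
  ultimately show "f \<in> {t0 \<otimes>\<^bsub>K\<^esub> g | g. g \<in> local_ring CC P}" by blast
next
  fix f assume "f \<in> {t0 \<otimes>\<^bsub>K\<^esub> g | g. g \<in> local_ring CC P}"
  then obtain g where g: "f = t0 \<otimes>\<^bsub>K\<^esub> g" "g \<in> carrier K" "fls_subdegree (fv w g) \<ge> 0"
    using local_ring_iff by auto
  have "has_residue (fls_X * fv w g) (0 * fls_nth (fv w g) 0)"
    by (intro has_residue_mult has_residue_X has_residueI_nonneg g)
  then show "f \<in> maximal_ideal_at CC P"
    using maximal_ideal_iff mult_K t0 g w_generic by auto
  qed
qed

text \<open>\<open>t0\<close>, of order one, is a multiple of \<open>t\<close> in the local ring,
  and \<open>t\<close> has positive order; so its order is one as well.\<close>

lemma local_parameter_subdegree: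
  assumes "local_parameter CC P t"
  shows "t \<in> carrier K" "t \<noteq> \<zero>\<^bsub>K\<^esub>" "fls_subdegree (fv w t) = 1"
proof -
  have t: "t \<in> carrier K" "has_residue (fv w t) 0"
    using assms maximal_ideal_iff by (auto simp: local_parameter_def)
  have "t0 \<in> maximal_ideal_at CC P" using t0_local_parameter unfolding local_parameter_def by (rule conjunct1)
  moreover have "maximal_ideal_at CC P = {t \<otimes>\<^bsub>K\<^esub> g | g. g \<in> local_ring CC P}"
    using assms unfolding local_parameter_def by (rule conjunct2)
  ultimately obtain g where g: "t0 = t \<otimes>\<^bsub>K\<^esub> g" "g \<in> local_ring CC P" by blast
  have X: "fls_X = fv w t * fv w g" using g t t0 mult_K w_generic local_ring_iff by metis
  then have nz: "fv w t \<noteq> 0" "fv w g \<noteq> 0" using fls_X_nonzero by (metis mult_zero_left mult_zero_right)+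
  have "1 = fls_subdegree (fv w t) + fls_subdegree (fv w g)"
    using nz fls_subdegree_mult[OF nz] X by (metis fls_X_subdegree)
  moreover have "fls_subdegree (fv w t) > 0" using t nz has_residue_0_pos by blast
  moreover have "fls_subdegree (fv w g) \<ge> 0" using g local_ring_iff by blast
  ultimately show "fls_subdegree (fv w t) = 1" by linarith
  show "t \<in> carrier K" by (rule t)
  show "t \<noteq> \<zero>\<^bsub>K\<^esub>" using nz fv_eq_0_iff[OF t(1) w_generic] by blast
qed

text \<open>Existence is witnessed by the parameter \<open>t0\<close> with expansion
  \<open>fls_X\<close>; uniqueness of the exponent holds because every local parameter has order one
  and every unit order zero.\<close>

theorem order_at_eq:
  assumes "f \<in> carrier K" "f \<noteq> \<zero>\<^bsub>K\<^esub>"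
  shows "order_at CC P f = fls_subdegree (fv w f)"
proof -
  have nz: "fv w f \<noteq> 0" using fv_eq_0_iff assms w_generic by blast
  have unit: "fv w u \<noteq> 0 \<and> fls_subdegree (fv w u) = 0" if "u \<in> local_ring CC P - maximal_ideal_at CC P" for u
    using that local_ring_iff maximal_ideal_iff has_residueI_pos
    by (metis Diff_iff le_less)
  show ?thesis
    unfolding order_at_def
  proof (rule the_equality)
    define n where "n = fls_subdegree (fv w f)"
    define u where "u = f \<otimes>\<^bsub>K\<^esub> (t0 [^]\<^bsub>K\<^esub> (- n))"
    note p = int_pow_K[OF t0(1,3)]
    have u: "u \<in> carrier K" "fv w u = fv w f * fls_X powi (- n)"
      unfolding u_def using mult_K assms p t0 w_generic by auto
    have X: "(fls_X :: 'a fls) powi (- n) \<noteq> 0" by (simp only: power_int_eq_0_iff fls_X_nonzero simp_thms)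
    have su: "fv w u \<noteq> 0" "fls_subdegree (fv w u) = 0"
      unfolding u(2) fls_subdegree_mult[OF nz X] fls_subdegree_powi using nz X by (simp_all only: n_def) simp_all
    have "u \<in> local_ring CC P - maximal_ideal_at CC P"
      using local_ring_iff maximal_ideal_iff u su has_residue_0_pos by force
    moreover have "f = u \<otimes>\<^bsub>K\<^esub> (t0 [^]\<^bsub>K\<^esub> n)"
      by (rule fv_inj[OF _ _ w_generic])
        (use assms u p mult_K t0 w_generic in \<open>auto simp: power_int_minus\<close>)
    ultimately show "\<exists>t u. local_parameter CC P t \<and> u \<in> local_ring CC P - maximal_ideal_at CC P \<and>
       f = u \<otimes>\<^bsub>K\<^esub> (t [^]\<^bsub>K\<^esub> fls_subdegree (fv w f))"
      using t0_local_parameter unfolding n_def by blast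
  next
    fix n :: int assume "\<exists>t u. local_parameter CC P t \<and> u \<in> local_ring CC P - maximal_ideal_at CC P \<and>
       f = u \<otimes>\<^bsub>K\<^esub> (t [^]\<^bsub>K\<^esub> n)"
    then obtain t u where tu: "local_parameter CC P t" "u \<in> local_ring CC P - maximal_ideal_at CC P"
       "f = u \<otimes>\<^bsub>K\<^esub> (t [^]\<^bsub>K\<^esub> n)" by blast
    note t = local_parameter_subdegree[OF tu(1)]
    have "u \<in> carrier K" using tu(2) local_ring_iff by auto
    then have "fv w f = fv w u * fv w t powi n"
      unfolding tu(3) using mult_K int_pow_K[OF t(1,2)] w_generic by simp
    moreover have "fv w t \<noteq> 0" using t fv_eq_0_iff w_generic by blast
    ultimately show "n = fls_subdegree (fv w f)"
      using unit[OF tu(2)] t(3) by (simp add: fls_subdegree_powi)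
  qed
qed

end

section \<open>Functions with poles on one fiber\<close>

text \<open>With \<open>E i\<close> the \<open>i\<close>-th coordinate point, \<open>x\<close>, \<open>z\<close>, \<open>b\<close> have orders \<open>N, 0, q\<close> at \<open>E 3\<close> and \<open>0, N, -1\<close> at
  \<open>E 2\<close>; the exponents are the least for which \<open>kmon q k\<close> is regular at both.\<close>

definition kmon :: "nat \<Rightarrow> nat \<Rightarrow> 'a::field ^ 3 \<Rightarrow> 'a" where
  "kmon q k v = x_coord q v powi (- int (q * k div (q ^ 2 - q + 1))) * z_coord q v ^ (if k = 0 then 0 else 1) * b_coord v ^ k"

context curve
begin

text \<open>If one coordinate vanishes, only one term of the equation is left, and it forces a
  second coordinate to vanish.\<close>

lemma coordinate_point:
  assumes "H v = 0" "v $ i \<noteq> 0" "v $ j = 0"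
  shows "v = v $ i *s axis i 1"
proof -
  have "v $ (j + 1) = 0 \<or> v $ (j + 2) = 0"
    using assms q_gt_2 c_nz by (simp add: H_cyclic[of v j] power_0_left)
  then have "v $ m = 0" if "m \<noteq> i" for m
    using assms that index_cyclic[of m j] index_cyclic[of i j] by metis
  then show ?thesis by (auto simp: vec_eq_iff axis_def)
qed

lemma expn3_residues:
  assumes "\<And>i. v $ i \<noteq> 0" "H v = 0"
  shows "has_residue (x (expn 3 v)) (x v)" "has_residue (z (expn 3 v)) (z v)" "has_residue (b (expn 3 v)) (b v)"
proof -
  have r: "has_residue (expn 3 v $ j) (v $ j / v $ 3)" for j using expn_props(4)[OF assms(2,1)] .
  have "has_residue (x (expn 3 v)) ((v $ 1 / v $ 3) * (v $ 2 / v $ 3) ^ (q - 1) / (v $ 3 / v $ 3) ^ q)"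
    unfolding x_coord_def using assms(1)[of 3] by (intro has_residue_divide has_residue_mult has_residue_power r) auto
  then show "has_residue (x (expn 3 v)) (x v)"
    using assms(1)[of 3] by (simp add: x_coord_def power_divide power_q_split[of "v $ 3"])
  have "has_residue (z (expn 3 v)) ((v $ 1 / v $ 3) ^ q / ((v $ 2 / v $ 3) * (v $ 3 / v $ 3) ^ (q - 1)))"
    unfolding z_coord_def using assms(1)[of 3] assms(1)[of 2]
    by (intro has_residue_divide has_residue_mult has_residue_power r) auto
  then show "has_residue (z (expn 3 v)) (z v)"
    using assms(1)[of 3] by (simp add: z_coord_def power_divide power_q_split[of "v $ 3"] mult.commute)
  have "has_residue (b (expn 3 v)) ((v $ 2 / v $ 3) / (v $ 3 / v $ 3))"
    unfolding b_coord_def using assms(1)[of 3] by (intro has_residue_divide r) auto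
  then show "has_residue (b (expn 3 v)) (b v)" using assms(1)[of 3] by (simp add: b_coord_def)
qed

text \<open>In the chart of the third coordinate, with \<open>Y\<close> the second one, the equation
  becomes \<open>c 1 * Y * (x - d) = r * (Y - b0) - c 3 * fls_X ^ q\<close>. Here
  \<open>Y - b0\<close> has order one by smoothness, and \<open>r\<close> is nonzero because
  \<open>z\<close> does not vanish at the point.\<close>

lemma unramified:
  assumes "\<And>i. v $ i \<noteq> 0" "H v = 0"
  shows "fls_subdegree (x (expn 3 v) - fls_const (x v)) = 1"
proof -
  interpret curve_point q c v 3 by unfold_locales (use assms in auto)
  have idx: "(3::3) + 1 = 1" "(3::3) + 2 = 2" by (simp_all add: index_mod_3)
  have a0_eq: "a0 = v $ 1 / v $ 3" and b0_eq: "b0 = v $ 2 / v $ 3"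
    by (simp_all add: a0_def b0_def index_mod_3)
  define Y where "Y = w $ 2"
  define d where "d = x v"
  have w3: "w $ 3 = 1" and w1: "w $ 1 = fls_const a0 + fls_X" using w_coord by (simp_all add: index_mod_3)
  have Yr: "has_residue Y b0" using expn_props(4)[OF Hv vi, of 2] by (simp add: Y_def w_def b0_eq index_mod_3)
  have b0: "b0 \<noteq> 0" using assms by (simp add: b0_eq)
  have d_eq: "d = a0 * b0 ^ (q - 1)"
    using assms(1)[of 3] by (simp add: d_def x_coord_def a0_eq b0_eq power_divide power_q_split[of "v $ 3"])
  have evS: "ev S w = Y - fls_const b0"
  proof -
    have "ev S w = ev (\<lambda>u. u $ 2) w - ev (\<lambda>u. b0 * u $ 3) w"
      unfolding S_def idx by (rule ev_diff) (auto intro: forms_coord forms_cmult[OF forms_coord] w_generic)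
    then show ?thesis using ev_cmult[OF forms_coord w_generic, of b0 3]
      by (simp add: ev_coord w_generic w3 Y_def)
  qed
  have "T v = 0" using vi by (simp add: T_def a0_eq idx index_mod_3)
  then have "V v = c 1 * v $ 2 ^ q" using q_gt_2 by (simp add: V_def power_0_left index_mod_3)
  then have rV: "has_residue (ev V w) (c 1 * b0 ^ q)"
    using residue_form[OF V_form] vi by (simp add: b0_eq power_divide)
  have nzV: "c 1 * b0 ^ q \<noteq> 0" using b0 c_nz by simp
  note V' = has_residue_nz[OF rV nzV] and U' = has_residue_nz[OF residue_U c_nz]
  have SU: "ev S w * ev U w = - (fls_X * ev V w)" using ev_SU ev_T by simp
  then have "ev S w \<noteq> 0" using V' by auto
  moreover have "fls_subdegree (ev S w * ev U w) = 1" unfolding SU using V' by simp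
  ultimately have sS: "fls_subdegree (Y - fls_const b0) = 1" using U' by (simp add: evS)
  have rel0: "c 3 * a0 ^ q + c 1 * a0 * b0 ^ q + c 2 * b0 = 0"
  proof -
    have "H v = (c 3 * a0 ^ q + c 1 * a0 * b0 ^ q + c 2 * b0) * v $ 3 ^ (q + 1)"
      using assms(1)[of 3] unfolding H_expand a0_eq b0_eq by (simp add: field_simps power_divide)
    then show ?thesis using Hv vi by simp
  qed
  have relw: "fls_const (c 3) * (fls_const (a0 ^ q) + fls_X ^ q) + fls_const (c 1) * (x w * Y) + fls_const (c 2) * Y = 0"
  proof -
    have "HL w = 0" using w_generic by (simp add: generic_def good_def)
    moreover have "x w * Y = w $ 1 * Y ^ q" by (simp add: x_coord_def w3 Y_def power_q_split[of "w $ 2"])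
    ultimately show ?thesis
      by (simp add: HL_expand w3 w1 Y_def[symmetric] frobenius_add_fls fls_const_power algebra_simps
          flip: fls_const_mult_const)
  qed
  have bd: "d * b0 = a0 * b0 ^ q" by (simp add: d_eq power_q_split[of b0])
  have 1: "fls_const (c 1) * Y * (x w - fls_const d)
     = fls_const (- (c 2 + c 1 * d)) * (Y - fls_const b0) - fls_const (c 3) * fls_X ^ q"
  proof -
    have "c 3 * a0 ^ q + (c 2 + c 1 * d) * b0 = c 3 * a0 ^ q + c 1 * (d * b0) + c 2 * b0"
      by (simp add: algebra_simps)
    also have "\<dots> = 0" unfolding bd using rel0 by (simp add: mult.assoc)
    finally have e: "c 3 * a0 ^ q = - ((c 2 + c 1 * d) * b0)" by (simp only: eq_neg_iff_add_eq_0)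
    have "fls_const (c 1) * Y * (x w - fls_const d) = fls_const (c 1) * (x w * Y) - fls_const (c 1 * d) * Y"
      by (simp add: algebra_simps flip: fls_const_mult_const)
    also have "fls_const (c 1) * (x w * Y) = - (fls_const (c 3 * a0 ^ q) + fls_const (c 3) * fls_X ^ q + fls_const (c 2) * Y)"
      using relw by (simp add: algebra_simps eq_neg_iff_add_eq_0 flip: fls_const_mult_const)
    finally have 2: "fls_const (c 1) * Y * (x w - fls_const d)
       = - (fls_const (c 3 * a0 ^ q) + fls_const (c 3) * fls_X ^ q + fls_const (c 2) * Y) - fls_const (c 1 * d) * Y" .
    define k where "k = fls_const (c 2 + c 1 * d)"
    have k: "fls_const (c 3 * a0 ^ q) = - (k * fls_const b0)" "fls_const (- (c 2 + c 1 * d)) = - k"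
      "fls_const (c 1 * d) = k - fls_const (c 2)"
      unfolding e k_def by (simp_all add: fls_minus_const flip: fls_const_uminus)
    show ?thesis unfolding 2 k by (simp add: algebra_simps)
  qed
  have zd: "c 2 + c 1 * d \<noteq> 0"
  proof
    assume "c 2 + c 1 * d = 0"
    then have "c 1 * d = - c 2" by (simp only: eq_neg_iff_add_eq_0 add.commute)
    then have "d = - c 2 / c 1" using c_nz[of 1] by (metis nonzero_mult_div_cancel_left)
    then show False using pt_surj(3)[OF assms] Z_root[of d] by (simp add: d2_def d_def)
  qed
  define r where "r = - (c 2 + c 1 * d)"
  have r0: "r \<noteq> 0" unfolding r_def using zd by (metis neg_equal_0_iff_equal)
  have Xq: "fls_subdegree (fls_const (c 3) * fls_X ^ q) = int q" "fls_const (c 3) * fls_X ^ q \<noteq> 0"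
    using c_nz by (simp_all add: fls_subdegree_pow)
  have nS: "Y - fls_const b0 \<noteq> 0" using sS by auto
  have s1: "fls_subdegree (fls_const r * (Y - fls_const b0)) = 1" using nS r0 sS by simp
  have "fls_subdegree (fls_const (c 1) * Y * (x w - fls_const d)) = 1"
    unfolding 1[folded r_def] using s1 Xq nS r0 q_gt_2 by (subst fls_subdegree_diff_eq1) auto
  moreover have "x w - fls_const d \<noteq> 0" using w_generic by (auto simp: generic_def)
  ultimately have "fls_subdegree (x w - fls_const d) = 1"
    using has_residue_nz[OF Yr b0] c_nz by simp
  then show ?thesis by (simp add: w_def d_def)
qed

lemma generic_x_minus: "generic w \<Longrightarrow> x w - fls_const d \<noteq> 0"
  by (auto simp: generic_def)

lemma dvd_coeffs_root:
  assumes "poly p d = (0::'k)"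
  obtains r where "p = [:-d, 1:] * r"
  using assms by (auto simp: poly_eq_0_iff_dvd elim: dvdE)

lemma pev_smult_all: "pev (\<lambda>k. P * p k) u y = evalp P u * pev p u y"
  by (simp add: pev_def sum_distrib_left mult_ac)

text \<open>Induction on the roots of \<open>D\<close>. A root at a branch value is absorbed into
  the powers of \<open>x\<close> or \<open>z\<close>. At any other root the right-hand side vanishes
  on the whole fiber, so every coefficient \<open>p k\<close> is divisible by the same linear
  factor, which cancels.\<close>

lemma remove_denominator:
  assumes reg: "\<And>d y. d \<noteq> 0 \<Longrightarrow> poly Z d \<noteq> 0 \<Longrightarrow> y \<in> fiber d \<Longrightarrow> fls_subdegree (g (expn 3 (pt d y))) \<ge> 0"
    and "D \<noteq> 0" "\<And>w. generic w \<Longrightarrow> g w * x w ^ e1 * z w ^ e2 * evalp D (x w) = pev p (x w) (b w)"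
  shows "\<exists>e1 e2 p. \<forall>w. generic w \<longrightarrow> g w * x w ^ e1 * z w ^ e2 = pev p (x w) (b w)"
  using assms(2,3)
proof (induction "degree D" arbitrary: D e1 e2 p)
  case 0
  then obtain a where a: "D = [:a:]" "a \<noteq> 0" by (metis degree_eq_zeroE pCons_0_0)
  have "g w * x w ^ e1 * z w ^ e2 = pev (\<lambda>k. [:1 / a:] * p k) (x w) (b w)" if w: "generic w" for w
  proof -
    have "fls_const (1 / a) * fls_const a = 1" using a by simp
    moreover have "pev p (x w) (b w) = g w * x w ^ e1 * z w ^ e2 * fls_const a" using 0(3)[OF w] a by simp
    ultimately show ?thesis unfolding pev_smult_all by (simp add: mult_ac)
  qed
  then show ?case by blast
next
  case (Suc n)
  then obtain d where d: "poly D d = 0" using alg_closed_imp_poly_has_root[of D] by auto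
  then obtain D' where D: "D = [:-d, 1:] * D'" using dvd_coeffs_root by blast
  have D'0: "D' \<noteq> 0" using Suc.prems(1) D by auto
  then have deg: "n = degree D'" using Suc.hyps(2) by (simp add: D degree_mult_eq del: mult_pCons_left)
  have evD: "evalp D u = (u - fls_const d) * evalp D' u" for u
    unfolding D evalp_mult by simp
  consider "d = 0" | "d = d2" | "d \<noteq> 0" "poly Z d \<noteq> 0" using Z_root by blast
  then show ?case
  proof cases
    case 1
    show ?thesis
      by (rule Suc.hyps(1)[OF deg D'0, of "Suc e1" e2 p]) (use Suc.prems(2) evD 1 in \<open>simp add: mult_ac\<close>)
  next
    case 2
    show ?thesis
    proof (rule Suc.hyps(1)[OF deg D'0, of e1 "Suc e2" "\<lambda>k. [:- (c 1 / c 3):] * p k"])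
      fix w assume w: "generic w"
      have "z w = fls_const (- (c 1 / c 3)) * (x w - fls_const d)"
        using z_eq_Z[OF generic_good[OF w]] Z_factor 2 by simp
      then have "g w * x w ^ e1 * z w ^ Suc e2 * evalp D' (x w)
         = fls_const (- (c 1 / c 3)) * (g w * x w ^ e1 * z w ^ e2 * evalp D (x w))"
        unfolding evD by (simp only: power_Suc mult_ac)
      then show "g w * x w ^ e1 * z w ^ Suc e2 * evalp D' (x w) = pev (\<lambda>k. [:- (c 1 / c 3):] * p k) (x w) (b w)"
        unfolding Suc.prems(2)[OF w] pev_smult_all by simp
    qed
  next
    case 3
    have "poly (p k) d = 0" if k: "k < N" for k
    proof (rule fiber_sum_eq_0[OF 3 _ k, where a = "\<lambda>k. poly (p k) d"])
      fix y assume y: "y \<in> fiber d"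
      note pt = pt_props[OF 3 y]
      define w where "w = expn 3 (pt d y)"
      have w: "generic w" unfolding w_def by (rule generic_expn) (use pt in auto)
      have res: "has_residue (x w) d" "has_residue (z w) (poly Z d)" "has_residue (b w) y"
        unfolding w_def using expn3_residues[OF pt(2,3)] pt by auto
      have "has_residue (g w * x w ^ e1 * z w ^ e2 * evalp D (x w)) (fls_nth (g w) 0 * d ^ e1 * poly Z d ^ e2 * poly D d)"
        by (intro has_residue_mult has_residue_power res has_residue_evalp has_residueI_nonneg)
          (use reg[OF 3 y] in \<open>simp add: w_def\<close>)
      then have "has_residue (pev p (x w) (b w)) 0" using Suc.prems(2)[OF w] d by simp
      moreover have "has_residue (pev p (x w) (b w)) (\<Sum>k<N. poly (p k) d * y ^ k)"
        unfolding pev_def by (intro has_residue_sum has_residue_mult has_residue_power res has_residue_evalp)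
      ultimately show "(\<Sum>k<N. poly (p k) d * y ^ k) = 0" using has_residue_unique by blast
    qed
    then have "\<forall>k. \<exists>r. k < N \<longrightarrow> p k = [:-d, 1:] * r" using dvd_coeffs_root by metis
    then obtain r where r: "\<And>k. k < N \<Longrightarrow> p k = [:-d, 1:] * r k" by metis
    show ?thesis
    proof (rule Suc.hyps(1)[OF deg D'0, of e1 e2 r])
      fix w assume w: "generic w"
      have "pev p (x w) (b w) = pev (\<lambda>k. [:-d, 1:] * r k) (x w) (b w)"
        unfolding pev_def by (intro sum.cong) (use r in auto)
      also have "\<dots> = (x w - fls_const d) * pev r (x w) (b w)" unfolding pev_smult_all by simp
      finally have "(x w - fls_const d) * (g w * x w ^ e1 * z w ^ e2 * evalp D' (x w))
         = (x w - fls_const d) * pev r (x w) (b w)"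
        using Suc.prems(2)[OF w] by (simp add: evD mult_ac)
      then show "g w * x w ^ e1 * z w ^ e2 * evalp D' (x w) = pev r (x w) (b w)"
        using generic_x_minus[OF w] by simp
    qed
  qed
qed

text \<open>The denominator is made a polynomial in \<open>x\<close> by multiplying with its other
  conjugates.\<close>

lemma rational_form:
  assumes "f \<in> carrier K"
  shows "\<exists>D p. D \<noteq> 0 \<and> (\<forall>w. generic w \<longrightarrow> fv w f * evalp D (x w) = pev p (x w) (b w))"
proof -
  note w0 = E_props(2)[of 1]
  obtain A B where AB: "(A, B) \<in> f" using carrier_eq(2)[OF assms w0] by fast
  note m = carrier_mem[OF assms AB]
  obtain d where d: "A \<in> forms UNIV d" "B \<in> forms UNIV d" using m(1)[OF w0] fractions_iff[OF w0] by blast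
  have Bnz: "ev B w \<noteq> 0" if "generic w" for w using m(1)[OF that] fractions_iff[OF that] by blast
  obtain A' B' where l: "lifts d A A'" "lifts d B B'" using d by (auto simp: forms_iff_lifts)
  obtain e p e' p' where
    p: "\<And>w. good w \<Longrightarrow> (x w * z w) ^ e * A' w = w $ 3 ^ d * pev p (x w) (b w)" and
    p': "\<And>w. good w \<Longrightarrow> (x w * z w) ^ e' * B' w = w $ 3 ^ d * pev p' (x w) (b w)"
    using normal_form[OF l(1)] normal_form[OF l(2)] by blast
  obtain D J Gs where D: "\<And>w. good w \<Longrightarrow> z w ^ J * (\<Prod>u\<in>mu. pev p' (x w) (fls_const u * b w)) = evalp D (x w)"
    "\<And>w. good w \<Longrightarrow> pev p' (x w) (b w) * evalpp Gs (x w) (b w) = evalp D (x w)"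
    using norm_form[of p'] by blast
  have "\<exists>k<N. p' k \<noteq> 0"
  proof (rule ccontr)
    assume "\<not> ?thesis"
    then have "pev p' (x (E 1)) (b (E 1)) = 0" by (simp add: pev_def)
    then have "B' (E 1) = 0" using p'[OF E_props(1)[of 1]] good_xzb_nz[OF E_props(1)[of 1]] by simp
    then show False using Bnz[OF w0] ev_eq[OF l(2) w0] by simp
  qed
  then have D0: "D \<noteq> 0" using norm_form_nz D(1) by blast
  define G where "G = (\<Sum>k<N. monom (p k) k)"
  have G: "evalpp G (x w) (b w) = pev p (x w) (b w)" for w by (simp add: G_def evalpp_sum pev_def)
  obtain J' r where r: "\<And>w. good w \<Longrightarrow> z w ^ J' * evalpp (G * Gs) (x w) (b w) = pev r (x w) (b w)"
    using reduce_mod_N[of "G * Gs"] by blast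
  define Y where "Y = [:0, 1:] * Z"
  have Y: "evalp Y (x w) = x w * z w" if "good w" for w using z_eq_Z[OF that] by (simp add: Y_def)
  have "fv w f * evalp (Y ^ e * Z ^ J' * D) (x w) = pev (\<lambda>k. Y ^ e' * r k) (x w) (b w)" if w: "generic w" for w
  proof -
    note g = generic_good[OF w]
    note nz = good_xzb_nz[OF g] good_coord[OF g, of 3]
    define \<alpha> where "\<alpha> = ev A w"
    define \<beta> where "\<beta> = ev B w"
    have ab: "fv w f = \<alpha> / \<beta>" "\<beta> \<noteq> 0" using m(2)[OF w] Bnz[OF w] by (auto simp: \<alpha>_def \<beta>_def)
    have a: "(x w * z w) ^ e * \<alpha> = w $ 3 ^ d * pev p (x w) (b w)" using p[OF g] ev_eq[OF l(1) w] by (simp add: \<alpha>_def)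
    have b': "(x w * z w) ^ e' * \<beta> = w $ 3 ^ d * pev p' (x w) (b w)" using p'[OF g] ev_eq[OF l(2) w] by (simp add: \<beta>_def)
    have "w $ 3 ^ d * (\<alpha> * evalp (Y ^ e * Z ^ J' * D) (x w))
       = w $ 3 ^ d * (((x w * z w) ^ e * \<alpha>) * z w ^ J' * (pev p' (x w) (b w) * evalpp Gs (x w) (b w)))"
      by (simp add: Y[OF g] z_eq_Z[OF g] D(2)[OF g, symmetric] mult_ac)
    also have "\<dots> = ((x w * z w) ^ e * \<alpha>) * z w ^ J' * evalpp Gs (x w) (b w) * (w $ 3 ^ d * pev p' (x w) (b w))"
      by (simp only: mult_ac)
    also have "\<dots> = w $ 3 ^ d * ((x w * z w) ^ e' * \<beta> * (z w ^ J' * (evalpp G (x w) (b w) * evalpp Gs (x w) (b w))))"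
      unfolding a b'[symmetric] G by (simp only: mult_ac)
    also have "\<dots> = w $ 3 ^ d * (\<beta> * pev (\<lambda>k. Y ^ e' * r k) (x w) (b w))"
      unfolding pev_smult_all r[OF g, symmetric] evalpp_mult evalp_power Y[OF g] by (simp only: mult_ac)
    finally have "\<alpha> * evalp (Y ^ e * Z ^ J' * D) (x w) = \<beta> * pev (\<lambda>k. Y ^ e' * r k) (x w) (b w)"
      using nz by simp
    then show ?thesis unfolding ab(1) using ab(2)
      by (metis nonzero_mult_div_cancel_left times_divide_eq_left)
  qed
  moreover have "Y ^ e * Z ^ J' * D \<noteq> 0" using D0 Z_nz by (simp add: Y_def)
  ultimately show ?thesis by blast
qed

section \<open>Degree bounds from the orders at the coordinate points\<close>

text \<open>The number of exponents \<open>t\<close> for which \<open>x ^ t * kmon q k\<close> has a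
  pole of order at most \<open>N * l\<close> at \<open>E 1\<close>. For \<open>k > 0\<close> the
  bound involves \<open>(q - 1) * k / N\<close> rounded up, which is its floor plus one.\<close>

definition dimk :: "nat \<Rightarrow> nat \<Rightarrow> nat" where
  "dimk l k = (if k = 0 then l + 1 else l - 1 + q * k div N - (q - 1) * k div N)"

lemma subdegree_sum_ge:
  fixes t :: "'i \<Rightarrow> 'k fls"
  assumes "\<And>i. i \<in> I \<Longrightarrow> t i \<noteq> 0 \<Longrightarrow> fls_subdegree (t i) \<ge> M" "sum t I \<noteq> 0"
  shows "fls_subdegree (sum t I) \<ge> M"
proof (rule fls_subdegree_geI[OF assms(2)])
  fix n assume n: "n < M"
  have "fls_nth (t i) n = 0" if "i \<in> I" for i
    using assms(1)[OF that] n by (cases "t i = 0") auto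
  then show "fls_nth (sum t I) n = 0" by (simp add: fls_nth_sum)
qed

lemma E_term_bound:
  assumes "fls_subdegree (pev p (x (E i)) (b (E i))) \<ge> M" "k < N" "p k \<noteq> 0"
  shows "fls_subdegree (evalp (p k) (x (E i))) + int k * fls_subdegree (b (E i)) \<ge> M"
proof -
  have nz: "evalp (p k) (x (E i)) \<noteq> 0" "b (E i) \<noteq> 0"
    using generic_evalp_nz[OF E_props(2)] assms good_xzb_nz(3)[OF E_props(1)] by auto
  have "M \<le> fls_subdegree (evalp (p k) (x (E i)) * b (E i) ^ k)"
    by (rule subdegree_ge_of_sum[OF _ E_distinct, of _ p i])
      (use assms nz in \<open>auto simp: pev_def\<close>)
  then show ?thesis using nz by (simp add: fls_subdegree_pow)
qed

lemma floor_bound: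
  assumes "int N * A + int n \<ge> int N * B"
  shows "B \<le> A + int (n div N)"
proof (rule ccontr)
  assume "\<not> ?thesis"
  then have "A + int (n div N) + 1 \<le> B" by simp
  then have "int N * (A + int (n div N) + 1) \<le> int N * B" by (rule mult_left_mono) simp
  moreover have "int n = int N * int (n div N) + int (n mod N)"
    by (metis mult_div_mod_eq of_nat_add of_nat_mult)
  moreover have "n mod N < N" using N_pos by simp
  ultimately show False using assms by (simp add: algebra_simps)
qed

lemma coprime_N_q1: "coprime N (q - 1)"
proof (rule coprimeI)
  fix d assume d: "d dvd N" "d dvd q - 1"
  then have "d dvd q * (q - 1)" by simp
  then show "is_unit d" using d(1) unfolding N_eq by (metis dvd_add_right_iff)
qed

lemma q1_mod_N: "0 < k \<Longrightarrow> k < N \<Longrightarrow> (q - 1) * k mod N > 0"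
proof -
  assume k: "0 < k" "k < N"
  have "\<not> N dvd (q - 1) * k"
    using coprime_N_q1 k by (auto simp: coprime_dvd_mult_right_iff dest: dvd_imp_le)
  then show ?thesis by (simp add: dvd_eq_mod_eq_0)
qed

text \<open>For \<open>0 < k < N\<close> the number \<open>(q - 1) * k\<close> is not divisible by
  \<open>N\<close>, so replacing it by a multiple of \<open>N\<close> makes the inequality strict;
  this gains the last unit.\<close>

lemma term_degree_bound:
  assumes "k < N" "int N * (int t + (if k = 0 then 0 else 1) - int (q * k div N)) + int k * (int q - 1) \<le> int N * int l"
  shows "t < dimk l k"
proof (cases "k = 0")
  case True
  then show ?thesis using assms N_pos by (simp add: dimk_def)
next
  case False
  define m' where "m' = (q - 1) * k div N"
  have "int k * (int q - 1) = int ((q - 1) * k)" using q_gt_2 by (simp add: of_nat_diff)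
  also have "\<dots> = int N * int m' + int ((q - 1) * k mod N)"
    unfolding m'_def by (metis mult_div_mod_eq of_nat_add of_nat_mult)
  finally have "int k * (int q - 1) > int N * int m'" using q1_mod_N[of k] False assms(1) by simp
  then have "int N * (int t + 1 - int (q * k div N) + int m') < int N * int l"
    using assms False by (simp add: algebra_simps)
  then have "int t + 1 - int (q * k div N) + int m' < int l" by (rule mult_left_less_imp_less) simp
  then show ?thesis using False by (simp add: dimk_def m'_def)
qed

lemma dimk_bound:
  assumes "k < N" "t < dimk l k" "l > 0"
  shows "int N * (int t + (if k = 0 then 0 else 1) - int (q * k div N)) + int k * (int q - 1) \<le> int N * int l"
proof (cases "k = 0")
  case True
  then show ?thesis using assms by (simp add: dimk_def)
next
  case False
  define m' where "m' = (q - 1) * k div N"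
  have "int k * (int q - 1) = int ((q - 1) * k)" using q_gt_2 by (simp add: of_nat_diff)
  also have "\<dots> = int N * int m' + int ((q - 1) * k mod N)"
    unfolding m'_def by (metis mult_div_mod_eq of_nat_add of_nat_mult)
  also have "\<dots> \<le> int N * (int m' + 1)" using N_pos by (simp add: algebra_simps order.strict_implies_order)
  finally have 1: "int k * (int q - 1) \<le> int N * (int m' + 1)" .
  have "int t + 1 - int (q * k div N) + (int m' + 1) \<le> int l"
    using assms False by (simp add: dimk_def m'_def)
  then have "int N * (int t + 1 - int (q * k div N) + (int m' + 1)) \<le> int N * int l"
    by (rule mult_left_mono) simp
  then show ?thesis using 1 False by (simp add: algebra_simps)
qed

lemma kmon_mult: "kmon q k w = x w powi (- int (q * k div N)) * z w ^ (if k = 0 then 0 else 1) * b w ^ k"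
  by (simp add: kmon_def N_def)

lemma qk_div_lt: "k < N \<Longrightarrow> q * k div N < q"
proof -
  assume "k < N"
  then have "q * k < q * N" using q_gt_2 by simp
  then show ?thesis by (simp add: less_mult_imp_div_less)
qed

lemma E_x_minus:
  assumes cc: "cc \<noteq> 0" "poly Z cc \<noteq> 0"
  shows "fls_subdegree (x (E 1) - fls_const cc) = - int N" "fls_subdegree (x (E 2) - fls_const cc) = 0"
    "fls_subdegree (x (E 3) - fls_const cc) = 0"
proof -
  show x3: "fls_subdegree (x (E 3) - fls_const cc) = 0"
  proof -
    have "has_residue (x (E 3) - fls_const cc) (0 - cc)"
      by (intro has_residue_diff has_residue_const has_residueI_pos) (use E_subdegree_xzb N_pos in auto)
    then show ?thesis using has_residue_nz cc by fastforce
  qed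
  show x2: "fls_subdegree (x (E 2) - fls_const cc) = 0"
  proof -
    have "has_residue ((x (E 2) - fls_const d2) + fls_const (d2 - cc)) (0 + (d2 - cc))"
      by (intro has_residue_add has_residue_const has_residueI_pos) (use E2_x_d2 N_pos in auto)
    moreover have "d2 - cc \<noteq> 0" using cc Z_root by auto
    ultimately show ?thesis using has_residue_nz(2) by (fastforce simp: fls_minus_const[symmetric])
  qed
  show x1: "fls_subdegree (x (E 1) - fls_const cc) = - int N"
  proof -
    have "x (E 1) \<noteq> 0" using good_xzb_nz E_props(1) by blast
    then show ?thesis
      using E_subdegree_xzb N_pos by (subst fls_subdegree_diff_eq1) auto
  qed
qed

text \<open>The factor \<open>(x - cc) ^ l\<close> removes the allowed poles, so the coefficients
  become polynomials up to powers of \<open>x\<close> and \<open>z\<close>. The orders at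
  \<open>E 3\<close>, \<open>E 2\<close> and \<open>E 1\<close> then bound, for each term
  separately, the order at 0, the order at \<open>d2\<close> and the degree of the
  coefficient.\<close>

theorem rr_upper:
  assumes f: "f \<in> carrier K" "f \<noteq> \<zero>\<^bsub>K\<^esub>" and cc: "cc \<noteq> 0" "poly Z cc \<noteq> 0"
    and axes: "\<And>i. fls_subdegree (fv (E i) f) \<ge> 0"
    and reg: "\<And>d y. d \<noteq> 0 \<Longrightarrow> poly Z d \<noteq> 0 \<Longrightarrow> y \<in> fiber d \<Longrightarrow>
       fls_subdegree (fv (expn 3 (pt d y)) f) \<ge> (if d = cc then - int l else 0)"
  shows "\<exists>p. (\<forall>k<N. \<forall>j\<ge>dimk l k. coeff (p k) j = 0) \<and>
     (\<forall>w. generic w \<longrightarrow> fv w f * (x w - fls_const cc) ^ l = (\<Sum>k<N. evalp (p k) (x w) * kmon q k w))"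
proof -
  define g where "g w = fv w f * (x w - fls_const cc) ^ l" for w
  have fnz: "fv w f \<noteq> 0" if "generic w" for w using fv_eq_0_iff[OF f(1) that] f(2) by blast
  have gsub: "fls_subdegree (g w) = fls_subdegree (fv w f) + int l * fls_subdegree (x w - fls_const cc)" if "generic w" for w
    using fnz[OF that] generic_x_minus[OF that] by (simp add: g_def fls_subdegree_pow)
  have gnz: "g w \<noteq> 0" if "generic w" for w using fnz[OF that] generic_x_minus[OF that] by (simp add: g_def)
  obtain D p0 where D: "D \<noteq> 0" "\<And>w. generic w \<Longrightarrow> fv w f * evalp D (x w) = pev p0 (x w) (b w)"
    using rational_form[OF f(1)] by blast
  have "\<exists>e1 e2 p. \<forall>w. generic w \<longrightarrow> g w * x w ^ e1 * z w ^ e2 = pev p (x w) (b w)"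
  proof (rule remove_denominator[OF _ D(1)])
    fix w assume "generic w"
    then show "g w * x w ^ 0 * z w ^ 0 * evalp D (x w) = pev (\<lambda>k. [:-cc, 1:] ^ l * p0 k) (x w) (b w)"
      unfolding pev_smult_all D(2)[OF \<open>generic w\<close>, symmetric] by (simp add: g_def)
  next
    fix d y assume d: "d \<noteq> 0" "poly Z d \<noteq> 0" "y \<in> fiber d"
    note pt = pt_props[OF d]
    define w where "w = expn 3 (pt d y)"
    have w: "generic w" unfolding w_def by (rule generic_expn) (use pt in auto)
    have r: "has_residue (x w) d" unfolding w_def using expn3_residues(1)[OF pt(2,3)] pt by simp
    have "fls_subdegree (g w) \<ge> 0"
    proof (cases "d = cc")
      case True
      have "has_residue (x w - fls_const cc) (d - cc)" by (intro has_residue_diff r has_residue_const)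
      then have "fls_subdegree (x w - fls_const cc) \<ge> 1"
        using has_residue_0_pos generic_x_minus[OF w] True by fastforce
      then have "int l * 1 \<le> int l * fls_subdegree (x w - fls_const cc)" by (rule mult_left_mono) simp
      then show ?thesis using gsub[OF w] reg[OF d] True by (simp add: w_def)
    next
      case False
      have "has_residue (x w - fls_const cc) (d - cc)" by (intro has_residue_diff r has_residue_const)
      then have "fls_subdegree (x w - fls_const cc) = 0" using has_residue_nz(2) False by fastforce
      then show ?thesis using gsub[OF w] reg[OF d] False by (simp add: w_def)
    qed
    then show "fls_subdegree (g (expn 3 (pt d y))) \<ge> 0" by (simp add: w_def)
  qed
  then obtain e0 e2 p1 where p1: "\<And>w. generic w \<Longrightarrow> g w * x w ^ e0 * z w ^ e2 = pev p1 (x w) (b w)" by blast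
  \<comment> \<open>The extra \<open>q\<close> exceeds every \<open>q * k div N\<close> with
    \<open>k < N\<close>, so the truncated difference \<open>e1 - q * k div N\<close> is a true
    one.\<close>
  define e1 where "e1 = e0 + q"
  define p where "p k = [:0, 1:] ^ q * p1 k" for k
  have p: "g w * x w ^ e1 * z w ^ e2 = pev p (x w) (b w)" if "generic w" for w
    unfolding p_def pev_smult_all p1[OF that, symmetric] by (simp add: e1_def power_add)
  have sub: "fls_subdegree (pev p (x (E i)) (b (E i))) = fls_subdegree (fv (E i) f)
     + int l * fls_subdegree (x (E i) - fls_const cc) + int e1 * fls_subdegree (x (E i)) + int e2 * fls_subdegree (z (E i))" for i
    unfolding p[OF E_props(2), symmetric] using gnz[OF E_props(2)] good_xzb_nz[OF E_props(1)]
    by (simp add: fls_subdegree_pow gsub[OF E_props(2)])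
  note x3 = E_x_minus(3)[OF cc] and x2 = E_x_minus(2)[OF cc] and x1 = E_x_minus(1)[OF cc]
  have ex: "\<exists>t. (\<forall>j\<ge>dimk l k. coeff t j = 0) \<and>
     p k = [:0, 1:] ^ (e1 - q * k div N) * (Z ^ (e2 + (if k = 0 then 0 else 1)) * t)" if k: "k < N" for k
  proof (cases "p k = 0")
    case True
    then show ?thesis by (intro exI[of _ 0]) simp
  next
    case False
    define m where "m = q * k div N"
    define n :: nat where "n = (if k = 0 then 0 else 1)"
    have mq: "m < q" using qk_div_lt[OF k] by (simp add: m_def)
    have "int N * int (order 0 (p k)) + int (q * k) \<ge> int N * int e1"
      using E_term_bound[where p = p and i = 3 and k = k, OF order_refl k False] sub[of 3] axes[of 3] x3 E_evalp(1)[OF False] E_subdegree_xzb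
      by (simp add: algebra_simps)
    then have o0: "e1 - m \<le> order 0 (p k)" using floor_bound m_def by fastforce
    have o2': "int N * int (order d2 (p k)) \<ge> int N * int e2 + int k"
      using E_term_bound[where p = p and i = 2 and k = k, OF order_refl k False] sub[of 2] axes[of 2] x2 E_evalp(2)[OF False] E_subdegree_xzb
      by (simp add: algebra_simps)
    \<comment> \<open>The simple pole of \<open>b\<close> at \<open>E 2\<close> contributes
      \<open>k\<close>; for \<open>0 < k < N\<close> rounding up to a multiple of \<open>N\<close>
      costs exactly one further factor \<open>Z\<close>, the one contained in
      \<open>kmon\<close>.\<close>
    have o2: "e2 + n \<le> order d2 (p k)"
    proof -
      have "int N * int e2 \<le> int N * int (order d2 (p k))" using o2' by linarith
      then have "e2 \<le> order d2 (p k)" using N_pos by simp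
      moreover have "e2 \<noteq> order d2 (p k)" if "k \<noteq> 0" using o2' that by auto
      ultimately show ?thesis by (auto simp: n_def)
    qed
    have d1: "int N * int (degree (p k)) + int k * (int q - 1) \<le> int N * (int l + int e1 + int e2)"
      using E_term_bound[where p = p and i = 1 and k = k, OF order_refl k False] sub[of 1] axes[of 1] x1 E_evalp(3)[OF False] E_subdegree_xzb
      by (simp add: algebra_simps)
    have "[:0, 1:] ^ (e1 - m) dvd p k" using o0 order_divides[of 0 "e1 - m" "p k"] unfolding minus_zero by blast
    then obtain s where s: "p k = [:0, 1:] ^ (e1 - m) * s" by (elim dvdE)
    have s0: "s \<noteq> 0" using s False by auto
    have "order d2 ([:0, 1:] ^ (e1 - m)) = 0"
      using d2_nz by (intro order_0I) (simp add: poly_power)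
    then have "order d2 s = order d2 (p k)"
      using False unfolding s by (subst order_mult) auto
    then have "[:-d2, 1:] ^ (e2 + n) dvd s" using o2 order_divides[of d2] by simp
    then obtain t' where t': "s = [:-d2, 1:] ^ (e2 + n) * t'" by (elim dvdE)
    define \<kappa> where "\<kappa> = - (c 1 / c 3)"
    have \<kappa>: "\<kappa> \<noteq> 0" using c_nz by (simp add: \<kappa>_def)
    define t where "t = smult (1 / \<kappa> ^ (e2 + n)) t'"
    have "Z ^ (e2 + n) = smult (\<kappa> ^ (e2 + n)) ([:-d2, 1:] ^ (e2 + n))"
      unfolding Z_alt \<kappa>_def by (rule smult_power)
    then have st: "s = Z ^ (e2 + n) * t" unfolding t_def t' using \<kappa> by simp
    have pk: "p k = [:0, 1:] ^ (e1 - m) * (Z ^ (e2 + n) * t)" using s st by simp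
    have t0: "t \<noteq> 0" using st s0 by auto
    have degZ: "degree Z = 1" using c_nz by (simp add: Z_def)
    have "degree (p k) = (e1 - m) + (e2 + n) + degree t"
      unfolding pk using t0 Z_nz by (simp add: degree_mult_eq degree_power_eq degZ)
    then have dg: "int (degree (p k)) = int e1 - int m + int e2 + int n + int (degree t)"
      using mq by (simp add: e1_def)
    have "int N * (int (degree t) + int n - int m) + int k * (int q - 1) \<le> int N * int l"
      using d1 unfolding dg by (simp add: algebra_simps)
    then have "degree t < dimk l k"
      using term_degree_bound[OF k, of "degree t" l] by (simp add: n_def m_def split: if_splits)
    then have "\<forall>j\<ge>dimk l k. coeff t j = 0" by (auto intro: coeff_eq_0)
    then show ?thesis using pk unfolding m_def n_def by blast
  qed
  then have "\<forall>k. \<exists>t. k < N \<longrightarrow> (\<forall>j\<ge>dimk l k. coeff t j = 0) \<and>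
     p k = [:0, 1:] ^ (e1 - q * k div N) * (Z ^ (e2 + (if k = 0 then 0 else 1)) * t)" by blast
  then obtain t where "\<forall>k. k < N \<longrightarrow> (\<forall>j\<ge>dimk l k. coeff (t k) j = 0) \<and>
     p k = [:0, 1:] ^ (e1 - q * k div N) * (Z ^ (e2 + (if k = 0 then 0 else 1)) * t k)"
    using choice[of "\<lambda>k t. k < N \<longrightarrow> (\<forall>j\<ge>dimk l k. coeff t j = 0) \<and>
     p k = [:0, 1:] ^ (e1 - q * k div N) * (Z ^ (e2 + (if k = 0 then 0 else 1)) * t)"] by blast
  then have t: "\<And>k j. k < N \<Longrightarrow> j \<ge> dimk l k \<Longrightarrow> coeff (t k) j = 0"
     "\<And>k. k < N \<Longrightarrow> p k = [:0, 1:] ^ (e1 - q * k div N) * (Z ^ (e2 + (if k = 0 then 0 else 1)) * t k)" by blast+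
  have "g w = (\<Sum>k<N. evalp (t k) (x w) * kmon q k w)" if w: "generic w" for w
  proof -
    note nz = good_xzb_nz[OF generic_good[OF w]] and zZ = z_eq_Z[OF generic_good[OF w]]
    have "evalp (p k) (x w) * b w ^ k = x w ^ e1 * z w ^ e2 * (evalp (t k) (x w) * kmon q k w)" if k: "k < N" for k
    proof -
      have "q * k div N \<le> e1" using qk_div_lt[OF k] by (simp add: e1_def)
      then have "x w ^ (e1 - q * k div N) = x w ^ e1 * x w powi (- int (q * k div N))"
        using nz by (simp add: power_diff power_int_minus divide_inverse)
      then show ?thesis
        unfolding t(2)[OF k] kmon_mult by (simp add: zZ power_add mult_ac)
    qed
    then have "pev p (x w) (b w) = x w ^ e1 * z w ^ e2 * (\<Sum>k<N. evalp (t k) (x w) * kmon q k w)"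
      unfolding pev_def sum_distrib_left by (intro sum.cong) auto
    then have "x w ^ e1 * z w ^ e2 * g w = x w ^ e1 * z w ^ e2 * (\<Sum>k<N. evalp (t k) (x w) * kmon q k w)"
      using p[OF w] by (simp add: mult_ac)
    then show ?thesis using nz by simp
  qed
  then show ?thesis using t(1) by (intro exI[of _ t]) (simp add: g_def)
qed

text \<open>The zeros are counted, fiber by fiber, as zeros of the norm to \<open>K(x)\<close>.\<close>

theorem zero_count:
  assumes p: "\<And>k j. k < N \<Longrightarrow> j \<ge> dimk l k \<Longrightarrow> coeff (p k) j = 0" and nz: "k1 < N" "p k1 \<noteq> 0" and "l > 0"
    and S: "finite S" "\<And>d y. (d, y) \<in> S \<Longrightarrow> d \<noteq> 0 \<and> poly Z d \<noteq> 0 \<and> y \<in> fiber d \<and>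
       (\<Sum>k<N. poly (p k) d * kmon q k (pt d y)) = 0"
  shows "card S \<le> l * N"
proof -
  \<comment> \<open>The factor \<open>x ^ q\<close> makes all negative powers of \<open>x\<close> in
    \<open>kmon\<close> polynomial; its zeros lie over 0 only and are subtracted at the end.\<close>
  define P where "P k = [:0, 1:] ^ (q - q * k div N) * (Z ^ (if k = 0 then 0 else 1) * p k)" for k
  have Pnz: "P k \<noteq> 0" if "p k \<noteq> 0" for k using that Z_nz by (simp add: P_def)
  have degp: "degree (p k) < dimk l k" if "k < N" "p k \<noteq> 0" for k
    using p that by (metis leading_coeff_0_iff linorder_not_less)
  obtain D J where D: "\<And>w. good w \<Longrightarrow> z w ^ J * (\<Prod>u\<in>mu. pev P (x w) (fls_const u * b w)) = evalp D (x w)"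
    using norm_form[of P] by blast
  have D0: "D \<noteq> 0" using norm_form_nz[OF nz(1) Pnz[OF nz(2)] D] .
  have tw_nz: "pev P (x w) (fls_const u * b w) \<noteq> 0" if "generic w" "u \<in> mu" for w u
    unfolding pev_twist using pev_generic_nonzero[OF nz(1) _ that(1), of "\<lambda>k. smult (u ^ k) (P k)"]
      Pnz[OF nz(2)] mu_nz[OF that(2)] by simp
  have Dsub: "fls_subdegree (evalp D (x w)) = int J * fls_subdegree (z w)
      + (\<Sum>u\<in>mu. fls_subdegree (pev P (x w) (fls_const u * b w)))" if w: "generic w" for w
  proof -
    have prod: "fls_subdegree (\<Prod>u\<in>A. t u) = (\<Sum>u\<in>A. fls_subdegree (t u))"
      if "finite A" "\<And>u. u \<in> A \<Longrightarrow> t u \<noteq> 0" for A and t :: "'k \<Rightarrow> 'k fls"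
      using that by (induction A rule: finite_induct) (auto simp: prod_zero_iff)
    have "(\<Prod>u\<in>mu. pev P (x w) (fls_const u * b w)) \<noteq> 0"
      using tw_nz[OF w] finite_mu by (simp add: prod_zero_iff)
    then show ?thesis
      unfolding D[OF generic_good[OF w], symmetric]
      using good_xzb_nz[OF generic_good[OF w]] tw_nz[OF w] finite_mu
      by (simp add: fls_subdegree_pow prod)
  qed
  have tw_bound: "fls_subdegree (pev P (x (E i)) (fls_const u * b (E i))) \<ge> M"
    if u: "u \<in> mu" and M: "\<And>k. k < N \<Longrightarrow> p k \<noteq> 0 \<Longrightarrow>
       fls_subdegree (evalp (P k) (x (E i))) + int k * fls_subdegree (b (E i)) \<ge> M" for u i M
    unfolding pev_def
  proof (rule subdegree_sum_ge)
    fix k assume k: "k \<in> {..<N}" "evalp (P k) (x (E i)) * (fls_const u * b (E i)) ^ k \<noteq> 0"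
    then have "p k \<noteq> 0" by (auto simp: P_def)
    moreover have "fls_subdegree (evalp (P k) (x (E i)) * (fls_const u * b (E i)) ^ k)
       = fls_subdegree (evalp (P k) (x (E i))) + int k * fls_subdegree (b (E i))"
      using k mu_nz[OF u] good_xzb_nz(3)[OF E_props(1)[of i]] by (simp add: fls_subdegree_pow)
    ultimately show "M \<le> fls_subdegree (evalp (P k) (x (E i)) * (fls_const u * b (E i)) ^ k)"
      using M k by simp
  qed (use tw_nz[OF E_props(2) u] in \<open>simp add: pev_def\<close>)
  have Psub: "fls_subdegree (evalp (P k) (x (E i))) = int (q - q * k div N) * fls_subdegree (x (E i))
     + (if k = 0 then 0 else fls_subdegree (z (E i))) + fls_subdegree (evalp (p k) (x (E i)))"
    if "p k \<noteq> 0" for k i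
    using generic_evalp_nz[OF E_props(2) that, of i] good_xzb_nz[OF E_props(1)[of i]]
    by (simp add: P_def fls_subdegree_pow z_eq_Z[OF E_props(1), symmetric])
  have qdiff: "int (q - q * k div N) = int q - int (q * k div N)" if "k < N" for k
    using qk_div_lt[OF that] by (simp add: of_nat_diff)
  have B3: "fls_subdegree (pev P (x (E 3)) (fls_const u * b (E 3))) \<ge> int N * int q" if "u \<in> mu" for u
  proof (rule tw_bound[OF that])
    fix k assume k: "k < N" "p k \<noteq> 0"
    define o3 where "o3 = int N * int (order 0 (p k))"
    have o3: "o3 \<ge> 0" by (simp add: o3_def)
    have "int N * int (q * k div N) \<le> int (q * k)"
      by (metis of_nat_mono of_nat_mult div_times_less_eq_dividend mult.commute)
    with o3 show "int N * int q \<le> fls_subdegree (evalp (P k) (x (E 3))) + int k * fls_subdegree (b (E 3))"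
      unfolding Psub[OF k(2)] E_evalp(1)[OF k(2), folded o3_def] E_subdegree_xzb qdiff[OF k(1)]
      by (simp add: algebra_simps)
  qed
  have B2: "fls_subdegree (pev P (x (E 2)) (fls_const u * b (E 2))) \<ge> 0" if "u \<in> mu" for u
  proof (rule tw_bound[OF that])
    fix k assume k: "k < N" "p k \<noteq> 0"
    define o2 where "o2 = int N * int (order d2 (p k))"
    have "o2 \<ge> 0" by (simp add: o2_def)
    then show "0 \<le> fls_subdegree (evalp (P k) (x (E 2))) + int k * fls_subdegree (b (E 2))"
      unfolding Psub[OF k(2)] E_evalp(2)[OF k(2), folded o2_def] E_subdegree_xzb using k(1) by simp
  qed
  have B1: "fls_subdegree (pev P (x (E 1)) (fls_const u * b (E 1))) \<ge> - (int N * (int q + int l))" if "u \<in> mu" for u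
  proof (rule tw_bound[OF that])
    fix k assume k: "k < N" "p k \<noteq> 0"
    show "- (int N * (int q + int l)) \<le> fls_subdegree (evalp (P k) (x (E 1))) + int k * fls_subdegree (b (E 1))"
      unfolding Psub[OF k(2)] E_evalp(3)[OF k(2)] E_subdegree_xzb qdiff[OF k(1)]
      using dimk_bound[OF k(1) degp[OF k] \<open>l > 0\<close>]
      by (simp add: algebra_simps split: if_splits)
  qed
  have sum_ge: "int N * M \<le> (\<Sum>u\<in>mu. F u)" if "\<And>u. u \<in> mu \<Longrightarrow> M \<le> F u" for F :: "'k \<Rightarrow> int" and M
    using sum_bounded_below[of mu M F] that by (simp add: card_mu)
  \<comment> \<open>Of the degree of \<open>D\<close>, at most \<open>J + N * (q + l)\<close>, the
    parts \<open>N * q\<close> at 0 and \<open>J\<close> at \<open>d2\<close> are artefacts of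
    clearing denominators. What is left for the other fibers is \<open>N * l\<close>.\<close>
  have o3: "int (order 0 D) \<ge> int N * int q"
  proof -
    have "int N * int (order 0 D) \<ge> int N * (int N * int q)"
      using Dsub[OF E_props(2), of 3] E_evalp(1)[OF D0] E_subdegree_xzb sum_ge[OF B3] by simp
    then show ?thesis using N_pos by simp
  qed
  have o2: "order d2 D \<ge> J"
  proof -
    have "int N * int (order d2 D) \<ge> int N * int J"
      using Dsub[OF E_props(2), of 2] E_evalp(2)[OF D0] E_subdegree_xzb sum_ge[OF B2] by (simp add: mult.commute)
    then show ?thesis using N_pos by simp
  qed
  have deg: "int (degree D) \<le> int J + int N * (int q + int l)"
  proof -
    have "int N * - (int N * (int q + int l)) \<le> (\<Sum>u\<in>mu. fls_subdegree (pev P (x (E 1)) (fls_const u * b (E 1))))"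
      by (rule sum_ge) (rule B1)
    then have "int N * int (degree D) \<le> int N * (int J + int N * (int q + int l))"
      using Dsub[OF E_props(2), of 1] unfolding E_evalp(3)[OF D0] E_subdegree_xzb by (simp add: algebra_simps)
    then show ?thesis using N_pos by simp
  qed
  define R where "R = fst ` S"
  have R: "finite R" "d \<in> R \<Longrightarrow> d \<noteq> 0 \<and> poly Z d \<noteq> 0" for d
    using S(1) S(2) unfolding R_def by (blast, auto simp del: Z_root)
  have fib: "card {y. (d, y) \<in> S} \<le> order d D" if dR: "d \<in> R" for d
  proof -
    have d: "d \<noteq> 0" "poly Z d \<noteq> 0" using R dR by auto
    obtain y1 where "(d, y1) \<in> S" using dR unfolding R_def by auto
    then have "\<exists>y. y \<in> fiber d" using S(2) by blast
    then obtain y0 where y0: "y0 \<in> fiber d" by blast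
    note pt = pt_props[OF d y0]
    define w where "w = expn 3 (pt d y0)"
    have w: "generic w" unfolding w_def by (rule generic_expn) (use pt in auto)
    have res: "has_residue (x w) d" "has_residue (z w) (poly Z d)" "has_residue (b w) y0"
      unfolding w_def using expn3_residues[OF pt(2,3)] pt by auto
    have "fls_subdegree (x w - fls_const d) = 1" using unramified[OF pt(2,3)] pt by (simp add: w_def)
    then have ord: "fls_subdegree (evalp D (x w)) = int (order d D)"
      using evalp_subdegree_order[OF D0] by fastforce
    have zsub: "fls_subdegree (z w) = 0" using has_residue_nz[OF res(2) d(2)] by simp
    \<comment> \<open>All points of the fiber are handled by expansions at a single one: a zero at
      the point with \<open>b\<close>-coordinate \<open>u * y0\<close> shows up as a zero of the
      conjugate belonging to \<open>u\<close>.\<close>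
    define A where "A = {u\<in>mu. u * y0 \<in> {y. (d, y) \<in> S}}"
    have fac: "fls_subdegree (pev P (x w) (fls_const u * b w)) \<ge> (if u \<in> A then 1 else 0)" if u: "u \<in> mu" for u
    proof -
      have r: "has_residue (pev P (x w) (fls_const u * b w)) (\<Sum>k<N. poly (P k) d * (u * y0) ^ k)"
        unfolding pev_def
        by (intro has_residue_sum has_residue_mult has_residue_power res has_residue_evalp has_residue_const)
      show ?thesis
      proof (cases "u \<in> A")
        case True
        then have mem: "(d, u * y0) \<in> S" by (simp add: A_def)
        then have y: "u * y0 \<in> fiber d" using S(2) by blast
        note pt' = pt_props[OF d y]
        have "poly (P k) d * (u * y0) ^ k = d ^ q * (poly (p k) d * kmon q k (pt d (u * y0)))" if "k < N" for k
        proof -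
          have "d ^ (q - q * k div N) = d ^ q * d powi (- int (q * k div N))"
            using d qk_div_lt[OF that] by (simp add: power_diff power_int_minus divide_inverse)
          then show ?thesis unfolding kmon_mult pt' by (simp add: P_def)
        qed
        then have "(\<Sum>k<N. poly (P k) d * (u * y0) ^ k) = d ^ q * (\<Sum>k<N. poly (p k) d * kmon q k (pt d (u * y0)))"
          by (simp add: sum_distrib_left)
        also have "\<dots> = 0" using S(2)[OF mem] by simp
        finally have "has_residue (pev P (x w) (fls_const u * b w)) 0" using r by simp
        then show ?thesis using has_residue_0_pos tw_nz[OF w u] True by fastforce
      qed (use has_residue_subdegree_nonneg[OF r] in simp)
    qed
    have y00: "y0 \<noteq> 0" using pt by simp
    have "{y. (d, y) \<in> S} = (\<lambda>u. u * y0) ` A"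
    proof (intro equalityI subsetI)
      fix y assume "y \<in> {y. (d, y) \<in> S}"
      then have "y \<in> fiber d" "(d, y) \<in> S" using S(2) by auto
      then have "y / y0 \<in> mu" using y0 d by (simp add: fiber_def mu_def power_divide)
      then have "y / y0 \<in> A" "y = (y / y0) * y0" using \<open>(d, y) \<in> S\<close> y00 by (auto simp: A_def)
      then show "y \<in> (\<lambda>u. u * y0) ` A" by blast
    qed (auto simp: A_def)
    moreover have "finite A" using finite_mu by (simp add: A_def)
    ultimately have "card {y. (d, y) \<in> S} \<le> card A" using card_image_le by metis
    also have "int (card A) = (\<Sum>u\<in>mu. if u \<in> A then 1 else 0)"
    proof -
      have "(\<Sum>u\<in>mu. if u \<in> A then 1 else 0) = (\<Sum>u\<in>mu \<inter> A. (1::int))"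
        by (rule sum.inter_restrict[symmetric, OF finite_mu])
      moreover have "mu \<inter> A = A" by (auto simp: A_def)
      ultimately show ?thesis by simp
    qed
    also have "\<dots> \<le> (\<Sum>u\<in>mu. fls_subdegree (pev P (x w) (fls_const u * b w)))"
      by (rule sum_mono) (rule fac)
    also have "\<dots> = int (order d D)" using Dsub[OF w] ord zsub by simp
    finally show ?thesis by simp
  qed
  have "S = Sigma R (\<lambda>d. {y. (d, y) \<in> S})" unfolding R_def by force
  then have "card S = (\<Sum>d\<in>R. card {y. (d, y) \<in> S})"
  proof -
    have "finite {y. (d, y) \<in> S}" for d
      by (rule finite_subset[OF _ finite_imageI[OF S(1), of snd]]) force
    then have "card (Sigma R (\<lambda>d. {y. (d, y) \<in> S})) = (\<Sum>d\<in>R. card {y. (d, y) \<in> S})"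
      using R(1) by (intro card_SigmaI) auto
    then show ?thesis using \<open>S = _\<close> by simp
  qed
  also have "\<dots> \<le> (\<Sum>d\<in>R. order d D)" by (rule sum_mono) (rule fib)
  finally have 1: "card S \<le> (\<Sum>d\<in>R. order d D)" .
  have "(\<Sum>d\<in>insert 0 (insert d2 R). order d D) \<le> degree D"
  proof -
    have fin: "finite (insert 0 (insert d2 R))" using R by simp
    have "(\<Sum>d\<in>insert 0 (insert d2 R). order d D) = (\<Sum>d\<in>insert 0 (insert d2 R). count (proots D) d)"
      using D0 by simp
    also have "\<dots> \<le> (\<Sum>d\<in>insert 0 (insert d2 R) \<union> set_mset (proots D). count (proots D) d)"
      using fin by (intro sum_mono2) auto
    also have "\<dots> = (\<Sum>d\<in>set_mset (proots D). count (proots D) d)"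
      using fin by (intro sum.mono_neutral_right) (auto simp: not_in_iff)
    also have "\<dots> = size (proots D)" by (simp add: size_multiset_overloaded_eq)
    also have "\<dots> \<le> degree D" by (rule size_proots_le)
    finally show ?thesis .
  qed
  moreover have "0 \<notin> insert d2 R" "d2 \<notin> R" using R(2) d2_nz Z_root by auto
  ultimately have "order 0 D + order d2 D + (\<Sum>d\<in>R. order d D) \<le> degree D"
    using R(1) by simp
  then have "int (\<Sum>d\<in>R. order d D) \<le> int (degree D) - int (order 0 D) - int (order d2 D)" by linarith
  also have "\<dots> \<le> int N * int l" using deg o3 o2 by (simp add: algebra_simps)
  finally have "(\<Sum>d\<in>R. order d D) \<le> N * l" by (metis of_nat_le_iff of_nat_mult)
  then show ?thesis using 1 by (simp add: mult.commute)
qed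

end

section \<open>Forms over a finite subfield\<close>

definition vec_power :: "nat \<Rightarrow> 'a::field ^ 3 \<Rightarrow> 'a ^ 3" where
  "vec_power m v = (\<chi> i. v $ i ^ m)"

lemma vec_power_nth [simp]: "vec_power m v $ i = v $ i ^ m"
  by (simp add: vec_power_def)

lemma poly_function_eq_0:
  fixes a :: "nat \<Rightarrow> 'a::alg_closed_field"
  assumes "\<And>u. (\<Sum>i\<le>n. a i * u ^ i) = 0" "i \<le> n"
  shows "a i = 0"
proof -
  define p where "p = (\<Sum>i\<le>n. monom (a i) i)"
  have "p = 0"
  proof (rule ccontr)
    assume "p \<noteq> 0"
    then have "finite {u. poly p u = 0}" by (rule poly_roots_finite)
    moreover have "{u. poly p u = 0} = UNIV" using assms(1) by (simp add: p_def poly_sum poly_monom)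
    ultimately show False using infinite_UNIV_alg_closed[where 'a = 'a] by simp
  qed
  then have "coeff p i = 0" by simp
  then show ?thesis using assms(2) by (simp add: p_def coeff_sum)
qed

lemma sum_triangle:
  "(\<Sum>(i, j)\<in>{(i, j). i + j \<le> (d::nat)}. f i j) = (\<Sum>i\<le>d. \<Sum>j\<le>d - i. f i j)"
proof -
  have "{(i, j). i + j \<le> d} = Sigma {..d} (\<lambda>i. {..d - i})" by auto
  then show ?thesis by (simp add: sum.Sigma)
qed

lemma form_coefficients_unique:
  fixes a :: "nat \<Rightarrow> nat \<Rightarrow> 'a::alg_closed_field"
  assumes "\<And>v :: 'a ^ 3. (\<Sum>(i, j)\<in>{(i, j). i + j \<le> d}. a i j * v $ 1 ^ i * v $ 2 ^ j * v $ 3 ^ (d - i - j)) = 0"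
    and "i + j \<le> d"
  shows "a i j = 0"
proof -
  have 1: "(\<Sum>j\<le>d - i. a i j * t ^ j) = 0" if "i \<le> d" for t i
  proof (rule poly_function_eq_0[OF _ that])
    fix u
    show "(\<Sum>i\<le>d. (\<Sum>j\<le>d - i. a i j * t ^ j) * u ^ i) = 0"
      using assms(1)[of "vector [u, t, 1]"]
      by (simp add: sum_triangle vector_3 sum_distrib_left sum_distrib_right mult_ac)
  qed
  show ?thesis by (rule poly_function_eq_0[OF 1]) (use assms(2) in auto)
qed

text \<open>The coefficients of a form are determined by its values over an infinite field, so
  commuting with the Frobenius map says that each coefficient is fixed by it.\<close>

lemma forms_GF_iff:
  fixes A :: "'a::alg_closed_field ^ 3 \<Rightarrow> 'a"
  assumes p: "prime CHAR('a)" and m: "m = CHAR('a) ^ n"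
  shows "A \<in> forms (GF m) d \<longleftrightarrow> A \<in> forms UNIV d \<and> (\<forall>v. A (vec_power m v) = A v ^ m)"
proof
  have fro: "sum f S ^ m = (\<Sum>s\<in>S. f s ^ m)" for f :: "nat \<times> nat \<Rightarrow> 'a" and S
    by (rule freshmans_dream_sum'[OF p m])
  have expand: "(\<Sum>(i, j)\<in>{(i, j). i + j \<le> d}. a i j * v $ 1 ^ i * v $ 2 ^ j * v $ 3 ^ (d - i - j)) ^ m
     = (\<Sum>(i, j)\<in>{(i, j). i + j \<le> d}. a i j ^ m * vec_power m v $ 1 ^ i * vec_power m v $ 2 ^ j * vec_power m v $ 3 ^ (d - i - j))"
    for a and v :: "'a ^ 3"
    unfolding fro by (simp add: case_prod_unfold power_mult_distrib mult.commute flip: power_mult)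
  {
    assume "A \<in> forms (GF m) d"
    then obtain a where a: "\<And>i j. a i j \<in> GF m"
      "A = (\<lambda>v. \<Sum>(i, j)\<in>{(i, j). i + j \<le> d}. a i j * v $ 1 ^ i * v $ 2 ^ j * v $ 3 ^ (d - i - j))"
      unfolding forms_def by blast
    have "a i j ^ m = a i j" for i j using a(1) by (simp add: GF_def)
    then have "A (vec_power m v) = A v ^ m" for v unfolding a(2) expand by simp
    moreover have "A \<in> forms UNIV d" using a(2) unfolding forms_def by blast
    ultimately show "A \<in> forms UNIV d \<and> (\<forall>v. A (vec_power m v) = A v ^ m)" by blast
  }
  assume A: "A \<in> forms UNIV d \<and> (\<forall>v. A (vec_power m v) = A v ^ m)"
  then obtain a where
    a: "A = (\<lambda>v. \<Sum>(i, j)\<in>{(i, j). i + j \<le> d}. a i j * v $ 1 ^ i * v $ 2 ^ j * v $ 3 ^ (d - i - j))"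
    unfolding forms_def by blast
  have m0: "m > 0" using p m by (simp add: prime_gt_0_nat)
  have "a i j ^ m - a i j = 0" if ij: "i + j \<le> d" for i j
  proof (rule form_coefficients_unique[OF _ ij])
    fix u :: "'a ^ 3"
    have "\<forall>i. \<exists>t. t ^ m = u $ i" using nth_root_exists m0 by blast
    \<comment> \<open>The Frobenius map is surjective on vectors, so the two coefficient families
      may be compared at an arbitrary \<open>u\<close>.\<close>
    then obtain t where t: "\<And>i. t i ^ m = u $ i" by metis
    define v :: "'a ^ 3" where "v = (\<chi> i. t i)"
    have u: "vec_power m v = u" by (simp add: vec_eq_iff v_def t)
    have "A u = A v ^ m" using A u by metis
    then show "(\<Sum>(i, j)\<in>{(i, j). i + j \<le> d}. (a i j ^ m - a i j) * u $ 1 ^ i * u $ 2 ^ j * u $ 3 ^ (d - i - j)) = 0"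
      unfolding a expand u by (simp add: case_prod_unfold sum_subtractf algebra_simps)
  qed
  then have aG: "a i j \<in> GF m" if "i + j \<le> d" for i j using that by (simp add: GF_def)
  \<comment> \<open>\<open>forms\<close> asks for all values of the coefficient function to lie in
    the field, also at indices that do not enter the sum.\<close>
  define a' where "a' i j = (if i + j \<le> d then a i j else 0)" for i j
  have "A = (\<lambda>v. \<Sum>(i, j)\<in>{(i, j). i + j \<le> d}. a' i j * v $ 1 ^ i * v $ 2 ^ j * v $ 3 ^ (d - i - j))"
    unfolding a by (intro ext sum.cong) (auto simp: a'_def)
  moreover have "a' i j \<in> GF m" for i j using aG m0 by (auto simp: a'_def GF_def power_0_left)
  ultimately show "A \<in> forms (GF m) d" unfolding forms_def by blast
qed

lemma proj_map_proj_point: "proj_map M (proj_point v) = proj_point (M *v v)"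
proof -
  have "proj_point v = range (\<lambda>a. a *s v)" for v :: "'a ^ 3"
    using proj_point_iff by blast
  then show ?thesis by (simp add: proj_map_def image_image vector_scalar_commute)
qed

lemma proj_point_scale: "a \<noteq> 0 \<Longrightarrow> proj_point (a *s v) = proj_point v"
proof -
  assume a: "a \<noteq> 0"
  have "u = a *s v \<longleftrightarrow> (1 / a) *s u = v" for u using a by (auto simp: vec_eq_iff field_simps)
  show ?thesis
  proof (intro equalityI subsetI)
    fix u assume "u \<in> proj_point (a *s v)"
    then obtain e where "u = e *s (a *s v)" using proj_point_iff by blast
    then have "u = (e * a) *s v" by simp
    then show "u \<in> proj_point v" using proj_point_iff by blast
  next
    fix u assume "u \<in> proj_point v"
    then obtain e where "u = e *s v" using proj_point_iff by blast
    then have "u = (e / a) *s (a *s v)" using a by (simp add: vec_eq_iff)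
    then show "u \<in> proj_point (a *s v)" using proj_point_iff by blast
  qed
qed

section \<open>The plane \<open>\<Pi>\<close>\<close>

definition gpt :: "nat \<Rightarrow> 'a::field \<Rightarrow> 'a ^ 3" where
  "gpt q g = vector [g, g ^ (q ^ 2 + 1), 1]"

text \<open>Kept for arbitrary \<open>t\<close>, since other members of the family will cut out the
  orbits.\<close>

definition hform :: "nat \<Rightarrow> 'a::field \<Rightarrow> 'a ^ 3 \<Rightarrow> 'a" where
  "hform q t v = t * v $ 1 * v $ 2 ^ q + t ^ (q ^ 2 + 1) * v $ 2 * v $ 3 ^ q + v $ 3 * v $ 1 ^ q"

text \<open>The Frobenius collineation \<open>\<Phi>\<^sub>\<Pi>\<close>.\<close>

definition phi :: "nat \<Rightarrow> 'a::field ^ 3 \<Rightarrow> 'a ^ 3" where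
  "phi q v = vector [v $ 3 ^ (q ^ 2), v $ 1 ^ (q ^ 2), v $ 2 ^ (q ^ 2)]"

lemma phi_nth: "phi q v $ 1 = v $ 3 ^ (q ^ 2)" "phi q v $ 2 = v $ 1 ^ (q ^ 2)" "phi q v $ 3 = v $ 2 ^ (q ^ 2)"
  by (simp_all add: phi_def vector_3)

lemma gpt_nth: "gpt q g $ 1 = g" "gpt q g $ 2 = g ^ (q ^ 2 + 1)" "gpt q g $ 3 = 1"
  by (simp_all add: gpt_def vector_3)

locale singer =
  fixes q :: nat and \<tau> \<beta> :: "'k::alg_closed_field"
  assumes char_prime: "prime CHAR('k)" and q_char_power: "\<exists>m. q = CHAR('k) ^ m" and q2: "q > 2"
    and tau: "\<tau> ^ (q ^ 2 + q + 1) = 1"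
    and beta: "primitive_root_of_unity (q ^ 2 - q + 1) \<beta>"
begin

definition cf :: "3 \<Rightarrow> 'k" where
  "cf i = (if i = 1 then \<tau> else if i = 2 then \<tau> ^ (q ^ 2 + 1) else 1)"

lemma tau_nz: "\<tau> \<noteq> 0" using tau by (auto simp: power_0_left)

sublocale curve q cf
  using char_prime q_char_power q2 tau_nz by unfold_locales (auto simp: cf_def)

lemma cf_simps: "cf 1 = \<tau>" "cf 2 = \<tau> ^ (q ^ 2 + 1)" "cf 3 = 1"
  by (simp_all add: cf_def)

lemma H_hform: "H v = hform q \<tau> v"
  by (simp add: H_expand cf_simps hform_def)

lemma hermitian_curve_CC: "hermitian_curve q \<tau> = CC"
  by (simp add: hermitian_curve_def CC_def H_hform hform_def)

definition M where "M = q ^ 4 + q ^ 2 + 1"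

lemma M_factor: "M = N * (q ^ 2 + q + 1)"
proof -
  have "int M = int N * int (q ^ 2 + q + 1)"
    unfolding int_N M_def by (simp add: algebra_simps power2_eq_square power4_eq_xxxx)
  then show ?thesis by (metis of_nat_eq_iff of_nat_mult)
qed

lemma q6: "q ^ 6 = M * (q ^ 2 - 1) + 1"
proof -
  have "q ^ 2 \<ge> 1" using q2 by simp
  then have "int (M * (q ^ 2 - 1) + 1) = int M * (int q ^ 2 - 1) + 1" by (simp add: of_nat_diff)
  also have "\<dots> = int (q ^ 6)" by (simp add: M_def algebra_simps power_numeral_reduce)
  finally show ?thesis by (metis of_nat_eq_iff)
qed

lemma root_GF: "g ^ M = 1 \<Longrightarrow> g \<in> GF (q ^ 6)" for g :: 'k
  by (simp add: GF_def q6 power_add power_mult)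

lemma Pi_eq: "Pi_plane q = {proj_point (gpt q g :: 'k ^ 3) | g. g ^ M = 1}"
  unfolding Pi_plane_def gpt_def M_def[symmetric] using root_GF by blast

lemma gpt_inj: "proj_point (gpt q g) = proj_point (gpt q g') \<Longrightarrow> g = g'" for g g' :: 'k
proof -
  assume "proj_point (gpt q g) = proj_point (gpt q g')"
  then have "gpt q g \<in> proj_point (gpt q g')" using self_proj_point by metis
  then obtain a where a: "gpt q g = a *s gpt q g'" using proj_point_iff by blast
  then have "gpt q g $ 3 = a * gpt q g' $ 3" "gpt q g $ 1 = a * gpt q g' $ 1" by simp_all
  then show "g = g'" by (simp add: gpt_nth)
qed

lemma exps: "q ^ 2 + 1 = q + N" "q ^ 3 + 1 = (q + 1) * N" "1 + (q ^ 2 + 1) * (q - 1) = q * N"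
proof -
  have "int (q ^ 2 + 1) = int (q + N)" unfolding of_nat_add int_N by (simp add: algebra_simps power2_eq_square)
  then show "q ^ 2 + 1 = q + N" by (metis of_nat_eq_iff)
  have "int (q ^ 3 + 1) = int ((q + 1) * N)"
    unfolding of_nat_mult int_N by (simp add: algebra_simps power_numeral_reduce)
  then show "q ^ 3 + 1 = (q + 1) * N" by (metis of_nat_eq_iff)
  have "int (1 + (q ^ 2 + 1) * (q - 1)) = int (q * N)"
  proof -
    have i: "int (q - 1) = int q - 1" using q2 by simp
    show ?thesis unfolding of_nat_mult of_nat_add int_N i by (simp add: algebra_simps power2_eq_square)
  qed
  then show "1 + (q ^ 2 + 1) * (q - 1) = q * N" by (metis of_nat_eq_iff)
qed

text \<open>Apart from the factor \<open>g ^ q\<close> only \<open>g ^ N\<close> enters, because the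
  Singer group multiplies \<open>g\<close> by \<open>N\<close>-th roots of unity and preserves the
  curve.\<close>

lemma hform_gpt: "hform q t (gpt q g) = g ^ q * (t * (g ^ N) ^ (q + 1) + t ^ (q ^ 2 + 1) * g ^ N + 1)" for g t :: 'k
proof -
  have "1 + (q ^ 2 + 1) * q = q + (q + 1) * N"
    using exps(2) by (simp add: algebra_simps power_numeral_reduce)
  then have "g * (g ^ (q ^ 2 + 1)) ^ q = g ^ q * (g ^ N) ^ (q + 1)"
    by (metis power_add power_mult mult.commute power_one_right)
  moreover have "g ^ (q ^ 2 + 1) = g ^ q * g ^ N" unfolding exps(1) by (simp add: power_add)
  ultimately show ?thesis unfolding hform_def gpt_nth
    by (simp only: power_one mult_1_left mult_1_right distrib_left mult.assoc mult.left_commute[of "g ^ q"])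
qed

lemma gpt_coords: "x (gpt q g) = (g ^ N) ^ q" "b (gpt q g) = g ^ (q ^ 2 + 1)" for g :: 'k
proof -
  have "x (gpt q g) = g ^ (1 + (q ^ 2 + 1) * (q - 1))"
    unfolding x_coord_def gpt_nth by (simp only: power_add power_mult power_one_right power_one div_by_1)
  then show "x (gpt q g) = (g ^ N) ^ q" unfolding exps(3) by (simp add: mult.commute flip: power_mult)
  show "b (gpt q g) = g ^ (q ^ 2 + 1)" unfolding b_coord_def gpt_nth by simp
qed

text \<open>The factor \<open>t\<close> arises because
  \<open>t * (t ^ (q ^ 2 + 1)) ^ (q ^ 2) = t ^ M = 1\<close>. So the equation is rational over \<Pi>
  only after rescaling.\<close>

lemma phi_hform:
  assumes "t ^ (q ^ 2 + q + 1) = (1::'k)"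
  shows "hform q t (phi q v) = t * hform q t v ^ (q ^ 2)"
proof -
  have fro: "(u + v) ^ (q ^ 2) = u ^ (q ^ 2) + v ^ (q ^ 2)" for u v :: 'k
    unfolding power2_eq_square power_mult by (simp add: frobenius_add)
  have "t * (t ^ (q ^ 2 + 1)) ^ (q ^ 2) = t ^ M"
    unfolding M_def by (simp add: power_add algebra_simps power_numeral_reduce flip: power_mult)
  also have "\<dots> = 1" unfolding M_factor mult.commute[of N] power_mult assms by simp
  finally have t: "t * (t ^ (q ^ 2 + 1)) ^ (q ^ 2) = 1" .
  have "t * hform q t v ^ (q ^ 2) = t * t ^ (q ^ 2) * v $ 1 ^ (q ^ 2) * (v $ 2 ^ q) ^ (q ^ 2)
     + (t * (t ^ (q ^ 2 + 1)) ^ (q ^ 2)) * v $ 2 ^ (q ^ 2) * (v $ 3 ^ q) ^ (q ^ 2)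
     + t * v $ 3 ^ (q ^ 2) * (v $ 1 ^ q) ^ (q ^ 2)"
    by (simp only: hform_def fro power_mult_distrib distrib_left mult.assoc)
  also have "\<dots> = hform q t (phi q v)"
    unfolding t hform_def phi_nth
    by (simp add: power_add mult_ac power_commutes flip: power_mult)
  finally show ?thesis by simp
qed

lemma frobenius_Q: "(u + v) ^ (q ^ 2) = u ^ (q ^ 2) + (v ^ (q ^ 2) :: 'k)"
  unfolding power2_eq_square power_mult by (simp add: frobenius_add)

lemma phi_CC: "H v = 0 \<Longrightarrow> H (phi q v) = 0"
  using phi_hform[OF tau, of v] q2 by (simp add: H_hform)

lemma phi_gpt: "g ^ M = 1 \<Longrightarrow> gpt q g = g *s phi q (gpt q g)" for g :: 'k
proof -
  assume g: "g ^ M = 1"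
  have "g * (g ^ (q ^ 2 + 1)) ^ (q ^ 2) = g ^ M"
    unfolding M_def by (simp add: power_add algebra_simps power_numeral_reduce flip: power_mult)
  then show ?thesis using g by (simp add: vec_eq_iff forall_3 phi_nth gpt_nth)
qed

lemma of_nat_M: "of_nat M = (1::'k)"
  by (simp add: M_def of_nat_q)

lemma card_M_roots: "card {g::'k. g ^ M = 1} = M"
  by (rule card_nth_roots) (use of_nat_M in \<open>auto simp: M_def\<close>)

lemma M_root_poly_eq_0:
  fixes p :: "'k poly"
  assumes "\<And>g. g ^ M = 1 \<Longrightarrow> poly p g = 0" "degree p < M"
  shows "p = 0"
  by (rule poly_eqI_degree[where A = "{g. g ^ M = 1}"]) (use assms card_M_roots in auto)

text \<open>Fixing the points of \<Pi> gives polynomial relations in \<open>g\<close> of degree at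
  most \<open>q ^ 2 + 2\<close> with \<open>M\<close> zeros, more than the degree. The exponents 0,
  1, 2, \<open>q ^ 2 + 1\<close>, \<open>q ^ 2 + 2\<close> being distinct, the matrix entries can be
  compared.\<close>

lemma scalar_of_fixing_Pi:
  fixes A :: "'k ^ 3 ^ 3"
  assumes "\<And>g. g ^ M = 1 \<Longrightarrow> \<exists>\<kappa>. A *v gpt q g = \<kappa> *s gpt q g"
  shows "\<exists>\<rho>. \<forall>v. A *v v = \<rho> *s v"
proof -
  have A: "(A *v gpt q g) $ i = A $ i $ 1 * g + A $ i $ 2 * g ^ (q ^ 2 + 1) + A $ i $ 3" for g i
    by (simp add: matrix_vector_mult_def sum_3 gpt_nth)
  have e13: "(A *v gpt q g) $ 1 = g * (A *v gpt q g) $ 3" and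
       e23: "(A *v gpt q g) $ 2 = g ^ (q ^ 2 + 1) * (A *v gpt q g) $ 3" if "g ^ M = 1" for g
    using assms[OF that] by (auto simp: gpt_nth mult.commute)
  have q2_4: "q ^ 2 > 4" using power_strict_mono[of 2 q 2] q2 by simp
  have M_big: "M > 2 * (q ^ 2 + 1)"
  proof -
    have "q ^ 4 = q ^ 2 * q ^ 2" by (simp add: power2_eq_square power4_eq_xxxx)
    moreover have "4 * q ^ 2 < q ^ 2 * q ^ 2" using q2_4 by (intro mult_strict_right_mono) (use q2 in auto)
    ultimately have "4 * q ^ 2 < q ^ 4" by (simp only:)
    moreover have "4 * s < t \<Longrightarrow> 4 < s \<Longrightarrow> 2 * (s + 1) < t + s + 1" for s t :: nat by presburger
    ultimately show ?thesis unfolding M_def using q2_4 by blast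
  qed
  define p1 where "p1 = monom (A $ 1 $ 1 - A $ 3 $ 3) 1 + monom (A $ 1 $ 2) (q ^ 2 + 1) + monom (A $ 1 $ 3) 0
     - monom (A $ 3 $ 1) 2 - monom (A $ 3 $ 2) (q ^ 2 + 2)"
  have "p1 = 0"
  proof (rule M_root_poly_eq_0)
    show "poly p1 g = 0" if "g ^ M = 1" for g
      using e13[OF that] unfolding A p1_def by (simp add: poly_monom algebra_simps power2_eq_square)
    have "degree p1 \<le> q ^ 2 + 2"
      unfolding p1_def by (intro degree_diff_le degree_add_le order.trans[OF degree_monom_le]) auto
    then show "degree p1 < M" using M_big by presburger
  qed
  then have "coeff p1 1 = 0" "coeff p1 (q ^ 2 + 1) = 0" "coeff p1 0 = 0" by simp_all
  then have 1: "A $ 1 $ 1 = A $ 3 $ 3" "A $ 1 $ 2 = 0" "A $ 1 $ 3 = 0"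
    using q2_4 q2 by (auto simp: p1_def split: if_splits)
  have "coeff p1 2 = 0" "coeff p1 (q ^ 2 + 2) = 0" using \<open>p1 = 0\<close> by simp_all
  then have 2: "A $ 3 $ 1 = 0" "A $ 3 $ 2 = 0"
    using q2_4 q2 1 by (auto simp: p1_def split: if_splits)
  define p2 where "p2 = monom (A $ 2 $ 1) 1 + monom (A $ 2 $ 2 - A $ 3 $ 3) (q ^ 2 + 1) + monom (A $ 2 $ 3) 0"
  have "p2 = 0"
  proof (rule M_root_poly_eq_0)
    show "poly p2 g = 0" if "g ^ M = 1" for g
      using e23[OF that] 2 unfolding A p2_def by (simp add: poly_monom algebra_simps)
    have "degree p2 \<le> q ^ 2 + 1"
      unfolding p2_def by (intro degree_add_le order.trans[OF degree_monom_le]) auto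
    then show "degree p2 < M" using M_big by presburger
  qed
  then have "coeff p2 1 = 0" "coeff p2 (q ^ 2 + 1) = 0" "coeff p2 0 = 0" by simp_all
  then have 3: "A $ 2 $ 1 = 0" "A $ 2 $ 2 = A $ 3 $ 3" "A $ 2 $ 3 = 0"
    using q2_4 q2 by (auto simp: p2_def split: if_splits)
  have "A *v v = A $ 3 $ 3 *s v" for v
    using 1 2 3 by (simp add: vec_eq_iff forall_3 matrix_vector_mult_def sum_3)
  then show ?thesis by blast
qed

end

lemma matrix_inv_mult:
  fixes A :: "'a::field ^ 'n ^ 'n"
  assumes "invertible A"
  shows "A ** matrix_inv A = mat 1" "matrix_inv A ** A = mat 1"
proof -
  have "A ** matrix_inv A = mat 1 \<and> matrix_inv A ** A = mat 1"
    using assms unfolding invertible_def matrix_inv_def by (rule someI_ex)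
  then show "A ** matrix_inv A = mat 1" "matrix_inv A ** A = mat 1" by auto
qed

context singer
begin

section \<open>The Frobenius collineation and rationality over \<Pi>\<close>

abbreviation Q where "Q \<equiv> q ^ 2"

lemma char_powers: "\<exists>m. Q = CHAR('k) ^ m" "\<exists>m. q ^ 6 = CHAR('k) ^ m"
proof -
  obtain m where "q = CHAR('k) ^ m" using q_char_power by blast
  then have "Q = CHAR('k) ^ (m * 2)" "q ^ 6 = CHAR('k) ^ (m * 6)" by (simp_all add: power_mult)
  then show "\<exists>m. Q = CHAR('k) ^ m" "\<exists>m. q ^ 6 = CHAR('k) ^ m" by blast+
qed

lemma Q_pos: "Q > 0" using q2 by simp

lemma beta_props:
  "\<beta> ^ N = 1" "\<beta> \<noteq> 0" "0 < k \<Longrightarrow> k < N \<Longrightarrow> \<beta> ^ k \<noteq> 1" "\<beta> ^ M = 1" "((\<beta> ^ Q) ^ Q) ^ Q = \<beta>"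
proof -
  show 1: "\<beta> ^ N = 1" and "0 < k \<Longrightarrow> k < N \<Longrightarrow> \<beta> ^ k \<noteq> 1"
    using beta by (auto simp: primitive_root_of_unity_def N_def)
  show "\<beta> \<noteq> 0" using 1 N_pos by (auto simp: power_0_left)
  show 2: "\<beta> ^ M = 1" unfolding M_factor power_mult 1 by simp
  have "Q * (Q * Q) = q ^ 6" by (simp add: power_numeral_reduce)
  then show "((\<beta> ^ Q) ^ Q) ^ Q = \<beta>"
    using root_GF[OF 2] by (simp add: GF_def mult.assoc flip: power_mult)
qed

lemma Q_power_inj: "u ^ Q = v ^ Q \<Longrightarrow> u = v" for u v :: 'k
proof -
  assume "u ^ Q = v ^ Q"
  then have "(u - v) ^ Q = 0" using frobenius_Q[of "u - v" v] by simp
  then show ?thesis by simp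
qed

text \<open>From \<open>\<beta> ^ (Q + 1) = \<beta> ^ q\<close>, a fixed \<beta> would satisfy
  \<open>\<beta> ^ (q - 2) = 1\<close> with \<open>0 < q - 2 < N\<close>; this is where
  \<open>q > 2\<close> enters. The three conjugates are then distinct.\<close>

lemma beta_distinct: "\<beta> ^ Q \<noteq> \<beta>" "(\<beta> ^ Q) ^ Q \<noteq> \<beta>" "(\<beta> ^ Q) ^ Q \<noteq> \<beta> ^ Q"
proof -
  show 1: "\<beta> ^ Q \<noteq> \<beta>"
  proof
    assume "\<beta> ^ Q = \<beta>"
    then have "\<beta> ^ (Q + 1) = \<beta> ^ 2" by (simp add: power2_eq_square)
    moreover have "\<beta> ^ (Q + 1) = \<beta> ^ q" unfolding exps(1) using beta_props(1) by (simp add: power_add)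
    moreover have "q = 2 + (q - 2)" using q2 by simp
    then have "\<beta> ^ q = \<beta> ^ 2 * \<beta> ^ (q - 2)" by (metis power_add)
    ultimately have "\<beta> ^ (q - 2) = 1" using beta_props(2) by simp
    moreover have "0 < q - 2" "q - 2 < N" using q2 N_gt by auto
    ultimately show False using beta_props(3) by blast
  qed
  show "(\<beta> ^ Q) ^ Q \<noteq> \<beta>" using beta_props(5) 1 by metis
  show "(\<beta> ^ Q) ^ Q \<noteq> \<beta> ^ Q" using Q_power_inj 1 by blast
qed

text \<open>The columns of \<open>W\<close> are fixed by \<open>phi\<close>, so \<open>W\<close> carries the canonical subplane to \<open>\<Pi>\<close>.\<close>

definition W :: "'k ^ 3 ^ 3" where
  "W = vector [vector [1, \<beta>, \<beta> ^ 2], vector [1, \<beta> ^ Q, (\<beta> ^ Q) ^ 2], vector [1, (\<beta> ^ Q) ^ Q, ((\<beta> ^ Q) ^ Q) ^ 2]]"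

definition V :: "'k ^ 3 ^ 3" where "V = matrix_inv W"

lemma W_invertible: "invertible W"
proof -
  \<comment> \<open>Vandermonde determinant in the three conjugates of \<beta>.\<close>
  have "det W = (\<beta> ^ Q - \<beta>) * ((\<beta> ^ Q) ^ Q - \<beta>) * ((\<beta> ^ Q) ^ Q - \<beta> ^ Q)"
    unfolding det_3 W_def vector_3 by (simp add: algebra_simps power2_eq_square)
  then show ?thesis unfolding invertible_det_nz using beta_distinct by simp
qed

lemma WV: "W ** V = mat 1" "V ** W = mat 1"
  using matrix_inv_mult[OF W_invertible] by (auto simp: V_def)

lemma WV_vec: "W *v (V *v v) = v" "V *v (W *v v) = v"
  by (simp_all add: matrix_vector_mul_assoc WV)

lemma W_mult: "(W *v u) $ 1 = u $ 1 + \<beta> * u $ 2 + \<beta> ^ 2 * u $ 3"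
  "(W *v u) $ 2 = u $ 1 + \<beta> ^ Q * u $ 2 + (\<beta> ^ Q) ^ 2 * u $ 3"
  "(W *v u) $ 3 = u $ 1 + (\<beta> ^ Q) ^ Q * u $ 2 + ((\<beta> ^ Q) ^ Q) ^ 2 * u $ 3"
  by (simp_all add: matrix_vector_mult_def sum_3 W_def vector_3)

lemma power_comm: "(u ^ m) ^ n = (u ^ n) ^ m" for u :: 'k
  by (simp add: mult.commute flip: power_mult)

lemma phi_W: "phi q (W *v u) = W *v vec_power Q u"
  unfolding vec_eq_iff forall_3 phi_nth W_mult vec_power_nth
  by (simp only: frobenius_Q power_mult_distrib power_comm[of _ 2 Q] beta_props(5) simp_thms)

lemma V_phi: "V *v phi q v = vec_power Q (V *v v)"
  by (metis WV_vec phi_W)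

text \<open>The entries of \<open>W\<close> are powers of \<beta>, fixed by the
  \<open>q ^ 6\<close>-power map; raising the entries of the inverse to that power gives an inverse
  of the same matrix.\<close>

lemma V_GF: "V $ i $ j \<in> GF (q ^ 6)"
proof -
  obtain m where m: "q ^ 6 = CHAR('k) ^ m" using char_powers by blast
  define V' :: "'k ^ 3 ^ 3" where "V' = (\<chi> i j. V $ i $ j ^ (q ^ 6))"
  have "\<beta> ^ (q ^ 6) = \<beta>" using root_GF[OF beta_props(4)] by (simp add: GF_def)
  then have b6: "(\<beta> ^ n) ^ (q ^ 6) = \<beta> ^ n" for n by (simp add: power_comm[of _ n])
  have "\<exists>n. W $ i $ j = \<beta> ^ n" for i j
  proof -
    have "\<exists>n. 1 = \<beta> ^ n" "\<exists>n. \<beta> = \<beta> ^ n" "\<exists>n. \<beta> ^ 2 = \<beta> ^ n" "\<exists>n. \<beta> ^ Q = \<beta> ^ n" "\<exists>n. (\<beta> ^ Q) ^ 2 = \<beta> ^ n"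
      "\<exists>n. (\<beta> ^ Q) ^ Q = \<beta> ^ n" "\<exists>n. ((\<beta> ^ Q) ^ Q) ^ 2 = \<beta> ^ n"
      by (metis power_0, metis power_one_right, (metis power_mult)+)
    then show ?thesis
      using exhaust_3[of i] exhaust_3[of j] unfolding W_def by (elim disjE) (simp_all only: vector_3)
  qed
  then have W6: "W $ i $ j ^ (q ^ 6) = W $ i $ j" for i j using b6 by metis
  have "W ** V' = mat 1"
  proof -
    have "(W ** V') $ i $ j = ((W ** V) $ i $ j) ^ (q ^ 6)" for i j
      unfolding matrix_matrix_mult_def V'_def
      by (simp add: freshmans_dream_sum'[OF char_prime m] power_mult_distrib W6)
    then show ?thesis unfolding WV using q2 by (simp add: vec_eq_iff mat_def power_0_left)
  qed
  then have "V' = V" using WV by (metis matrix_mul_assoc matrix_mul_lid matrix_mul_rid)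
  then have "V' $ i $ j = V $ i $ j" by simp
  then show ?thesis by (simp add: V'_def GF_def)
qed

lemma phi_fixed:
  assumes "phi q v = v"
  shows "v $ 2 = v $ 1 ^ Q" "v $ 3 = (v $ 1 ^ Q) ^ Q" "((v $ 1 ^ Q) ^ Q) ^ Q = v $ 1"
  using assms by (metis phi_nth)+

lemma V_canonical: "projectivity_to_canonical q V"
  unfolding projectivity_to_canonical_def
proof (intro conjI allI V_GF)
  show "invertible V" using WV invertible_def by blast
  show "proj_map V ` Pi_plane q = proj_plane (GF Q)"
  proof (intro equalityI subsetI)
    fix P assume "P \<in> proj_map V ` Pi_plane q"
    then obtain g where g: "g ^ M = 1" "P = proj_map V (proj_point (gpt q g))" unfolding Pi_eq by blast
    define u where "u = V *v gpt q g"
    have P: "P = proj_point u" by (simp add: g(2) proj_map_proj_point u_def)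
    have "W *v u \<noteq> 0" using gpt_nth(3)[of q g] by (auto simp: u_def WV_vec)
    then have u0: "u \<noteq> 0" by auto
    have g0: "g \<noteq> 0" using g(1) by (auto simp: M_def)
    have "u = V *v (g *s phi q (gpt q g))" unfolding u_def using phi_gpt[OF g(1)] by simp
    also have "\<dots> = g *s vec_power Q u" by (simp add: vector_scalar_commute V_phi u_def)
    finally have u: "u $ i = g * u $ i ^ Q" for i by (metis vector_smult_component vec_power_nth)
    have "Q - 1 > 0" using q2 power_strict_mono[of 1 q 2] by simp
    \<comment> \<open>Hilbert 90 by hand: \<open>u $ i = g * u $ i ^ Q\<close> and
      \<open>e ^ Q = e * g\<close> make \<open>e * u $ i\<close> fixed by the Frobenius map.\<close>
    then obtain e where e: "e ^ (Q - 1) = g" using nth_root_exists by blast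
    have e0: "e \<noteq> 0" using e g0 \<open>Q - 1 > 0\<close> by (auto simp: power_0_left)
    have eQ: "e ^ Q = e * g" using e Q_pos by (metis power_eq_if neq0_conv)
    have "(e *s u) $ i \<in> GF Q" for i
      using u[of i] by (simp add: GF_def power_mult_distrib eQ mult.assoc)
    moreover have "e *s u \<noteq> 0" using e0 u0 by simp
    moreover have "P = proj_point (e *s u)" using P proj_point_scale[OF e0] by simp
    ultimately show "P \<in> proj_plane (GF Q)" unfolding proj_plane_def by blast
  next
    fix P :: "'k point" assume "P \<in> proj_plane (GF Q)"
    then obtain u where u: "P = proj_point u" "u \<noteq> 0" "\<And>i. u $ i \<in> GF Q" unfolding proj_plane_def by blast
    define v where "v = W *v u"
    have "vec_power Q u = u" using u(3) by (simp add: vec_eq_iff GF_def)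
    then have "phi q v = v" by (simp add: v_def phi_W)
    note v = phi_fixed[OF this]
    have Vv: "V *v v = u" by (simp add: v_def WV_vec)
    then have "v \<noteq> 0" using u(2) by auto
    define s where "s = v $ 1"
    have s0: "s \<noteq> 0"
    proof
      assume "s = 0"
      then have "v $ 1 = 0" "v $ 2 = 0" "v $ 3 = 0" using v(1,2) Q_pos by (auto simp: s_def)
      then show False using \<open>v \<noteq> 0\<close> by (simp add: vec_eq_iff forall_3)
    qed
    \<comment> \<open>A vector fixed by \<open>phi\<close> has the coordinates \<open>s\<close>,
      \<open>s ^ Q\<close>, \<open>(s ^ Q) ^ Q\<close>; this is the first coordinate after the third
      is normalized to one.\<close>
    define g where "g = s / (s ^ Q) ^ Q"
    have sQ: "((s ^ Q) ^ Q) ^ Q = s" using v(3) by (simp add: s_def)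
    have gQ: "g ^ Q = s ^ Q / s" "(g ^ Q) ^ Q = (s ^ Q) ^ Q / s ^ Q" by (simp_all add: g_def power_divide sQ)
    have "M = Q * Q + Q + 1" by (simp add: M_def power2_eq_square power4_eq_xxxx mult.assoc)
    then have "g ^ M = (g ^ Q) ^ Q * g ^ Q * g" by (simp only: power_add power_mult power_one_right)
    then have gM: "g ^ M = 1" unfolding gQ(2) unfolding gQ(1) using s0 by (simp add: g_def)
    have g1: "g ^ (Q + 1) = s ^ Q / (s ^ Q) ^ Q" using s0 gQ by (simp add: g_def)
    have "v = (s ^ Q) ^ Q *s gpt q g"
      unfolding vec_eq_iff forall_3 vector_smult_component gpt_nth g1
      using v(1,2) s0 by (simp add: s_def g_def)
    then have "proj_point v = proj_point (gpt q g)" using proj_point_scale s0 by (metis power_not_zero)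
    moreover have "P = proj_map V (proj_point v)" using u(1) Vv by (simp add: proj_map_proj_point)
    ultimately show "P \<in> proj_map V ` Pi_plane q" using gM unfolding Pi_eq by blast
  qed
qed

lemma defined_over_Pi_I:
  fixes A B :: "'k ^ 3 \<Rightarrow> 'k"
  assumes "A \<in> forms UNIV d" "B \<in> forms UNIV d" "(A, B) \<in> f"
    "\<And>v. A (phi q v) = A v ^ Q" "\<And>v. B (phi q v) = B v ^ Q"
  shows "defined_over_Pi q f"
proof -
  obtain m where m: "Q = CHAR('k) ^ m" using char_powers by blast
  have lin: "(\<lambda>v. (W *v v) $ i) \<in> forms UNIV 1" for i
    unfolding matrix_vector_mult_def sum_3 by (simp, intro forms_add forms_cmult) (use forms_coord in auto)
  have GF: "(\<lambda>u. C (W *v u)) \<in> forms (GF Q) d" if "C \<in> forms UNIV d" "\<And>v. C (phi q v) = C v ^ Q" for C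
    unfolding forms_GF_iff[OF char_prime m]
  proof (intro conjI allI)
    show "(\<lambda>u. C (W *v u)) \<in> forms UNIV d" using lifts_compose[OF that(1) lin] by simp
    show "C (W *v vec_power Q v) = C (W *v v) ^ Q" for v using that(2)[of "W *v v"] by (simp add: phi_W)
  qed
  have "((\<lambda>v. A (W *v (V *v v))), (\<lambda>v. B (W *v (V *v v)))) \<in> f" using assms(3) by (simp add: WV_vec)
  then show ?thesis
    unfolding defined_over_Pi_def
    by (intro exI[of _ V] conjI V_canonical exI[of _ d] bexI[OF _ GF[OF assms(1,4)]] bexI[OF _ GF[OF assms(2,5)]])
qed

text \<open>Comparing the Frobenius conjugate of \<open>A\<close> with \<open>A\<close> itself gives
  a matrix fixing every point of \<Pi>, hence a scalar. So each admissible projectivity transports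
  the standard Frobenius to \<open>phi\<close>, up to a scalar.\<close>

lemma canonical_phi:
  fixes A :: "'k ^ 3 ^ 3"
  assumes "projectivity_to_canonical q A"
  shows "\<exists>\<rho>. \<forall>v. vec_power Q (A *v v) = \<rho> *s (A *v phi q v)"
proof -
  obtain m where m: "Q = CHAR('k) ^ m" using char_powers by blast
  have inv: "invertible A" using assms by (simp add: projectivity_to_canonical_def)
  define L where "L = matrix_inv A"
  have LA: "L *v (A *v v) = v" "A *v (L *v v) = v" for v
    by (simp_all add: matrix_vector_mul_assoc L_def matrix_inv_mult[OF inv])
  define S :: "'k ^ 3 ^ 3" where "S = vector [vector [0, 1, 0], vector [0, 0, 1], vector [1, 0, 0]]"
  have S: "S *v phi q v = vec_power Q v" for v
    by (simp add: vec_eq_iff forall_3 matrix_vector_mult_def sum_3 S_def vector_3 phi_nth)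
  define AQ where "AQ = (\<chi> i j. A $ i $ j ^ Q)"
  have AQ: "AQ *v vec_power Q v = vec_power Q (A *v v)" for v
    unfolding vec_eq_iff vec_power_nth matrix_vector_mult_def AQ_def vec_lambda_beta
      freshmans_dream_sum'[OF char_prime m] power_mult_distrib by simp
  define T where "T = L ** AQ ** S"
  have T: "T *v phi q v = L *v vec_power Q (A *v v)" for v
    by (simp add: T_def S AQ flip: matrix_vector_mul_assoc)
  have "\<exists>\<kappa>. T *v gpt q g = \<kappa> *s gpt q g" if g: "g ^ M = 1" for g
  proof -
    have "proj_map A (proj_point (gpt q g)) \<in> proj_plane (GF Q)"
      using assms g unfolding projectivity_to_canonical_def Pi_eq by blast
    then obtain u where u: "proj_point (A *v gpt q g) = proj_point u" "u \<noteq> 0" "\<And>i. u $ i \<in> GF Q"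
      unfolding proj_plane_def proj_map_proj_point by blast
    then obtain e where e: "A *v gpt q g = e *s u" using self_proj_point proj_point_iff by metis
    have "e \<noteq> 0"
    proof
      assume "e = 0"
      then have "gpt q g = 0" using e LA(1)[of "gpt q g"] by simp
      then show False using gpt_nth(3)[of q g] by simp
    qed
    then have "vec_power Q (A *v gpt q g) = (e ^ Q / e) *s (A *v gpt q g)"
      unfolding e using u(3) by (simp add: vec_eq_iff GF_def power_mult_distrib)
    then have "T *v phi q (gpt q g) = (e ^ Q / e) *s gpt q g"
      unfolding T by (simp add: vector_scalar_commute LA)
    moreover have "T *v gpt q g = g *s (T *v phi q (gpt q g))"
      using phi_gpt[OF g] by (metis vector_scalar_commute)
    ultimately have "T *v gpt q g = (g * (e ^ Q / e)) *s gpt q g" by simp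
    then show ?thesis by blast
  qed
  then obtain \<rho> where \<rho>: "\<And>v. T *v v = \<rho> *s v" using scalar_of_fixing_Pi by blast
  have "vec_power Q (A *v v) = \<rho> *s (A *v phi q v)" for v
    using T[of v] \<rho>[of "phi q v"] LA(2)[of "vec_power Q (A *v v)"] by (metis vector_scalar_commute)
  then show ?thesis by blast
qed

lemma phi_forms: "(\<lambda>v::'k^3. phi q v $ i) \<in> forms UNIV Q"
proof -
  have "(\<lambda>v::'k^3. v $ j ^ Q) \<in> forms UNIV Q" for j using forms_power[OF forms_coord, of j Q] by simp
  then show ?thesis using exhaust_3[of i] by (auto simp: phi_nth)
qed

text \<open>A function over \<open>\<Pi>\<close> commutes with the Frobenius collineation, whatever its
  representation by forms; the given rational forms may both vanish at the point.\<close>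

lemma value_rational:
  assumes f: "f \<in> carrier K" "defined_over_Pi q f" and g: "g ^ M = 1" "H (gpt q g) = 0"
    and reg: "regular_at (proj_point (gpt q g)) f"
  shows "value_at (proj_point (gpt q g)) f ^ Q = value_at (proj_point (gpt q g)) f"
proof -
  obtain m where m: "Q = CHAR('k) ^ m" using char_powers by blast
  define v where "v = gpt q g"
  interpret cp: curve_point q cf v 3 by unfold_locales (use g in \<open>auto simp: v_def gpt_nth\<close>)
  note w = cp.w_generic
  obtain T d A B where T: "projectivity_to_canonical q T" and AB: "A \<in> forms (GF Q) d" "B \<in> forms (GF Q) d"
    and mem: "(\<lambda>v. A (T *v v), \<lambda>v. B (T *v v)) \<in> f"
    using f(2) unfolding defined_over_Pi_def by blast
  obtain \<rho> where \<rho>: "\<And>v. vec_power Q (T *v v) = \<rho> *s (T *v phi q v)" using canonical_phi[OF T] by blast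
  have twist: "C (T *v v) ^ Q = \<rho> ^ d * C (T *v phi q v)" if "C \<in> forms (GF Q) d" for C v
  proof -
    have C: "C \<in> forms UNIV d" "\<And>v. C (vec_power Q v) = C v ^ Q"
      using that unfolding forms_GF_iff[OF char_prime m] by blast+
    then obtain C' where "lifts d C C'" using forms_iff_lifts by blast
    then have "C (\<rho> *s (T *v phi q v)) = \<rho> ^ d * C (T *v phi q v)" using lifts_scale by blast
    then show ?thesis using C(2) \<rho> by metis
  qed
  obtain A' B' u where A'B': "(A', B') \<in> f" "u \<in> proj_point v" "B' u \<noteq> 0"
    using reg unfolding regular_at_def v_def by blast
  note mf = carrier_mem[OF f(1) mem w] and mf' = carrier_mem[OF f(1) A'B'(1) w]
  obtain d' where d': "A' \<in> forms UNIV d'" "B' \<in> forms UNIV d'" using mf'(1) fractions_iff[OF w] by blast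
  obtain d'' where d'': "(\<lambda>v. B (T *v v)) \<in> forms UNIV d''" "ev (\<lambda>v. B (T *v v)) cp.w \<noteq> 0"
    using mf(1) fractions_iff[OF w] by blast
  obtain lA lB where l: "lifts d' A' lA" "lifts d' B' lB" using d' by (auto simp: forms_iff_lifts)
  have Bv: "B' v \<noteq> 0"
  proof -
    obtain a where "u = a *s v" using A'B'(2) proj_point_iff by blast
    then have "B' u = a ^ d' * B' v" using lifts_scale[OF l(2)] by blast
    then show ?thesis using A'B'(3) by auto
  qed
  have "((\<lambda>v. A (T *v v), \<lambda>v. B (T *v v)), (A', B')) \<in> fraction_rel CC"
    using fraction_rel_iff[OF w] mf mf' by metis
  then have eq: "A (T *v u) * B' u = A' u * B (T *v u)" if "H u = 0" for u
    using that unfolding fraction_rel_def by (auto simp: all_CC)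
  \<comment> \<open>The defect of \<open>A' / B'\<close> from commuting with \<open>phi\<close>. Its
    product with the nonzero \<open>B ^ Q\<close> vanishes on the curve, so \<open>R\<close> itself
    does, also at points where the rational representation is undefined.\<close>
  define R where "R u = A' (phi q u) * B' u ^ Q - A' u ^ Q * B' (phi q u)" for u
  have BX: "B (T *v u) ^ Q * R u = 0" if u: "H u = 0" for u
  proof -
    define a where "a = A (T *v u)"
    define b where "b = B (T *v u)"
    have 1: "a * B' u = A' u * b" using eq[OF u] by (simp add: a_def b_def)
    have "\<rho> ^ d * (A (T *v phi q u) * B' (phi q u)) = \<rho> ^ d * (A' (phi q u) * B (T *v phi q u))"
      using eq[OF phi_CC[OF u]] by simp
    then have 2: "a ^ Q * B' (phi q u) = A' (phi q u) * b ^ Q"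
      using twist[OF AB(1), of u] twist[OF AB(2), of u] by (simp add: a_def b_def mult_ac)
    have "b ^ Q * (A' (phi q u) * B' u ^ Q) = (A' (phi q u) * b ^ Q) * B' u ^ Q" by (simp add: mult_ac)
    also have "\<dots> = (a * B' u) ^ Q * B' (phi q u)" unfolding 2[symmetric] by (simp add: power_mult_distrib mult_ac)
    also have "\<dots> = b ^ Q * (A' u ^ Q * B' (phi q u))" unfolding 1 by (simp add: power_mult_distrib mult_ac)
    finally show ?thesis by (simp add: R_def b_def right_diff_distrib)
  qed
  have Xf: "R \<in> forms UNIV (d' * Q + Q * d')"
  proof -
    have "(\<lambda>u. A' (phi q u) * B' u ^ Q) \<in> forms UNIV (d' * Q + Q * d')"
      by (intro forms_mult lifts_compose[OF d'(1) phi_forms] forms_power d')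
    moreover have "(\<lambda>u. A' u ^ Q * B' (phi q u)) \<in> forms UNIV (Q * d' + d' * Q)"
      by (intro forms_mult lifts_compose[OF d'(2) phi_forms] forms_power d')
    ultimately show ?thesis unfolding R_def[abs_def] by (intro forms_diff) (simp_all add: add.commute)
  qed
  have Bf: "(\<lambda>u. B (T *v u) ^ Q) \<in> forms UNIV (Q * d'')" by (rule forms_power[OF d''(1)])
  have "ev (\<lambda>u. B (T *v u) ^ Q * R u) cp.w = 0"
    using ev_eq_0_iff[OF forms_mult[OF Bf Xf] w] BX by blast
  then have "ev R cp.w = 0" using ev_mult[OF Bf Xf w] ev_power[OF d''(1) w] d''(2) by simp
  then have Xv: "R v = 0" using ev_eq_0_iff[OF Xf w] cp.Hv by blast
  have g0: "g \<noteq> 0" using g(1) by (auto simp: M_def)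
  have "v = g *s phi q v" using phi_gpt[OF g(1)] by (simp add: v_def)
  then have ph: "phi q v = (1 / g) *s v" using g0 by (metis (no_types, lifting) divide_self_if vector_smult_assoc vector_smult_lid times_divide_eq_left mult_1)
  have "A' (phi q v) = (1 / g) ^ d' * A' v" "B' (phi q v) = (1 / g) ^ d' * B' v"
    unfolding ph using lifts_scale[OF l(1)] lifts_scale[OF l(2)] by blast+
  then have "(1 / g) ^ d' * (A' v * B' v ^ Q - A' v ^ Q * B' v) = 0"
    using Xv by (simp add: R_def algebra_simps)
  then have "A' v * B' v ^ Q = A' v ^ Q * B' v" using g0 by simp
  then have "(A' v / B' v) ^ Q = A' v / B' v" using Bv by (simp add: power_divide field_simps)
  then show ?thesis using cp.value_at_quotient[OF f(1) A'B'(1) Bv] by (simp add: v_def)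
qed

section \<open>Singer orbits on the curve\<close>

text \<open>By \<open>hform_gpt\<close>, the point of \<open>\<Pi>\<close> with parameter \<open>g\<close> lies on the curve iff \<open>g ^ N\<close> is one of
  the \<open>q + 1\<close> elements of \<open>Yr\<close>, and these label the Singer orbits.\<close>

definition Yr :: "'k set" where
  "Yr = {y. \<tau> * y ^ (q + 1) + \<tau> ^ (Q + 1) * y + 1 = 0}"

lemma tau_prod: "\<tau> ^ (Q + 1) * \<tau> ^ q = 1"
  using tau by (simp add: ac_simps flip: power_add)

lemma Yr_nz: "y \<in> Yr \<Longrightarrow> y \<noteq> 0"
  by (auto simp: Yr_def)

lemma card_Yr: "card Yr = q + 1"
proof -
  define p where "p = monom \<tau> (q + 1) + [:1, \<tau> ^ (Q + 1):]"
  have deg: "degree p = q + 1"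
    unfolding p_def using tau_nz q2 by (subst degree_add_eq_left) (auto simp: degree_monom_eq)
  have ev: "poly p y = \<tau> * y ^ (q + 1) + \<tau> ^ (Q + 1) * y + 1" for y
    by (simp add: p_def poly_monom algebra_simps)
  have "card {y. poly p y = 0} = degree p"
  proof (rule card_roots_separable)
    show "p \<noteq> 0" using deg by auto
    fix a assume a: "poly p a = 0"
    have "poly (pderiv p) a = \<tau> * a ^ q + \<tau> ^ (Q + 1)"
      by (simp add: p_def pderiv_add pderiv_monom pderiv_pCons poly_monom of_nat_q)
    \<comment> \<open>As \<open>q\<close> is zero in the field, \<open>a\<close> times the
      derivative is \<open>p\<close> without its constant term.\<close>
    then have "a * poly (pderiv p) a + 1 = 0" using a unfolding ev by (simp add: algebra_simps)
    then show "poly (pderiv p) a \<noteq> 0" by auto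
  qed
  then show ?thesis unfolding ev deg Yr_def .
qed

lemma finite_Yr: "finite Yr"
  using card_Yr by (metis add_is_0 card.infinite one_neq_zero)

text \<open>The equation multiplied by \<open>\<tau> ^ q\<close> (\<open>E1\<close>) is subtracted
  from \<open>y\<close> times its \<open>q\<close>-th power (\<open>E2\<close>). It follows that
  every \<open>g\<close> with \<open>g ^ N\<close> in \<open>Yr\<close> parametrizes a point of
  \<Pi>.\<close>

lemma Yr_root:
  assumes "y \<in> Yr"
  shows "y ^ (Q + q + 1) = 1"
proof -
  have E: "\<tau> * y ^ (q + 1) + \<tau> ^ (Q + 1) * y + 1 = 0" using assms by (simp add: Yr_def)
  have E1: "\<tau> ^ (q + 1) * y ^ (q + 1) + y + \<tau> ^ q = 0"
  proof -
    have "\<tau> ^ (q + 1) * y ^ (q + 1) + y + \<tau> ^ q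
      = \<tau> ^ q * (\<tau> * y ^ (q + 1)) + (\<tau> ^ (Q + 1) * \<tau> ^ q) * y + \<tau> ^ q"
      unfolding tau_prod by (simp add: algebra_simps)
    also have "\<dots> = \<tau> ^ q * (\<tau> * y ^ (q + 1) + \<tau> ^ (Q + 1) * y + 1)" by (simp only: algebra_simps mult_1_left mult_1_right)
    finally show ?thesis using E by simp
  qed
  have tq: "(\<tau> ^ (Q + 1)) ^ q = \<tau> ^ (q + 1)"
  proof -
    have "(\<tau> ^ (Q + 1)) ^ q * \<tau> ^ Q = (\<tau> ^ (Q + 1) * \<tau> ^ q) ^ q"
      by (simp add: power_mult_distrib power2_eq_square power_mult)
    also have "\<dots> = \<tau> ^ (q + 1) * \<tau> ^ Q" unfolding tau_prod using tau by (simp add: ac_simps flip: power_add)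
    finally show ?thesis using tau_nz by simp
  qed
  have "0 = (\<tau> * y ^ (q + 1) + \<tau> ^ (Q + 1) * y + 1) ^ q" unfolding E using q2 by simp
  also have "\<dots> = \<tau> ^ q * (y ^ (q + 1)) ^ q + \<tau> ^ (q + 1) * y ^ q + 1"
    by (simp only: frobenius_add power_mult_distrib power_one tq)
  finally have E2: "\<tau> ^ q * (y ^ (q + 1)) ^ q + \<tau> ^ (q + 1) * y ^ q + 1 = 0" by simp
  have pows: "(y ^ (q + 1)) ^ q * y = y ^ (Q + q + 1)" "y ^ q * y = y ^ (q + 1)"
    by (simp_all add: power2_eq_square power_add power_mult power_mult_distrib mult_ac)
  have "(a * A + d * B + 1) * y = a * (A * y) + d * (B * y) + y" for a d A B
    by (simp add: algebra_simps)
  from this[of "\<tau> ^ q" "(y ^ (q + 1)) ^ q" "\<tau> ^ (q + 1)" "y ^ q"]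
  have "\<tau> ^ q * y ^ (Q + q + 1) + \<tau> ^ (q + 1) * y ^ (q + 1) + y
     = (\<tau> ^ q * (y ^ (q + 1)) ^ q + \<tau> ^ (q + 1) * y ^ q + 1) * y"
    unfolding pows by (rule sym)
  then have "\<tau> ^ q * y ^ (Q + q + 1) + \<tau> ^ (q + 1) * y ^ (q + 1) + y = 0" unfolding E2 by simp
  moreover have "A + B + y = 0 \<Longrightarrow> B + y + C = 0 \<Longrightarrow> A = C" for A B C
    by (metis add.assoc add.commute add_left_cancel)
  ultimately have "\<tau> ^ q * y ^ (Q + q + 1) = \<tau> ^ q" using E1 by blast
  then show ?thesis using tau_nz by simp
qed

text \<open>A second member of the family through the orbit labelled \<open>y\<close> has a
  parameter \<open>t\<close> satisfying the equation of \<open>Yr\<close> for the same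
  \<open>y\<close>. The pencil spanned by the two curves then contains the form that vanishes where
  \<open>x = y ^ q\<close>.\<close>

lemma other_hermitian:
  assumes y: "y \<in> Yr"
  shows "\<exists>t. t \<noteq> \<tau> \<and> t ^ (Q + q + 1) = 1 \<and> (\<forall>v. hform q t v = H v + (t - \<tau>) * (v $ 1 * v $ 2 ^ q - y ^ q * (v $ 2 * v $ 3 ^ q)))"
proof -
  note y0 = Yr_nz[OF y]
  \<comment> \<open>The condition on \<open>t\<close>, multiplied by \<open>t ^ q\<close> and
    simplified with \<open>t ^ (Q + q + 1) = 1\<close>. It has \<open>q + 1\<close> distinct roots,
    so one differs from \<tau>; that its roots satisfy the norm condition is recovered below from
    its \<open>q\<close>-th power.\<close>
  define p where "p = monom (y ^ (q + 1)) (q + 1) + (monom 1 q + [:y:])"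
  have deg: "degree p = q + 1"
    unfolding p_def using y0 q2
    by (subst degree_add_eq_left) (auto simp: degree_monom_eq intro!: le_less_trans[OF degree_add_le_max])
  have ev: "poly p t = y ^ (q + 1) * t ^ (q + 1) + t ^ q + y" for t
    by (simp add: p_def poly_monom)
  have "card {t. poly p t = 0} = degree p"
  proof (rule card_roots_separable)
    show "p \<noteq> 0" using deg by auto
    fix a assume a: "poly p a = 0"
    then have "a \<noteq> 0" using y0 q2 unfolding ev by (auto simp: power_0_left)
    then show "poly (pderiv p) a \<noteq> 0"
      using y0 by (simp add: p_def pderiv_add pderiv_monom pderiv_pCons poly_monom of_nat_q)
  qed
  then have "card {t. poly p t = 0} = q + 1" using deg by simp
  then have "\<not> {t. poly p t = 0} \<subseteq> {\<tau>}"
    using q2 card_mono[of "{\<tau>}" "{t. poly p t = 0}"] by auto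
  then obtain t where t: "poly p t = 0" "t \<noteq> \<tau>" by blast
  have t0: "t \<noteq> 0" using t(1) y0 q2 unfolding ev by (auto simp: power_0_left)
  have P1: "y ^ (q + 1) * t ^ (q + 1) + t ^ q + y = 0" using t(1) unfolding ev .
  define T where "T = t ^ (Q + q + 1)"
  have "0 = (y ^ (q + 1) * t ^ (q + 1) + t ^ q + y) ^ q" unfolding P1 using q2 by simp
  also have "\<dots> = (y ^ (q + 1)) ^ q * (t ^ (q + 1)) ^ q + (t ^ q) ^ q + y ^ q"
    by (simp only: frobenius_add power_mult_distrib)
  finally have P2: "(y ^ (q + 1)) ^ q * (t ^ (q + 1)) ^ q + (t ^ q) ^ q + y ^ q = 0" by simp
  have pows: "(y ^ (q + 1)) ^ q * y = y ^ (Q + q + 1)" "(t ^ (q + 1)) ^ q * t = T" "(t ^ q) ^ q * t = t ^ (Q + 1)"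
    "y ^ q * y = y ^ (q + 1)"
    unfolding T_def by (simp_all add: power2_eq_square power_add power_mult power_mult_distrib mult_ac)
  have "(A * B + C + D) * (y * t) = (A * y) * (B * t) + y * (C * t) + (D * y) * t" for A B C D
    by (simp add: algebra_simps)
  from this[of "(y ^ (q + 1)) ^ q" "(t ^ (q + 1)) ^ q" "(t ^ q) ^ q" "y ^ q"]
  have "((y ^ (q + 1)) ^ q * (t ^ (q + 1)) ^ q + (t ^ q) ^ q + y ^ q) * (y * t)
     = y ^ (Q + q + 1) * T + y * t ^ (Q + 1) + y ^ (q + 1) * t"
    unfolding pows .
  then have P3: "T + y * t ^ (Q + 1) + y ^ (q + 1) * t = 0" unfolding P2 Yr_root[OF y] by simp
  have T1: "T = 1"
  proof -
    have pows: "t ^ (Q + 1) * t ^ q = T" "t * t ^ q = t ^ (q + 1)"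
      unfolding T_def by (simp_all add: ac_simps flip: power_add)
    have "(T + y * A + C * t) * B = T * B + y * (A * B) + C * (t * B)" for A B C
      by (simp add: algebra_simps)
    from this[of "t ^ (Q + 1)" "y ^ (q + 1)" "t ^ q"]
    have "(T + y * t ^ (Q + 1) + y ^ (q + 1) * t) * t ^ q = T * t ^ q + y * T + y ^ (q + 1) * t ^ (q + 1)"
      unfolding pows .
    then have "T * t ^ q + y * T + y ^ (q + 1) * t ^ (q + 1) = 0" unfolding P3 by simp
    then have "(T * t ^ q + y * T + y ^ (q + 1) * t ^ (q + 1)) - (y ^ (q + 1) * t ^ (q + 1) + t ^ q + y) = 0"
      unfolding P1 by simp
    then have "(T - 1) * (t ^ q + y) = 0" by (simp add: algebra_simps)
    moreover have "t ^ q + y \<noteq> 0"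
    proof
      assume "t ^ q + y = 0"
      then have "y ^ (q + 1) * t ^ (q + 1) = 0" using P1 by (simp add: add.assoc)
      then show False using y0 t0 by simp
    qed
    ultimately show ?thesis by simp
  qed
  have E: "\<tau> * y ^ (q + 1) + \<tau> ^ (Q + 1) * y + 1 = 0" using y by (simp add: Yr_def)
  have "(1 + y * t ^ (Q + 1) + y ^ (q + 1) * t) - (\<tau> * y ^ (q + 1) + \<tau> ^ (Q + 1) * y + 1) = 0"
    using P3 unfolding T1 E by simp
  then have "y * (t ^ (Q + 1) - \<tau> ^ (Q + 1) + (t - \<tau>) * y ^ q) = 0" by (simp add: algebra_simps)
  then have "t ^ (Q + 1) - \<tau> ^ (Q + 1) + (t - \<tau>) * y ^ q = 0" using y0 by simp
  then have d: "t ^ (Q + 1) = \<tau> ^ (Q + 1) - (t - \<tau>) * y ^ q" by (simp add: algebra_simps eq_neg_iff_add_eq_0)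
  have "hform q t v = H v + (t - \<tau>) * (v $ 1 * v $ 2 ^ q - y ^ q * (v $ 2 * v $ 3 ^ q))" for v
    unfolding H_hform hform_def d by (simp add: algebra_simps)
  then show ?thesis using t(2) T1 unfolding T_def by blast
qed

lemma power_q_inj: "u ^ q = v ^ q \<Longrightarrow> u = v" for u v :: 'k
proof -
  assume "u ^ q = v ^ q"
  then have "(u - v) ^ q = 0" by (simp add: frobenius_diff)
  then show ?thesis by simp
qed

lemma param_props:
  assumes "g ^ N \<in> Yr"
  shows "g \<noteq> 0" "g ^ M = 1" "H (gpt q g) = 0" "gpt q g $ i \<noteq> 0"
    "(g ^ N) ^ q \<noteq> 0" "poly Z ((g ^ N) ^ q) \<noteq> 0" "g ^ (Q + 1) \<in> fiber ((g ^ N) ^ q)"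
    "gpt q g = pt ((g ^ N) ^ q) (g ^ (Q + 1))"
proof -
  show g0: "g \<noteq> 0" using Yr_nz[OF assms] N_pos by (auto simp: power_0_left)
  show "g ^ M = 1" unfolding M_factor power_mult using Yr_root[OF assms] by simp
  show h: "H (gpt q g) = 0" using assms unfolding H_hform hform_gpt Yr_def by simp
  show nz: "gpt q g $ i \<noteq> 0" for i using g0 exhaust_3[of i] by (auto simp: gpt_nth)
  note s = pt_surj[OF nz h, unfolded gpt_coords gpt_nth]
  show "(g ^ N) ^ q \<noteq> 0" "poly Z ((g ^ N) ^ q) \<noteq> 0" "g ^ (Q + 1) \<in> fiber ((g ^ N) ^ q)" using s by auto
  show "gpt q g = pt ((g ^ N) ^ q) (g ^ (Q + 1))" using s(1) by simp
qed

lemma CC_Pi: "CC \<inter> Pi_plane q = (\<lambda>g. proj_point (gpt q g)) ` {g. g ^ N \<in> Yr}"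
proof (intro equalityI subsetI)
  fix P assume "P \<in> CC \<inter> Pi_plane q"
  then obtain g where g: "g ^ M = 1" "P = proj_point (gpt q g)" "P \<in> CC" unfolding Pi_eq by blast
  have g0: "g \<noteq> 0" using g(1) by (auto simp: M_def)
  have "H (gpt q g) = 0" using g(2,3) self_proj_point unfolding CC_def by blast
  then have "g ^ N \<in> Yr" using g0 unfolding H_hform hform_gpt Yr_def by simp
  then show "P \<in> (\<lambda>g. proj_point (gpt q g)) ` {g. g ^ N \<in> Yr}" using g(2) by blast
next
  fix P assume "P \<in> (\<lambda>g. proj_point (gpt q g)) ` {g. g ^ N \<in> Yr}"
  then obtain g where g: "g ^ N \<in> Yr" "P = proj_point (gpt q g)" by blast
  note p = param_props[OF g(1)]
  have "gpt q g \<noteq> 0" using p(4)[of 1] by auto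
  then show "P \<in> CC \<inter> Pi_plane q" using proj_point_CC p g(2) unfolding Pi_eq by blast
qed

lemma card_params:
  assumes "S \<subseteq> Yr"
  shows "card {g::'k. g ^ N \<in> S} = card S * N" "finite {g::'k. g ^ N \<in> S}"
proof -
  have fin: "finite S" using assms finite_Yr finite_subset by blast
  have card1: "card {g. g ^ N = y} = N" if "y \<in> S" for y
    using that assms Yr_nz of_nat_N N_pos by (intro card_nth_roots) auto
  have fin1: "finite {g. g ^ N = y}" if "y \<in> S" for y
    using card1[OF that] N_pos by (metis card.infinite less_not_refl)
  have eq: "{g. g ^ N \<in> S} = (\<Union>y\<in>S. {g. g ^ N = y})" by auto
  show "finite {g::'k. g ^ N \<in> S}" unfolding eq using fin fin1 by blast
  show "card {g::'k. g ^ N \<in> S} = card S * N"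
    unfolding eq by (subst card_UN_disjoint) (use fin fin1 card1 in auto)
qed

text \<open>On the \<open>N\<close> parameters of an orbit \<open>g ^ (Q + 1)\<close> equals
  \<open>g ^ q * y\<close>, so it is injective, and the fiber has \<open>N\<close> elements too.
  Thus all geometric points over \<open>x = y ^ q\<close> lie in \<Pi>.\<close>

lemma fiber_param:
  assumes y: "y \<in> Yr" and u: "u \<in> fiber (y ^ q)"
  shows "\<exists>g. g ^ N = y \<and> g ^ (Q + 1) = u"
proof -
  have cards: "card {g::'k. g ^ N = y} = N" "finite {g::'k. g ^ N = y}" using card_params[of "{y}"] y by auto
  obtain g0 where "g0 ^ N = y" using nth_root_exists[OF N_pos] by blast
  then have d: "y ^ q \<noteq> 0" "poly Z (y ^ q) \<noteq> 0" using param_props(5,6)[of g0] y by auto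
  have "inj_on (\<lambda>g. g ^ (Q + 1)) {g. g ^ N = y}"
  proof (rule inj_onI)
    fix g h assume "g \<in> {g. g ^ N = y}" "h \<in> {g. g ^ N = y}" "g ^ (Q + 1) = h ^ (Q + 1)"
    then have "g ^ q = h ^ q" using Yr_nz[OF y] unfolding exps(1) power_add by simp
    then show "g = h" by (rule power_q_inj)
  qed
  then have 1: "card ((\<lambda>g. g ^ (Q + 1)) ` {g. g ^ N = y}) = N" using cards by (simp add: card_image)
  have 2: "(\<lambda>g. g ^ (Q + 1)) ` {g. g ^ N = y} \<subseteq> fiber (y ^ q)" using param_props(7) y by auto
  have 3: "finite (fiber (y ^ q))" using card_fiber[OF d] N_pos by (metis card.infinite less_not_refl)
  have "(\<lambda>g. g ^ (Q + 1)) ` {g. g ^ N = y} = fiber (y ^ q)"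
    by (rule card_subset_eq[OF 3 2 trans[OF 1 card_fiber[OF d, symmetric]]])
  with u have "u \<in> (\<lambda>g. g ^ (Q + 1)) ` {g. g ^ N = y}" by (simp only:)
  then obtain g where "u = g ^ (Q + 1)" "g \<in> {g. g ^ N = y}" by (rule imageE)
  then show ?thesis by (intro exI[of _ g]) simp
qed

lemma mu_beta: "mu = (\<lambda>k. \<beta> ^ k) ` {..<N}"
proof -
  have "inj_on (\<lambda>k. \<beta> ^ k) {..<N}"
  proof (rule linorder_inj_onI)
    fix i j assume ij: "i < j" "i \<in> {..<N}" "j \<in> {..<N}"
    have "\<beta> ^ j = \<beta> ^ i * \<beta> ^ (j - i)" using ij by (simp flip: power_add)
    moreover have "\<beta> ^ (j - i) \<noteq> 1" using beta_props(3)[of "j - i"] ij by auto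
    ultimately show "\<beta> ^ i \<noteq> \<beta> ^ j" using beta_props(2) by auto
  qed auto
  then have "card ((\<lambda>k. \<beta> ^ k) ` {..<N}) = N" by (simp add: card_image)
  moreover have "(\<lambda>k. \<beta> ^ k) ` {..<N} \<subseteq> mu"
    using beta_props(1) by (auto simp: mu_def power_comm[of \<beta> _ N])
  ultimately show ?thesis using card_subset_eq[OF finite_mu] card_mu by metis
qed

text \<open>Because \<open>\<beta> ^ (Q + 1) = \<beta> ^ q\<close>, the generator multiplies the
  parameter \<open>g\<close> by \<beta>.\<close>

lemma singer_orbit_eq:
  assumes "g0 ^ N \<in> Yr"
  shows "singer_orbit q \<beta> (proj_point (gpt q g0)) = (\<lambda>g. proj_point (gpt q g)) ` {g. g ^ N = g0 ^ N}"
proof -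
  have "\<beta> ^ (Q + 1) = \<beta> ^ q" unfolding exps(1) power_add using beta_props(1) by simp
  then have step: "singer_matrix q \<beta> *v gpt q g = gpt q (\<beta> * g)" for g
    by (simp add: vec_eq_iff forall_3 matrix_vector_mult_def sum_3 singer_matrix_def vector_3 gpt_nth power_mult_distrib)
  have pw: "(proj_map (singer_matrix q \<beta>) ^^ k) (proj_point (gpt q g0)) = proj_point (gpt q (\<beta> ^ k * g0))" for k
    by (induction k) (simp_all add: proj_map_proj_point step mult.assoc)
  have "range (\<lambda>k. \<beta> ^ k * g0) = {g. g ^ N = g0 ^ N}"
  proof (intro equalityI subsetI)
    fix g assume "g \<in> range (\<lambda>k. \<beta> ^ k * g0)"
    then show "g \<in> {g. g ^ N = g0 ^ N}"
      using beta_props(1) by (auto simp: power_mult_distrib power_comm[of \<beta> _ N])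
  next
    fix g assume g: "g \<in> {g. g ^ N = g0 ^ N}"
    have g0: "g0 \<noteq> 0" by (rule param_props(1)[OF assms])
    then have "g / g0 \<in> mu" using g by (simp add: mu_def power_divide)
    then obtain k where "g / g0 = \<beta> ^ k" unfolding mu_beta by blast
    then have "g = \<beta> ^ k * g0" using g0 by (simp add: field_simps)
    then show "g \<in> range (\<lambda>k. \<beta> ^ k * g0)" by blast
  qed
  from arg_cong[OF this, of "(`) (\<lambda>g. proj_point (gpt q g))"] show ?thesis
    unfolding singer_orbit_def pw by (simp add: image_image)
qed

text \<open>The Hermitian curve cutting out, apart from the coordinate points, the orbit labelled \<open>y\<close>,
  with an equation scaled to be rational over \<open>\<Pi>\<close>.\<close>

lemma orbit_form:
  assumes y: "y \<in> Yr"
  shows "\<exists>h \<kappa>. h \<in> forms UNIV (q + 1) \<and> (\<forall>v. h (phi q v) = h v ^ Q) \<and> \<kappa> \<noteq> 0 \<and>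
     (\<forall>v. H v = 0 \<longrightarrow> h v = \<kappa> * (v $ 1 * v $ 2 ^ q - y ^ q * (v $ 2 * v $ 3 ^ q)))"
proof -
  obtain t where t: "t \<noteq> \<tau>" "t ^ (Q + q + 1) = 1"
    "\<And>v. hform q t v = H v + (t - \<tau>) * (v $ 1 * v $ 2 ^ q - y ^ q * (v $ 2 * v $ 3 ^ q))"
    using other_hermitian[OF y] by blast
  have Q1: "Q - 1 > 0" using q2 power_strict_mono[of 1 q 2] by simp
  then obtain m where m: "m ^ (Q - 1) = t" using nth_root_exists by blast
  have "t \<noteq> 0" using t(2) by (auto simp: power_0_left)
  then have m0: "m \<noteq> 0" using m Q1 by (auto simp: power_0_left)
  have mQ: "m ^ Q = m * t" using m Q_pos by (metis power_eq_if neq0_conv)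
  define h where "h v = m * hform q t v" for v
  have qf: "(\<lambda>v::'k^3. v $ i ^ q) \<in> forms UNIV q" for i using forms_power[OF forms_coord, of i q] by simp
  have "(\<lambda>v::'k^3. (t * (v $ 1 * v $ 2 ^ q) + t ^ (Q + 1) * (v $ 2 * v $ 3 ^ q)) + v $ 3 * v $ 1 ^ q) \<in> forms UNIV (1 + q)"
    by (intro forms_add forms_cmult forms_mult forms_coord qf)
  then have "hform q t \<in> forms UNIV (q + 1)" by (simp add: hform_def[abs_def] mult.assoc)
  then have 1: "h \<in> forms UNIV (q + 1)" unfolding h_def[abs_def] by (rule forms_cmult)
  have "h (phi q v) = h v ^ Q" for v
    unfolding h_def phi_hform[OF t(2)] power_mult_distrib mQ by simp
  moreover have "m * (t - \<tau>) \<noteq> 0" using m0 t(1) by simp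
  ultimately show ?thesis using 1 t(3) by (intro exI[of _ h] exI[of _ "m * (t - \<tau>)"]) (simp add: h_def)
qed

definition oform :: "'k \<Rightarrow> 'k ^ 3 \<Rightarrow> 'k" where
  "oform y = (SOME h. \<exists>\<kappa>. h \<in> forms UNIV (q + 1) \<and> (\<forall>v. h (phi q v) = h v ^ Q) \<and> \<kappa> \<noteq> 0 \<and>
     (\<forall>v. H v = 0 \<longrightarrow> h v = \<kappa> * (v $ 1 * v $ 2 ^ q - y ^ q * (v $ 2 * v $ 3 ^ q))))"

definition oconst :: "'k \<Rightarrow> 'k" where
  "oconst y = (SOME \<kappa>. \<kappa> \<noteq> 0 \<and> (\<forall>v. H v = 0 \<longrightarrow> oform y v = \<kappa> * (v $ 1 * v $ 2 ^ q - y ^ q * (v $ 2 * v $ 3 ^ q))))"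

lemma oform_props:
  assumes "y \<in> Yr"
  shows "oform y \<in> forms UNIV (q + 1)" "oform y (phi q v) = oform y v ^ Q" "oconst y \<noteq> 0"
    "H v = 0 \<Longrightarrow> oform y v = oconst y * (v $ 1 * v $ 2 ^ q - y ^ q * (v $ 2 * v $ 3 ^ q))"
proof -
  have *: "\<exists>\<kappa>. oform y \<in> forms UNIV (q + 1) \<and> (\<forall>v. oform y (phi q v) = oform y v ^ Q) \<and> \<kappa> \<noteq> 0 \<and>
     (\<forall>v. H v = 0 \<longrightarrow> oform y v = \<kappa> * (v $ 1 * v $ 2 ^ q - y ^ q * (v $ 2 * v $ 3 ^ q)))"
    unfolding oform_def by (rule someI_ex[OF orbit_form[OF assms]])
  then show "oform y \<in> forms UNIV (q + 1)" "oform y (phi q v) = oform y v ^ Q" by blast+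
  have "\<exists>\<kappa>. \<kappa> \<noteq> 0 \<and> (\<forall>v. H v = 0 \<longrightarrow> oform y v = \<kappa> * (v $ 1 * v $ 2 ^ q - y ^ q * (v $ 2 * v $ 3 ^ q)))"
    using * by blast
  from someI_ex[OF this, folded oconst_def] show "oconst y \<noteq> 0"
    "H v = 0 \<Longrightarrow> oform y v = oconst y * (v $ 1 * v $ 2 ^ q - y ^ q * (v $ 2 * v $ 3 ^ q))" by blast+
qed

lemma oform_value:
  assumes "y \<in> Yr" "H v = 0" "\<And>i. v $ i \<noteq> 0"
  shows "oform y v = oconst y * (v $ 2 * v $ 3 ^ q) * (x v - y ^ q)"
  unfolding oform_props(4)[OF assms(1,2)] using assms(3)[of 3]
  by (simp add: x_coord_def power_q_split[of "v $ 2"] algebra_simps)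

lemma ev_oform:
  assumes y: "y \<in> Yr" and w: "generic w"
  shows "ev (oform y) w = fls_const (oconst y) * (w $ 2 * w $ 3 ^ q) * (x w - fls_const (y ^ q))"
proof -
  have qf: "(\<lambda>v::'k^3. v $ i ^ q) \<in> forms UNIV q" for i using forms_power[OF forms_coord, of i q] by simp
  define r where "r v = v $ 1 * v $ 2 ^ q - y ^ q * (v $ 2 * v $ 3 ^ q)" for v :: "'k ^ 3"
  have f1: "(\<lambda>v::'k^3. v $ 1 * v $ 2 ^ q) \<in> forms UNIV (1 + q)" "(\<lambda>v::'k^3. v $ 2 * v $ 3 ^ q) \<in> forms UNIV (1 + q)"
    by (intro forms_mult forms_coord qf)+
  have r: "r \<in> forms UNIV (1 + q)" unfolding r_def[abs_def] by (intro forms_diff forms_cmult f1)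
  have o: "oform y \<in> forms UNIV (1 + q)" using oform_props(1)[OF y] by (simp add: add.commute)
  have "ev (\<lambda>v. oform y v - oconst y * r v) w = 0"
    using ev_eq_0_iff[OF forms_diff[OF o forms_cmult[OF r]] w] oform_props(4)[OF y] by (simp add: r_def)
  then have "ev (oform y) w = fls_const (oconst y) * ev r w"
    using ev_diff[OF o forms_cmult[OF r] w] ev_cmult[OF r w] by simp
  also have "ev r w = w $ 1 * w $ 2 ^ q - fls_const (y ^ q) * (w $ 2 * w $ 3 ^ q)"
    unfolding r_def[abs_def] ev_diff[OF f1(1) forms_cmult[OF f1(2)] w] ev_cmult[OF f1(2) w]
      ev_mult[OF forms_coord qf w] ev_power[OF forms_coord w] ev_coord[OF w] ..
  also have "\<dots> = w $ 2 * w $ 3 ^ q * (x w - fls_const (y ^ q))"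
    using good_coord[OF generic_good[OF w], of 3]
    by (simp add: x_coord_def power_q_split[of "w $ 2"] algebra_simps)
  finally show ?thesis by (simp add: mult.assoc)
qed

text \<open>Any two curves of the family meet with multiplicity \<open>q\<close> at each coordinate
  point; together with the \<open>N\<close> points of an orbit this exhausts the Bezout number
  \<open>(q + 1) ^ 2 = 3 * q + N\<close>.\<close>

lemma E_oform:
  assumes y: "y \<in> Yr"
  shows "ev (oform y) (E i) \<noteq> 0" "fls_subdegree (ev (oform y) (E i)) = int q"
proof -
  obtain g0 where "g0 ^ N = y" using nth_root_exists[OF N_pos] by blast
  then have d: "y ^ q \<noteq> 0" "poly Z (y ^ q) \<noteq> 0" using param_props(5,6)[of g0] y by auto
  have e: "ev (oform y) (E i) = fls_const (oconst y) * (E i $ 2 * E i $ 3 ^ q) * (x (E i) - fls_const (y ^ q))"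
    by (rule ev_oform[OF y E_props(2)])
  have nz: "E i $ 2 \<noteq> 0" "E i $ 3 \<noteq> 0" "x (E i) - fls_const (y ^ q) \<noteq> 0" "oconst y \<noteq> 0"
    using good_coord[OF E_props(1)] generic_x_minus[OF E_props(2)] oform_props(3)[OF y] by auto
  show "ev (oform y) (E i) \<noteq> 0" unfolding e using nz by simp
  have s: "fls_subdegree (E 3 $ 3) = 0" "fls_subdegree (E 3 $ 2) = int q"
    "fls_subdegree (E 1 $ 2) = 1" "fls_subdegree (E 1 $ 3) = int q"
    "fls_subdegree (E 2 $ 2) = 0" "fls_subdegree (E 2 $ 3) = 1"
    using E_subdegree_coord[of 1] E_subdegree_coord[of 2] E_subdegree_coord[of 3]
    by (simp_all add: index_mod_3)
  have "fls_subdegree (ev (oform y) (E i)) = fls_subdegree (E i $ 2) + int q * fls_subdegree (E i $ 3)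
      + fls_subdegree (x (E i) - fls_const (y ^ q))"
    unfolding e using nz by (simp add: fls_subdegree_pow)
  then show "fls_subdegree (ev (oform y) (E i)) = int q"
    using exhaust_3[of i] s E_x_minus[OF d] int_N by (auto simp: algebra_simps)
qed

end

section \<open>The Riemann-Roch space of a multiple of a Singer orbit\<close>

locale singer_orbit_divisor = singer +
  fixes l :: nat and y0 :: 'a
  assumes l: "2 \<le> l" "l \<le> q - 1" and y0: "y0 \<in> Yr"
begin

definition G where "G = (\<lambda>g. proj_point (gpt q g)) ` {g::'a. g ^ N = y0}"
definition cc where "cc = y0 ^ q"
definition B0 where "B0 v = oform y0 v ^ l"
definition DG where "DG P = int l * indicator G P"

text \<open>Admissible numerators over the common denominator \<open>B0\<close>: rational over
  \<Pi>, of the degree of \<open>B0\<close>, and vanishing at the coordinate points at least to the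
  order \<open>q * l\<close> that \<open>B0\<close> has there.\<close>

definition ratl :: "('a ^ 3 \<Rightarrow> 'a) \<Rightarrow> bool" where
  "ratl F \<longleftrightarrow> F \<in> forms UNIV (l * (q + 1)) \<and> (\<forall>v. F (phi q v) = F v ^ Q) \<and>
     (\<forall>i. ev F (E i) = 0 \<or> fls_subdegree (ev F (E i)) \<ge> int (q * l))"

lemma cc_props: "cc \<noteq> 0" "poly Z cc \<noteq> 0"
proof -
  obtain g0 where "g0 ^ N = y0" using nth_root_exists[OF N_pos] by blast
  then show "cc \<noteq> 0" "poly Z cc \<noteq> 0" using param_props(5,6)[of g0] y0 by (auto simp: cc_def)
qed

lemma x_scale:
  assumes "a \<noteq> 0"
  shows "x (a *s v) = x v"
proof -
  have e: "(a * v $ 1) * (a * v $ 2) ^ (q - 1) = a ^ q * (v $ 1 * v $ 2 ^ (q - 1))"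
    by (simp add: power_mult_distrib power_q_split[of a] mult_ac)
  show ?thesis unfolding x_coord_def vector_smult_component e using assms by (simp add: power_mult_distrib)
qed

lemma G_nonzero_coord: "proj_point v \<in> G \<Longrightarrow> v $ i \<noteq> 0"
  and G_x: "proj_point v \<in> G \<Longrightarrow> x v = cc"
proof -
  assume "proj_point v \<in> G"
  then obtain g where g: "proj_point v = proj_point (gpt q g)" "g ^ N = y0" unfolding G_def by blast
  note p = param_props[of g, unfolded g(2), OF y0]
  have "gpt q g \<in> proj_point v" using g(1) self_proj_point by metis
  then obtain a where a: "gpt q g = a *s v" using proj_point_iff by blast
  have "a \<noteq> 0" using p(4)[of 1] unfolding a by auto
  then have "x v = x (gpt q g)" unfolding a by (simp add: x_scale)
  then show "x v = cc" by (simp add: gpt_coords g(2) cc_def)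
  show "v $ i \<noteq> 0" using p(4)[of i] unfolding a by auto
qed

lemma in_G:
  assumes "\<And>i. v $ i \<noteq> 0" "H v = 0" "x v = cc"
  shows "proj_point v \<in> G"
proof -
  note s = pt_surj[OF assms(1,2), unfolded assms(3)]
  have "b v \<in> fiber (y0 ^ q)" using s(4) by (simp add: cc_def)
  from fiber_param[OF y0 this] obtain g where g: "g ^ N = y0" "g ^ (Q + 1) = b v" by blast
  have "gpt q g = pt cc (b v)" using param_props(8)[of g] y0 g by (simp add: cc_def)
  then have "proj_point v = proj_point (gpt q g)" using s(1) proj_point_scale[OF assms(1)[of 3]] by metis
  then show ?thesis using g unfolding G_def by blast
qed

lemma B0_form: "B0 \<in> forms UNIV (l * (q + 1))"
  unfolding B0_def[abs_def] by (rule forms_power[OF oform_props(1)[OF y0]])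

lemma ev_B0: "generic w \<Longrightarrow> ev B0 w = ev (oform y0) w ^ l"
  unfolding B0_def[abs_def] by (rule ev_power[OF oform_props(1)[OF y0]])

lemma ev_B0_nz: "generic w \<Longrightarrow> ev B0 w \<noteq> 0"
  using ev_B0 ev_oform[OF y0] oform_props(3)[OF y0] generic_x_minus good_coord[OF generic_good] by simp

lemma frac_mem:
  assumes "F \<in> forms UNIV (l * (q + 1))"
  shows "(F, B0) \<in> fractions CC"
  using fractions_iff[OF E_props(2)[of 1]] assms B0_form ev_B0_nz[OF E_props(2)[of 1]] by blast

lemma oform_subdegree:
  assumes "\<And>i. v $ i \<noteq> 0" "H v = 0"
  shows "fls_subdegree (ev (oform y0) (expn 3 v)) = (if x v = cc then 1 else 0)"
proof -
  define w where "w = expn 3 v"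
  have w: "generic w" unfolding w_def by (rule generic_expn) (use assms in auto)
  have r: "has_residue (w $ j) (v $ j / v $ 3)" for j unfolding w_def using expn_props(4) assms by blast
  have nz: "w $ 2 \<noteq> 0" "w $ 3 \<noteq> 0" "x w - fls_const (y0 ^ q) \<noteq> 0" "oconst y0 \<noteq> 0"
    using good_coord[OF generic_good[OF w]] generic_x_minus[OF w] oform_props(3)[OF y0] by auto
  have "fls_subdegree (w $ 2) = 0" "fls_subdegree (w $ 3) = 0"
    using has_residue_nz(2)[OF r[of 2]] has_residue_nz(2)[OF r[of 3]] assms(1) by auto
  then have 1: "fls_subdegree (ev (oform y0) w) = fls_subdegree (x w - fls_const (y0 ^ q))"
    unfolding ev_oform[OF y0 w] using nz by (simp add: fls_subdegree_pow)
  show ?thesis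
  proof (cases "x v = cc")
    case True
    then show ?thesis using unramified[OF assms] 1 by (simp add: w_def cc_def)
  next
    case False
    have "has_residue (x w - fls_const (y0 ^ q)) (x v - y0 ^ q)"
      unfolding w_def by (intro has_residue_diff has_residue_const expn3_residues assms)
    then show ?thesis using has_residue_nz(2) False 1 by (fastforce simp: w_def cc_def)
  qed
qed

lemma curve_pointI: "H v = 0 \<Longrightarrow> v $ i \<noteq> 0 \<Longrightarrow> curve_point q cf v i"
  by unfold_locales

lemma order_at_expn:
  assumes "H v = 0" "v $ i \<noteq> 0" "f \<in> carrier K" "f \<noteq> \<zero>\<^bsub>K\<^esub>"
  shows "order_at CC (proj_point v) f = fls_subdegree (fv (expn i v) f)"
proof -
  interpret cp: curve_point q cf v i using assms(1,2) by (rule curve_pointI)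
  show ?thesis using cp.order_at_eq[OF assms(3,4)] by (simp add: cp.w_def)
qed

lemma CC_cases:
  assumes "P \<in> CC"
  obtains (generic) v where "P = proj_point v" "H v = 0" "\<And>i. v $ i \<noteq> 0"
  | (axis) i where "P = proj_point (axis i 1)"
proof -
  obtain v i where v: "P = proj_point v" "H v = 0" "v $ i \<noteq> 0" using CC_E[OF assms] by blast
  show ?thesis
  proof (cases "\<forall>j. v $ j \<noteq> 0")
    case True
    then show ?thesis using generic v by blast
  next
    case False
    then obtain j where "v $ j = 0" by blast
    then have "v = v $ i *s axis i 1" using coordinate_point v by blast
    then have "P = proj_point (axis i 1)" using v(1,3) proj_point_scale by metis
    then show ?thesis by (rule axis)
  qed
qed

lemma rr_member:
  assumes F: "ratl F"
  shows "fraction CC F B0 \<in> riemann_roch_space q CC DG"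
proof -
  have Ff: "F \<in> forms UNIV (l * (q + 1))" "\<And>v. F (phi q v) = F v ^ Q" using F by (auto simp: ratl_def)
  note mem = frac_mem[OF Ff(1)]
  define f where "f = fraction CC F B0"
  have f: "f \<in> carrier K" "\<And>w. generic w \<Longrightarrow> fv w f = ev F w / ev B0 w"
    using fv_fraction[OF _ mem] E_props(2) unfolding f_def by blast+
  have "(F, B0) \<in> f" unfolding f_def using fraction_eq[OF E_props(2)[of 1] mem] mem by blast
  moreover have "B0 (phi q v) = B0 v ^ Q" for v
    unfolding B0_def oform_props(2)[OF y0] by (simp add: mult.commute flip: power_mult)
  ultimately have "defined_over_Pi q f" using defined_over_Pi_I[OF Ff(1) B0_form] Ff(2) by blast
  moreover have "principal_divisor CC f P + DG P \<ge> 0" if nz: "f \<noteq> \<zero>\<^bsub>K\<^esub>" for P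
  proof (cases "P \<in> CC")
    case False
    then show ?thesis by (simp add: principal_divisor_def DG_def)
  next
    case True
    have evF: "ev F w \<noteq> 0" if "generic w" for w
      using fv_eq_0_iff[OF f(1) that] nz f(2)[OF that] by auto
    have sub: "fls_subdegree (fv w f) = fls_subdegree (ev F w) - int l * fls_subdegree (ev (oform y0) w)"
      if w: "generic w" for w
      unfolding f(2)[OF w] using evF[OF w] ev_B0_nz[OF w]
      by (simp add: fls_divide_subdegree ev_B0[OF w] fls_subdegree_pow)
    from True show ?thesis
    proof (cases rule: CC_cases)
      case (generic v)
      interpret cp: curve_point q cf v 3 using generic by (intro curve_pointI) auto
      have o: "order_at CC P f = fls_subdegree (fv (expn 3 v) f)"
        unfolding generic(1) by (rule order_at_expn) (use generic f nz in auto)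
      have w: "local.generic (expn 3 v)" by (rule generic_expn) (use generic in auto)
      have "fls_subdegree (ev F (expn 3 v)) \<ge> 0"
        using has_residue_subdegree_nonneg[OF cp.residue_form[OF Ff(1)]] by (simp add: cp.w_def)
      moreover have "x v = cc \<Longrightarrow> P \<in> G" using in_G generic by blast
      ultimately show ?thesis
        using True o sub[OF w] oform_subdegree[OF generic(3,2)]
        by (auto simp: principal_divisor_def DG_def)
    next
      case (axis i)
      have o: "order_at CC P f = fls_subdegree (fv (E i) f)"
        unfolding axis E_def by (rule order_at_expn) (use H_axis f nz in auto)
      have "fls_subdegree (ev F (E i)) \<ge> int (q * l)" using F evF[OF E_props(2)] by (auto simp: ratl_def)
      then have "order_at CC P f \<ge> 0"
        unfolding o sub[OF E_props(2)] E_oform(2)[OF y0] by (simp add: mult.commute)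
      then show ?thesis using True by (simp add: principal_divisor_def DG_def)
    qed
  qed
  ultimately show ?thesis
    unfolding riemann_roch_space_def f_def[symmetric] using f(1) by blast
qed

lemma param_x_ne: "g ^ N \<in> Yr - {y0} \<Longrightarrow> x (gpt q g) \<noteq> cc"
  unfolding gpt_coords cc_def using power_q_inj by auto

lemma B0_value_nz:
  assumes "g ^ N \<in> Yr - {y0}"
  shows "B0 (gpt q g) \<noteq> 0"
proof -
  have g: "g ^ N \<in> Yr" using assms by simp
  note p = param_props[OF g]
  have "oform y0 (gpt q g) \<noteq> 0"
    unfolding oform_value[OF y0 p(3,4)] using oform_props(3)[OF y0] p(4) param_x_ne[OF assms]
    by (simp add: cc_def)
  then show ?thesis by (simp add: B0_def)
qed

lemma rr_value:
  assumes F: "F \<in> forms UNIV (l * (q + 1))" and g: "g ^ N \<in> Yr - {y0}"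
  shows "value_at (proj_point (gpt q g)) (fraction CC F B0) = F (gpt q g) / B0 (gpt q g)"
proof -
  have gY: "g ^ N \<in> Yr" using g by simp
  note p = param_props[OF gY]
  interpret cp: curve_point q cf "gpt q g" 3 using p by (intro curve_pointI) auto
  note mem = frac_mem[OF F]
  have "fraction CC F B0 \<in> carrier K" using fv_fraction(1)[OF E_props(2)[of 1] mem] .
  moreover have "(F, B0) \<in> fraction CC F B0" using fraction_eq[OF E_props(2)[of 1] mem] mem by blast
  ultimately show ?thesis using cp.value_at_quotient B0_value_nz[OF g] by blast
qed

lemma has_residue_kmon:
  assumes "\<And>i. v $ i \<noteq> 0" "H v = 0"
  shows "has_residue (kmon q k (expn 3 v)) (kmon q k v)"
proof -
  have "x v \<noteq> 0" using assms(1) by (simp add: x_coord_def)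
  then show ?thesis unfolding kmon_def
    by (intro has_residue_mult has_residue_power has_residue_powi expn3_residues assms)
qed

text \<open>Turns the identity of Laurent series from \<open>rr_upper\<close> into one between
  values at the remaining points of \<Pi>, by taking residues of both sides.\<close>

lemma rr_elements:
  assumes f: "f \<in> riemann_roch_space q CC DG"
  shows "\<exists>p. (\<forall>k<N. \<forall>j\<ge>dimk l k. coeff (p k) j = 0) \<and>
    (\<forall>g. g ^ N \<in> Yr - {y0} \<longrightarrow>
      value_at (proj_point (gpt q g)) f ^ Q = value_at (proj_point (gpt q g)) f \<and>
      value_at (proj_point (gpt q g)) f * (x (gpt q g) - cc) ^ l
        = (\<Sum>k<N. poly (p k) (x (gpt q g)) * kmon q k (gpt q g)))"
proof -
  have fK: "f \<in> carrier K" "defined_over_Pi q f"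
    and div: "f = \<zero>\<^bsub>K\<^esub> \<or> (\<forall>P. principal_divisor CC f P + DG P \<ge> 0)"
    using f by (auto simp: riemann_roch_space_def)
  have ord: "fls_subdegree (fv (expn i v) f) \<ge> (if proj_point v \<in> G then - int l else 0)"
    if "H v = 0" "v $ i \<noteq> 0" for v i
  proof (cases "f = \<zero>\<^bsub>K\<^esub>")
    case True
    then show ?thesis using zero_K(2)[OF generic_expn[OF that]] by simp
  next
    case False
    have "v \<noteq> 0" using that(2) by auto
    then have "proj_point v \<in> CC" using proj_point_CC that(1) by blast
    moreover have "principal_divisor CC f (proj_point v) + DG (proj_point v) \<ge> 0" using div False by blast
    ultimately show ?thesis
      using order_at_expn[OF that fK(1) False] by (auto simp: principal_divisor_def DG_def split: if_splits)
  qed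
  have "\<exists>p. (\<forall>k<N. \<forall>j\<ge>dimk l k. coeff (p k) j = 0) \<and>
     (\<forall>w. generic w \<longrightarrow> fv w f * (x w - fls_const cc) ^ l = (\<Sum>k<N. evalp (p k) (x w) * kmon q k w))"
  proof (cases "f = \<zero>\<^bsub>K\<^esub>")
    case True
    then show ?thesis using zero_K(2) by (intro exI[of _ "\<lambda>_. 0"]) simp
  next
    case False
    show ?thesis
    proof (rule rr_upper[OF fK(1) False cc_props])
      fix i
      have "proj_point (axis i 1) \<notin> G" using G_nonzero_coord[of "axis i 1" "i + 1"] by (auto simp: axis_def index_distinct)
      then show "fls_subdegree (fv (E i) f) \<ge> 0" using ord[OF H_axis, of i i] by (simp add: E_def)
    next
      fix d y assume d: "d \<noteq> 0" "poly Z d \<noteq> 0" "y \<in> fiber d"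
      note p = pt_props[OF d]
      have "proj_point (pt d y) \<in> G \<Longrightarrow> d = cc" using G_x p(4) by metis
      then show "fls_subdegree (fv (expn 3 (pt d y)) f) \<ge> (if d = cc then - int l else 0)"
        using ord[OF p(3,2), of 3] by (auto split: if_splits)
    qed
  qed
  then obtain p where p: "\<forall>k<N. \<forall>j\<ge>dimk l k. coeff (p k) j = 0"
     "\<And>w. generic w \<Longrightarrow> fv w f * (x w - fls_const cc) ^ l = (\<Sum>k<N. evalp (p k) (x w) * kmon q k w)" by blast
  have "value_at (proj_point (gpt q g)) f ^ Q = value_at (proj_point (gpt q g)) f \<and>
      value_at (proj_point (gpt q g)) f * (x (gpt q g) - cc) ^ l
        = (\<Sum>k<N. poly (p k) (x (gpt q g)) * kmon q k (gpt q g))" if g: "g ^ N \<in> Yr - {y0}" for g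
  proof -
    define v where "v = gpt q g"
    have gY: "g ^ N \<in> Yr" using g by simp
    note pp = param_props[OF gY, folded v_def]
    interpret cp: curve_point q cf v 3 using pp by (intro curve_pointI) auto
    have "proj_point v \<notin> G" using G_x param_x_ne[OF g] by (auto simp: v_def)
    then have reg: "fls_subdegree (fv cp.w f) \<ge> 0" using ord[OF pp(3,4)] by (simp add: cp.w_def)
    have "regular_at (proj_point v) f" using cp.regular_iff[OF fK(1)] reg by blast
    then have 1: "value_at (proj_point v) f ^ Q = value_at (proj_point v) f"
      using value_rational[OF fK param_props(2,3)[OF gY]] unfolding v_def by blast
    have r: "has_residue (fv cp.w f) (value_at (proj_point v) f)" by (rule cp.value_at_eq[OF fK(1) reg])
    have "has_residue (fv cp.w f * (x cp.w - fls_const cc) ^ l) (value_at (proj_point v) f * (x v - cc) ^ l)"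
      unfolding cp.w_def
      by (intro has_residue_mult has_residue_power has_residue_diff has_residue_const expn3_residues pp
          r[unfolded cp.w_def])
    moreover have "has_residue (\<Sum>k<N. evalp (p k) (x cp.w) * kmon q k cp.w) (\<Sum>k<N. poly (p k) (x v) * kmon q k v)"
      unfolding cp.w_def by (intro has_residue_sum has_residue_mult has_residue_evalp expn3_residues has_residue_kmon pp)
    ultimately have "value_at (proj_point v) f * (x v - cc) ^ l = (\<Sum>k<N. poly (p k) (x v) * kmon q k v)"
      using p(2)[OF cp.w_generic] has_residue_unique by metis
    then show ?thesis using 1 by (simp add: v_def)
  qed
  then show ?thesis using p(1) by blast
qed

section \<open>Monomial generators\<close>

text \<open>The three inequalities are the conditions of order at least \<open>q * l\<close> at
  \<open>E 3\<close>, \<open>E 1\<close> and \<open>E 2\<close>. They are permuted by the cyclic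
  shift of exponents that \<open>phi\<close> induces.\<close>

definition triangle :: "nat \<Rightarrow> nat \<Rightarrow> nat \<Rightarrow> bool" where
  "triangle i j k \<longleftrightarrow> i + j + k = l * (q + 1) \<and> q * l \<le> i + q * j \<and> q * l \<le> j + q * k \<and> q * l \<le> k + q * i"

definition mon3 :: "nat \<Rightarrow> nat \<Rightarrow> nat \<Rightarrow> 'a ^ 3 \<Rightarrow> 'a" where
  "mon3 i j k v = v $ 1 ^ i * v $ 2 ^ j * v $ 3 ^ k"

lemma lifts_mon3: "lifts (i + j + k) (mon3 i j k) (\<lambda>w. w $ 1 ^ i * w $ 2 ^ j * w $ 3 ^ k)"
  using lifts_monom[of i j k "i + j + k" 1] by (simp add: mon3_def[abs_def])

lemma triangle_form: "triangle i j k \<Longrightarrow> mon3 i j k \<in> forms UNIV (l * (q + 1))"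
  using lifts_mon3[of i j k] unfolding forms_iff_lifts triangle_def by metis

lemma triangle_subdegree:
  assumes "triangle i j k"
  shows "fls_subdegree (ev (mon3 i j k) (E m)) \<ge> int (q * l)"
proof -
  have e: "ev (mon3 i j k) (E m) = E m $ 1 ^ i * E m $ 2 ^ j * E m $ 3 ^ k"
    using ev_eq[OF lifts_mon3 E_props(2)] .
  have s: "fls_subdegree (ev (mon3 i j k) (E m)) = int i * fls_subdegree (E m $ 1) + int j * fls_subdegree (E m $ 2)
     + int k * fls_subdegree (E m $ 3)"
    unfolding e using good_coord[OF E_props(1)] by (simp add: fls_subdegree_pow)
  have c: "fls_subdegree (E 3 $ 3) = 0" "fls_subdegree (E 3 $ 1) = 1" "fls_subdegree (E 3 $ 2) = int q"
    "fls_subdegree (E 1 $ 1) = 0" "fls_subdegree (E 1 $ 2) = 1" "fls_subdegree (E 1 $ 3) = int q"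
    "fls_subdegree (E 2 $ 2) = 0" "fls_subdegree (E 2 $ 3) = 1" "fls_subdegree (E 2 $ 1) = int q"
    using E_subdegree_coord[of 1] E_subdegree_coord[of 2] E_subdegree_coord[of 3]
    by (simp_all add: index_mod_3)
  have t: "int (q * l) \<le> int (i + q * j)" "int (q * l) \<le> int (j + q * k)" "int (q * l) \<le> int (k + q * i)"
    using assms unfolding triangle_def of_nat_le_iff by blast+
  show ?thesis using exhaust_3[of m] t unfolding s by (auto simp: c algebra_simps)
qed

lemma triangle_cyclic: "triangle i j k \<Longrightarrow> triangle k i j"
  unfolding triangle_def by auto

lemma mon3_phi: "mon3 k i j (phi q v) = mon3 i j k v ^ Q"
  by (simp add: mon3_def phi_nth power_mult_distrib mult_ac flip: power_mult)

text \<open>The trace of \<open>a X\<^sub>1\<^sup>i X\<^sub>2\<^sup>j X\<^sub>3\<^sup>k\<close> with respect to the Frobenius of \<open>\<Pi>\<close>.\<close>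

definition trform :: "'a \<Rightarrow> nat \<Rightarrow> nat \<Rightarrow> nat \<Rightarrow> 'a ^ 3 \<Rightarrow> 'a" where
  "trform a i j k v = a * mon3 i j k v + a ^ Q * mon3 k i j v + (a ^ Q) ^ Q * mon3 j k i v"

lemma ratl_trform:
  assumes t: "triangle i j k" and a: "((a ^ Q) ^ Q) ^ Q = a"
  shows "ratl (trform a i j k)"
proof -
  note t2 = triangle_cyclic[OF t] and t3 = triangle_cyclic[OF triangle_cyclic[OF t]]
  note f = triangle_form[OF t] triangle_form[OF t2] triangle_form[OF t3]
  have 1: "trform a i j k \<in> forms UNIV (l * (q + 1))"
    unfolding trform_def[abs_def] by (intro forms_add forms_cmult f)
  have 2: "trform a i j k (phi q v) = trform a i j k v ^ Q" for v
    unfolding trform_def frobenius_Q power_mult_distrib mon3_phi a by (simp add: add_ac)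
  have 3: "fls_subdegree (ev (trform a i j k) (E m)) \<ge> int (q * l)" if "ev (trform a i j k) (E m) \<noteq> 0" for m
  proof -
    have e: "ev (trform a i j k) (E m) = (\<Sum>s\<in>{0,1,2::nat}. if s = 0 then fls_const a * ev (mon3 i j k) (E m)
      else if s = 1 then fls_const (a ^ Q) * ev (mon3 k i j) (E m) else fls_const ((a ^ Q) ^ Q) * ev (mon3 j k i) (E m))"
      unfolding trform_def[abs_def]
        ev_add[OF forms_add[OF forms_cmult[OF f(1)] forms_cmult[OF f(2)]] forms_cmult[OF f(3)] E_props(2)]
        ev_add[OF forms_cmult[OF f(1)] forms_cmult[OF f(2)] E_props(2)]
        ev_cmult[OF f(1) E_props(2)] ev_cmult[OF f(2) E_props(2)] ev_cmult[OF f(3) E_props(2)]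
      by (simp add: add.assoc)
    have b: "fls_subdegree (fls_const e * ev (mon3 i j k) (E m)) \<ge> int (q * l)"
      if "triangle i j k" "fls_const e * ev (mon3 i j k) (E m) \<noteq> 0" for e i j k
      using triangle_subdegree[OF that(1), of m] that(2) by simp
    show ?thesis
      unfolding e
    proof (rule subdegree_sum_ge)
      show "(\<Sum>s\<in>{0,1,2::nat}. if s = 0 then fls_const a * ev (mon3 i j k) (E m)
      else if s = 1 then fls_const (a ^ Q) * ev (mon3 k i j) (E m) else fls_const ((a ^ Q) ^ Q) * ev (mon3 j k i) (E m)) \<noteq> 0"
        using that unfolding e .
    next
      fix s assume "s \<in> {0,1,2::nat}" and nz: "(if s = 0 then fls_const a * ev (mon3 i j k) (E m)
      else if s = 1 then fls_const (a ^ Q) * ev (mon3 k i j) (E m) else fls_const ((a ^ Q) ^ Q) * ev (mon3 j k i) (E m)) \<noteq> 0"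
      show "int (q * l) \<le> fls_subdegree (if s = 0 then fls_const a * ev (mon3 i j k) (E m)
      else if s = 1 then fls_const (a ^ Q) * ev (mon3 k i j) (E m) else fls_const ((a ^ Q) ^ Q) * ev (mon3 j k i) (E m))"
      proof (cases "s = 0")
        case True
        show ?thesis using nz b[OF t, of a] unfolding if_P[OF True] by blast
      next
        case False
        show ?thesis
        proof (cases "s = 1")
          case True
          show ?thesis using nz b[OF t2, of "a ^ Q"] unfolding if_not_P[OF False] if_P[OF True] by blast
        next
          case False2: False
          show ?thesis using nz b[OF t3, of "(a ^ Q) ^ Q"] unfolding if_not_P[OF False] if_not_P[OF False2] by blast
        qed
      qed
    qed
  qed
  show ?thesis unfolding ratl_def using 1 2 3 by blast
qed

text \<open>Multiplied by \<open>(X_2 X_3^q)^l\<close>, each basis function becomes a monomial in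
  the coordinates. Its exponents meet the condition at \<open>E 3\<close> by the floor in
  \<open>kmon\<close>, at \<open>E 2\<close> by its factor \<open>z\<close>, and at
  \<open>E 1\<close> by the bound \<open>dimk\<close>.\<close>

lemma basis_monomial:
  assumes k: "k < N" and j: "j < dimk l k"
  shows "\<exists>i1 i2 i3. triangle i1 i2 i3 \<and> (\<forall>v. (\<forall>i. v $ i \<noteq> 0) \<longrightarrow>
     mon3 i1 i2 i3 v = (v $ 2 * v $ 3 ^ q) ^ l * (x v ^ j * kmon q k v))"
proof -
  define m where "m = int (q * k div N)"
  define n :: int where "n = (if k = 0 then 0 else 1)"
  define t where "t = int j - m"
  define qq where "qq = int q"
  define L where "L = int l"
  define kk where "kk = int k"
  define a1 where "a1 = t + qq * n"
  define a2 where "a2 = L + (qq - 1) * t - n + kk"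
  define a3 where "a3 = qq * L - qq * t - (qq - 1) * n - kk"
  have NN: "int N = qq * qq - qq + 1" using int_N by (simp add: qq_def algebra_simps)
  have qq: "qq \<ge> 3" using q2 by (simp add: qq_def)
  have sum: "a1 + a2 + a3 = L * (qq + 1)" by (simp add: a1_def a2_def a3_def algebra_simps)
  have c3: "a1 + qq * a2 \<ge> qq * L"
  proof -
    have "int N * m \<le> qq * kk" unfolding m_def qq_def kk_def
      by (metis of_nat_mono of_nat_mult div_times_less_eq_dividend mult.commute)
    moreover have "int N * int j \<ge> 0" by simp
    moreover have "int N * t + qq * kk = int N * int j + (qq * kk - int N * m)"
      by (simp add: t_def algebra_simps)
    ultimately have "int N * t + qq * kk \<ge> 0" by linarith
    moreover have "a1 + qq * a2 = qq * L + (int N * t + qq * kk)"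
      unfolding NN by (simp add: a1_def a2_def algebra_simps)
    ultimately show ?thesis by simp
  qed
  have c2: "a3 + qq * a1 \<ge> qq * L"
  proof -
    have "kk \<le> int N * n" using k by (auto simp: kk_def n_def)
    moreover have "a3 + qq * a1 = qq * L + (int N * n - kk)"
      unfolding NN by (simp add: a1_def a3_def algebra_simps)
    ultimately show ?thesis by simp
  qed
  have c1: "a2 + qq * a3 \<ge> qq * L"
  proof -
    have "int N * (t + n) + kk * (qq - 1) \<le> int N * L"
      using dimk_bound[OF k j] l unfolding t_def n_def m_def kk_def qq_def L_def by (simp add: algebra_simps)
    moreover have "a2 + qq * a3 = qq * L + (int N * L - (int N * (t + n) + kk * (qq - 1)))"
      unfolding NN by (simp add: a2_def a3_def algebra_simps)
    ultimately show ?thesis by simp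
  qed
  \<comment> \<open>The first inequality plus \<open>q\<close> times the second yields
    \<open>N * a \<ge> 0\<close> once the sum of the exponents is inserted; by cyclic symmetry this
    serves all three exponents.\<close>
  have nonneg: "a \<ge> 0" if "a + b + c = L * (qq + 1)" "a + qq * b \<ge> qq * L" "c + qq * a \<ge> qq * L" for a b c
  proof (rule ccontr)
    assume a: "\<not> a \<ge> 0"
    have "qq * (qq * L) \<le> qq * (c + qq * a)" using that(3) qq by (intro mult_left_mono) auto
    then have "qq * L + qq * (qq * L) \<le> a + qq * b + qq * c + qq * qq * a" using that(2) by (simp add: algebra_simps)
    also have "\<dots> = qq * (a + b + c) + int N * a" unfolding NN by (simp add: algebra_simps)
    also have "\<dots> = qq * L + qq * (qq * L) + int N * a" unfolding that(1) by (simp add: algebra_simps)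
    finally have "int N * a \<ge> 0" by simp
    then show False using a N_pos by (simp add: zero_le_mult_iff)
  qed
  have nn: "a1 \<ge> 0" "a2 \<ge> 0" "a3 \<ge> 0"
    using nonneg[of a1 a2 a3] nonneg[of a2 a3 a1] nonneg[of a3 a1 a2] sum c1 c2 c3 by simp_all
  obtain i1 i2 i3 where i: "a1 = int i1" "a2 = int i2" "a3 = int i3" using nn nonneg_int_cases by metis
  have "triangle i1 i2 i3"
  proof -
    have "int (i1 + i2 + i3) = int (l * (q + 1))" "int (q * l) \<le> int (i1 + q * i2)"
      "int (q * l) \<le> int (i2 + q * i3)" "int (q * l) \<le> int (i3 + q * i1)"
      using sum c1 c2 c3 unfolding i L_def qq_def of_nat_add of_nat_mult of_nat_1 by (simp_all only:)
    then show ?thesis unfolding triangle_def of_nat_eq_iff of_nat_le_iff by blast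
  qed
  moreover have "mon3 i1 i2 i3 v = (v $ 2 * v $ 3 ^ q) ^ l * (x v ^ j * kmon q k v)" if nz: "\<And>i. v $ i \<noteq> 0" for v
  proof -
    have x0: "x v \<noteq> 0" using nz by (simp add: x_coord_def)
    have xt: "x v powi t = v $ 1 powi t * v $ 2 powi ((qq - 1) * t) * v $ 3 powi (- (qq * t))"
      using nz q2 unfolding x_coord_def
      by (simp add: power_int_mult_distrib power_int_divide_distrib power_int_minus divide_inverse qq_def
          power_int_power power_int_inverse of_nat_diff)
    have "x v ^ j * kmon q k v = x v powi t * z v powi n * b v powi kk"
      unfolding kmon_mult t_def m_def using x0
      by (simp add: power_int_diff power_int_minus divide_inverse n_def kk_def)
    also have "z v powi n = v $ 1 powi (qq * n) * v $ 2 powi (- n) * v $ 3 powi (- ((qq - 1) * n))"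
      using nz q2 unfolding z_coord_def n_def qq_def
      by (simp add: power_int_minus divide_inverse of_nat_diff flip: power_int_of_nat)
    also have "b v powi kk = v $ 2 powi kk * v $ 3 powi (- kk)"
      using nz unfolding b_coord_def kk_def by (simp add: power_mult_distrib power_inverse power_int_minus divide_inverse)
    finally have e: "x v ^ j * kmon q k v = v $ 1 powi t * v $ 2 powi ((qq - 1) * t) * v $ 3 powi (- (qq * t))
      * (v $ 1 powi (qq * n) * v $ 2 powi (- n) * v $ 3 powi (- ((qq - 1) * n))) * (v $ 2 powi kk * v $ 3 powi (- kk))"
      unfolding xt .
    have "(v $ 2 * v $ 3 ^ q) ^ l = v $ 2 powi L * v $ 3 powi (qq * L)"
      by (simp add: L_def qq_def power_mult_distrib power_int_mult flip: power_mult)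
    then have "(v $ 2 * v $ 3 ^ q) ^ l * (x v ^ j * kmon q k v) = v $ 1 powi a1 * v $ 2 powi a2 * v $ 3 powi a3"
      unfolding e a1_def a2_def a3_def using nz
      by (simp add: power_int_add power_int_diff power_int_minus divide_inverse)
    then show ?thesis by (simp add: i mon3_def)
  qed
  ultimately show ?thesis by blast
qed

end

section \<open>Descent of vector spaces to the field of constants\<close>

lemma vec_to_ac_nth [simp]: "vec_to_ac c $ i = to_ac (c $ i)"
  by (simp add: vec_to_ac_def)

lemma inj_vec_to_ac: "inj vec_to_ac"
  by (rule injI) (simp add: vec_eq_iff)

lemma vec_to_ac_0: "vec_to_ac 0 = 0"
  and vec_to_ac_add: "vec_to_ac (c + d) = vec_to_ac c + vec_to_ac d"
  and vec_to_ac_scale: "vec_to_ac (a *s c) = to_ac a *s vec_to_ac c"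
  by (simp_all add: vec_eq_iff)

lemma vec_to_ac_span:
  assumes "c \<in> vec.span B"
  shows "vec_to_ac c \<in> vec.span (vec_to_ac ` B)"
  using assms
proof (induction rule: vec.span_induct_alt)
  case base
  show ?case by (simp add: vec_to_ac_0 vec.span_zero)
next
  case (step a u v)
  show ?case unfolding vec_to_ac_add vec_to_ac_scale
    by (rule vec.span_add[OF vec.span_scale[OF vec.span_base[OF imageI[OF step(1)]]] step(2)])
qed

text \<open>An independent set is extended to a basis. The image of the basis spans, since it spans
  the unit vectors, and has as many elements as the dimension, so it is independent.\<close>

lemma vec_to_ac_independent:
  fixes B :: "('f::field ^ 'n) set"
  assumes "vec.independent B"
  shows "vec.independent (vec_to_ac ` B)"
proof -
  obtain B1 where B1: "B \<subseteq> B1" "vec.independent B1" "vec.span B1 = UNIV"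
    using vec.maximal_independent_subset_extend[of B UNIV] assms by (metis subset_UNIV top.extremum_uniqueI)
  have card: "card B1 = CARD('n)" "finite B1"
    using B1(2,3) vec.dim_eq_card_independent vec.dim_span vec_dim_card vec.finiteI_independent by metis+
  have "UNIV \<subseteq> vec.span (vec_to_ac ` B1)"
  proof
    fix v :: "'f alg_closure ^ 'n"
    have "v = (\<Sum>i\<in>UNIV. v $ i *s axis i 1)" by (simp add: basis_expansion)
    moreover have "axis i 1 \<in> vec.span (vec_to_ac ` B1)" for i
    proof -
      have "axis i 1 = vec_to_ac (axis i (1::'f))" by (simp add: vec_eq_iff axis_def)
      then show ?thesis using vec_to_ac_span[of "axis i (1::'f)" B1] B1(3) by simp
    qed
    ultimately show "v \<in> vec.span (vec_to_ac ` B1)"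
      by (metis (no_types, lifting) vec.span_sum vec.span_scale)
  qed
  then have "vec.independent (vec_to_ac ` B1)"
  proof (rule vec.card_le_dim_spanning[rotated])
    show "finite (vec_to_ac ` B1)" using card(2) by simp
    show "card (vec_to_ac ` B1) \<le> vec.dim (UNIV :: ('f alg_closure ^ 'n) set)"
      unfolding vec_dim_card using card card_image_le[of B1 vec_to_ac] by simp
  qed simp
  then show ?thesis using B1(1) vec.independent_mono by (meson image_mono)
qed

text \<open>The vectors \<open>e i\<close> bound the dimension of \<open>T\<close> from above, and that of \<open>S\<close> from below.\<close>

lemma descent_equality:
  fixes S T :: "('f::field ^ 'n) set" and e :: "'i \<Rightarrow> 'f alg_closure ^ 'n"
  assumes "vec.subspace S" "vec.subspace T" "S \<subseteq> T"
    and "vec.independent (e ` I)" "inj_on e I" "finite I"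
    and "e ` I \<subseteq> vec.span (vec_to_ac ` S)" "vec_to_ac ` T \<subseteq> vec.span (e ` I)"
  shows "S = T" "vec.dim S = card I"
proof -
  have cardI: "card (e ` I) = card I" using assms(5) by (rule card_image)
  obtain B where B: "B \<subseteq> S" "vec.independent B" "S \<subseteq> vec.span B" "card B = vec.dim S"
    by (rule vec.basis_exists)
  have "vec_to_ac ` S \<subseteq> vec.span (vec_to_ac ` B)" using B(3) vec_to_ac_span by blast
  then have "e ` I \<subseteq> vec.span (vec_to_ac ` B)"
    using assms(7) vec.span_mono vec.span_span by blast
  moreover have "finite B" using B(2) vec.finiteI_independent by blast
  ultimately have "card I \<le> card (vec_to_ac ` B)"
    using vec.independent_span_bound[of "vec_to_ac ` B" "e ` I"] assms(4) cardI by simp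
  also have "\<dots> \<le> vec.dim S" using B(4) card_image_le[OF \<open>finite B\<close>] by metis
  finally have 1: "card I \<le> vec.dim S" .
  obtain B' where B': "B' \<subseteq> T" "vec.independent B'" "T \<subseteq> vec.span B'" "card B' = vec.dim T"
    by (rule vec.basis_exists)
  have "vec_to_ac ` B' \<subseteq> vec.span (e ` I)" using B'(1) assms(8) by blast
  then have "card (vec_to_ac ` B') \<le> card (e ` I)"
    using vec.independent_span_bound[OF _ vec_to_ac_independent[OF B'(2)]] assms(6) by blast
  then have 2: "vec.dim T \<le> card I"
    using B'(4) cardI card_image[OF inj_on_subset[OF inj_vec_to_ac subset_UNIV]] by metis
  have 3: "vec.dim S \<le> vec.dim T" using assms(3) by (rule vec.dim_subset)
  show "vec.dim S = card I" using 1 2 3 by linarith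
  show "S = T"
    by (rule vec.subspace_dim_equal[OF assms(1-3)]) (use 1 2 3 in linarith)
qed

lemma power_CARD_eq_same:
  fixes a :: "'f::{field, finite}"
  shows "a ^ CARD('f) = a"
proof (cases "a = 0")
  case True
  then show ?thesis by (simp add: power_0_left)
next
  case False
  have "inj_on ((*) a) (- {0})" using False by (simp add: inj_on_def)
  moreover have "(*) a ` (- {0}) = - {0}"
  proof (rule card_subset_eq)
    show "card ((*) a ` (- {0})) = card (- {0::'f})" by (rule card_image) fact
  qed (use False in auto)
  ultimately have "(\<Prod>y\<in>- {0}. y) = (\<Prod>y\<in>- {0}. a * y)"
    by (metis (no_types, lifting) prod.reindex_cong)
  also have "\<dots> = a ^ card (- {0::'f}) * (\<Prod>y\<in>- {0}. y)" by (simp add: prod.distrib)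
  finally have "a ^ card (- {0::'f}) = 1" by simp
  moreover have "CARD('f) = Suc (card (- {0::'f}))"
    by (metis Compl_eq_Diff_UNIV UNIV_I card_Suc_Diff1 finite)
  ultimately show ?thesis by simp
qed

lemma range_to_ac:
  fixes a :: "'f::{field, finite} alg_closure"
  assumes "a ^ CARD('f) = a"
  shows "a \<in> range to_ac"
proof -
  define p :: "'f alg_closure poly" where "p = monom 1 CARD('f) + monom (- 1) 1"
  have "card {0, 1::'f} \<le> CARD('f)" by (intro card_mono) auto
  then have c: "CARD('f) > 1" by simp
  have deg: "degree p = CARD('f)" unfolding p_def
    using c by (subst degree_add_eq_left) (auto simp: degree_monom_eq)
  then have p: "p \<noteq> 0" using c by auto
  have "to_ac ` UNIV \<subseteq> {x. poly p x = 0}"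
    by (auto simp: p_def poly_monom power_CARD_eq_same simp flip: to_ac_power)
  moreover have "card {x. poly p x = 0} \<le> CARD('f)" using card_poly_roots_bound[OF p] deg by simp
  moreover have "card (to_ac ` (UNIV :: 'f set)) = CARD('f)"
    by (rule card_image) (simp add: inj_on_def)
  ultimately have "to_ac ` UNIV = {x. poly p x = 0}"
    using poly_roots_finite[OF p] by (intro card_seteq) auto
  then show ?thesis using assms by (auto simp: p_def poly_monom)
qed

section \<open>The number of basis elements\<close>

text \<open>The terms for \<open>k\<close> and \<open>n - k\<close> add up to \<open>a - 1\<close>,
  as \<open>n\<close> does not divide \<open>a * k\<close>.\<close>

lemma sum_div_coprime:
  fixes a n :: nat
  assumes "coprime a n" "n > 0"
  shows "2 * (\<Sum>k\<in>{1..<n}. int (a * k div n)) = (int a - 1) * (int n - 1)"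
proof -
  have pair: "int (a * k div n) + int (a * (n - k) div n) = int a - 1" if k: "k \<in> {1..<n}" for k
  proof -
    have "\<not> n dvd k" using k by (auto dest: dvd_imp_le)
    then have "\<not> n dvd a * k" using assms(1) by (simp add: coprime_dvd_mult_right_iff coprime_commute)
    then have r: "int (a * k) mod int n \<noteq> 0"
      by (metis dvd_eq_mod_eq_0 of_nat_eq_0_iff of_nat_mod)
    have "int (a * (n - k)) = - int (a * k) + int a * int n" using k by (simp add: of_nat_diff algebra_simps)
    then have "int (a * (n - k)) div int n = - int (a * k) div int n + int a"
      using assms(2) by (simp only: div_mult_self1[of "int n" "- int (a * k)" "int a"] of_nat_eq_0_iff add.commute[of "int a"])
    also have "- int (a * k) div int n = - (int (a * k) div int n) - 1"
      using zdiv_zminus1_eq_if[of "int n" "int (a * k)"] r assms(2) by (simp only: of_nat_eq_0_iff if_False)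
    finally show ?thesis by (simp add: of_nat_div)
  qed
  have "(\<Sum>k\<in>{1..<n}. int (a * k div n)) = (\<Sum>k\<in>{1..<n}. int (a * (n - k) div n))"
    by (subst sum.atLeastLessThan_rev) simp
  then have "2 * (\<Sum>k\<in>{1..<n}. int (a * k div n)) = (\<Sum>k\<in>{1..<n}. int (a * k div n) + int (a * (n - k) div n))"
    by (simp add: sum.distrib)
  also have "\<dots> = (\<Sum>k\<in>{1..<n}. int a - 1)" using pair by (intro sum.cong) auto
  also have "\<dots> = (int a - 1) * (int n - 1)" using assms(2) by (simp add: of_nat_diff)
  finally show ?thesis .
qed

context curve
begin

text \<open>The two floor sums contribute \<open>(q - 1) * (N - 1)\<close> and
  \<open>(q - 2) * (N - 1)\<close> after doubling; their difference is \<open>N - 1\<close>, that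
  is, \<open>q ^ 2 - q\<close>.\<close>

lemma sum_dimk:
  assumes "l > 0"
  shows "2 * int (\<Sum>k<N. dimk l k) = (2 * int l - 1) * (int q ^ 2 - int q) + 2 * int l + 2"
proof -
  have "{..<N} = insert 0 {1..<N}" using N_pos by auto
  then have "int (\<Sum>k<N. dimk l k) = int l + 1 + (\<Sum>k\<in>{1..<N}. int (dimk l k))" by (simp add: dimk_def)
  also have "(\<Sum>k\<in>{1..<N}. int (dimk l k))
    = (\<Sum>k\<in>{1..<N}. (int l - 1) + (int (q * k div N) - int ((q - 1) * k div N)))"
  proof (intro sum.cong refl)
    fix k assume "k \<in> {1..<N}"
    moreover have "(q - 1) * k div N \<le> q * k div N" by (intro div_le_mono) simp
    ultimately show "int (dimk l k) = (int l - 1) + (int (q * k div N) - int ((q - 1) * k div N))"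
      using assms by (simp add: dimk_def of_nat_diff)
  qed
  finally have e: "2 * int (\<Sum>k<N. dimk l k) = 2 * int l + 2 + 2 * (int l - 1) * (int N - 1)
     + 2 * (\<Sum>k\<in>{1..<N}. int (q * k div N)) - 2 * (\<Sum>k\<in>{1..<N}. int ((q - 1) * k div N))"
    using N_pos by (simp add: sum.distrib sum_subtractf of_nat_diff algebra_simps)
  have "coprime q N" using coprime_N_q by (simp add: coprime_commute)
  from sum_div_coprime[OF this N_pos]
  have s1: "2 * (\<Sum>k\<in>{1..<N}. int (q * k div N)) = (int q - 1) * (int N - 1)" .
  have "coprime (q - 1) N" using coprime_N_q1 by (simp add: coprime_commute)
  from sum_div_coprime[OF this N_pos]
  have s2: "2 * (\<Sum>k\<in>{1..<N}. int ((q - 1) * k div N)) = (int q - 2) * (int N - 1)"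
    using q_gt_2 by (simp add: of_nat_diff)
  show ?thesis unfolding e s1 s2 int_N by (simp add: algebra_simps power2_eq_square)
qed

end

section \<open>The code\<close>

context singer_orbit_divisor
begin

text \<open>The word of \<open>x ^ j * kmon q k / (x - cc) ^ l\<close>, with positions parametrized
  by \<open>gg\<close>. It lives over the closure; no rationality of its entries is claimed.\<close>

definition evalvec :: "('n::finite \<Rightarrow> 'a) \<Rightarrow> nat \<times> nat \<Rightarrow> 'a ^ 'n" where
  "evalvec gg kj = (\<chi> i. x (gpt q (gg i)) ^ snd kj * kmon q (fst kj) (gpt q (gg i)) / (x (gpt q (gg i)) - cc) ^ l)"

definition quotvec :: "('n::finite \<Rightarrow> 'a) \<Rightarrow> ('a ^ 3 \<Rightarrow> 'a) \<Rightarrow> 'a ^ 'n" where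
  "quotvec gg F = (\<chi> i. F (gpt q (gg i)) / B0 (gpt q (gg i)))"

definition basis_index :: "(nat \<times> nat) set" where
  "basis_index = (SIGMA k:{..<N}. {..<dimk l k})"

lemma finite_basis_index: "finite basis_index"
  and card_basis_index: "card basis_index = (\<Sum>k<N. dimk l k)"
  by (simp_all add: basis_index_def)

lemma dimk_le: "k < N \<Longrightarrow> dimk l k \<le> l + 1"
proof -
  assume k: "k < N"
  have "q * k div N \<le> ((q - 1) * k + N) div N" using k q2 by (intro div_le_mono) (cases q, auto)
  also have "\<dots> = (q - 1) * k div N + 1" using N_pos by simp
  finally show ?thesis by (auto simp: dimk_def)
qed

lemma params_in_Yr: "bij_betw gg UNIV {g. g ^ N \<in> Yr - {y0}} \<Longrightarrow> gg i ^ N \<in> Yr - {y0}"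
  by (auto simp: bij_betw_def)

lemma params_surj: "bij_betw gg UNIV {g. g ^ N \<in> Yr - {y0}} \<Longrightarrow> g ^ N \<in> Yr - {y0} \<Longrightarrow> \<exists>i. gg i = g"
  by (metis bij_betw_imp_surj_on image_iff mem_Collect_eq)

text \<open>The linear combination of the basis vectors is a polynomial in \<open>x\<close> for each \<open>k\<close>; it vanishes on
  \<open>q\<close> full fibers of \<open>x\<close>, more than its degree.\<close>

lemma evalvec_relation:
  fixes gg :: "'n::finite \<Rightarrow> 'a"
  assumes gg: "bij_betw gg UNIV {g. g ^ N \<in> Yr - {y0}}"
    and sum: "(\<Sum>kj\<in>basis_index. a kj *s evalvec gg kj) = 0" and kj: "kj \<in> basis_index"
  shows "a kj = 0"
proof -
  define p where "p k = (\<Sum>j<dimk l k. monom (a (k, j)) j)" for k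
  obtain k j where k: "kj = (k, j)" "k < N" "j < dimk l k" using kj by (auto simp: basis_index_def)
  have root: "poly (p k) (y ^ q) = 0" if y: "y \<in> Yr - {y0}" for y
  proof -
    define d where "d = y ^ q"
    have yY: "y \<in> Yr" using y by simp
    obtain g0 where "g0 ^ N = y" using nth_root_exists[OF N_pos] by blast
    then have d: "d \<noteq> 0" "poly Z d \<noteq> 0" using param_props(5,6)[of g0] yY by (auto simp: d_def)
    have "(\<Sum>k<N. (poly (p k) d * d powi (- int (q * k div N)) * poly Z d ^ (if k = 0 then 0 else 1)) * u ^ k) = 0"
      if u: "u \<in> fiber d" for u
    proof -
      obtain g where g: "g ^ N = y" "g ^ (Q + 1) = u" using fiber_param[OF yY] u unfolding d_def by blast
      have gY: "g ^ N \<in> Yr - {y0}" using g y by simp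
      then obtain i where i: "gg i = g" using params_surj[OF gg] by blast
      have v: "gpt q g = pt d u" using param_props(8)[of g] yY g by (simp add: d_def)
      have nz: "(x (gpt q g) - cc) ^ l \<noteq> 0" using param_x_ne[OF gY] by simp
      have "0 = (\<Sum>kj\<in>basis_index. a kj *s evalvec gg kj) $ i" unfolding sum by simp
      also have "\<dots> = (\<Sum>kj\<in>basis_index. a kj * (x (gpt q g) ^ snd kj * kmon q (fst kj) (gpt q g))) / (x (gpt q g) - cc) ^ l"
        by (simp add: evalvec_def i sum_divide_distrib)
      finally have "0 = (\<Sum>kj\<in>basis_index. a kj * (x (gpt q g) ^ snd kj * kmon q (fst kj) (gpt q g)))"
        using nz l by auto
      also have "\<dots> = (\<Sum>k<N. \<Sum>j<dimk l k. a (k, j) * (x (gpt q g) ^ j * kmon q k (gpt q g)))"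
        unfolding basis_index_def by (subst sum.Sigma) (auto simp: case_prod_beta)
      also have "\<dots> = (\<Sum>k<N. poly (p k) (x (gpt q g)) * kmon q k (gpt q g))"
        by (simp add: p_def poly_sum poly_monom sum_distrib_right mult.assoc)
      also have "\<dots> = (\<Sum>k<N. (poly (p k) d * d powi (- int (q * k div N)) * poly Z d ^ (if k = 0 then 0 else 1)) * u ^ k)"
        unfolding v kmon_mult pt_props(4-6)[OF d u] by (simp only: mult.assoc)
      finally show ?thesis by simp
    qed
    from fiber_sum_eq_0[OF d this k(2)]
    have "poly (p k) d * d powi (- int (q * k div N)) * poly Z d ^ (if k = 0 then 0 else 1) = 0" by blast
    then have "poly (p k) d = 0" using d by (auto simp del: power_int_minus)
    then show ?thesis unfolding d_def .
  qed
  have co: "coeff (p k) i = (if i < dimk l k then a (k, i) else 0)" for i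
    unfolding p_def coeff_sum coeff_monom by (simp add: sum.delta)
  have "p k = 0"
  proof (rule poly_eqI_degree)
    show "poly (p k) d = poly 0 d" if "d \<in> (\<lambda>y. y ^ q) ` (Yr - {y0})" for d using that root by auto
    have "card ((\<lambda>y. y ^ q) ` (Yr - {y0})) = q"
      using y0 finite_Yr card_Yr power_q_inj by (subst card_image) (auto intro!: inj_onI)
    moreover have "degree (p k) \<le> l"
      by (rule degree_le) (use dimk_le[OF k(2)] co in auto)
    moreover have "l < q" using l q2 by linarith
    ultimately show "degree (p k) < card ((\<lambda>y. y ^ q) ` (Yr - {y0}))" "degree 0 < card ((\<lambda>y. y ^ q) ` (Yr - {y0}))" by simp_all
  qed
  then have "coeff (p k) j = 0" by simp
  then show ?thesis using co k by simp
qed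

lemma evalvec_independent:
  fixes gg :: "'n::finite \<Rightarrow> 'a"
  assumes gg: "bij_betw gg UNIV {g. g ^ N \<in> Yr - {y0}}"
  shows "inj_on (evalvec gg) basis_index" "vec.independent (evalvec gg ` basis_index)"
proof -
  show inj: "inj_on (evalvec gg) basis_index"
  proof (rule inj_onI, rule ccontr)
    fix s t assume st: "s \<in> basis_index" "t \<in> basis_index" "evalvec gg s = evalvec gg t" "s \<noteq> t"
    define a :: "nat \<times> nat \<Rightarrow> 'a" where "a r = (if r = s then 1 else if r = t then - 1 else 0)" for r
    have "a r *s evalvec gg r = (if r = s then evalvec gg s else 0) + (if r = t then - evalvec gg t else 0)" for r
      using st(4) by (auto simp: a_def)
    then have "(\<Sum>r\<in>basis_index. a r *s evalvec gg r) = 0"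
      using st finite_basis_index by (simp add: sum.distrib sum.delta)
    from evalvec_relation[OF gg this st(1)] show False by (simp add: a_def)
  qed
  show "vec.independent (evalvec gg ` basis_index)"
  proof
    assume "vec.dependent (evalvec gg ` basis_index)"
    then obtain u where u: "\<exists>v\<in>evalvec gg ` basis_index. u v \<noteq> 0" "(\<Sum>v\<in>evalvec gg ` basis_index. u v *s v) = 0"
      using vec.dependent_finite[of "evalvec gg ` basis_index"] finite_basis_index by blast
    have "(\<Sum>r\<in>basis_index. u (evalvec gg r) *s evalvec gg r) = 0"
      using u(2) unfolding sum.reindex[OF inj] o_def .
    from evalvec_relation[OF gg this] u(1) show False by blast
  qed
qed

lemma functional_code_upper:
  fixes gg :: "'n::finite \<Rightarrow> 'a"
  assumes gg: "bij_betw gg UNIV {g. g ^ N \<in> Yr - {y0}}"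
    and c: "c \<in> functional_code q CC (\<lambda>i. proj_point (gpt q (gg i))) DG"
  shows "c \<in> vec.span (evalvec gg ` basis_index)" "c $ i ^ Q = c $ i"
proof -
  obtain f where f: "f \<in> riemann_roch_space q CC DG" "c = (\<chi> i. value_at (proj_point (gpt q (gg i))) f)"
    using c by (auto simp: functional_code_def)
  from rr_elements[OF f(1)] obtain p where p: "\<forall>k<N. \<forall>j\<ge>dimk l k. coeff (p k) j = 0"
    "\<And>g. g ^ N \<in> Yr - {y0} \<Longrightarrow>
      value_at (proj_point (gpt q g)) f ^ Q = value_at (proj_point (gpt q g)) f \<and>
      value_at (proj_point (gpt q g)) f * (x (gpt q g) - cc) ^ l
        = (\<Sum>k<N. poly (p k) (x (gpt q g)) * kmon q k (gpt q g))" by blast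
  show "c $ i ^ Q = c $ i" using p(2)[OF params_in_Yr[OF gg]] unfolding f(2) by simp
  have "c = (\<Sum>kj\<in>basis_index. coeff (p (fst kj)) (snd kj) *s evalvec gg kj)"
  proof (subst vec_eq_iff, rule allI)
    fix i
    define v where "v = gpt q (gg i)"
    have gY: "gg i ^ N \<in> Yr - {y0}" by (rule params_in_Yr[OF gg])
    have nz: "(x v - cc) ^ l \<noteq> 0" using param_x_ne[OF gY] by (simp add: v_def)
    have pe: "poly (p k) d = (\<Sum>j<dimk l k. coeff (p k) j * d ^ j)" if "k < N" for k d
    proof -
      have "p k = (\<Sum>j<dimk l k. monom (coeff (p k) j) j)"
        using p(1) that by (intro poly_eqI) (simp add: coeff_sum sum.delta)
      from arg_cong[OF this, of "\<lambda>r. poly r d"] show ?thesis by (simp add: poly_sum poly_monom)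
    qed
    have "c $ i * (x v - cc) ^ l = (\<Sum>k<N. poly (p k) (x v) * kmon q k v)"
      using p(2)[OF gY] unfolding f(2) v_def by simp
    also have "\<dots> = (\<Sum>k<N. \<Sum>j<dimk l k. coeff (p k) j * (x v ^ j * kmon q k v))"
      by (intro sum.cong refl) (simp add: pe sum_distrib_right mult.assoc)
    also have "\<dots> = (\<Sum>kj\<in>basis_index. coeff (p (fst kj)) (snd kj) * (x v ^ snd kj * kmon q (fst kj) v))"
      unfolding basis_index_def by (subst sum.Sigma) (auto simp: case_prod_beta)
    finally have "c $ i = (\<Sum>kj\<in>basis_index. coeff (p (fst kj)) (snd kj) * (x v ^ snd kj * kmon q (fst kj) v)) / (x v - cc) ^ l"
      using nz by (simp add: eq_divide_eq)
    then show "c $ i = (\<Sum>kj\<in>basis_index. coeff (p (fst kj)) (snd kj) *s evalvec gg kj) $ i"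
      by (simp add: evalvec_def sum_divide_distrib flip: v_def)
  qed
  then show "c \<in> vec.span (evalvec gg ` basis_index)"
    by (metis (no_types, lifting) vec.span_sum vec.span_scale vec.span_base imageI)
qed

lemma functional_code_lower:
  fixes gg :: "'n::finite \<Rightarrow> 'a"
  assumes gg: "bij_betw gg UNIV {g. g ^ N \<in> Yr - {y0}}" and F: "ratl F"
  shows "quotvec gg F \<in> functional_code q CC (\<lambda>i. proj_point (gpt q (gg i))) DG"
proof -
  have "quotvec gg F = (\<chi> i. value_at (proj_point (gpt q (gg i))) (fraction CC F B0))"
    using rr_value[OF _ params_in_Yr[OF gg]] F by (simp add: quotvec_def vec_eq_iff ratl_def)
  then show ?thesis unfolding functional_code_def using rr_member[OF F] by blast
qed

text \<open>Inverts the trace: the traces with multipliers 1, \<beta> and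
  \<open>\<beta>\<^sup>2\<close> are combinations of a monomial and its two cyclic shifts with
  matrix \<open>W\<close>, so the first column of \<open>V\<close> recovers the monomial.\<close>

lemma basis_in_quotient_span:
  fixes gg :: "'n::finite \<Rightarrow> 'a"
  assumes gg: "bij_betw gg UNIV {g. g ^ N \<in> Yr - {y0}}" and kj: "kj \<in> basis_index"
  shows "evalvec gg kj \<in> vec.span (quotvec gg ` {F. ratl F})"
proof -
  obtain k j where k: "kj = (k, j)" "k < N" "j < dimk l k" using kj by (auto simp: basis_index_def)
  obtain i1 i2 i3 where t: "triangle i1 i2 i3" and m: "\<And>v. (\<And>i. v $ i \<noteq> 0) \<Longrightarrow>
     mon3 i1 i2 i3 v = (v $ 2 * v $ 3 ^ q) ^ l * (x v ^ j * kmon q k v)"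
    using basis_monomial[OF k(2,3)] by blast
  have b: "((\<beta> ^ Q) ^ Q) ^ Q = \<beta>" by (rule beta_props(5))
  have b2: "(((\<beta>\<^sup>2) ^ Q) ^ Q) ^ Q = \<beta>\<^sup>2" unfolding power_comm[of _ 2 Q] b ..
  have r: "ratl (trform 1 i1 i2 i3)" "ratl (trform \<beta> i1 i2 i3)" "ratl (trform (\<beta>\<^sup>2) i1 i2 i3)"
    using ratl_trform[OF t _] b b2 by (simp, blast, blast)
  have mono: "mon3 i1 i2 i3 v = V $ 1 $ 1 * trform 1 i1 i2 i3 v + V $ 2 $ 1 * trform \<beta> i1 i2 i3 v + V $ 3 $ 1 * trform (\<beta>\<^sup>2) i1 i2 i3 v" for v
  proof -
    define u :: "'a ^ 3" where "u = vector [V $ 1 $ 1, V $ 2 $ 1, V $ 3 $ 1]"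
    have "(W *v u) $ i = (W ** V) $ i $ 1" for i
      by (simp add: u_def matrix_vector_mult_def matrix_matrix_mult_def sum_3 vector_3)
    then have "(W *v u) $ 1 = 1" "(W *v u) $ 2 = 0" "(W *v u) $ 3 = 0" unfolding WV by (simp_all add: mat_def)
    then have w: "V $ 1 $ 1 + \<beta> * V $ 2 $ 1 + \<beta>\<^sup>2 * V $ 3 $ 1 = 1"
      "V $ 1 $ 1 + \<beta> ^ Q * V $ 2 $ 1 + (\<beta> ^ Q)\<^sup>2 * V $ 3 $ 1 = 0"
      "V $ 1 $ 1 + (\<beta> ^ Q) ^ Q * V $ 2 $ 1 + ((\<beta> ^ Q) ^ Q)\<^sup>2 * V $ 3 $ 1 = 0"
      unfolding W_mult by (simp_all add: u_def vector_3)
    have "V $ 1 $ 1 * trform 1 i1 i2 i3 v + V $ 2 $ 1 * trform \<beta> i1 i2 i3 v + V $ 3 $ 1 * trform (\<beta>\<^sup>2) i1 i2 i3 v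
      = (V $ 1 $ 1 + \<beta> * V $ 2 $ 1 + \<beta>\<^sup>2 * V $ 3 $ 1) * mon3 i1 i2 i3 v
        + (V $ 1 $ 1 + \<beta> ^ Q * V $ 2 $ 1 + (\<beta> ^ Q)\<^sup>2 * V $ 3 $ 1) * mon3 i3 i1 i2 v
        + (V $ 1 $ 1 + (\<beta> ^ Q) ^ Q * V $ 2 $ 1 + ((\<beta> ^ Q) ^ Q)\<^sup>2 * V $ 3 $ 1) * mon3 i2 i3 i1 v"
      unfolding trform_def power_comm[of _ 2 Q] power_one by (simp only: distrib_left distrib_right mult_ac add_ac mult_1_left mult_1_right)
    then show ?thesis unfolding w by simp
  qed
  have "evalvec gg kj $ i = oconst y0 ^ l * (mon3 i1 i2 i3 (gpt q (gg i)) / B0 (gpt q (gg i)))" for i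
  proof -
    define v where "v = gpt q (gg i)"
    have gY: "gg i ^ N \<in> Yr - {y0}" "gg i ^ N \<in> Yr" using params_in_Yr[OF gg, of i] by auto
    note p = param_props[OF gY(2), folded v_def]
    have nz: "v $ 2 \<noteq> 0" "v $ 3 \<noteq> 0" "x v \<noteq> cc" "oconst y0 \<noteq> 0"
      using p(4) param_x_ne[OF gY(1)] oform_props(3)[OF y0] by (auto simp: v_def)
    have "B0 v = oconst y0 ^ l * (v $ 2 * v $ 3 ^ q) ^ l * (x v - cc) ^ l"
      unfolding B0_def oform_value[OF y0 p(3,4)] cc_def by (simp only: power_mult_distrib)
    then show ?thesis using nz by (simp add: evalvec_def k(1) m[OF p(4)] flip: v_def)
  qed
  then have "evalvec gg kj = oconst y0 ^ l *s (V $ 1 $ 1 *s quotvec gg (trform 1 i1 i2 i3)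
      + V $ 2 $ 1 *s quotvec gg (trform \<beta> i1 i2 i3) + V $ 3 $ 1 *s quotvec gg (trform (\<beta>\<^sup>2) i1 i2 i3))"
    unfolding vec_eq_iff mono by (simp add: quotvec_def add_divide_distrib distrib_left mult.assoc)
  moreover have "quotvec gg F \<in> vec.span (quotvec gg ` {F. ratl F})" if "ratl F" for F
    using that by (intro vec.span_base) auto
  ultimately show ?thesis using r by (simp add: vec.span_add vec.span_scale)
qed

text \<open>Valid for the span over the closure, hence for the code. Positions correspond
  injectively to pairs of values of \<open>x\<close> and \<open>b\<close>, the form in which
  \<open>zero_count\<close> counts.\<close>

lemma span_zero_count:
  fixes gg :: "'n::finite \<Rightarrow> 'a"
  assumes gg: "bij_betw gg UNIV {g. g ^ N \<in> Yr - {y0}}"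
    and c: "c \<in> vec.span (evalvec gg ` basis_index)" "c \<noteq> 0"
  shows "card {i. c $ i = 0} \<le> l * N"
proof -
  obtain u where u: "c = (\<Sum>v\<in>evalvec gg ` basis_index. u v *s v)"
    using c(1) vec.span_finite[of "evalvec gg ` basis_index"] finite_basis_index by auto
  define a where "a kj = u (evalvec gg kj)" for kj
  have c': "c = (\<Sum>kj\<in>basis_index. a kj *s evalvec gg kj)"
    unfolding u sum.reindex[OF evalvec_independent(1)[OF gg]] a_def o_def ..
  have "\<exists>kj\<in>basis_index. a kj \<noteq> 0"
  proof (rule ccontr)
    assume "\<not> (\<exists>kj\<in>basis_index. a kj \<noteq> 0)"
    then have "c = 0" unfolding c' by (intro sum.neutral) simp
    then show False using c(2) by simp
  qed
  then obtain k1 j1 where k1: "(k1, j1) \<in> basis_index" "a (k1, j1) \<noteq> 0" by auto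
  define p where "p k = (\<Sum>j<dimk l k. monom (a (k, j)) j)" for k
  have co: "coeff (p k) i = (if i < dimk l k then a (k, i) else 0)" for i k
    unfolding p_def coeff_sum coeff_monom by (simp add: sum.delta)
  define T where "T = (\<lambda>i. (x (gpt q (gg i)), b (gpt q (gg i)))) ` {i. c $ i = 0}"
  have "card T \<le> l * N"
  proof (rule zero_count)
    show "coeff (p k) j = 0" if "k < N" "dimk l k \<le> j" for k j using that by (simp add: co)
    show "k1 < N" using k1(1) by (auto simp: basis_index_def)
    have "j1 < dimk l k1" using k1(1) by (auto simp: basis_index_def)
    then have "coeff (p k1) j1 \<noteq> 0" using k1(2) by (simp add: co)
    then show "p k1 \<noteq> 0" by auto
    show "l > 0" "finite T" using l by (auto simp: T_def)
    fix d y assume "(d, y) \<in> T"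
    then obtain i where i: "d = x (gpt q (gg i))" "y = b (gpt q (gg i))" "c $ i = 0" by (auto simp: T_def)
    define v where "v = gpt q (gg i)"
    have gY: "gg i ^ N \<in> Yr - {y0}" "gg i ^ N \<in> Yr" using params_in_Yr[OF gg, of i] by auto
    note pp = param_props[OF gY(2), folded v_def]
    have dy: "d = (gg i ^ N) ^ q" "y = gg i ^ (Q + 1)" unfolding i gpt_coords by simp_all
    have v: "v = pt d y" using pp(8) unfolding dy .
    have nz: "(x v - cc) ^ l \<noteq> 0" using param_x_ne[OF gY(1)] by (simp add: v_def)
    have "0 = (\<Sum>kj\<in>basis_index. a kj *s evalvec gg kj) $ i" using i(3) unfolding c' by simp
    also have "\<dots> = (\<Sum>kj\<in>basis_index. a kj * (x v ^ snd kj * kmon q (fst kj) v)) / (x v - cc) ^ l"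
      by (simp add: evalvec_def v_def sum_divide_distrib)
    finally have "0 = (\<Sum>kj\<in>basis_index. a kj * (x v ^ snd kj * kmon q (fst kj) v))"
      using nz l by auto
    also have "\<dots> = (\<Sum>k<N. \<Sum>j<dimk l k. a (k, j) * (x v ^ j * kmon q k v))"
      unfolding basis_index_def by (subst sum.Sigma) (auto simp: case_prod_beta)
    also have "\<dots> = (\<Sum>k<N. poly (p k) (x v) * kmon q k v)"
      by (simp add: p_def poly_sum poly_monom sum_distrib_right mult.assoc)
    finally have 0: "(\<Sum>k<N. poly (p k) d * kmon q k v) = 0" using i(1) by (simp add: v_def)
    then show "d \<noteq> 0 \<and> poly Z d \<noteq> 0 \<and> y \<in> fiber d \<and> (\<Sum>k<N. poly (p k) d * kmon q k (pt d y)) = 0"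
      using pp(5,6,7) 0[unfolded v] unfolding dy by blast
  qed
  moreover have "inj_on (\<lambda>i. (x (gpt q (gg i)), b (gpt q (gg i)))) {i. c $ i = 0}"
  proof (rule inj_onI)
    fix i j assume "(x (gpt q (gg i)), b (gpt q (gg i))) = (x (gpt q (gg j)), b (gpt q (gg j)))"
    then have e: "(gg i ^ N) ^ q = (gg j ^ N) ^ q" "gg i ^ (Q + 1) = gg j ^ (Q + 1)" unfolding gpt_coords by auto
    have Y: "gg i ^ N \<in> Yr" "gg j ^ N \<in> Yr" using params_in_Yr[OF gg] by auto
    have "gpt q (gg i) = gpt q (gg j)" unfolding param_props(8)[OF Y(1)] param_props(8)[OF Y(2)] e ..
    then have "gg i = gg j" by (intro gpt_inj) simp
    then show "i = j" using gg by (auto simp: bij_betw_def inj_on_def)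
  qed
  ultimately show ?thesis by (simp add: T_def card_image)
qed

lemma prod_oform:
  assumes "finite A" "A \<subseteq> Yr"
  shows "(\<lambda>v. \<Prod>y\<in>A. oform y v) \<in> forms UNIV (card A * (q + 1)) \<and>
    (generic w \<longrightarrow> ev (\<lambda>v. \<Prod>y\<in>A. oform y v) w = (\<Prod>y\<in>A. ev (oform y) w))"
  using assms
proof (induction A rule: finite_induct)
  case empty
  have "(\<lambda>v::'a^3. 1::'a) \<in> forms UNIV 0" using forms_power[OF forms_coord, of 1 0] by simp
  then show ?case by (simp add: ev_1)
next
  case (insert y A)
  have y: "oform y \<in> forms UNIV (q + 1)" using oform_props(1) insert by simp
  have A: "(\<lambda>v. \<Prod>y\<in>A. oform y v) \<in> forms UNIV (card A * (q + 1))" using insert by simp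
  have "(\<lambda>v. oform y v * (\<Prod>y\<in>A. oform y v)) \<in> forms UNIV (q + 1 + card A * (q + 1))"
    by (rule forms_mult[OF y A])
  then show ?case using ev_mult[OF y A, of w] insert by (simp add: algebra_simps)
qed

lemma ratl_prod_oform:
  assumes "A \<subseteq> Yr" "card A = l"
  shows "ratl (\<lambda>v. \<Prod>y\<in>A. oform y v)"
proof -
  have fin: "finite A" using assms(1) finite_Yr finite_subset by blast
  note P = prod_oform[OF fin assms(1), unfolded assms(2)]
  have "(\<Prod>y\<in>A. oform y (phi q v)) = (\<Prod>y\<in>A. oform y v) ^ Q" for v
    unfolding prod_power_distrib by (intro prod.cong refl oform_props(2)) (use assms in auto)
  moreover have "fls_subdegree (ev (\<lambda>v. \<Prod>y\<in>A. oform y v) (E i)) = int (q * l)" for i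
  proof -
    have "(\<Prod>y\<in>B. ev (oform y) (E i)) \<noteq> 0 \<and> fls_subdegree (\<Prod>y\<in>B. ev (oform y) (E i)) = int (q * card B)"
      if "finite B" "B \<subseteq> Yr" for B
      using that by (induction B rule: finite_induct) (simp_all add: E_oform algebra_simps)
    then show ?thesis using P E_props(2) fin assms by metis
  qed
  ultimately show ?thesis unfolding ratl_def using P by simp
qed

lemma exists_min_weight:
  fixes gg :: "'n::finite \<Rightarrow> 'a"
  assumes gg: "bij_betw gg UNIV {g. g ^ N \<in> Yr - {y0}}"
  shows "\<exists>F. ratl F \<and> card {i. quotvec gg F $ i = 0} = l * N"
proof -
  \<comment> \<open>There are \<open>q\<close> labels besides \<open>y0\<close>; each chosen one
    contributes the \<open>N\<close> zeros of its orbit.\<close>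
  have "l \<le> card (Yr - {y0})" using card_Yr y0 l by simp
  then obtain A where A: "A \<subseteq> Yr - {y0}" "card A = l" by (meson obtain_subset_with_card_n)
  have fin: "finite A" using A(1) finite_Yr finite_subset by blast
  define F where "F v = (\<Prod>y\<in>A. oform y v)" for v
  have F: "ratl F" unfolding F_def[abs_def] using A by (intro ratl_prod_oform) auto
  have "quotvec gg F $ i = 0 \<longleftrightarrow> gg i ^ N \<in> A" for i
  proof -
    have gY: "gg i ^ N \<in> Yr - {y0}" "gg i ^ N \<in> Yr" using params_in_Yr[OF gg, of i] by auto
    note p = param_props[OF gY(2)]
    have "oform y (gpt q (gg i)) = 0 \<longleftrightarrow> gg i ^ N = y" if "y \<in> A" for y
    proof -
      have y: "y \<in> Yr" using that A by auto
      have "oform y (gpt q (gg i)) = 0 \<longleftrightarrow> (gg i ^ N) ^ q = y ^ q"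
        unfolding oform_value[OF y p(3,4)] gpt_coords using p(4) oform_props(3)[OF y] by simp
      then show ?thesis using power_q_inj by blast
    qed
    then have "F (gpt q (gg i)) = 0 \<longleftrightarrow> gg i ^ N \<in> A" unfolding F_def prod_zero_iff[OF fin] by auto
    then show ?thesis using B0_value_nz[OF gY(1)] by (simp add: quotvec_def)
  qed
  then have "{i. quotvec gg F $ i = 0} = gg -` {g. g ^ N \<in> A}" by auto
  moreover have "bij_betw gg (gg -` {g. g ^ N \<in> A}) {g. g ^ N \<in> A}"
  proof (rule bij_betw_imageI)
    show "inj_on gg (gg -` {g. g ^ N \<in> A})" using gg inj_on_subset by (auto simp: bij_betw_def)
    have "{g. g ^ N \<in> A} \<subseteq> range gg" using gg A(1) by (auto simp: bij_betw_def)
    then show "gg ` (gg -` {g. g ^ N \<in> A}) = {g. g ^ N \<in> A}" unfolding image_vimage_eq by blast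
  qed
  ultimately have "card {i. quotvec gg F $ i = 0} = card {g. g ^ N \<in> A}" using bij_betw_same_card by metis
  also have "\<dots> = l * N" using card_params(1)[of A] A by auto
  finally show ?thesis using F by blast
qed

end

lemma min_distance_subspace:
  fixes C :: "('f::field ^ 'n::finite) set"
  assumes C: "vec.subspace C"
    and ge: "\<And>c. c \<in> C \<Longrightarrow> c \<noteq> 0 \<Longrightarrow> m \<le> card {i. c $ i \<noteq> 0}"
    and eq: "\<exists>c\<in>C. c \<noteq> 0 \<and> card {i. c $ i \<noteq> 0} = m"
  shows "min_distance C = m"
proof -
  define D where "D = {hamming_dist u v | u v. u \<in> C \<and> v \<in> C \<and> u \<noteq> v}"
  have hd: "hamming_dist u v = card {i. (u - v) $ i \<noteq> 0}" for u v :: "'f ^ 'n"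
    by (simp add: hamming_dist_def)
  obtain c where c: "c \<in> C" "c \<noteq> 0" "card {i. c $ i \<noteq> 0} = m" using eq by blast
  have 1: "m \<in> D" unfolding D_def
    using c vec.subspace_0[OF C] hd[of c 0] by (intro CollectI exI[of _ c] exI[of _ 0]) simp
  have 2: "m \<le> d" if "d \<in> D" for d
  proof -
    obtain u v where uv: "d = hamming_dist u v" "u \<in> C" "v \<in> C" "u \<noteq> v" using \<open>d \<in> D\<close> by (auto simp: D_def)
    show ?thesis unfolding uv(1) hd by (rule ge) (use uv vec.subspace_diff[OF C] in auto)
  qed
  have "d \<le> CARD('n)" if "d \<in> D" for d
    using that by (auto simp: D_def hamming_dist_def intro: card_mono)
  then have "finite D" by (meson finite_nat_set_iff_bounded_le)
  then have "Min D = m" using 1 2 by (intro Min_eqI)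
  then show ?thesis unfolding min_distance_def D_def .
qed

context singer_orbit_divisor
begin

lemma ratl_0: "ratl (\<lambda>v. 0)"
  and ratl_add: "ratl F \<Longrightarrow> ratl F' \<Longrightarrow> ratl (\<lambda>v. F v + F' v)"
  and ratl_cmult: "e ^ Q = e \<Longrightarrow> ratl F \<Longrightarrow> ratl (\<lambda>v. e * F v)"
proof -
  have f0: "(\<lambda>v::'a^3. 0::'a) \<in> forms UNIV (l * (q + 1))" using forms_cmult[OF B0_form, of 0] by simp
  have "ev (\<lambda>v. 0) (E i) = 0" for i using ev_cmult[OF B0_form E_props(2), of 0 i] by simp
  then show "ratl (\<lambda>v. 0)" using f0 Q_pos by (simp add: ratl_def power_0_left)
  show "ratl (\<lambda>v. F v + F' v)" if "ratl F" "ratl F'"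
  proof -
    have f: "F \<in> forms UNIV (l * (q + 1))" "F' \<in> forms UNIV (l * (q + 1))" using that by (auto simp: ratl_def)
    have "fls_subdegree (ev F (E i) + ev F' (E i)) \<ge> int (q * l)" if nz: "ev F (E i) + ev F' (E i) \<noteq> 0" for i
    proof (cases "ev F (E i) = 0 \<or> ev F' (E i) = 0")
      case True
      then show ?thesis using nz \<open>ratl F\<close> \<open>ratl F'\<close> unfolding ratl_def by (metis add.left_neutral add.right_neutral)
    next
      case False
      then have "fls_subdegree (ev F (E i)) \<ge> int (q * l)" "fls_subdegree (ev F' (E i)) \<ge> int (q * l)"
        using \<open>ratl F\<close> \<open>ratl F'\<close> unfolding ratl_def by blast+
      then show ?thesis using fls_plus_subdegree[OF nz] by linarith
    qed
    then show ?thesis using that unfolding ratl_def ev_add[OF f E_props(2)]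
      by (intro conjI forms_add) (auto simp: frobenius_Q)
  qed
  show "ratl (\<lambda>v. e * F v)" if "e ^ Q = e" "ratl F"
  proof -
    have f: "F \<in> forms UNIV (l * (q + 1))" using that by (auto simp: ratl_def)
    have "fls_subdegree (fls_const e * ev F (E i)) \<ge> int (q * l)" if "fls_const e * ev F (E i) \<noteq> 0" for i
      using that \<open>ratl F\<close> fls_subdegree_mult[of "fls_const e" "ev F (E i)"] by (auto simp: ratl_def)
    then have "\<forall>i. fls_const e * ev F (E i) = 0 \<or> fls_subdegree (fls_const e * ev F (E i)) \<ge> int (q * l)" by blast
    moreover have "\<forall>v. e * F (phi q v) = (e * F v) ^ Q" using that by (simp add: ratl_def power_mult_distrib)
    ultimately show ?thesis using forms_cmult[OF f] unfolding ratl_def ev_cmult[OF f E_props(2)] by blast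
  qed
qed

end

text \<open>Over the closure, the code lies in the span of \<open>evalvec\<close>, and the rational forms already span
  it; by descent both have the same constants.\<close>

lemma singer_functional_code:
  fixes \<tau> \<beta> y0 :: "'f::{field,finite} alg_closure" and gg :: "'n::finite \<Rightarrow> 'f alg_closure"
  assumes "singer_orbit_divisor q \<tau> \<beta> l y0"
    and gg: "bij_betw gg UNIV {g. g ^ (q\<^sup>2 - q + 1) \<in> singer.Yr q \<tau> - {y0}}"
    and card: "CARD('f) = q\<^sup>2"
  defines "code \<equiv> functional_code q (hermitian_curve q \<tau>) (\<lambda>i. proj_point (gpt q (gg i)))
      (singer_orbit_divisor.DG q l y0)"
  shows "\<exists>C :: ('f ^ 'n) set. vec_to_ac ` C = code \<and> vec.subspace C \<and>
    2 * int (vec.dim C) = (2 * int l - 1) * (int q ^ 2 - int q) + 2 * int l + 2 \<and>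
    min_distance C = (q - l) * (q\<^sup>2 - q + 1)"
proof -
  interpret singer_orbit_divisor q \<tau> \<beta> l y0 by fact
  have gg': "bij_betw gg UNIV {g. g ^ N \<in> Yr - {y0}}" using gg by (simp add: N_def)
  have code: "code = functional_code q CC (\<lambda>i. proj_point (gpt q (gg i))) DG"
    by (simp add: code_def hermitian_curve_CC)
  define S :: "('f ^ 'n) set" where "S = {c. \<exists>F. ratl F \<and> vec_to_ac c = quotvec gg F}"
  define T :: "('f ^ 'n) set" where "T = {c. vec_to_ac c \<in> vec.span (evalvec gg ` basis_index)}"
  have constants: "\<exists>c :: 'f ^ 'n. vec_to_ac c = w" if w: "w \<in> code" for w
  proof -
    have "w $ i \<in> range to_ac" for i
      using functional_code_upper(2)[OF gg' w[unfolded code]] range_to_ac card by metis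
    then have "vec_to_ac (\<chi> i. of_ac (w $ i)) = w" by (simp add: vec_eq_iff to_ac_of_ac)
    then show ?thesis by blast
  qed
  have quot: "quotvec gg F \<in> vec_to_ac ` S" if F: "ratl F" for F
  proof -
    obtain c where "vec_to_ac c = quotvec gg F"
      using constants functional_code_lower[OF gg' F] unfolding code by blast
    then show ?thesis using F unfolding S_def by force
  qed
  have S: "vec.subspace S"
  proof (rule vec.subspaceI)
    have "vec_to_ac 0 = quotvec gg (\<lambda>v. 0)" by (simp add: vec_eq_iff quotvec_def)
    then show "0 \<in> S" using ratl_0 by (auto simp: S_def)
  next
    fix c d assume "c \<in> S" "d \<in> S"
    then obtain F F' where F: "ratl F" "ratl F'" "vec_to_ac c = quotvec gg F" "vec_to_ac d = quotvec gg F'"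
      by (auto simp: S_def)
    have "vec_to_ac (c + d) = quotvec gg (\<lambda>v. F v + F' v)"
      unfolding vec_to_ac_add F(3,4) by (simp add: vec_eq_iff quotvec_def add_divide_distrib)
    then show "c + d \<in> S" using ratl_add F(1,2) unfolding S_def by blast
  next
    fix a c assume "c \<in> S"
    then obtain F where F: "ratl F" "vec_to_ac c = quotvec gg F" by (auto simp: S_def)
    have "vec_to_ac (a *s c) = quotvec gg (\<lambda>v. to_ac a * F v)"
      unfolding vec_to_ac_scale F(2) by (simp add: vec_eq_iff quotvec_def)
    moreover have "to_ac a ^ Q = to_ac a"
      using power_CARD_eq_same[of a] unfolding card by (simp flip: to_ac_power)
    ultimately show "a *s c \<in> S" using ratl_cmult F(1) unfolding S_def by blast
  qed
  have T: "vec.subspace T"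
    by (rule vec.subspaceI)
      (auto simp: T_def vec_to_ac_0 vec_to_ac_add vec_to_ac_scale vec.span_zero vec.span_add vec.span_scale)
  have ST: "S \<subseteq> T"
    using functional_code_upper(1)[OF gg'] functional_code_lower[OF gg'] unfolding S_def T_def by fastforce
  have "quotvec gg ` {F. ratl F} \<subseteq> vec_to_ac ` S" using quot by blast
  then have e1: "evalvec gg ` basis_index \<subseteq> vec.span (vec_to_ac ` S)"
    using basis_in_quotient_span[OF gg'] vec.span_mono by blast
  have e2: "vec_to_ac ` T \<subseteq> vec.span (evalvec gg ` basis_index)" by (auto simp: T_def)
  note descent = descent_equality[OF S T ST evalvec_independent(2,1)[OF gg'] finite_basis_index e1 e2]
  have img: "vec_to_ac ` S = code"
  proof (intro equalityI subsetI)
    fix w assume "w \<in> vec_to_ac ` S"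
    then show "w \<in> code" using functional_code_lower[OF gg'] unfolding S_def code by auto
  next
    fix w assume w: "w \<in> code"
    then obtain c :: "'f ^ 'n" where c: "vec_to_ac c = w" using constants by blast
    then have "c \<in> T" using functional_code_upper(1)[OF gg'] w unfolding code T_def by blast
    then show "w \<in> vec_to_ac ` S" using c descent(1) by blast
  qed
  have cardn: "CARD('n) = q * N"
    using bij_betw_same_card[OF gg'] card_params(1)[of "Yr - {y0}"] card_Yr y0 by simp
  have lq: "l < q" using l q2 by linarith
  have weight: "card {i. c $ i \<noteq> 0} + card {i. vec_to_ac c $ i = 0} = q * N" for c :: "'f ^ 'n"
  proof -
    have "card {i. c $ i \<noteq> 0} + card {i. c $ i = 0} = card ({i. c $ i \<noteq> 0} \<union> {i. c $ i = 0})"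
      by (rule card_Un_disjoint[symmetric]) auto
    also have "{i. c $ i \<noteq> 0} \<union> {i. c $ i = 0} = UNIV" by auto
    finally show ?thesis using cardn by simp
  qed
  have diff: "(q - l) * N + l * N = q * N" using lq by (simp flip: add_mult_distrib)
  have "min_distance S = (q - l) * N"
  proof (rule min_distance_subspace[OF S])
    fix c assume c: "c \<in> S" "c \<noteq> 0"
    have "vec_to_ac c \<noteq> 0" using c(2) inj_vec_to_ac vec_to_ac_0 unfolding inj_def by metis
    moreover have "vec_to_ac c \<in> vec.span (evalvec gg ` basis_index)" using ST c(1) by (auto simp: T_def)
    ultimately have "card {i. vec_to_ac c $ i = 0} \<le> l * N" by (intro span_zero_count[OF gg'])
    then show "(q - l) * N \<le> card {i. c $ i \<noteq> 0}" using weight[of c] diff by linarith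
  next
    obtain F where F: "ratl F" "card {i. quotvec gg F $ i = 0} = l * N" using exists_min_weight[OF gg'] by blast
    then obtain c where c: "c \<in> S" "vec_to_ac c = quotvec gg F" using quot by force
    have w: "card {i. c $ i \<noteq> 0} = (q - l) * N" using weight[of c] F(2) diff unfolding c(2) by linarith
    then have "c \<noteq> 0" using lq N_pos by auto
    then show "\<exists>c\<in>S. c \<noteq> 0 \<and> card {i. c $ i \<noteq> 0} = (q - l) * N" using c w by blast
  qed
  moreover have "2 * int (vec.dim S) = (2 * int l - 1) * (int q ^ 2 - int q) + 2 * int l + 2"
    unfolding descent(2) card_basis_index using l by (intro sum_dimk) simp
  ultimately show ?thesis using S img unfolding N_def by blast
qed

lemma CHAR_finite_alg_closure:
  assumes "primepow q" "CARD('f::{field,finite}) = q\<^sup>2"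
  shows "prime CHAR('f alg_closure)" "\<exists>m. q = CHAR('f alg_closure) ^ m"
proof -
  obtain p m where p: "prime p" "q = p ^ m" using assms(1) by (auto simp: primepow_def)
  have "CHAR('f) \<noteq> 0" by (rule finite_imp_CHAR_pos[THEN gr_implies_not0]) simp
  then have pr: "prime CHAR('f)" using prime_CHAR_semidom by blast
  \<comment> \<open>Translation by one permutes the field, so the number of its elements is zero in
    it and is divisible by the characteristic.\<close>
  have "(\<Sum>a\<in>UNIV. a + 1) = (\<Sum>a\<in>UNIV. a :: 'f)"
    by (rule sum.reindex_bij_witness[of _ "\<lambda>a. a - 1" "\<lambda>a. a + 1"]) auto
  then have "of_nat CARD('f) = (0 :: 'f)" by (simp add: sum.distrib)
  then have "CHAR('f) dvd p ^ (m * 2)"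
    unfolding of_nat_eq_0_iff_char_dvd assms(2) p(2) by (simp add: power_mult)
  then have "CHAR('f) dvd p" using pr prime_dvd_power by blast
  then have "CHAR('f) = p" using p(1) pr primes_dvd_imp_eq by blast
  then show "prime CHAR('f alg_closure)" "\<exists>m. q = CHAR('f alg_closure) ^ m" using p by auto
qed

theorem theorem4p3:
  fixes q l :: nat
    and \<tau> \<beta> :: "'f::{field,finite} alg_closure"
    and P\<^sub>0 :: "'f alg_closure point"
    and G :: "'f alg_closure point set"
    and Q :: "'n::finite \<Rightarrow> 'f alg_closure point"
  assumes "primepow q" and "q > 2"
    and "CARD('f) = q^2"
    and "2 \<le> l" and "l \<le> q - 1"
    and "\<tau> ^ (q^2 + q + 1) = 1"
    and "\<beta> \<in> GF (q^6)" and "primitive_root_of_unity (q^2 - q + 1) \<beta>"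
    and "P\<^sub>0 \<in> hermitian_curve q \<tau> \<inter> Pi_plane q"
    and "G = singer_orbit q \<beta> P\<^sub>0"
    and "bij_betw Q UNIV (hermitian_curve q \<tau> \<inter> Pi_plane q - G)"
  shows "\<exists>C :: ('f ^ 'n) set.
    vec_to_ac ` C = functional_code q (hermitian_curve q \<tau>) Q (\<lambda>P. int l * indicator G P) \<and>
    vec.subspace C \<and>
    CARD('n) = q * (q^2 - q + 1) \<and>
    real (vec.dim C) = 1/2 * (2 * real l - 1) * (real q ^ 2 - real q) + real l + 1 \<and>
    min_distance C = (q - l) * (q^2 - q + 1) \<and>
    int (min_distance C) = int CARD('n) - divisor_degree (\<lambda>P. int l * indicator G P)"
proof -
  interpret S: singer q \<tau> \<beta>
    using CHAR_finite_alg_closure[OF assms(1,3)] assms(2,6,8) by unfold_locales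
  have curve: "hermitian_curve q \<tau> \<inter> Pi_plane q = (\<lambda>g. proj_point (gpt q g)) ` {g. g ^ S.N \<in> S.Yr}"
    unfolding S.hermitian_curve_CC by (rule S.CC_Pi)
  obtain g0 where g0: "P\<^sub>0 = proj_point (gpt q g0)" "g0 ^ S.N \<in> S.Yr" using assms(9) unfolding curve by blast
  define y0 where "y0 = g0 ^ S.N"
  interpret S: singer_orbit_divisor q \<tau> \<beta> l y0
    using assms(4,5) g0(2) by unfold_locales (auto simp: y0_def)
  have G: "G = S.G" unfolding assms(10) g0(1) S.singer_orbit_eq[OF g0(2)] y0_def[symmetric] S.G_def ..
  have DG: "(\<lambda>P. int l * indicator G P) = S.DG" by (simp add: S.DG_def[abs_def] G)
  have inj: "inj (\<lambda>g :: 'f alg_closure. proj_point (gpt q g))" by (rule injI) (rule S.gpt_inj)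
  have points: "hermitian_curve q \<tau> \<inter> Pi_plane q - G = (\<lambda>g. proj_point (gpt q g)) ` {g. g ^ S.N \<in> S.Yr - {y0}}"
    unfolding curve G S.G_def image_set_diff[OF inj, symmetric] by (rule arg_cong[of _ _ "(`) _"]) auto
  \<comment> \<open>The enumeration of the points is arbitrary; it is pulled back to their
    parameters, which \<open>gpt_inj\<close> makes unique.\<close>
  define gg where "gg i = (THE g. Q i = proj_point (gpt q g))" for i
  have gg: "Q i = proj_point (gpt q (gg i))" for i
  proof -
    obtain g where g: "Q i = proj_point (gpt q g)"
      using bij_betwE[OF assms(11)] unfolding points by blast
    show ?thesis unfolding gg_def by (rule theI[of _ g]) (use g S.gpt_inj in auto)
  qed
  have "bij_betw gg UNIV {g. g ^ S.N \<in> S.Yr - {y0}}"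
  proof (rule bij_betw_imageI)
    have Qinj: "inj Q" and Qimg: "range Q = (\<lambda>g. proj_point (gpt q g)) ` {g. g ^ S.N \<in> S.Yr - {y0}}"
      using assms(11) unfolding points by (auto simp: bij_betw_def)
    show "inj gg"
    proof (rule injI)
      fix i j assume "gg i = gg j"
      then have "Q i = Q j" by (simp only: gg)
      then show "i = j" using Qinj by (simp only: inj_eq)
    qed
    have "(\<lambda>g. proj_point (gpt q g)) ` range gg = (\<lambda>g. proj_point (gpt q g)) ` {g. g ^ S.N \<in> S.Yr - {y0}}"
      unfolding Qimg[symmetric] image_image by (simp only: gg[symmetric])
    then show "range gg = {g. g ^ S.N \<in> S.Yr - {y0}}" by (rule inj_image_eq_iff[OF inj, THEN iffD1])
  qed
  note bij = this
  have Q: "Q = (\<lambda>i. proj_point (gpt q (gg i)))" using gg by blast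
  obtain C :: "('f ^ 'n) set" where C: "vec_to_ac ` C = functional_code q (hermitian_curve q \<tau>) Q S.DG"
    "vec.subspace C" "2 * int (vec.dim C) = (2 * int l - 1) * (int q ^ 2 - int q) + 2 * int l + 2"
    "min_distance C = (q - l) * (q\<^sup>2 - q + 1)"
    using singer_functional_code[OF S.singer_orbit_divisor_axioms bij[unfolded S.N_def] assms(3)] unfolding Q by blast
  have cardn: "CARD('n) = q * S.N"
    using bij_betw_same_card[OF bij] S.card_params(1)[of "S.Yr - {y0}"] S.card_Yr S.y0 by simp
  have "2 * real (vec.dim C) = (2 * real l - 1) * (real q ^ 2 - real q) + 2 * real l + 2"
    using arg_cong[OF C(3), of real_of_int] by simp
  then have dim: "real (vec.dim C) = 1/2 * (2 * real l - 1) * (real q ^ 2 - real q) + real l + 1"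
    by (simp add: field_simps)
  have "card G = S.N"
  proof -
    have "card G = card {g :: 'f alg_closure. g ^ S.N \<in> {y0}}"
      unfolding G S.G_def by (simp add: card_image inj_on_subset[OF inj])
    then show ?thesis using S.card_params(1)[of "{y0}"] S.y0 by simp
  qed
  moreover have "{P. int l * indicator G P \<noteq> 0} = G" using assms(4) by (auto simp: indicator_def)
  ultimately have "divisor_degree (\<lambda>P. int l * indicator G P) = int (l * S.N)"
    unfolding divisor_degree_def by simp
  moreover have "(q - l) * S.N + l * S.N = q * S.N" using assms(2,5) by (simp flip: add_mult_distrib)
  ultimately have "int (min_distance C) = int CARD('n) - divisor_degree (\<lambda>P. int l * indicator G P)"
    unfolding C(4) cardn S.N_def[symmetric] by linarith
  then show ?thesis using C dim cardn unfolding DG S.N_def by blast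
qed

end
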